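(* Let $\Bbbk$ be an algebraically closed field and $A$ a basic finite-dimensional unital $\Bbbk$-algebra. Let $\mathtt{k}\in\{2,3,4,\dots\}$. (i) There exists a selfadjoint endofunctor $\mathrm{F}$ of $A\text{-}\mathrm{mod}$ satisfying $\mathrm{F}\circ\mathrm{F}\cong \mathtt{k}\,\mathrm{ID}$ if and only if $\mathtt{k}=\mathtt{m}^2$ for some $\mathtt{m}\in\{2,3,4,\dots\}$. (ii) If $\mathtt{k}=\mathtt{m}^2$ with $\mathtt{m}\in\{2,3,4,\dots\}$, then the assignment $\mathrm{F}'\mapsto \mathtt{m}\mathrm{F}'$ induces a bijection between isomorphism classes of selfadjoint endofunctors $\mathrm{F}'$ of $A\text{-}\mathrm{mod}$ satisfying $\mathrm{F}'\circ\mathrm{F}'\cong\mathrm{ID}$ and isomorphism classes of selfadjoint endofunctors $\mathrm{F}$ of $A\text{-}\mathrm{mod}$ satisfying $\mathrm{F}\circ\mathrm{F}\cong \mathtt{k}\,\mathrm{ID}$.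
   Context: $A\text{-}\mathrm{mod}$ is the category of finite-dimensional left $A$-modules; all functors are additive and $\Bbbk$-linear. $\mathrm{ID}$ denotes the identity functor. For a functor $\mathrm{F}$ and $\mathtt{k}\in\mathbb{N}$, $\mathtt{k}\mathrm{F}$ denotes the direct sum of $\mathtt{k}$ copies of $\mathrm{F}$ (and $0\mathrm{F}$ is the zero functor). A functor $\mathrm{F}$ is selfadjoint if $\mathrm{F}$ is left adjoint to itself (equivalently, right adjoint to itself). *)

theory Defs
  imports "HOL-Computational_Algebra.Polynomial" "Jordan_Normal_Form.Matrix"
begin

definition alg_closed :: "'k::field itself \<Rightarrow> bool" where
  "alg_closed _ \<longleftrightarrow> (\<forall>p :: 'k poly. degree p > 0 \<longrightarrow> (\<exists>x. poly p x = 0))"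

definition k_algebra :: "('k::field \<Rightarrow> 'a::ring_1 \<Rightarrow> 'a) \<Rightarrow> bool" where
  "k_algebra sm \<longleftrightarrow>
     (\<forall>c x y. sm c (x + y) = sm c x + sm c y) \<and>
     (\<forall>c d x. sm (c + d) x = sm c x + sm d x) \<and>
     (\<forall>c d x. sm (c * d) x = sm c (sm d x)) \<and>
     (\<forall>x. sm 1 x = x) \<and>
     (\<forall>c x y. sm c (x * y) = sm c x * y) \<and>
     (\<forall>c x y. sm c (x * y) = x * sm c y)"

definition fin_dim_algebra :: "('k::field \<Rightarrow> 'a::ring_1 \<Rightarrow> 'a) \<Rightarrow> bool" where
  "fin_dim_algebra sm \<longleftrightarrow>
     (\<exists>bs :: 'a list. \<forall>x. \<exists>cs :: 'k list. length cs = length bs \<and> x = sum_list (map2 sm cs bs))"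

text \<open>Finite-dimensional left A-modules, concretely: (n, rho) with rho : A \<rightarrow> n\<times>n matrices a
  unital k-algebra homomorphism (i.e. a module structure on k^n).  Every finite-dimensional
  module is isomorphic to one of these, so this category is equivalent to A-mod.\<close>
type_synonym ('a, 'k) modl = "nat \<times> ('a \<Rightarrow> 'k mat)"

definition is_module :: "('k::field \<Rightarrow> 'a::ring_1 \<Rightarrow> 'a) \<Rightarrow> ('a, 'k) modl \<Rightarrow> bool" where
  "is_module sm M \<longleftrightarrow>
     (\<forall>a. snd M a \<in> carrier_mat (fst M) (fst M)) \<and>
     snd M 1 = 1\<^sub>m (fst M) \<and>
     (\<forall>a b. snd M (a * b) = snd M a * snd M b) \<and>
     (\<forall>a b. snd M (a + b) = snd M a + snd M b) \<and>
     (\<forall>c a. snd M (sm c a) = c \<cdot>\<^sub>m snd M a)"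

definition hom :: "('a::ring_1, 'k::field) modl \<Rightarrow> ('a, 'k) modl \<Rightarrow> 'k mat set" where
  "hom M N = {f. f \<in> carrier_mat (fst N) (fst M) \<and> (\<forall>a. f * snd M a = snd N a * f)}"

definition submodule :: "('a::ring_1, 'k::field) modl \<Rightarrow> 'k vec set \<Rightarrow> bool" where
  "submodule M W \<longleftrightarrow> W \<subseteq> carrier_vec (fst M) \<and> 0\<^sub>v (fst M) \<in> W \<and>
     (\<forall>v\<in>W. \<forall>w\<in>W. v + w \<in> W) \<and> (\<forall>c. \<forall>v\<in>W. c \<cdot>\<^sub>v v \<in> W) \<and>
     (\<forall>a. \<forall>v\<in>W. snd M a *\<^sub>v v \<in> W)"

definition simple_module :: "('a::ring_1, 'k::field) modl \<Rightarrow> bool" where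
  "simple_module M \<longleftrightarrow> fst M > 0 \<and>
     (\<forall>W. submodule M W \<longrightarrow> W = {0\<^sub>v (fst M)} \<or> W = carrier_vec (fst M))"

text \<open>Basic algebra (over an algebraically closed field): every simple module is one-dimensional
  (equivalently A/rad A \<cong> k \<times> ... \<times> k).\<close>
definition basic_algebra :: "('k::field \<Rightarrow> 'a::ring_1 \<Rightarrow> 'a) \<Rightarrow> bool" where
  "basic_algebra sm \<longleftrightarrow> (\<forall>M :: ('a, 'k) modl. is_module sm M \<and> simple_module M \<longrightarrow> fst M = 1)"

type_synonym ('a, 'k) endofun =
  "(('a, 'k) modl \<Rightarrow> ('a, 'k) modl) \<times> (('a, 'k) modl \<Rightarrow> ('a, 'k) modl \<Rightarrow> 'k mat \<Rightarrow> 'k mat)"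

definition is_functor :: "('k::field \<Rightarrow> 'a::ring_1 \<Rightarrow> 'a) \<Rightarrow> ('a, 'k) endofun \<Rightarrow> bool" where
  "is_functor sm F \<longleftrightarrow>
     (\<forall>M. is_module sm M \<longrightarrow> is_module sm (fst F M)) \<and>
     (\<forall>M N f. is_module sm M \<and> is_module sm N \<and> f \<in> hom M N \<longrightarrow>
        snd F M N f \<in> hom (fst F M) (fst F N)) \<and>
     (\<forall>M. is_module sm M \<longrightarrow> snd F M M (1\<^sub>m (fst M)) = 1\<^sub>m (fst (fst F M))) \<and>
     (\<forall>L M N f g. is_module sm L \<and> is_module sm M \<and> is_module sm N \<and>
        f \<in> hom L M \<and> g \<in> hom M N \<longrightarrow> snd F L N (g * f) = snd F M N g * snd F L M f) \<and>
     (\<forall>M N f g. is_module sm M \<and> is_module sm N \<and> f \<in> hom M N \<and> g \<in> hom M N \<longrightarrow>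
        snd F M N (f + g) = snd F M N f + snd F M N g) \<and>
     (\<forall>M N f c. is_module sm M \<and> is_module sm N \<and> f \<in> hom M N \<longrightarrow>
        snd F M N (c \<cdot>\<^sub>m f) = c \<cdot>\<^sub>m snd F M N f)"

definition fid :: "('a::ring_1, 'k::field) endofun" where
  "fid = (\<lambda>M. M, \<lambda>M N f. f)"

definition fcomp :: "('a::ring_1, 'k::field) endofun \<Rightarrow> ('a, 'k) endofun \<Rightarrow> ('a, 'k) endofun" where
  "fcomp G F = (\<lambda>M. fst G (fst F M), \<lambda>M N f. snd G (fst F M) (fst F N) (snd F M N f))"

definition dsum_obj :: "('a::ring_1, 'k::field) modl \<Rightarrow> ('a, 'k) modl \<Rightarrow> ('a, 'k) modl" where
  "dsum_obj M N = (fst M + fst N,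
     \<lambda>a. four_block_mat (snd M a) (0\<^sub>m (fst M) (fst N)) (0\<^sub>m (fst N) (fst M)) (snd N a))"

fun rep_obj :: "nat \<Rightarrow> ('a::ring_1, 'k::field) modl \<Rightarrow> ('a, 'k) modl" where
  "rep_obj 0 M = (0, \<lambda>a. 1\<^sub>m 0)"
| "rep_obj (Suc i) M = dsum_obj M (rep_obj i M)"

fun rep_mor :: "nat \<Rightarrow> ('a::ring_1, 'k::field) modl \<Rightarrow> ('a, 'k) modl \<Rightarrow> 'k mat \<Rightarrow> 'k mat" where
  "rep_mor 0 M N f = 0\<^sub>m 0 0"
| "rep_mor (Suc i) M N f = four_block_mat f (0\<^sub>m (fst N) (i * fst M))
     (0\<^sub>m (i * fst N) (fst M)) (rep_mor i M N f)"

definition fmult :: "nat \<Rightarrow> ('a::ring_1, 'k::field) endofun \<Rightarrow> ('a, 'k) endofun" where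
  "fmult m F = (\<lambda>M. rep_obj m (fst F M),
                \<lambda>M N f. rep_mor m (fst F M) (fst F N) (snd F M N f))"

definition nat_iso :: "('k::field \<Rightarrow> 'a::ring_1 \<Rightarrow> 'a) \<Rightarrow> ('a, 'k) endofun \<Rightarrow> ('a, 'k) endofun \<Rightarrow> bool" where
  "nat_iso sm F G \<longleftrightarrow> (\<exists>\<eta>.
     (\<forall>M. is_module sm M \<longrightarrow> \<eta> M \<in> hom (fst F M) (fst G M) \<and>
        (\<exists>\<theta> \<in> hom (fst G M) (fst F M). \<theta> * \<eta> M = 1\<^sub>m (fst (fst F M)) \<and>
                                         \<eta> M * \<theta> = 1\<^sub>m (fst (fst G M)))) \<and>
     (\<forall>M N f. is_module sm M \<and> is_module sm N \<and> f \<in> hom M N \<longrightarrow>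
        snd G M N f * \<eta> M = \<eta> N * snd F M N f))"

definition selfadjoint :: "('k::field \<Rightarrow> 'a::ring_1 \<Rightarrow> 'a) \<Rightarrow> ('a, 'k) endofun \<Rightarrow> bool" where
  "selfadjoint sm F \<longleftrightarrow> (\<exists>\<phi>.
     (\<forall>M N. is_module sm M \<and> is_module sm N \<longrightarrow>
        bij_betw (\<phi> M N) (hom (fst F M) N) (hom M (fst F N))) \<and>
     (\<forall>M M' N N' g h f. is_module sm M \<and> is_module sm M' \<and> is_module sm N \<and> is_module sm N' \<and>
        g \<in> hom M' M \<and> h \<in> hom N N' \<and> f \<in> hom (fst F M) N \<longrightarrow>
        \<phi> M' N' (h * f * snd F M' M g) = snd F N N' h * \<phi> M N f * g))"

end

theory Submission
  imports Defs "Jordan_Normal_Form.Determinant"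
begin

text \<open>A selfadjoint \<open>F\<close> is exact. Let \<open>L\<close> be simple, hence one-dimensional, and \<open>L'\<close> a simple quotient of
  \<open>F L\<close>. Since \<open>F (F L) = k L\<close>, the module \<open>F L'\<close> is a quotient of \<open>k L\<close>, so \<open>F L' = n L\<close>; then \<open>F L\<close> embeds
  into \<open>F (n L) = k L'\<close>, so \<open>F L = m L'\<close>. Adjunction gives \<open>m = n\<close>, and counting dimensions \<open>m n = k\<close>.

  Let \<open>k = m\<^sup>2\<close>. By adjunction \<open>End F = Hom(ID, F F)\<close> is free of rank \<open>m\<^sup>2\<close> over the center, so evaluation
  at a simple \<open>L\<close> maps it onto the \<open>m \<times> m\<close> matrices, with a kernel that depends only on the block of \<open>L\<close>.
  Separating blocks by central elements yields natural endomorphisms of \<open>F\<close> acting like matrix units on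
  every \<open>F L\<close>. The one for the index \<open>(0, 0)\<close> lifts to an idempotent, whose image is a summand \<open>G\<close> of \<open>F\<close>, and
  the others give a transformation \<open>m G \<rightarrow> F\<close> that is invertible on simple modules, hence everywhere.

  There are finitely many simple modules and the field is infinite. So two exact functors with
  one-dimensional values on simple modules are isomorphic as soon as each simple module admits a natural
  transformation that is nonzero there: a generic linear combination is invertible. This gives that
  \<open>G\<close> is selfadjoint (it is isomorphic to its right adjoint, the image of the mate of the idempotent),
  that \<open>G G = ID\<close>, and that \<open>m G = m G'\<close> implies \<open>G = G'\<close>.\<close>

text \<open>The functors are never replaced by bimodules: every construction is a family of matrices
  indexed by modules, and naturality is carried along. Agreement on simple modules does not make two
  functors isomorphic, so each comparison starts from an actual transformation, cut out of
  \<open>End F\<close> or of the structure maps of \<open>F F = m\<^sup>2 ID\<close>; only its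
  invertibility is tested on simple modules. The obstacle is that evaluation of \<open>End F\<close>
  is onto the matrices at one simple module, but not at several together: simple modules in one
  block see the same central scalars, and the value at one determines the value at the other. So
  matrix units can be prescribed once per block, and relations between them then hold on the rest of
  the block by themselves. A lift of a matrix unit need not be idempotent on larger modules; there
  its defect is repaired along a composition series, one Newton step per added dimension, so the
  number of steps depends on the module.\<close>

section \<open>Matrix identities and finite sums of matrices\<close>

declare assoc_mult_mat [simp del] assoc_mult_mat_vec [simp del]

text \<open>The side conditions use \<open>dim_row\<close> and \<open>dim_col\<close> instead of
  \<open>carrier_mat\<close>: read as conditional rewrite rules, this one and its companions have no
  premise with a variable absent from the left-hand side.\<close>

lemma mat_mult_assoc:
  "dim_col A = dim_row B \<Longrightarrow> dim_col B = dim_row C \<Longrightarrow> (A * B) * C = A * (B * (C :: 'b::semiring_0 mat))"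
  by (rule assoc_mult_mat[of A "dim_row A" "dim_col A" B "dim_col B" C "dim_col C"]) (auto intro!: carrier_matI)

lemma mat_vec_assoc:
  "dim_col A = dim_row B \<Longrightarrow> dim_col B = dim_vec v \<Longrightarrow> (A * B) *\<^sub>v v = A *\<^sub>v (B *\<^sub>v (v :: 'b::semiring_0 vec))"
  by (rule assoc_mult_mat_vec[of A "dim_row A" "dim_col A" B "dim_col B" v]) (auto intro!: carrier_matI carrier_vecI)

lemma mat_mult_add:
  "dim_col A = dim_row B \<Longrightarrow> dim_row B = dim_row C \<Longrightarrow> dim_col B = dim_col C \<Longrightarrow>
   A * (B + C) = A * B + A * (C :: 'b::semiring_0 mat)"
  by (rule mult_add_distrib_mat[of A "dim_row A" "dim_col A" B "dim_col B" C]) (auto intro!: carrier_matI)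

lemma mat_add_mult:
  "dim_col A = dim_row C \<Longrightarrow> dim_row A = dim_row B \<Longrightarrow> dim_col A = dim_col B \<Longrightarrow>
   (A + B) * C = A * C + B * (C :: 'b::semiring_0 mat)"
  by (rule add_mult_distrib_mat[of A "dim_row A" "dim_col A" B C "dim_col C"]) (auto intro!: carrier_matI)

lemma mat_mult_smult:
  "dim_col A = dim_row B \<Longrightarrow> A * (c \<cdot>\<^sub>m B) = c \<cdot>\<^sub>m (A * (B :: 'b::comm_semiring_0 mat))"
  by (rule mult_smult_distrib[of A "dim_row A" "dim_col A" B "dim_col B"]) (auto intro!: carrier_matI)

lemma mat_smult_mult:
  "dim_col A = dim_row B \<Longrightarrow> (c \<cdot>\<^sub>m A) * B = c \<cdot>\<^sub>m (A * (B :: 'b::comm_semiring_0 mat))"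
  by (rule mult_smult_assoc_mat[of A "dim_row A" "dim_col A" B "dim_col B"]) (auto intro!: carrier_matI)

lemma mat_add_zero:
  "dim_row A = r \<Longrightarrow> dim_col A = c \<Longrightarrow> A + 0\<^sub>m r c = (A :: 'b::monoid_add mat)"
  "dim_row A = r \<Longrightarrow> dim_col A = c \<Longrightarrow> 0\<^sub>m r c + A = (A :: 'b::monoid_add mat)"
  by auto

lemma mat_mult_minus:
  "dim_col A = dim_row B \<Longrightarrow> dim_row B = dim_row C \<Longrightarrow> dim_col B = dim_col C \<Longrightarrow>
   A * (B - C) = A * B - A * (C :: 'b::ring mat)"
  by (rule mult_minus_distrib_mat[of A "dim_row A" "dim_col A" B "dim_col B" C]) (auto intro!: carrier_matI)

lemma mat_minus_mult:
  "dim_col A = dim_row C \<Longrightarrow> dim_row A = dim_row B \<Longrightarrow> dim_col A = dim_col B \<Longrightarrow>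
   (A - B) * C = A * C - B * (C :: 'b::ring mat)"
  by (rule minus_mult_distrib_mat[of A "dim_row A" "dim_col A" B C "dim_col C"]) (auto intro!: carrier_matI)

lemmas mat_simps = mat_mult_assoc mat_mult_add mat_add_mult mat_mult_minus mat_minus_mult
  mat_mult_smult mat_smult_mult

text \<open>Matrices of unspecified size form no monoid, so the dimensions of the empty sum are
  carried as parameters.\<close>

fun msum :: "nat \<Rightarrow> nat \<Rightarrow> (nat \<Rightarrow> 'k::field mat) \<Rightarrow> nat \<Rightarrow> 'k mat" where
  "msum r c f 0 = 0\<^sub>m r c"
| "msum r c f (Suc n) = f n + msum r c f n"

lemma msum_carrier[simp]: "(\<And>i. i < n \<Longrightarrow> f i \<in> carrier_mat r c) \<Longrightarrow> msum r c f n \<in> carrier_mat r c"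
  by (induction n) auto

lemma msum_dim[simp]: "dim_row (msum r c f n) = r" "dim_col (msum r c f n) = c"
  by (induction n) auto


lemma msum_index:
  "(\<And>i. i < n \<Longrightarrow> f i \<in> carrier_mat r c) \<Longrightarrow> a < r \<Longrightarrow> b < c \<Longrightarrow>
   msum r c f n $$ (a, b) = (\<Sum>i<n. f i $$ (a, b))"
  by (induction n) (auto simp: add.commute)

lemma msum_cong: "(\<And>i. i < n \<Longrightarrow> f i = g i) \<Longrightarrow> msum r c f n = msum r c g n"
  by (induction n) auto

lemma mult_msum:
  assumes "A \<in> carrier_mat q r" "\<And>i. i < n \<Longrightarrow> f i \<in> carrier_mat r c"
  shows "A * msum r c f n = msum q c (\<lambda>i. A * f i) n"
  using assms(2)
proof (induction n)
  case (Suc n)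
  have "f n \<in> carrier_mat r c" using Suc.prems by simp
  moreover have "A * msum r c f n = msum q c (\<lambda>i. A * f i) n"
    by (rule Suc.IH) (use Suc.prems in simp)
  ultimately show ?case using assms(1) by (simp add: mat_mult_add)
qed (use assms(1) in simp)

lemma msum_mult:
  assumes "A \<in> carrier_mat c q" "\<And>i. i < n \<Longrightarrow> f i \<in> carrier_mat r c"
  shows "msum r c f n * A = msum r q (\<lambda>i. f i * A) n"
  using assms(2)
proof (induction n)
  case (Suc n)
  have "f n \<in> carrier_mat r c" using Suc.prems by simp
  moreover have "msum r c f n * A = msum r q (\<lambda>i. f i * A) n"
    by (rule Suc.IH) (use Suc.prems in simp)
  ultimately show ?case using assms(1) by (simp add: mat_add_mult)
qed (use assms(1) in simp)

lemma msum_zero: "msum r c (\<lambda>i. 0\<^sub>m r c) n = 0\<^sub>m r c"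
  by (induction n) auto

lemma msum_delta:
  assumes "j < n" "f j \<in> carrier_mat r c"
  shows "msum r c (\<lambda>i. if i = j then f i else 0\<^sub>m r c) n = f j"
  using assms(1)
proof (induction n)
  case (Suc n)
  show ?case
  proof (cases "j = n")
    case True
    have "msum r c (\<lambda>i. if i = j then f i else 0\<^sub>m r c) n = msum r c (\<lambda>i. 0\<^sub>m r c) n"
      by (rule msum_cong) (use True in auto)
    thus ?thesis using True assms(2) by (simp add: msum_zero)
  next
    case False
    thus ?thesis using Suc assms(2) by (simp add: left_add_zero_mat)
  qed
qed simp

lemma msum_Suc_shift:
  assumes "\<And>i. i < Suc n \<Longrightarrow> f i \<in> carrier_mat r c"
  shows "msum r c f (Suc n) = f 0 + msum r c (\<lambda>i. f (Suc i)) n"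
proof -
  show ?thesis
  proof (rule eq_matI)
    fix a b assume "a < dim_row (f 0 + msum r c (\<lambda>i. f (Suc i)) n)"
      "b < dim_col (f 0 + msum r c (\<lambda>i. f (Suc i)) n)"
    hence ab: "a < r" "b < c" by auto
    have "msum r c f (Suc n) $$ (a, b) = (\<Sum>i<Suc n. f i $$ (a, b))"
      by (rule msum_index) (use assms ab in auto)
    also have "\<dots> = f 0 $$ (a, b) + (\<Sum>i<n. f (Suc i) $$ (a, b))"
      by (rule sum.lessThan_Suc_shift)
    also have "(\<Sum>i<n. f (Suc i) $$ (a, b)) = msum r c (\<lambda>i. f (Suc i)) n $$ (a, b)"
      by (rule msum_index[symmetric]) (use assms ab in auto)
    finally show "msum r c f (Suc n) $$ (a, b) = (f 0 + msum r c (\<lambda>i. f (Suc i)) n) $$ (a, b)"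
      using ab by simp
  qed auto
qed

text \<open>A pair \<open>(i, j)\<close> is coded as the single index \<open>i * n + j\<close>, the
  order in which copies are counted when direct sums are iterated in
  \<open>bip_trans\<close>.\<close>

lemma msum_nested:
  assumes "\<And>i j. i < m \<Longrightarrow> j < n \<Longrightarrow> f i j \<in> carrier_mat r c"
  shows "msum r c (\<lambda>p. f (p div n) (p mod n)) (m * n) = msum r c (\<lambda>i. msum r c (f i) n) m"
proof (rule eq_matI)
  fix a b assume ab: "a < dim_row (msum r c (\<lambda>i. msum r c (f i) n) m)"
    "b < dim_col (msum r c (\<lambda>i. msum r c (f i) n) m)"
  hence ab: "a < r" "b < c" by auto
  have n0: "p < m * n \<Longrightarrow> 0 < n" for p by (cases n) auto
  have c1: "f (p div n) (p mod n) \<in> carrier_mat r c" if "p < m * n" for p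
    using that n0[OF that] by (intro assms) (auto simp: less_mult_imp_div_less)
  have "msum r c (\<lambda>p. f (p div n) (p mod n)) (m * n) $$ (a, b)
      = (\<Sum>p<m * n. f (p div n) (p mod n) $$ (a, b))"
    using c1 ab by (simp add: msum_index)
  also have "\<dots> = (\<Sum>i<m. \<Sum>p\<in>{i * n..<i * n + n}. f (p div n) (p mod n) $$ (a, b))"
    by (simp add: sum.nat_group)
  also have "\<dots> = (\<Sum>i<m. \<Sum>j<n. f i j $$ (a, b))"
  proof (rule sum.cong[OF refl])
    fix i assume "i \<in> {..<m}"
    show "(\<Sum>p\<in>{i * n..<i * n + n}. f (p div n) (p mod n) $$ (a, b)) = (\<Sum>j<n. f i j $$ (a, b))"
      by (rule sum.reindex_bij_witness[of _ "\<lambda>j. i * n + j" "\<lambda>p. p - i * n"])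
         (auto simp: div_mult_self3 dest!: le_Suc_ex)
  qed
  also have "\<dots> = msum r c (\<lambda>i. msum r c (f i) n) m $$ (a, b)"
    using ab assms by (simp add: msum_index)
  finally show "msum r c (\<lambda>p. f (p div n) (p mod n)) (m * n) $$ (a, b)
      = msum r c (\<lambda>i. msum r c (f i) n) m $$ (a, b)" .
qed auto

subsection \<open>Modules, homomorphisms, functors and natural transformations\<close>

lemma homD: "f \<in> hom M N \<Longrightarrow> f \<in> carrier_mat (fst N) (fst M)"
  and hom_comm: "f \<in> hom M N \<Longrightarrow> f * snd M a = snd N a * f"
  by (auto simp: hom_def)

lemma mult_one_hom: "f \<in> hom M N \<Longrightarrow> f * 1\<^sub>m (fst M) = f" "f \<in> hom M N \<Longrightarrow> 1\<^sub>m (fst N) * f = f"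
  by (auto simp: hom_def)

lemma hom_assoc: "f \<in> hom L M \<Longrightarrow> g \<in> hom M N \<Longrightarrow> h \<in> hom N K \<Longrightarrow> (h * g) * f = h * (g * f)"
  by (auto simp: hom_def mat_mult_assoc)

locale kalg =
  fixes sm :: "'k::field \<Rightarrow> 'a::ring_1 \<Rightarrow> 'a"
begin

abbreviation "md M \<equiv> is_module sm M"
abbreviation "fn F \<equiv> is_functor sm F"

lemma md_carrier: "md M \<Longrightarrow> snd M a \<in> carrier_mat (fst M) (fst M)"
  and md_dim: "md M \<Longrightarrow> dim_row (snd M a) = fst M" "md M \<Longrightarrow> dim_col (snd M a) = fst M"
  and md_one: "md M \<Longrightarrow> snd M 1 = 1\<^sub>m (fst M)"
  and md_mult: "md M \<Longrightarrow> snd M (a * b) = snd M a * snd M b"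
  and md_add: "md M \<Longrightarrow> snd M (a + b) = snd M a + snd M b"
  and md_smult: "md M \<Longrightarrow> snd M (sm c a) = c \<cdot>\<^sub>m snd M a"
  by (auto simp: is_module_def)

lemma hom_one: "md M \<Longrightarrow> 1\<^sub>m (fst M) \<in> hom M M"
  unfolding hom_def using md_dim by auto

lemma hom_mult: 
  assumes "md L" "md M" "md N" "f \<in> hom L M" "g \<in> hom M N" shows "g * f \<in> hom L N"
proof -
  have d: "f \<in> carrier_mat (fst M) (fst L)" "g \<in> carrier_mat (fst N) (fst M)"
    using assms by (auto dest: homD)
  have "(g * f) * snd L a = snd N a * (g * f)" for a
  proof -
    have "(g * f) * snd L a = g * (f * snd L a)"
      using d md_dim[OF assms(1)] by (simp add: mat_mult_assoc)
    also have "\<dots> = (g * snd M a) * f"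
      using d md_dim[OF assms(2)] by (simp add: mat_mult_assoc hom_comm[OF assms(4)])
    also have "\<dots> = snd N a * (g * f)"
      using d md_dim[OF assms(3)] by (simp add: mat_mult_assoc hom_comm[OF assms(5)])
    finally show ?thesis .
  qed
  thus ?thesis using d by (auto simp: hom_def)
qed

lemma hom_add: 
  assumes "md M" "md N" "f \<in> hom M N" "g \<in> hom M N" shows "f + g \<in> hom M N"
  using assms md_dim[OF assms(1)] md_dim[OF assms(2)] by (auto simp: hom_def mat_mult_add mat_add_mult)

lemma hom_smult: 
  assumes "md M" "md N" "f \<in> hom M N" shows "c \<cdot>\<^sub>m f \<in> hom M N"
  using assms md_dim[OF assms(1)] md_dim[OF assms(2)] by (auto simp: hom_def mat_mult_smult mat_smult_mult)

lemma hom_zero: 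
  assumes "md M" "md N" shows "0\<^sub>m (fst N) (fst M) \<in> hom M N"
  using md_dim[OF assms(1)] md_dim[OF assms(2)] by (auto simp: hom_def)

lemma hom_msum: 
  assumes "md M" "md N" "\<And>i. i < n \<Longrightarrow> f i \<in> hom M N" 
  shows "msum (fst N) (fst M) f n \<in> hom M N"
  using assms(3) by (induction n) (auto intro: hom_add hom_zero assms)

lemma fn_md: "fn F \<Longrightarrow> md M \<Longrightarrow> md (fst F M)"
  and fn_hom: "fn F \<Longrightarrow> md M \<Longrightarrow> md N \<Longrightarrow> f \<in> hom M N \<Longrightarrow> snd F M N f \<in> hom (fst F M) (fst F N)"
  and fn_one: "fn F \<Longrightarrow> md M \<Longrightarrow> snd F M M (1\<^sub>m (fst M)) = 1\<^sub>m (fst (fst F M))"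
  and fn_mult: "fn F \<Longrightarrow> md L \<Longrightarrow> md M \<Longrightarrow> md N \<Longrightarrow> f \<in> hom L M \<Longrightarrow> g \<in> hom M N \<Longrightarrow>
    snd F L N (g * f) = snd F M N g * snd F L M f"
  and fn_add: "fn F \<Longrightarrow> md M \<Longrightarrow> md N \<Longrightarrow> f \<in> hom M N \<Longrightarrow> g \<in> hom M N \<Longrightarrow>
    snd F M N (f + g) = snd F M N f + snd F M N g"
  and fn_smult: "fn F \<Longrightarrow> md M \<Longrightarrow> md N \<Longrightarrow> f \<in> hom M N \<Longrightarrow>
    snd F M N (c \<cdot>\<^sub>m f) = c \<cdot>\<^sub>m snd F M N f"
  unfolding is_functor_def by blast+

lemma zero_smult_mat: "A \<in> carrier_mat r c \<Longrightarrow> (0 :: 'k) \<cdot>\<^sub>m A = 0\<^sub>m r c"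
  by (rule eq_matI) auto

lemma fn_zero:
  assumes "fn F" "md M" "md N"
  shows "snd F M N (0\<^sub>m (fst N) (fst M)) = 0\<^sub>m (fst (fst F N)) (fst (fst F M))"
proof -
  have z: "0\<^sub>m (fst N) (fst M) \<in> hom M N" using assms hom_zero by blast
  have "snd F M N (0 \<cdot>\<^sub>m 0\<^sub>m (fst N) (fst M)) = 0 \<cdot>\<^sub>m snd F M N (0\<^sub>m (fst N) (fst M))"
    using fn_smult[OF assms z] .
  thus ?thesis using homD[OF fn_hom[OF assms z]] by (simp add: zero_smult_mat)
qed

lemma fn_msum:
  assumes "fn F" "md M" "md N" "\<And>i. i < n \<Longrightarrow> f i \<in> hom M N"
  shows "snd F M N (msum (fst N) (fst M) f n)
       = msum (fst (fst F N)) (fst (fst F M)) (\<lambda>i. snd F M N (f i)) n"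
  using assms(4)
  by (induction n) (auto simp: fn_zero fn_add[OF assms(1-3)] hom_msum assms)

text \<open>Functors are total functions, defined also on pairs that are not modules. All conditions
  are guarded by \<open>md\<close>, and components elsewhere are arbitrary, so identities between
  transformations are stated pointwise on modules.\<close>

definition nt where
  "nt F G \<eta> \<longleftrightarrow> (\<forall>M. md M \<longrightarrow> \<eta> M \<in> hom (fst F M) (fst G M)) \<and>
     (\<forall>M N f. md M \<and> md N \<and> f \<in> hom M N \<longrightarrow> snd G M N f * \<eta> M = \<eta> N * snd F M N f)"

lemma nt_hom: "nt F G \<eta> \<Longrightarrow> md M \<Longrightarrow> \<eta> M \<in> hom (fst F M) (fst G M)"
  and nt_nat: "nt F G \<eta> \<Longrightarrow> md M \<Longrightarrow> md N \<Longrightarrow> f \<in> hom M N \<Longrightarrow>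
     snd G M N f * \<eta> M = \<eta> N * snd F M N f"
  unfolding nt_def by blast+

lemma ntI: "(\<And>M. md M \<Longrightarrow> \<eta> M \<in> hom (fst F M) (fst G M)) \<Longrightarrow>
   (\<And>M N f. md M \<Longrightarrow> md N \<Longrightarrow> f \<in> hom M N \<Longrightarrow> snd G M N f * \<eta> M = \<eta> N * snd F M N f) \<Longrightarrow> nt F G \<eta>"
  unfolding nt_def by blast

lemma nt_id:
  assumes "fn F" shows "nt F F (\<lambda>M. 1\<^sub>m (fst (fst F M)))"
  by (rule ntI) (use assms in \<open>auto intro!: hom_one fn_md simp: mult_one_hom[OF fn_hom]\<close>)

lemma nt_comp:
  assumes F: "fn F" "fn G" "fn H" and n: "nt F G \<eta>" "nt G H \<theta>"
  shows "nt F H (\<lambda>M. \<theta> M * \<eta> M)"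
proof (rule ntI)
  fix M assume "md M"
  thus "\<theta> M * \<eta> M \<in> hom (fst F M) (fst H M)"
    using assms by (auto intro!: hom_mult[of _ "fst G M"] fn_md nt_hom[OF n(1)] nt_hom[OF n(2)])
next
  fix M N f assume m: "md M" "md N" "f \<in> hom M N"
  note h = nt_hom[OF n(1) m(1)] nt_hom[OF n(1) m(2)] nt_hom[OF n(2) m(1)] nt_hom[OF n(2) m(2)]
    fn_hom[OF F(1) m] fn_hom[OF F(2) m] fn_hom[OF F(3) m]
  have "snd H M N f * (\<theta> M * \<eta> M) = (snd H M N f * \<theta> M) * \<eta> M"
    by (rule hom_assoc[symmetric, OF h(1) h(3) h(7)])
  also have "\<dots> = \<theta> N * (snd G M N f * \<eta> M)"
    unfolding nt_nat[OF n(2) m] by (rule hom_assoc[OF h(1) h(6) h(4)])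
  also have "\<dots> = \<theta> N * \<eta> N * snd F M N f"
    unfolding nt_nat[OF n(1) m] by (rule hom_assoc[symmetric, OF h(5) h(2) h(4)])
  finally show "snd H M N f * (\<theta> M * \<eta> M) = \<theta> N * \<eta> N * snd F M N f" .
qed

lemma nt_add:
  assumes F: "fn F" "fn G" and n: "nt F G \<eta>" "nt F G \<theta>"
  shows "nt F G (\<lambda>M. \<eta> M + \<theta> M)"
proof (rule ntI)
  fix M assume "md M"
  thus "\<eta> M + \<theta> M \<in> hom (fst F M) (fst G M)"
    using assms by (auto intro!: hom_add fn_md nt_hom[OF n(1)] nt_hom[OF n(2)])
next
  fix M N f assume m: "md M" "md N" "f \<in> hom M N"
  note h = nt_hom[OF n(1) m(1)] nt_hom[OF n(1) m(2)] nt_hom[OF n(2) m(1)] nt_hom[OF n(2) m(2)]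
    fn_hom[OF F(1) m] fn_hom[OF F(2) m]
  show "snd G M N f * (\<eta> M + \<theta> M) = (\<eta> N + \<theta> N) * snd F M N f"
    using h[THEN homD] nt_nat[OF n(1) m] nt_nat[OF n(2) m] by (simp add: mat_mult_add mat_add_mult)
qed

lemma nt_smult:
  assumes F: "fn F" "fn G" and n: "nt F G \<eta>"
  shows "nt F G (\<lambda>M. c \<cdot>\<^sub>m \<eta> M)"
proof (rule ntI)
  fix M assume "md M"
  thus "c \<cdot>\<^sub>m \<eta> M \<in> hom (fst F M) (fst G M)"
    using assms by (auto intro!: hom_smult fn_md nt_hom[OF n])
next
  fix M N f assume m: "md M" "md N" "f \<in> hom M N"
  note h = nt_hom[OF n(1) m(1)] nt_hom[OF n(1) m(2)] fn_hom[OF F(1) m] fn_hom[OF F(2) m]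
  show "snd G M N f * (c \<cdot>\<^sub>m \<eta> M) = (c \<cdot>\<^sub>m \<eta> N) * snd F M N f"
    using h[THEN homD] nt_nat[OF n(1) m] by (simp add: mat_mult_smult mat_smult_mult)
qed

lemma nt_zero:
  assumes F: "fn F" "fn G"
  shows "nt F G (\<lambda>M. 0\<^sub>m (fst (fst G M)) (fst (fst F M)))"
proof (rule ntI)
  fix M assume "md M"
  thus "0\<^sub>m (fst (fst G M)) (fst (fst F M)) \<in> hom (fst F M) (fst G M)"
    using assms by (auto intro!: hom_zero fn_md)
next
  fix M N f assume m: "md M" "md N" "f \<in> hom M N"
  show "snd G M N f * 0\<^sub>m (fst (fst G M)) (fst (fst F M)) = 0\<^sub>m (fst (fst G N)) (fst (fst F N)) * snd F M N f"
    using homD[OF fn_hom[OF F(1) m]] homD[OF fn_hom[OF F(2) m]] by simp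
qed

lemma nt_msum:
  assumes F: "fn F" "fn G" and n: "\<And>i. i < n \<Longrightarrow> nt F G (\<eta> i)"
  shows "nt F G (\<lambda>M. msum (fst (fst G M)) (fst (fst F M)) (\<lambda>i. \<eta> i M) n)"
  using n by (induction n) (auto intro: nt_zero nt_add F)

lemma fnI:
  assumes "\<And>M. md M \<Longrightarrow> md (fst F M)"
    and "\<And>M N f. md M \<Longrightarrow> md N \<Longrightarrow> f \<in> hom M N \<Longrightarrow> snd F M N f \<in> hom (fst F M) (fst F N)"
    and "\<And>M. md M \<Longrightarrow> snd F M M (1\<^sub>m (fst M)) = 1\<^sub>m (fst (fst F M))"
    and "\<And>L M N f g. md L \<Longrightarrow> md M \<Longrightarrow> md N \<Longrightarrow> f \<in> hom L M \<Longrightarrow> g \<in> hom M N \<Longrightarrow>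
      snd F L N (g * f) = snd F M N g * snd F L M f"
    and "\<And>M N f g. md M \<Longrightarrow> md N \<Longrightarrow> f \<in> hom M N \<Longrightarrow> g \<in> hom M N \<Longrightarrow>
      snd F M N (f + g) = snd F M N f + snd F M N g"
    and "\<And>M N f c. md M \<Longrightarrow> md N \<Longrightarrow> f \<in> hom M N \<Longrightarrow>
      snd F M N (c \<cdot>\<^sub>m f) = c \<cdot>\<^sub>m snd F M N f"
  shows "fn F"
  unfolding is_functor_def by (intro conjI allI impI; (elim conjE)?; rule assms; assumption)

lemma fn_fid: "fn fid" by (auto simp: is_functor_def fid_def)


lemma fst_fcomp [simp]: "fst (fcomp G F) M = fst G (fst F M)"
  and snd_fcomp [simp]: "snd (fcomp G F) M N f = snd G (fst F M) (fst F N) (snd F M N f)"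
  and fst_fid [simp]: "fst fid M = M"
  and snd_fid [simp]: "snd fid M N f = f"
  by (auto simp: fcomp_def fid_def)

lemma fn_fcomp:
  assumes "fn F" "fn G" shows "fn (fcomp G F)"
proof (rule fnI)
  fix L M N f g assume "md L" "md M" "md N" "f \<in> hom L M" "g \<in> hom M N"
  thus "snd (fcomp G F) L N (g * f) = snd (fcomp G F) M N g * snd (fcomp G F) L M f"
    using assms fn_mult[OF assms(1), of L M N f g]
      fn_mult[OF assms(2), of "fst F L" "fst F M" "fst F N" "snd F L M f" "snd F M N g"]
    by (simp add: fn_md fn_hom)
qed (use assms in \<open>simp_all add: fn_md fn_hom fn_one fn_add fn_smult\<close>)

lemma nt_whisker_left:
  assumes H: "fn H" and F: "fn F" "fn G" and n: "nt F G \<eta>"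
  shows "nt (fcomp H F) (fcomp H G) (\<lambda>M. snd H (fst F M) (fst G M) (\<eta> M))"
proof (rule ntI)
  fix M assume "md M"
  thus "snd H (fst F M) (fst G M) (\<eta> M) \<in> hom (fst (fcomp H F) M) (fst (fcomp H G) M)"
    using assms by (auto intro!: fn_hom fn_md nt_hom[OF n])
next
  fix M N f assume m: "md M" "md N" "f \<in> hom M N"
  note h = nt_hom[OF n(1) m(1)] nt_hom[OF n(1) m(2)] fn_hom[OF F(1) m] fn_hom[OF F(2) m]
  show "snd (fcomp H G) M N f * snd H (fst F M) (fst G M) (\<eta> M)
     = snd H (fst F N) (fst G N) (\<eta> N) * snd (fcomp H F) M N f"
    using m F h nt_nat[OF n m]
    by (auto simp: fn_mult[OF H, symmetric] fn_md)
qed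

lemma nt_whisker_right:
  assumes H: "fn H" and n: "nt F G \<eta>"
  shows "nt (fcomp F H) (fcomp G H) (\<lambda>M. \<eta> (fst H M))"
  by (rule ntI) (use assms in \<open>auto intro!: nt_hom[OF n] nt_nat[OF n] fn_md fn_hom\<close>)

text \<open>\<open>nat_iso\<close> provides an inverse at each module separately. Chosen
  simultaneously, the inverses are automatically natural: insert
  \<open>\<theta> N * \<eta> N = 1\<close> on the left and move \<open>\<eta>\<close> across by its
  own naturality.\<close>

lemma nat_isoE:
  assumes F: "fn F" "fn G" and "nat_iso sm F G"
  obtains \<eta> \<theta> where "nt F G \<eta>" "nt G F \<theta>" "\<And>M. md M \<Longrightarrow> \<theta> M * \<eta> M = 1\<^sub>m (fst (fst F M))"
    "\<And>M. md M \<Longrightarrow> \<eta> M * \<theta> M = 1\<^sub>m (fst (fst G M))"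
proof -
  from assms(3) obtain \<eta> where
    1: "\<forall>M. md M \<longrightarrow> \<eta> M \<in> hom (fst F M) (fst G M) \<and>
        (\<exists>\<theta> \<in> hom (fst G M) (fst F M). \<theta> * \<eta> M = 1\<^sub>m (fst (fst F M)) \<and> \<eta> M * \<theta> = 1\<^sub>m (fst (fst G M)))"
   and 2: "\<forall>M N f. md M \<and> md N \<and> f \<in> hom M N \<longrightarrow> snd G M N f * \<eta> M = \<eta> N * snd F M N f"
    unfolding nat_iso_def by blast
  have n: "nt F G \<eta>" using 1 2 unfolding nt_def by blast
  from 1 have "\<forall>M. \<exists>\<theta>. md M \<longrightarrow> \<theta> \<in> hom (fst G M) (fst F M) \<and> \<theta> * \<eta> M = 1\<^sub>m (fst (fst F M)) \<and> \<eta> M * \<theta> = 1\<^sub>m (fst (fst G M))"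
    by blast
  then obtain \<theta> where t: "\<And>M. md M \<Longrightarrow> \<theta> M \<in> hom (fst G M) (fst F M) \<and> \<theta> M * \<eta> M = 1\<^sub>m (fst (fst F M)) \<and> \<eta> M * \<theta> M = 1\<^sub>m (fst (fst G M))"
    by metis
  have "nt G F \<theta>"
  proof (rule ntI)
    fix M N f assume m: "md M" "md N" "f \<in> hom M N"
    note h = nt_hom[OF n m(1)] nt_hom[OF n m(2)] t[OF m(1), THEN conjunct1] t[OF m(2), THEN conjunct1]
      fn_hom[OF F(1) m] fn_hom[OF F(2) m]
    note d = h[THEN homD]
    have "snd F M N f * \<theta> M = (\<theta> N * \<eta> N) * (snd F M N f * \<theta> M)"
      using t[OF m(2)] d by simp
    also have "\<dots> = \<theta> N * ((\<eta> N * snd F M N f) * \<theta> M)"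
      using d by (simp add: mat_mult_assoc)
    also have "\<dots> = \<theta> N * (snd G M N f * (\<eta> M * \<theta> M))"
      unfolding nt_nat[OF n m, symmetric] using d by (simp add: mat_mult_assoc)
    also have "\<dots> = \<theta> N * snd G M N f" using t[OF m(1)] d by simp
    finally show "snd F M N f * \<theta> M = \<theta> N * snd G M N f" .
  qed (use t in auto)
  with n t that show thesis by blast
qed

lemma nat_isoI:
  assumes "nt F G \<eta>" "\<And>M. md M \<Longrightarrow> \<theta> M \<in> hom (fst G M) (fst F M)"
   "\<And>M. md M \<Longrightarrow> \<theta> M * \<eta> M = 1\<^sub>m (fst (fst F M))"
    "\<And>M. md M \<Longrightarrow> \<eta> M * \<theta> M = 1\<^sub>m (fst (fst G M))"
  shows "nat_iso sm F G"
  unfolding nat_iso_def using assms unfolding nt_def by (intro exI[of _ \<eta>]) blast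

lemma nat_iso_sym:
  assumes "fn F" "fn G" "nat_iso sm F G" shows "nat_iso sm G F"
  by (rule nat_isoE[OF assms]) (rule nat_isoI, auto intro: nt_hom)

end

subsection \<open>Finite direct sums\<close>

definition in1 :: "nat \<Rightarrow> nat \<Rightarrow> 'k::field mat" where
  "in1 n m = mat (n + m) n (\<lambda>(r, c). if r = c then 1 else 0)"
definition in2 :: "nat \<Rightarrow> nat \<Rightarrow> 'k::field mat" where
  "in2 n m = mat (n + m) m (\<lambda>(r, c). if r = n + c then 1 else 0)"
definition pr1 :: "nat \<Rightarrow> nat \<Rightarrow> 'k::field mat" where
  "pr1 n m = mat n (n + m) (\<lambda>(r, c). if r = c then 1 else 0)"
definition pr2 :: "nat \<Rightarrow> nat \<Rightarrow> 'k::field mat" where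
  "pr2 n m = mat m (n + m) (\<lambda>(r, c). if c = n + r then 1 else 0)"

lemma in_pr_carrier [simp]:
  "in1 n m \<in> carrier_mat (n + m) n" "in2 n m \<in> carrier_mat (n + m) m"
  "pr1 n m \<in> carrier_mat n (n + m)" "pr2 n m \<in> carrier_mat m (n + m)"
  by (auto simp: in1_def in2_def pr1_def pr2_def)

lemma in_pr_dim [simp]:
  "dim_row (in1 n m) = n + m" "dim_col (in1 n m) = n"
  "dim_row (in2 n m) = n + m" "dim_col (in2 n m) = m"
  "dim_row (pr1 n m) = n" "dim_col (pr1 n m) = n + m"
  "dim_row (pr2 n m) = m" "dim_col (pr2 n m) = n + m"
  by (auto simp: in1_def in2_def pr1_def pr2_def)

lemma pr1_mult:
  assumes "A \<in> carrier_mat (n + m) c"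
  shows "pr1 n m * A = mat n c (\<lambda>(i, j). A $$ (i, j))"
proof (rule eq_matI)
  fix i j assume "i < dim_row (mat n c (\<lambda>(i, j). A $$ (i, j)))" "j < dim_col (mat n c (\<lambda>(i, j). A $$ (i, j)))"
  hence ij: "i < n" "j < c" by auto
  have "(pr1 n m * A) $$ (i, j) = (\<Sum>k\<in>{0..<n + m}. (if i = k then 1 else 0) * A $$ (k, j))"
    using assms ij by (simp add: scalar_prod_def pr1_def)
  also have "\<dots> = A $$ (i, j)"
    using ij by (simp add: if_distrib[of "\<lambda>x. x * _"] cong: if_cong)
  finally show "(pr1 n m * A) $$ (i, j) = mat n c (\<lambda>(i, j). A $$ (i, j)) $$ (i, j)" using ij by simp
qed (use assms in auto)

lemma pr2_mult:
  assumes "A \<in> carrier_mat (n + m) c"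
  shows "pr2 n m * A = mat m c (\<lambda>(i, j). A $$ (n + i, j))"
proof (rule eq_matI)
  fix i j assume "i < dim_row (mat m c (\<lambda>(i, j). A $$ (n + i, j)))" "j < dim_col (mat m c (\<lambda>(i, j). A $$ (n + i, j)))"
  hence ij: "i < m" "j < c" by auto
  have "(pr2 n m * A) $$ (i, j) = (\<Sum>k\<in>{0..<n + m}. (if k = n + i then 1 else 0) * A $$ (k, j))"
    using assms ij by (simp add: scalar_prod_def pr2_def)
  also have "\<dots> = A $$ (n + i, j)"
    using ij by (simp add: if_distrib[of "\<lambda>x. x * _"] cong: if_cong)
  finally show "(pr2 n m * A) $$ (i, j) = mat m c (\<lambda>(i, j). A $$ (n + i, j)) $$ (i, j)" using ij by simp
qed (use assms in auto)

lemma pr_in: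
  "pr1 n m * in1 n m = 1\<^sub>m n" "pr1 n m * in2 n m = 0\<^sub>m n m"
  "pr2 n m * in1 n m = 0\<^sub>m m n" "pr2 n m * in2 n m = 1\<^sub>m m"
  by (simp_all only: pr1_mult[OF in_pr_carrier(1)] pr1_mult[OF in_pr_carrier(2)]
      pr2_mult[OF in_pr_carrier(1)] pr2_mult[OF in_pr_carrier(2)])
    (auto simp: in1_def in2_def intro!: eq_matI)

lemma in_pr: "in1 n m * pr1 n m + in2 n m * pr2 n m = 1\<^sub>m (n + m)"
proof (rule eq_matI)
  fix i j assume "i < dim_row (1\<^sub>m (n + m))" "j < dim_col (1\<^sub>m (n + m))"
  hence ij: "i < n + m" "j < n + m" by auto
  have "(in1 n m * pr1 n m) $$ (i, j) = (\<Sum>k\<in>{0..<n}. (if k = i then 1 else 0) * (if k = j then 1 else 0))"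
    using ij by (auto simp: scalar_prod_def in1_def pr1_def intro!: sum.cong)
  also have "\<dots> = (if i = j \<and> i < n then 1 else 0)"
    by (simp add: if_distrib[of "\<lambda>x. x * _"] cong: if_cong)
  finally have 1: "(in1 n m * pr1 n m) $$ (i, j) = (if i = j \<and> i < n then 1 else 0)" .
  have "(in2 n m * pr2 n m) $$ (i, j) = (\<Sum>k\<in>{0..<m}. (if k = i - n \<and> n \<le> i then 1 else 0) * (if k = j - n \<and> n \<le> j then 1 else 0))"
    using ij by (auto simp: scalar_prod_def in2_def pr2_def intro!: sum.cong)
  also have "\<dots> = (\<Sum>k\<in>{0..<m}. (if k = i - n then (if n \<le> i \<and> i - n = j - n \<and> n \<le> j then 1 else 0) else 0))"
    by (intro sum.cong) auto
  also have "\<dots> = (if i = j \<and> n \<le> i then 1 else 0)"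
    using ij by (subst sum.delta) auto
  finally have 2: "(in2 n m * pr2 n m) $$ (i, j) = (if i = j \<and> n \<le> i then 1 else 0)" .
  show "(in1 n m * pr1 n m + in2 n m * pr2 n m) $$ (i, j) = 1\<^sub>m (n + m) $$ (i, j)"
    using ij by (simp add: 1 2)
qed auto

lemma diag_block_in_pr:
  assumes "f \<in> carrier_mat n' n" "g \<in> carrier_mat m' m"
  defines "D \<equiv> four_block_mat f (0\<^sub>m n' m) (0\<^sub>m m' n) g"
  shows "D * in1 n m = in1 n' m' * f" "D * in2 n m = in2 n' m' * g"
    "pr1 n' m' * D = f * pr1 n m" "pr2 n' m' * D = g * pr2 n m"
    "D \<in> carrier_mat (n' + m') (n + m)"
proof -
  show D: "D \<in> carrier_mat (n' + m') (n + m)" using assms by simp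
  have pm: "pr1 n' m' * D = f * pr1 n m"
  proof (rule eq_matI)
    fix i j assume "i < dim_row (f * pr1 n m)" "j < dim_col (f * pr1 n m)"
    hence ij: "i < n'" "j < n + m" using assms by auto
    have "(f * pr1 n m) $$ (i, j) = (\<Sum>k\<in>{0..<n}. f $$ (i, k) * (if k = j then 1 else 0))"
      using assms ij by (auto simp: scalar_prod_def pr1_def)
    also have "\<dots> = (if j < n then f $$ (i, j) else 0)"
      using ij by (simp add: if_distrib cong: if_cong)
    finally show "(pr1 n' m' * D) $$ (i, j) = (f * pr1 n m) $$ (i, j)"
      using ij assms by (subst pr1_mult[OF D]) (auto simp: D_def)
  qed (use assms D in auto)
  have pm2: "pr2 n' m' * D = g * pr2 n m"
  proof (rule eq_matI)
    fix i j assume "i < dim_row (g * pr2 n m)" "j < dim_col (g * pr2 n m)"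
    hence ij: "i < m'" "j < n + m" using assms by auto
    have "(g * pr2 n m) $$ (i, j) = (\<Sum>k\<in>{0..<m}. g $$ (i, k) * (if k = j - n \<and> n \<le> j then 1 else 0))"
      using assms ij by (auto simp: scalar_prod_def pr2_def intro!: sum.cong)
    also have "\<dots> = (if n \<le> j then g $$ (i, j - n) else 0)"
      using ij by (auto simp add: if_distrib cong: if_cong)
    finally show "(pr2 n' m' * D) $$ (i, j) = (g * pr2 n m) $$ (i, j)"
      using ij assms by (subst pr2_mult[OF D]) (auto simp: D_def)
  qed (use assms D in auto)
  show "pr1 n' m' * D = f * pr1 n m" "pr2 n' m' * D = g * pr2 n m" by fact+
  \<comment> \<open>Only the projections are checked entrywise. The relations for the inclusions
    follow by expanding \<open>D\<close> through the resolution of the identity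
    \<open>in_pr\<close>.\<close>
  have one: "D = (in1 n' m' * pr1 n' m' + in2 n' m' * pr2 n' m') * D"
    unfolding in_pr using D by simp
  have exp: "D = in1 n' m' * (f * pr1 n m) + in2 n' m' * (g * pr2 n m)"
    by (subst one) (use D in \<open>simp add: mat_add_mult mat_mult_assoc pm pm2\<close>)
  show "D * in1 n m = in1 n' m' * f" "D * in2 n m = in2 n' m' * g"
    by (subst exp, use assms(1,2) in \<open>simp add: mat_add_mult mat_mult_assoc pr_in mat_add_zero\<close>)+
qed

section \<open>The m-fold direct sum as a block diagonal module\<close>

lemma rep_obj_fst [simp]: "fst (rep_obj m X) = m * fst X"
  by (induction m) (auto simp: dsum_obj_def)

lemma rep_obj_snd: "snd (rep_obj m X) a = rep_mor m X X (snd X a)"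
  by (induction m) (auto simp: dsum_obj_def)

lemma rep_mor_carrier:
  "f \<in> carrier_mat (fst N) (fst M) \<Longrightarrow> rep_mor m M N f \<in> carrier_mat (m * fst N) (m * fst M)"
  by (induction m) auto

lemma rep_mor_one: "rep_mor m M M (1\<^sub>m (fst M)) = 1\<^sub>m (m * fst M)"
  by (induction m) auto

lemma rep_mor_mult:
  assumes "f \<in> carrier_mat (fst M) (fst L)" "g \<in> carrier_mat (fst N) (fst M)"
  shows "rep_mor m L N (g * f) = rep_mor m M N g * rep_mor m L M f"
proof (induction m)
  case (Suc m)
  show ?case
    using assms rep_mor_carrier[OF assms(1), of m] rep_mor_carrier[OF assms(2), of m] Suc
    by (simp, subst mult_four_block_mat) (auto simp: left_add_zero_mat right_add_zero_mat)
qed auto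

lemma rep_mor_add:
  assumes "f \<in> carrier_mat (fst N) (fst M)" "g \<in> carrier_mat (fst N) (fst M)"
  shows "rep_mor m M N (f + g) = rep_mor m M N f + rep_mor m M N g"
proof (induction m)
  case (Suc m)
  show ?case
    using assms rep_mor_carrier[OF assms(1), of m] rep_mor_carrier[OF assms(2), of m] Suc
    by (simp, subst add_four_block_mat) auto
qed auto

lemma rep_mor_smult:
  assumes "f \<in> carrier_mat (fst N) (fst M)"
  shows "rep_mor m M N (c \<cdot>\<^sub>m f) = c \<cdot>\<^sub>m rep_mor m M N f"
proof (induction m)
  case (Suc m)
  show ?case
    using assms rep_mor_carrier[OF assms(1), of m] Suc
    by (simp, subst smult_four_block_mat) auto
qed auto

text \<open>The inclusion of summand \<open>i\<close> into m copies of an n-dimensional space, with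
  the recursion of \<open>rep_obj\<close>: index 0 is the first block, a successor passes through
  the second block. For \<open>i \<ge> m\<close> the recursion ends in an empty matrix and the value
  is 0.\<close>

fun inc :: "nat \<Rightarrow> nat \<Rightarrow> nat \<Rightarrow> 'k::field mat" where
  "inc n 0 i = 0\<^sub>m 0 n"
| "inc n (Suc m) i = (case i of 0 \<Rightarrow> in1 n (m * n) | Suc j \<Rightarrow> in2 n (m * n) * inc n m j)"

fun prj :: "nat \<Rightarrow> nat \<Rightarrow> nat \<Rightarrow> 'k::field mat" where
  "prj n 0 i = 0\<^sub>m n 0"
| "prj n (Suc m) i = (case i of 0 \<Rightarrow> pr1 n (m * n) | Suc j \<Rightarrow> prj n m j * pr2 n (m * n))"

lemma inc_dim [simp]: "dim_row (inc n m i) = m * n" "dim_col (inc n m i) = n"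
  by (induction m arbitrary: i) (auto split: nat.splits)

lemma prj_dim [simp]: "dim_row (prj n m i) = n" "dim_col (prj n m i) = m * n"
  by (induction m arbitrary: i) (auto split: nat.splits)

lemma inc_prj_carrier [simp]: "inc n m i \<in> carrier_mat (m * n) n" "prj n m i \<in> carrier_mat n (m * n)"
  by (auto intro!: carrier_matI)

lemma prj_inc: "i < m \<Longrightarrow> j < m \<Longrightarrow> prj n m i * inc n m j = (if i = j then 1\<^sub>m n else 0\<^sub>m n n)"
proof (induction m arbitrary: i j)
  case (Suc m)
  show ?case
  proof (cases i; cases j)
    fix i' j' assume ij: "i = Suc i'" "j = Suc j'"
    have "prj n (Suc m) i * inc n (Suc m) j = prj n m i' * (pr2 n (m * n) * in2 n (m * n)) * inc n m j'"
      by (simp add: ij mat_mult_assoc)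
    also have "\<dots> = prj n m i' * inc n m j'" by (simp add: pr_in)
    finally have E: "prj n (Suc m) i * inc n (Suc m) j = prj n m i' * inc n m j'" .
    show ?thesis unfolding E using Suc.IH[of i' j'] Suc.prems ij by simp
  next
    fix i' assume ij: "i = Suc i'" "j = 0"
    have "prj n (Suc m) i * inc n (Suc m) j = prj n m i' * (pr2 n (m * n) * in1 n (m * n))"
      by (simp add: ij mat_mult_assoc)
    thus ?thesis using ij by (simp add: pr_in)
  next
    fix j' assume ij: "i = 0" "j = Suc j'"
    have "prj n (Suc m) i * inc n (Suc m) j = (pr1 n (m * n) * in2 n (m * n)) * inc n m j'"
      by (simp add: ij mat_mult_assoc)
    thus ?thesis using ij by (simp add: pr_in)
  qed (simp add: pr_in)
qed simp

lemma inc_prj: "msum (m * n) (m * n) (\<lambda>i. inc n m i * prj n m i) m = (1\<^sub>m (m * n) :: 'k::field mat)"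
proof (induction m)
  case (Suc m)
  have "msum (Suc m * n) (Suc m * n) (\<lambda>i. inc n (Suc m) i * prj n (Suc m) i) (Suc m)
     = (inc n (Suc m) 0 * prj n (Suc m) 0 :: 'k mat)
       + msum (Suc m * n) (Suc m * n) (\<lambda>i. inc n (Suc m) (Suc i) * prj n (Suc m) (Suc i)) m"
    by (rule msum_Suc_shift) (rule mult_carrier_mat[OF inc_prj_carrier(1) inc_prj_carrier(2)])
  also have "msum (Suc m * n) (Suc m * n) (\<lambda>i. inc n (Suc m) (Suc i) * prj n (Suc m) (Suc i)) m
     = (msum (n + m * n) (n + m * n) (\<lambda>i. in2 n (m * n) * (inc n m i * prj n m i) * pr2 n (m * n)) m :: 'k mat)"
    by (auto simp: mat_mult_assoc intro!: msum_cong)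
  also have "\<dots> = in2 n (m * n) * msum (m * n) (m * n) (\<lambda>i. inc n m i * prj n m i) m * pr2 n (m * n)"
  proof -
    have "in2 n (m * n) * msum (m * n) (m * n) (\<lambda>i. inc n m i * prj n m i) m
       = (msum (n + m * n) (m * n) (\<lambda>i. in2 n (m * n) * (inc n m i * prj n m i)) m :: 'k mat)"
      by (rule mult_msum) (auto intro!: mult_carrier_mat[OF inc_prj_carrier(1) inc_prj_carrier(2)])
    moreover have "\<dots> * pr2 n (m * n)
       = msum (n + m * n) (n + m * n) (\<lambda>i. in2 n (m * n) * (inc n m i * prj n m i) * pr2 n (m * n)) m"
      by (rule msum_mult) (auto intro!: carrier_matI)
    ultimately show ?thesis by simp
  qed
  also have "\<dots> = in2 n (m * n) * pr2 n (m * n)" by (simp add: Suc.IH)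
  finally show ?case by (simp add: in_pr)
qed auto

lemma rep_mor_inc:
  assumes "f \<in> carrier_mat (fst N) (fst M)"
  shows "i < m \<Longrightarrow> rep_mor m M N f * inc (fst M) m i = inc (fst N) m i * f"
proof (induction m arbitrary: i)
  case (Suc m)
  let ?g = "rep_mor m M N f"
  have g: "?g \<in> carrier_mat (m * fst N) (m * fst M)" by (rule rep_mor_carrier[OF assms])
  note D = diag_block_in_pr[OF assms g]
  show ?case
  proof (cases i)
    case (Suc i')
    have "rep_mor (Suc m) M N f * inc (fst M) (Suc m) i
       = (rep_mor (Suc m) M N f * in2 (fst M) (m * fst M)) * inc (fst M) m i'"
      using D(5) assms g by (simp add: Suc mat_mult_assoc)
    also have "\<dots> = in2 (fst N) (m * fst N) * (?g * inc (fst M) m i')"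
      using g by (simp add: D(2) mat_mult_assoc)
    also have "?g * inc (fst M) m i' = inc (fst N) m i' * f"
      using Suc Suc.prems by (intro Suc.IH) simp
    finally show ?thesis using Suc assms by (simp add: mat_mult_assoc)
  qed (use D(1) in simp)
qed auto

lemma prj_rep_mor:
  assumes "f \<in> carrier_mat (fst N) (fst M)"
  shows "i < m \<Longrightarrow> prj (fst N) m i * rep_mor m M N f = f * prj (fst M) m i"
proof (induction m arbitrary: i)
  case (Suc m)
  let ?g = "rep_mor m M N f"
  have g: "?g \<in> carrier_mat (m * fst N) (m * fst M)" by (rule rep_mor_carrier[OF assms])
  note D = diag_block_in_pr[OF assms g]
  show ?case
  proof (cases i)
    case (Suc i')
    have "prj (fst N) (Suc m) i * rep_mor (Suc m) M N f
       = prj (fst N) m i' * (pr2 (fst N) (m * fst N) * rep_mor (Suc m) M N f)"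
      using D(5) assms g by (simp add: Suc mat_mult_assoc)
    also have "\<dots> = (prj (fst N) m i' * ?g) * pr2 (fst M) (m * fst M)"
      using g by (simp add: D(4) mat_mult_assoc)
    also have "prj (fst N) m i' * ?g = f * prj (fst M) m i'"
      using Suc Suc.prems by (intro Suc.IH) simp
    finally show ?thesis using Suc assms by (simp add: mat_mult_assoc)
  qed (use D(3) in simp)
qed auto


text \<open>If \<open>n < r\<close>, padding \<open>A\<close> with zero columns and \<open>B\<close>
  with zero rows gives square matrices of size \<open>r\<close> with product 1. One-sided inverses
  of square matrices are two-sided, so \<open>B' * A' = 1\<close>, although the last rows of
  \<open>B'\<close> vanish. The dimension counts below rest on this inequality.\<close>

lemma right_inverse_dim_le:
  fixes A :: "'k::field mat"
  assumes A: "A \<in> carrier_mat r n" and B: "B \<in> carrier_mat n r" and AB: "A * B = 1\<^sub>m r"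
  shows "r \<le> n"
proof (rule ccontr)
  assume "\<not> r \<le> n"
  then obtain d where d: "r = n + d" "d > 0" using less_imp_add_positive by (metis not_le)
  define A' where "A' = A * pr1 n d"
  define B' where "B' = in1 n d * B"
  have c: "A' \<in> carrier_mat r r" "B' \<in> carrier_mat r r"
    using A B d by (auto simp: A'_def B'_def intro!: carrier_matI)
  have "A' * B' = A * ((pr1 n d * in1 n d) * B)"
    using A B d by (simp add: A'_def B'_def mat_mult_assoc)
  also have "\<dots> = 1\<^sub>m r" using AB B by (simp add: pr_in)
  finally have "B' * A' = 1\<^sub>m r" using mat_mult_left_right_inverse[OF c] by simp
  hence "pr2 n d = pr2 n d * (B' * A')" using d by simp
  also have "\<dots> = (pr2 n d * in1 n d) * (B * A')"
    using A B d c by (simp add: B'_def mat_mult_assoc)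
  also have "\<dots> = 0\<^sub>m d r" using A B c by (simp add: pr_in)
  finally have "pr2 n d * in2 n d = (0\<^sub>m d d :: 'k mat)" using d by simp
  hence "(1\<^sub>m d :: 'k mat) $$ (0, 0) = 0\<^sub>m d d $$ (0, 0)" by (simp add: pr_in)
  thus False using d by simp
qed

section \<open>Direct sums of copies of one module, described by equations\<close>

context kalg
begin

lemma md_rep_obj:
  assumes "md X" shows "md (rep_obj m X)"
  unfolding is_module_def rep_obj_snd rep_obj_fst
  using assms by (auto simp: md_one md_mult md_add md_smult rep_mor_one
      intro!: rep_mor_carrier rep_mor_mult rep_mor_add rep_mor_smult md_carrier)

lemma rep_mor_hom:
  assumes "md X" "md Y" "f \<in> hom X Y" shows "rep_mor m X Y f \<in> hom (rep_obj m X) (rep_obj m Y)"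
proof -
  note c = homD[OF assms(3)] md_carrier[OF assms(1)] md_carrier[OF assms(2)]
  have "rep_mor m X Y f * rep_mor m X X (snd X a) = rep_mor m Y Y (snd Y a) * rep_mor m X Y f" for a
    using c by (subst (1 2) rep_mor_mult[symmetric]) (auto simp: hom_comm[OF assms(3)])
  thus ?thesis using rep_mor_carrier[OF c(1)] by (simp add: hom_def rep_obj_snd)
qed

lemma fst_fmult [simp]: "fst (fmult m F) M = rep_obj m (fst F M)"
  and snd_fmult [simp]: "snd (fmult m F) M N f = rep_mor m (fst F M) (fst F N) (snd F M N f)"
  by (auto simp: fmult_def)

lemma fn_fmult:
  assumes "fn F" shows "fn (fmult m F)"
proof (rule fnI)
  fix L M N f g assume a: "md L" "md M" "md N" "f \<in> hom L M" "g \<in> hom M N"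
  thus "snd (fmult m F) L N (g * f) = snd (fmult m F) M N g * snd (fmult m F) L M f"
    using fn_hom[OF assms a(1,2,4)] fn_hom[OF assms a(2,3,5)]
    by (simp add: fn_mult[OF assms, of L M N f g] rep_mor_mult[OF homD homD])
next
  fix M N f g assume a: "md M" "md N" "f \<in> hom M N" "g \<in> hom M N"
  thus "snd (fmult m F) M N (f + g) = snd (fmult m F) M N f + snd (fmult m F) M N g"
    using fn_hom[OF assms a(1,2,3)] fn_hom[OF assms a(1,2,4)]
    by (simp add: fn_add[OF assms] rep_mor_add[OF homD homD])
next
  fix M N f c assume a: "md M" "md N" "f \<in> hom M N"
  thus "snd (fmult m F) M N (c \<cdot>\<^sub>m f) = c \<cdot>\<^sub>m snd (fmult m F) M N f"
    using fn_hom[OF assms a(1,2,3)]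
    by (simp add: fn_smult[OF assms] rep_mor_smult[OF homD])
qed (use assms in \<open>auto simp: fn_md fn_one rep_mor_one intro!: md_rep_obj rep_mor_hom fn_hom\<close>)

text \<open>\<open>Y\<close> is a direct sum of m copies of \<open>X\<close>, witnessed by
  inclusions and projections instead of an isomorphism with \<open>rep_obj m X\<close>. Being
  equational, the notion is preserved by additive functors (\<open>bip_fn\<close>) and fixes no
  coordinates on \<open>Y\<close>.\<close>

definition bip where
  "bip m X Y \<iota> \<pi> \<longleftrightarrow> (\<forall>i<m. \<iota> i \<in> hom X Y \<and> \<pi> i \<in> hom Y X) \<and>
     (\<forall>i<m. \<forall>j<m. \<pi> i * \<iota> j = (if i = j then 1\<^sub>m (fst X) else 0\<^sub>m (fst X) (fst X))) \<and>
     msum (fst Y) (fst Y) (\<lambda>i. \<iota> i * \<pi> i) m = 1\<^sub>m (fst Y)"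

lemma bip_hom: "bip m X Y \<iota> \<pi> \<Longrightarrow> i < m \<Longrightarrow> \<iota> i \<in> hom X Y" "bip m X Y \<iota> \<pi> \<Longrightarrow> i < m \<Longrightarrow> \<pi> i \<in> hom Y X"
  and bip_delta: "bip m X Y \<iota> \<pi> \<Longrightarrow> i < m \<Longrightarrow> j < m \<Longrightarrow>
     \<pi> i * \<iota> j = (if i = j then 1\<^sub>m (fst X) else 0\<^sub>m (fst X) (fst X))"
  and bip_sum: "bip m X Y \<iota> \<pi> \<Longrightarrow> msum (fst Y) (fst Y) (\<lambda>i. \<iota> i * \<pi> i) m = 1\<^sub>m (fst Y)"
  unfolding bip_def by blast+

lemma bip_carrier:
  assumes "bip m X Y \<iota> \<pi>" "i < m"
  shows "\<iota> i \<in> carrier_mat (fst Y) (fst X)" "\<pi> i \<in> carrier_mat (fst X) (fst Y)"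
  using assms bip_hom homD by blast+

lemma bip_dims:
  assumes "bip m X Y \<iota> \<pi>" "i < m"
  shows "dim_row (\<iota> i) = fst Y" "dim_col (\<iota> i) = fst X" "dim_row (\<pi> i) = fst X" "dim_col (\<pi> i) = fst Y"
  using bip_carrier[OF assms] by auto

lemma bip_pr_sum:
  assumes b: "bip m X Y \<iota> \<pi>" and i: "i < m" and g: "\<And>j. j < m \<Longrightarrow> g j \<in> carrier_mat (fst X) c"
  shows "\<pi> i * msum (fst Y) c (\<lambda>j. \<iota> j * g j) m = g i"
proof -
  have "\<pi> i * msum (fst Y) c (\<lambda>j. \<iota> j * g j) m = msum (fst X) c (\<lambda>j. \<pi> i * (\<iota> j * g j)) m"
    using bip_carrier[OF b] i g by (intro mult_msum) (auto intro!: mult_carrier_mat)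
  also have "\<dots> = msum (fst X) c (\<lambda>j. if j = i then g j else 0\<^sub>m (fst X) c) m"
  proof (rule msum_cong)
    fix j assume j: "j < m"
    have "\<pi> i * (\<iota> j * g j) = (\<pi> i * \<iota> j) * g j"
      using i j g[OF j] by (subst mat_mult_assoc) (auto simp: bip_dims[OF b])
    thus "\<pi> i * (\<iota> j * g j) = (if j = i then g j else 0\<^sub>m (fst X) c)"
      using bip_delta[OF b i j] g[OF j] by (auto simp: left_mult_zero_mat)
  qed
  also have "\<dots> = g i" by (rule msum_delta[where f=g]) (use i g in auto)
  finally show ?thesis .
qed

lemma bip_sum_in:
  assumes b: "bip m X Y \<iota> \<pi>" and i: "i < m" and g: "\<And>j. j < m \<Longrightarrow> g j \<in> carrier_mat r (fst X)"
  shows "msum r (fst Y) (\<lambda>j. g j * \<pi> j) m * \<iota> i = g i"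
proof -
  have "msum r (fst Y) (\<lambda>j. g j * \<pi> j) m * \<iota> i = msum r (fst X) (\<lambda>j. (g j * \<pi> j) * \<iota> i) m"
    using bip_carrier[OF b] i g by (intro msum_mult) (auto intro!: mult_carrier_mat)
  also have "\<dots> = msum r (fst X) (\<lambda>j. if j = i then g j else 0\<^sub>m r (fst X)) m"
  proof (rule msum_cong)
    fix j assume j: "j < m"
    have "(g j * \<pi> j) * \<iota> i = g j * (\<pi> j * \<iota> i)"
      using i j g[OF j] by (subst mat_mult_assoc) (auto simp: bip_dims[OF b])
    thus "(g j * \<pi> j) * \<iota> i = (if j = i then g j else 0\<^sub>m r (fst X))"
      using bip_delta[OF b j i] g[OF j] by (auto simp: right_mult_zero_mat)
  qed
  also have "\<dots> = g i" by (rule msum_delta[where f=g]) (use i g in auto)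
  finally show ?thesis .
qed

text \<open>The canonical comparison of two direct sums of the same module. Exchanging the roles of
  the sums yields the other composite, so this one equation gives an isomorphism.\<close>

lemma bip_iso:
  assumes b: "bip m X Y \<iota> \<pi>" and b': "bip m X Y' \<iota>' \<pi>'"
  shows "msum (fst Y) (fst Y') (\<lambda>i. \<iota> i * \<pi>' i) m * msum (fst Y') (fst Y) (\<lambda>i. \<iota>' i * \<pi> i) m = 1\<^sub>m (fst Y)"
proof -
  have "msum (fst Y) (fst Y') (\<lambda>i. \<iota> i * \<pi>' i) m * msum (fst Y') (fst Y) (\<lambda>i. \<iota>' i * \<pi> i) m
     = msum (fst Y) (fst Y) (\<lambda>i. (\<iota> i * \<pi>' i) * msum (fst Y') (fst Y) (\<lambda>i. \<iota>' i * \<pi> i) m) m"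
    using bip_carrier[OF b] bip_carrier[OF b'] by (intro msum_mult) (auto intro!: mult_carrier_mat)
  also have "\<dots> = msum (fst Y) (fst Y) (\<lambda>i. \<iota> i * \<pi> i) m"
  proof (rule msum_cong)
    fix i assume i: "i < m"
    have "(\<iota> i * \<pi>' i) * msum (fst Y') (fst Y) (\<lambda>i. \<iota>' i * \<pi> i) m
       = \<iota> i * (\<pi>' i * msum (fst Y') (fst Y) (\<lambda>i. \<iota>' i * \<pi> i) m)"
      using bip_carrier[OF b i] bip_carrier[OF b' i] by (subst mat_mult_assoc) auto
    thus "(\<iota> i * \<pi>' i) * msum (fst Y') (fst Y) (\<lambda>i. \<iota>' i * \<pi> i) m = \<iota> i * \<pi> i"
      using bip_pr_sum[OF b' i, of \<pi>] bip_carrier[OF b] by simp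
  qed
  finally show ?thesis using bip_sum[OF b] by simp
qed

lemma bip_rep:
  assumes "md X" shows "bip m X (rep_obj m X) (inc (fst X) m) (prj (fst X) m)"
  unfolding bip_def
  by (auto simp: prj_inc inc_prj hom_def rep_obj_snd rep_mor_inc[OF md_carrier[OF assms]]
      prj_rep_mor[OF md_carrier[OF assms]])

lemma bip_dim:
  assumes "md X" and b: "bip m X Y \<iota> \<pi>" shows "fst Y = m * fst X"
proof (rule antisym)
  let ?\<theta> = "msum (fst Y) (fst (rep_obj m X)) (\<lambda>i. \<iota> i * prj (fst X) m i) m"
  let ?\<theta>' = "msum (fst (rep_obj m X)) (fst Y) (\<lambda>i. inc (fst X) m i * \<pi> i) m"
  note b' = bip_rep[OF assms(1), of m]
  have c: "?\<theta> \<in> carrier_mat (fst Y) (m * fst X)" "?\<theta>' \<in> carrier_mat (m * fst X) (fst Y)"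
    by (auto intro!: carrier_matI)
  show "fst Y \<le> m * fst X" using right_inverse_dim_le[OF c bip_iso[OF b b']] .
  show "m * fst X \<le> fst Y" using right_inverse_dim_le[OF c(2,1)] bip_iso[OF b' b] by simp
qed

lemma bip_fn:
  assumes F: "fn F" and m: "md X" "md Y" and b: "bip m X Y \<iota> \<pi>"
  shows "bip m (fst F X) (fst F Y) (\<lambda>i. snd F X Y (\<iota> i)) (\<lambda>i. snd F Y X (\<pi> i))"
  unfolding bip_def
proof (intro conjI allI impI)
  fix i j assume i: "i < m"
  show "snd F X Y (\<iota> i) \<in> hom (fst F X) (fst F Y)" "snd F Y X (\<pi> i) \<in> hom (fst F Y) (fst F X)"
    using bip_hom[OF b i] F m by (auto intro: fn_hom)
  assume j: "j < m"
  show "snd F Y X (\<pi> i) * snd F X Y (\<iota> j) = (if i = j then 1\<^sub>m (fst (fst F X)) else 0\<^sub>m (fst (fst F X)) (fst (fst F X)))"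
    using fn_mult[OF F m(1,2,1) bip_hom(1)[OF b j] bip_hom(2)[OF b i]] bip_delta[OF b i j]
      fn_one[OF F m(1)] fn_zero[OF F m(1) m(1)] by auto
next
  have h: "\<iota> i * \<pi> i \<in> hom Y Y" if "i < m" for i
    using hom_mult[OF m(2,1,2) bip_hom(2)[OF b that] bip_hom(1)[OF b that]] .
  have "msum (fst (fst F Y)) (fst (fst F Y)) (\<lambda>i. snd F X Y (\<iota> i) * snd F Y X (\<pi> i)) m
     = msum (fst (fst F Y)) (fst (fst F Y)) (\<lambda>i. snd F Y Y (\<iota> i * \<pi> i)) m"
    by (intro msum_cong fn_mult[symmetric] F m bip_hom[OF b])
  also have "\<dots> = 1\<^sub>m (fst (fst F Y))"
    using fn_msum[OF F m(2,2), of m "\<lambda>i. \<iota> i * \<pi> i"] h bip_sum[OF b] fn_one[OF F m(2)] by simp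
  finally show "msum (fst (fst F Y)) (fst (fst F Y)) (\<lambda>i. snd F X Y (\<iota> i) * snd F Y X (\<pi> i)) m
    = 1\<^sub>m (fst (fst F Y))" .
qed

lemma bip_iso_target:
  assumes m: "md X" "md Y" "md Z" and b: "bip m X Y \<iota> \<pi>"
    and h: "f \<in> hom Y Z" "g \<in> hom Z Y" "g * f = 1\<^sub>m (fst Y)" "f * g = 1\<^sub>m (fst Z)"
  shows "bip m X Z (\<lambda>i. f * \<iota> i) (\<lambda>i. \<pi> i * g)"
  unfolding bip_def
proof (intro conjI allI impI)
  note fg = h(1,2)[THEN homD]
  fix i j assume i: "i < m"
  show "f * \<iota> i \<in> hom X Z" "\<pi> i * g \<in> hom Z X"
    using hom_mult[OF m(1,2,3) bip_hom(1)[OF b i] h(1)] hom_mult[OF m(3,2,1) h(2) bip_hom(2)[OF b i]] .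
  assume j: "j < m"
  have "(\<pi> i * g) * (f * \<iota> j) = \<pi> i * ((g * f) * \<iota> j)"
    using fg bip_carrier[OF b i] bip_carrier[OF b j] by (simp add: mat_mult_assoc)
  thus "(\<pi> i * g) * (f * \<iota> j) = (if i = j then 1\<^sub>m (fst X) else 0\<^sub>m (fst X) (fst X))"
    using bip_delta[OF b i j] bip_carrier[OF b j] h(3) by simp
next
  note fg = h(1,2)[THEN homD]
  have "msum (fst Z) (fst Z) (\<lambda>i. (f * \<iota> i) * (\<pi> i * g)) m = msum (fst Z) (fst Z) (\<lambda>i. (f * (\<iota> i * \<pi> i)) * g) m"
    using fg bip_carrier[OF b] by (intro msum_cong) (simp add: mat_mult_assoc bip_dims[OF b])
  also have "\<dots> = msum (fst Z) (fst Y) (\<lambda>i. f * (\<iota> i * \<pi> i)) m * g"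
    using fg bip_carrier[OF b] by (intro msum_mult[symmetric]) (auto intro!: mult_carrier_mat)
  also have "msum (fst Z) (fst Y) (\<lambda>i. f * (\<iota> i * \<pi> i)) m = f * msum (fst Y) (fst Y) (\<lambda>i. \<iota> i * \<pi> i) m"
    using fg bip_carrier[OF b] by (intro mult_msum[symmetric]) (auto intro!: mult_carrier_mat)
  finally show "msum (fst Z) (fst Z) (\<lambda>i. (f * \<iota> i) * (\<pi> i * g)) m = 1\<^sub>m (fst Z)"
    using bip_sum[OF b] fg h(4) by simp
qed

lemma bip_iso_source:
  assumes m: "md X" "md Y" "md Z" and b: "bip m X Y \<iota> \<pi>"
    and h: "f \<in> hom X Z" "g \<in> hom Z X" "g * f = 1\<^sub>m (fst X)" "f * g = 1\<^sub>m (fst Z)"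
  shows "bip m Z Y (\<lambda>i. \<iota> i * g) (\<lambda>i. f * \<pi> i)"
  unfolding bip_def
proof (intro conjI allI impI)
  note fg = h(1,2)[THEN homD]
  fix i j assume i: "i < m"
  show "\<iota> i * g \<in> hom Z Y" "f * \<pi> i \<in> hom Y Z"
    using hom_mult[OF m(3,1,2) h(2) bip_hom(1)[OF b i]] hom_mult[OF m(2,1,3) bip_hom(2)[OF b i] h(1)] .
  assume j: "j < m"
  have "(f * \<pi> i) * (\<iota> j * g) = f * (\<pi> i * \<iota> j) * g"
    using fg bip_carrier[OF b i] bip_carrier[OF b j] by (simp add: mat_mult_assoc)
  thus "(f * \<pi> i) * (\<iota> j * g) = (if i = j then 1\<^sub>m (fst Z) else 0\<^sub>m (fst Z) (fst Z))"
    using bip_delta[OF b i j] bip_carrier[OF b j] h(4) fg by simp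
next
  note fg = h(1,2)[THEN homD]
  have "msum (fst Y) (fst Y) (\<lambda>i. (\<iota> i * g) * (f * \<pi> i)) m = msum (fst Y) (fst Y) (\<lambda>i. \<iota> i * \<pi> i) m"
  proof (rule msum_cong)
    fix i assume i: "i < m"
    have "(\<iota> i * g) * (f * \<pi> i) = \<iota> i * ((g * f) * \<pi> i)"
      using fg bip_carrier[OF b i] by (simp add: mat_mult_assoc)
    thus "(\<iota> i * g) * (f * \<pi> i) = \<iota> i * \<pi> i" using h(3) bip_carrier[OF b i] by simp
  qed
  thus "msum (fst Y) (fst Y) (\<lambda>i. (\<iota> i * g) * (f * \<pi> i)) m = 1\<^sub>m (fst Y)"
    using bip_sum[OF b] by simp
qed

lemma bip_trans:
  assumes m: "md X" "md Y" "md Z" and b: "bip m X Y \<iota> \<pi>" and b': "bip n Y Z \<iota>' \<pi>'"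
  shows "bip (n * m) X Z (\<lambda>p. \<iota>' (p div m) * \<iota> (p mod m)) (\<lambda>p. \<pi> (p mod m) * \<pi>' (p div m))"
  unfolding bip_def
proof (intro conjI allI impI)
  fix p q assume p: "p < n * m"
  have pm: "p div m < n" "p mod m < m"
    using p by (auto simp: less_mult_imp_div_less) (cases m; simp)
  show "\<iota>' (p div m) * \<iota> (p mod m) \<in> hom X Z" "\<pi> (p mod m) * \<pi>' (p div m) \<in> hom Z X"
    using hom_mult[OF m bip_hom(1)[OF b pm(2)] bip_hom(1)[OF b' pm(1)]]
      hom_mult[OF m(3,2,1) bip_hom(2)[OF b' pm(1)] bip_hom(2)[OF b pm(2)]] .
  assume q: "q < n * m"
  have qm: "q div m < n" "q mod m < m"
    using q by (auto simp: less_mult_imp_div_less) (cases m; simp)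
  note c = bip_carrier[OF b pm(2)] bip_carrier[OF b qm(2)] bip_carrier[OF b' pm(1)] bip_carrier[OF b' qm(1)]
  have eq: "p = q \<longleftrightarrow> p div m = q div m \<and> p mod m = q mod m"
    by (metis div_mult_mod_eq)
  have "(\<pi> (p mod m) * \<pi>' (p div m)) * (\<iota>' (q div m) * \<iota> (q mod m))
    = \<pi> (p mod m) * ((\<pi>' (p div m) * \<iota>' (q div m)) * \<iota> (q mod m))"
    using c by (simp add: mat_mult_assoc)
  also have "\<dots> = (if p = q then 1\<^sub>m (fst X) else 0\<^sub>m (fst X) (fst X))"
    unfolding bip_delta[OF b' pm(1) qm(1)] eq using c bip_delta[OF b pm(2) qm(2)] by auto
  finally show "(\<pi> (p mod m) * \<pi>' (p div m)) * (\<iota>' (q div m) * \<iota> (q mod m))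
    = (if p = q then 1\<^sub>m (fst X) else 0\<^sub>m (fst X) (fst X))" .
next
  have c: "\<iota>' i * \<iota> j * (\<pi> j * \<pi>' i) \<in> carrier_mat (fst Z) (fst Z)" if "i < n" "j < m" for i j
    using bip_carrier[OF b that(2)] bip_carrier[OF b' that(1)] by (auto intro!: mult_carrier_mat)
  have "msum (fst Z) (fst Z) (\<lambda>p. \<iota>' (p div m) * \<iota> (p mod m) * (\<pi> (p mod m) * \<pi>' (p div m))) (n * m)
    = msum (fst Z) (fst Z) (\<lambda>i. msum (fst Z) (fst Z) (\<lambda>j. \<iota>' i * \<iota> j * (\<pi> j * \<pi>' i)) m) n"
    by (rule msum_nested[where f="\<lambda>i j. \<iota>' i * \<iota> j * (\<pi> j * \<pi>' i)"]) (rule c)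
  also have "\<dots> = msum (fst Z) (fst Z) (\<lambda>i. \<iota>' i * \<pi>' i) n"
  proof (rule msum_cong)
    fix i assume i: "i < n"
    note ci = bip_carrier[OF b' i]
    have "msum (fst Z) (fst Z) (\<lambda>j. \<iota>' i * \<iota> j * (\<pi> j * \<pi>' i)) m
       = msum (fst Z) (fst Z) (\<lambda>j. (\<iota>' i * (\<iota> j * \<pi> j)) * \<pi>' i) m"
      using ci bip_carrier[OF b] by (intro msum_cong) (simp add: mat_mult_assoc bip_dims[OF b])
    also have "\<dots> = msum (fst Z) (fst Y) (\<lambda>j. \<iota>' i * (\<iota> j * \<pi> j)) m * \<pi>' i"
      using ci bip_carrier[OF b] by (intro msum_mult[symmetric]) (auto intro!: mult_carrier_mat)
    also have "msum (fst Z) (fst Y) (\<lambda>j. \<iota>' i * (\<iota> j * \<pi> j)) m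
        = \<iota>' i * msum (fst Y) (fst Y) (\<lambda>j. \<iota> j * \<pi> j) m"
      using ci bip_carrier[OF b] by (intro mult_msum[symmetric]) (auto intro!: mult_carrier_mat)
    finally show "msum (fst Z) (fst Z) (\<lambda>j. \<iota>' i * \<iota> j * (\<pi> j * \<pi>' i)) m = \<iota>' i * \<pi>' i"
      using bip_sum[OF b] ci by simp
  qed
  finally show "msum (fst Z) (fst Z) (\<lambda>p. \<iota>' (p div m) * \<iota> (p mod m) * (\<pi> (p mod m) * \<pi>' (p div m))) (n * m)
     = 1\<^sub>m (fst Z)" using bip_sum[OF b'] by simp
qed

end


subsection \<open>Functorial direct sums and adjunctions\<close>

context kalg
begin

text \<open>Expresses that \<open>G\<close> is \<open>m F\<close> up to natural isomorphism without
  the block matrices of \<open>fmult m F\<close>; the link is \<open>copies_iff_nat_iso\<close>. In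
  this form the relation composes and passes through composition with a functor on either
  side.\<close>

definition copies where
  "copies m F G \<longleftrightarrow> (\<exists>\<iota> \<pi>. (\<forall>i<m. nt F G (\<iota> i) \<and> nt G F (\<pi> i)) \<and>
     (\<forall>M. md M \<longrightarrow> bip m (fst F M) (fst G M) (\<lambda>i. \<iota> i M) (\<lambda>i. \<pi> i M)))"

lemma copiesE:
  assumes "copies m F G"
  obtains \<iota> \<pi> where "\<And>i. i < m \<Longrightarrow> nt F G (\<iota> i)" "\<And>i. i < m \<Longrightarrow> nt G F (\<pi> i)"
    "\<And>M. md M \<Longrightarrow> bip m (fst F M) (fst G M) (\<lambda>i. \<iota> i M) (\<lambda>i. \<pi> i M)"
  using assms unfolding copies_def by blast

lemma copiesI:
  assumes "\<And>i. i < m \<Longrightarrow> nt F G (\<iota> i)" "\<And>i. i < m \<Longrightarrow> nt G F (\<pi> i)"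
    "\<And>M. md M \<Longrightarrow> bip m (fst F M) (fst G M) (\<lambda>i. \<iota> i M) (\<lambda>i. \<pi> i M)"
  shows "copies m F G"
  unfolding copies_def using assms by blast

lemma copies_fmult:
  assumes F: "fn F" shows "copies m F (fmult m F)"
proof (rule copiesI[of m F _ "\<lambda>i M. inc (fst (fst F M)) m i" "\<lambda>i M. prj (fst (fst F M)) m i"])
  fix i assume i: "i < m"
  show "nt F (fmult m F) (\<lambda>M. inc (fst (fst F M)) m i)"
    by (rule ntI) (use bip_hom(1)[OF bip_rep i] F fn_md rep_mor_inc[OF homD[OF fn_hom[OF F]] i] in auto)
  show "nt (fmult m F) F (\<lambda>M. prj (fst (fst F M)) m i)"
    by (rule ntI) (use bip_hom(2)[OF bip_rep i] F fn_md prj_rep_mor[OF homD[OF fn_hom[OF F]] i] in auto)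
qed (use F in \<open>auto intro!: bip_rep fn_md\<close>)

lemma copies_unique:
  assumes F: "fn F" "fn G" "fn H" and c: "copies m F G" "copies m F H"
  shows "nat_iso sm G H"
proof -
  from c(1) obtain \<iota> \<pi> where 1: "\<And>i. i < m \<Longrightarrow> nt F G (\<iota> i)" "\<And>i. i < m \<Longrightarrow> nt G F (\<pi> i)"
    and b: "\<And>M. md M \<Longrightarrow> bip m (fst F M) (fst G M) (\<lambda>i. \<iota> i M) (\<lambda>i. \<pi> i M)"
    using copiesE by blast
  from c(2) obtain \<iota>' \<pi>' where 2: "\<And>i. i < m \<Longrightarrow> nt F H (\<iota>' i)" "\<And>i. i < m \<Longrightarrow> nt H F (\<pi>' i)"
    and b': "\<And>M. md M \<Longrightarrow> bip m (fst F M) (fst H M) (\<lambda>i. \<iota>' i M) (\<lambda>i. \<pi>' i M)"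
    using copiesE by blast
  have n: "nt G H (\<lambda>M. msum (fst (fst H M)) (fst (fst G M)) (\<lambda>i. \<iota>' i M * \<pi> i M) m)"
    by (intro nt_msum F nt_comp[OF F(2,1,3)] 1 2)
  have n': "nt H G (\<lambda>M. msum (fst (fst G M)) (fst (fst H M)) (\<lambda>i. \<iota> i M * \<pi>' i M) m)"
    by (intro nt_msum F nt_comp[OF F(3,1,2)] 1 2)
  show ?thesis
    by (rule nat_isoI[OF n nt_hom[OF n'] bip_iso[OF b b'] bip_iso[OF b' b]])
qed

lemma copies_iso_target:
  assumes F: "fn F" "fn G" "fn H" and c: "copies m F G" and i: "nat_iso sm G H"
  shows "copies m F H"
proof -
  from c obtain \<iota> \<pi> where 1: "\<And>i. i < m \<Longrightarrow> nt F G (\<iota> i)" "\<And>i. i < m \<Longrightarrow> nt G F (\<pi> i)"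
    and b: "\<And>M. md M \<Longrightarrow> bip m (fst F M) (fst G M) (\<lambda>i. \<iota> i M) (\<lambda>i. \<pi> i M)"
    using copiesE by blast
  obtain \<eta> \<theta> where e: "nt G H \<eta>" "nt H G \<theta>" "\<And>M. md M \<Longrightarrow> \<theta> M * \<eta> M = 1\<^sub>m (fst (fst G M))"
    "\<And>M. md M \<Longrightarrow> \<eta> M * \<theta> M = 1\<^sub>m (fst (fst H M))"
    using nat_isoE[OF F(2,3) i] by blast
  show ?thesis
    by (rule copiesI[of m F H "\<lambda>i M. \<eta> M * \<iota> i M" "\<lambda>i M. \<pi> i M * \<theta> M"])
      (auto intro!: nt_comp[OF F] nt_comp[OF F(3,2,1)] 1 e(1,2) bip_iso_target[OF _ _ _ b] e(3,4) fn_md F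
        nt_hom[OF e(1)] nt_hom[OF e(2)])
qed

lemma copies_iso_source:
  assumes F: "fn F" "fn G" "fn H" and c: "copies m F G" and i: "nat_iso sm F H"
  shows "copies m H G"
proof -
  from c obtain \<iota> \<pi> where 1: "\<And>i. i < m \<Longrightarrow> nt F G (\<iota> i)" "\<And>i. i < m \<Longrightarrow> nt G F (\<pi> i)"
    and b: "\<And>M. md M \<Longrightarrow> bip m (fst F M) (fst G M) (\<lambda>i. \<iota> i M) (\<lambda>i. \<pi> i M)"
    using copiesE by blast
  obtain \<eta> \<theta> where e: "nt F H \<eta>" "nt H F \<theta>" "\<And>M. md M \<Longrightarrow> \<theta> M * \<eta> M = 1\<^sub>m (fst (fst F M))"
    "\<And>M. md M \<Longrightarrow> \<eta> M * \<theta> M = 1\<^sub>m (fst (fst H M))"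
    using nat_isoE[OF F(1,3) i] by blast
  show ?thesis
    by (rule copiesI[of m H G "\<lambda>i M. \<iota> i M * \<theta> M" "\<lambda>i M. \<eta> M * \<pi> i M"])
      (auto intro!: nt_comp[OF F(3,1,2)] nt_comp[OF F(2,1,3)] 1 e(1,2) bip_iso_source[OF _ _ _ b] e(3,4) fn_md F
        nt_hom[OF e(1)] nt_hom[OF e(2)])
qed

lemma copies_iff_nat_iso:
  assumes "fn F" "fn G" shows "copies m F G \<longleftrightarrow> nat_iso sm G (fmult m F)"
  using copies_unique[OF assms fn_fmult[OF assms(1)]] copies_fmult[OF assms(1)]
    copies_iso_target[OF assms(1) fn_fmult[OF assms(1)] assms(2)] nat_iso_sym assms fn_fmult by blast

lemma copies_trans:
  assumes F: "fn F" "fn G" "fn H" and c: "copies m F G" "copies n G H"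
  shows "copies (n * m) F H"
proof -
  from c(1) obtain \<iota> \<pi> where 1: "\<And>i. i < m \<Longrightarrow> nt F G (\<iota> i)" "\<And>i. i < m \<Longrightarrow> nt G F (\<pi> i)"
    and b: "\<And>M. md M \<Longrightarrow> bip m (fst F M) (fst G M) (\<lambda>i. \<iota> i M) (\<lambda>i. \<pi> i M)"
    using copiesE by blast
  from c(2) obtain \<iota>' \<pi>' where 2: "\<And>i. i < n \<Longrightarrow> nt G H (\<iota>' i)" "\<And>i. i < n \<Longrightarrow> nt H G (\<pi>' i)"
    and b': "\<And>M. md M \<Longrightarrow> bip n (fst G M) (fst H M) (\<lambda>i. \<iota>' i M) (\<lambda>i. \<pi>' i M)"
    using copiesE by blast
  show ?thesis
  proof (rule copiesI[of _ F H "\<lambda>p M. \<iota>' (p div m) M * \<iota> (p mod m) M" "\<lambda>p M. \<pi> (p mod m) M * \<pi>' (p div m) M"])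
    fix p assume p: "p < n * m"
    have pm: "p div m < n" "p mod m < m"
      using p by (auto simp: less_mult_imp_div_less) (cases m; simp)
    show "nt F H (\<lambda>M. \<iota>' (p div m) M * \<iota> (p mod m) M)" "nt H F (\<lambda>M. \<pi> (p mod m) M * \<pi>' (p div m) M)"
      by (rule nt_comp[OF F 1(1)[OF pm(2)] 2(1)[OF pm(1)]], rule nt_comp[OF F(3,2,1) 2(2)[OF pm(1)] 1(2)[OF pm(2)]])
  next
    fix M assume M: "md M"
    show "bip (n * m) (fst F M) (fst H M) (\<lambda>i. \<iota>' (i div m) M * \<iota> (i mod m) M) (\<lambda>i. \<pi> (i mod m) M * \<pi>' (i div m) M)"
      by (rule bip_trans[OF _ _ _ b[OF M] b'[OF M]]) (use M F fn_md in auto)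
  qed
qed

lemma copies_fcomp_left:
  assumes F: "fn F" "fn G" "fn H" and c: "copies m F G"
  shows "copies m (fcomp H F) (fcomp H G)"
proof -
  from c(1) obtain \<iota> \<pi> where 1: "\<And>i. i < m \<Longrightarrow> nt F G (\<iota> i)" "\<And>i. i < m \<Longrightarrow> nt G F (\<pi> i)"
    and b: "\<And>M. md M \<Longrightarrow> bip m (fst F M) (fst G M) (\<lambda>i. \<iota> i M) (\<lambda>i. \<pi> i M)"
    using copiesE by blast
  show ?thesis
    by (rule copiesI[of m _ _ "\<lambda>i M. snd H (fst F M) (fst G M) (\<iota> i M)" "\<lambda>i M. snd H (fst G M) (fst F M) (\<pi> i M)"])
       (auto intro!: nt_whisker_left F 1 bip_fn b fn_md)
qed

lemma copies_fcomp_right: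
  assumes F: "fn F" "fn G" "fn H" and c: "copies m F G"
  shows "copies m (fcomp F H) (fcomp G H)"
proof -
  from c(1) obtain \<iota> \<pi> where 1: "\<And>i. i < m \<Longrightarrow> nt F G (\<iota> i)" "\<And>i. i < m \<Longrightarrow> nt G F (\<pi> i)"
    and b: "\<And>M. md M \<Longrightarrow> bip m (fst F M) (fst G M) (\<lambda>i. \<iota> i M) (\<lambda>i. \<pi> i M)"
    using copiesE by blast
  show ?thesis
    by (rule copiesI[of m _ _ "\<lambda>i M. \<iota> i (fst H M)" "\<lambda>i M. \<pi> i (fst H M)"])
       (auto intro!: nt_whisker_right F 1 bip_fn b fn_md)
qed

text \<open>The unit and counit form of \<open>F\<close> being left adjoint to \<open>G\<close>. Its
  triangle identities are equations, which pass to direct sums and summands more easily than a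
  family of bijections. Two functors are allowed because the right adjoint of a summand of
  \<open>F\<close> first appears as a different functor.\<close>

definition adj where
  "adj F G \<eta> \<epsilon> \<longleftrightarrow> nt fid (fcomp G F) \<eta> \<and> nt (fcomp F G) fid \<epsilon> \<and>
     (\<forall>M. md M \<longrightarrow> \<epsilon> (fst F M) * snd F M (fst G (fst F M)) (\<eta> M) = 1\<^sub>m (fst (fst F M))) \<and>
     (\<forall>N. md N \<longrightarrow> snd G (fst F (fst G N)) N (\<epsilon> N) * \<eta> (fst G N) = 1\<^sub>m (fst (fst G N)))"

lemma adj_unit: "adj F G \<eta> \<epsilon> \<Longrightarrow> md M \<Longrightarrow> \<eta> M \<in> hom M (fst G (fst F M))"
  and adj_counit: "adj F G \<eta> \<epsilon> \<Longrightarrow> md M \<Longrightarrow> \<epsilon> M \<in> hom (fst F (fst G M)) M"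
  and adj_unit_nat: "adj F G \<eta> \<epsilon> \<Longrightarrow> md M \<Longrightarrow> md N \<Longrightarrow> f \<in> hom M N \<Longrightarrow>
     snd G (fst F M) (fst F N) (snd F M N f) * \<eta> M = \<eta> N * f"
  and adj_counit_nat: "adj F G \<eta> \<epsilon> \<Longrightarrow> md M \<Longrightarrow> md N \<Longrightarrow> f \<in> hom M N \<Longrightarrow>
     \<epsilon> N * snd F (fst G M) (fst G N) (snd G M N f) = f * \<epsilon> M"
  and adj_triangle1: "adj F G \<eta> \<epsilon> \<Longrightarrow> md M \<Longrightarrow> \<epsilon> (fst F M) * snd F M (fst G (fst F M)) (\<eta> M) = 1\<^sub>m (fst (fst F M))"
  and adj_triangle2: "adj F G \<eta> \<epsilon> \<Longrightarrow> md N \<Longrightarrow> snd G (fst F (fst G N)) N (\<epsilon> N) * \<eta> (fst G N) = 1\<^sub>m (fst (fst G N))"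
  unfolding adj_def nt_def fst_fcomp snd_fcomp fst_fid snd_fid by metis+

text \<open>Together with \<open>adj_transpose2\<close> this says that the transpositions
  \<open>f \<mapsto> G f * \<eta>\<close> and \<open>g \<mapsto> \<epsilon> * F g\<close> are
  mutually inverse. Arguments by adjunction below use these two rules in place of a bijection of Hom
  sets.\<close>

lemma adj_transpose1:
  assumes F: "fn F" and G: "fn G" and a: "adj F G \<eta> \<epsilon>" and m: "md M" "md N" and f: "f \<in> hom (fst F M) N"
  shows "\<epsilon> N * snd F M (fst G N) (snd G (fst F M) N f * \<eta> M) = f"
proof -
  note FM = fn_md[OF F m(1)] and GN = fn_md[OF G m(2)]
  note GFM = fn_md[OF G FM] and FGN = fn_md[OF F GN]
  note h = adj_unit[OF a m(1)] fn_hom[OF G FM m(2) f]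
  note d = f[THEN homD] fn_hom[OF F GFM GN h(2), THEN homD] fn_hom[OF F m(1) GFM h(1), THEN homD]
     adj_counit[OF a m(2), THEN homD] adj_counit[OF a FM, THEN homD]
  have "\<epsilon> N * snd F M (fst G N) (snd G (fst F M) N f * \<eta> M)
      = (\<epsilon> N * snd F (fst G (fst F M)) (fst G N) (snd G (fst F M) N f)) * snd F M (fst G (fst F M)) (\<eta> M)"
    using fn_mult[OF F m(1) GFM GN h] d by (simp add: mat_mult_assoc)
  also have "\<dots> = f"
    using adj_counit_nat[OF a FM m(2) f] adj_triangle1[OF a m(1)] d by (simp add: mat_mult_assoc)
  finally show ?thesis .
qed

lemma adj_transpose2:
  assumes F: "fn F" and G: "fn G" and a: "adj F G \<eta> \<epsilon>" and m: "md M" "md N" and g: "g \<in> hom M (fst G N)"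
  shows "snd G (fst F M) N (\<epsilon> N * snd F M (fst G N) g) * \<eta> M = g"
proof -
  note FM = fn_md[OF F m(1)] and GN = fn_md[OF G m(2)]
  note FGN = fn_md[OF F GN]
  note h = fn_hom[OF F m(1) GN g] adj_counit[OF a m(2)]
  note d = g[THEN homD] fn_hom[OF G FM FGN h(1), THEN homD] fn_hom[OF G FGN m(2) h(2), THEN homD]
     adj_unit[OF a m(1), THEN homD] adj_unit[OF a GN, THEN homD]
  have "snd G (fst F M) N (\<epsilon> N * snd F M (fst G N) g) * \<eta> M
      = snd G (fst F (fst G N)) N (\<epsilon> N) * (snd G (fst F M) (fst F (fst G N)) (snd F M (fst G N) g) * \<eta> M)"
    using fn_mult[OF G FM FGN m(2) h] d by (simp add: mat_mult_assoc)
  also have "\<dots> = (snd G (fst F (fst G N)) N (\<epsilon> N) * \<eta> (fst G N)) * g"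
    using adj_unit_nat[OF a m(1) GN g] d by (simp add: mat_mult_assoc)
  finally show ?thesis
    using adj_triangle2[OF a m(2)] d by simp
qed

lemma adj_selfadjoint:
  assumes F: "fn F" and a: "adj F F \<eta> \<epsilon>"
  shows "selfadjoint sm F"
  unfolding selfadjoint_def
proof (intro exI[of _ "\<lambda>M N f. snd F (fst F M) N f * \<eta> M"] conjI allI impI; elim conjE)
  fix M N assume m: "md M" "md N"
  note FM = fn_md[OF F m(1)] and FN = fn_md[OF F m(2)]
  note FFM = fn_md[OF F FM] and FFN = fn_md[OF F FN]
  show "bij_betw (\<lambda>f. snd F (fst F M) N f * \<eta> M) (hom (fst F M) N) (hom M (fst F N))"
  proof (rule bij_betw_byWitness[where f'="\<lambda>g. \<epsilon> N * snd F M (fst F N) g"])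
    show "(\<lambda>f. snd F (fst F M) N f * \<eta> M) ` hom (fst F M) N \<subseteq> hom M (fst F N)"
      using hom_mult[OF m(1) FFM FN adj_unit[OF a m(1)] fn_hom[OF F FM m(2)]] by blast
    show "(\<lambda>g. \<epsilon> N * snd F M (fst F N) g) ` hom M (fst F N) \<subseteq> hom (fst F M) N"
      using hom_mult[OF FM FFN m(2) fn_hom[OF F m(1) FN] adj_counit[OF a m(2)]] by blast
  qed (use adj_transpose1[OF F F a m] adj_transpose2[OF F F a m] in auto)
next
  fix M M' N N' g h f
  assume m: "md M" "md M'" "md N" "md N'" and hh: "g \<in> hom M' M" "h \<in> hom N N'" "f \<in> hom (fst F M) N"
  note FM = fn_md[OF F m(1)] fn_md[OF F m(2)] fn_md[OF F m(3)] fn_md[OF F m(4)]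
  note Fg = fn_hom[OF F m(2,1) hh(1)]
  note d = hh[THEN homD] Fg[THEN homD] fn_hom[OF F FM(2,1) Fg, THEN homD] fn_hom[OF F FM(1) m(3) hh(3), THEN homD]
    fn_hom[OF F m(3,4) hh(2), THEN homD] adj_unit[OF a m(1), THEN homD] adj_unit[OF a m(2), THEN homD]
  have "snd F (fst F M') N' (h * f * snd F M' M g) =
     snd F N N' h * (snd F (fst F M) N f * snd F (fst F M') (fst F M) (snd F M' M g))"
    using d fn_mult[OF F FM(2) FM(1) m(4) Fg hom_mult[OF FM(1) m(3,4) hh(3,2)]]
      fn_mult[OF F FM(1) m(3,4) hh(3,2)] by (simp add: mat_mult_assoc)
  moreover have "snd F (fst F M') (fst F M) (snd F M' M g) * \<eta> M' = \<eta> M * g"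
    by (rule adj_unit_nat[OF a m(2,1) hh(1)])
  ultimately show "snd F (fst F M') N' (h * f * snd F M' M g) * \<eta> M' = snd F N N' h * (snd F (fst F M) N f * \<eta> M) * g"
    using d by (simp add: mat_mult_assoc)
qed

text \<open>Yoneda: the unit is the image of the identity under the bijection, and the counit is the
  preimage of the identity. Naturality of the counit and the first triangle are verified after
  applying \<open>\<phi>\<close>, which is injective.\<close>

lemma selfadjoint_adj:
  assumes F: "fn F" and s: "selfadjoint sm F"
  obtains \<eta> \<epsilon> where "adj F F \<eta> \<epsilon>"
proof -
  from s[unfolded selfadjoint_def] obtain \<phi> where
    b0: "\<forall>M N. md M \<and> md N \<longrightarrow> bij_betw (\<phi> M N) (hom (fst F M) N) (hom M (fst F N))"
    and n0: "\<forall>M M' N N' g h f. md M \<and> md M' \<and> md N \<and> md N' \<and> g \<in> hom M' M \<and> h \<in> hom N N' \<and>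
      f \<in> hom (fst F M) N \<longrightarrow> \<phi> M' N' (h * f * snd F M' M g) = snd F N N' h * \<phi> M N f * g"
    by (elim exE conjE) (rule that)
  have b: "bij_betw (\<phi> M N) (hom (fst F M) N) (hom M (fst F N))" if "md M" "md N" for M N
    by (rule b0[rule_format]) (use that in simp)
  have n: "\<phi> M' N' (h * f * snd F M' M g) = snd F N N' h * \<phi> M N f * g"
    if "md M" "md M'" "md N" "md N'" "g \<in> hom M' M" "h \<in> hom N N'" "f \<in> hom (fst F M) N"
    for M M' N N' g h f
    by (rule n0[rule_format]) (intro conjI that)
  define \<eta> where "\<eta> M = \<phi> M (fst F M) (1\<^sub>m (fst (fst F M)))" for M
  have \<phi>h: "\<phi> M N f \<in> hom M (fst F N)" if "md M" "md N" "f \<in> hom (fst F M) N" for M N f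
    using b[OF that(1,2)] that(3) by (auto simp: bij_betw_def)
  have inj: "f = g" if "md M" "md N" "f \<in> hom (fst F M) N" "g \<in> hom (fst F M) N" "\<phi> M N f = \<phi> M N g" for M N f g
    using b[OF that(1,2)] that(3-) by (auto simp: bij_betw_def inj_on_def)
  have \<eta>h: "\<eta> M \<in> hom M (fst F (fst F M))" if "md M" for M
    unfolding \<eta>_def using that F by (auto intro!: \<phi>h hom_one fn_md)
  have "\<exists>e. md N \<longrightarrow> e \<in> hom (fst F (fst F N)) N \<and> \<phi> (fst F N) N e = 1\<^sub>m (fst (fst F N))" for N
  proof (cases "md N")
    case True
    have "1\<^sub>m (fst (fst F N)) \<in> \<phi> (fst F N) N ` hom (fst F (fst F N)) N"
      using b[OF fn_md[OF F True] True] hom_one[OF fn_md[OF F True]] by (simp add: bij_betw_def)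
    thus ?thesis by auto
  qed simp
  then obtain \<epsilon> where \<epsilon>: "\<And>N. md N \<Longrightarrow> \<epsilon> N \<in> hom (fst F (fst F N)) N"
    "\<And>N. md N \<Longrightarrow> \<phi> (fst F N) N (\<epsilon> N) = 1\<^sub>m (fst (fst F N))"
    by metis
  \<comment> \<open>The joint naturality of \<open>\<phi>\<close> is separated into its two
    variables by taking an identity for \<open>g\<close> or for \<open>h\<close>.\<close>
  have n1: "\<phi> M N' (h * f) = snd F N N' h * \<phi> M N f"
    if "md M" "md N" "md N'" "h \<in> hom N N'" "f \<in> hom (fst F M) N" for M N N' h f
  proof -
    note c = that(4,5)[THEN homD] \<phi>h[OF that(1,2,5), THEN homD] fn_hom[OF F that(2-4), THEN homD]
    show ?thesis
      using n[OF that(1,1,2,3) hom_one[OF that(1)] that(4,5)] fn_one[OF F that(1)] c by simp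
  qed
  have n2: "\<phi> M' N (f * snd F M' M g) = \<phi> M N f * g"
    if "md M" "md M'" "md N" "g \<in> hom M' M" "f \<in> hom (fst F M) N" for M M' N g f
  proof -
    note c = that(4,5)[THEN homD] \<phi>h[OF that(1,3,5), THEN homD] fn_hom[OF F that(2,1,4), THEN homD]
    show ?thesis
      using n[OF that(1,2,3,3) that(4) hom_one[OF that(3)] that(5)] fn_one[OF F that(3)] c by simp
  qed
  have \<phi>e: "\<phi> M N f = snd F (fst F M) N f * \<eta> M" if "md M" "md N" "f \<in> hom (fst F M) N" for M N f
    using n1[OF that(1) fn_md[OF F that(1)] that(2,3) hom_one] fn_md[OF F that(1)] that(3)[THEN homD]
    by (simp add: \<eta>_def)
  have "adj F F \<eta> \<epsilon>"
    unfolding adj_def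
  proof (intro conjI allI impI)
    show "nt fid (fcomp F F) \<eta>"
    proof (rule ntI)
      fix M N f assume m: "md M" "md N" "f \<in> hom M N"
      note FM = fn_md[OF F m(1)] fn_md[OF F m(2)] and Ff = fn_hom[OF F m]
      have "snd (fcomp F F) M N f * \<eta> M = \<phi> M (fst F N) (snd F M N f)"
        using \<phi>e[OF m(1) FM(2) Ff] by simp
      also have "\<dots> = \<phi> M (fst F N) (1\<^sub>m (fst (fst F N)) * snd F M N f)"
        using Ff[THEN homD] by simp
      also have "\<dots> = \<eta> N * snd fid M N f"
        using n2[OF m(2,1) FM(2) m(3) hom_one[OF FM(2)]] by (simp add: \<eta>_def)
      finally show "snd (fcomp F F) M N f * \<eta> M = \<eta> N * snd fid M N f" .
    qed (use \<eta>h in simp)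
    show "nt (fcomp F F) fid \<epsilon>"
    proof (rule ntI)
      fix M N f assume m: "md M" "md N" "f \<in> hom M N"
      note FM = fn_md[OF F m(1)] fn_md[OF F m(2)] and Ff = fn_hom[OF F m]
      note FFM = fn_md[OF F FM(1)] fn_md[OF F FM(2)] and FFf = fn_hom[OF F FM Ff]
      have "f * \<epsilon> M = \<epsilon> N * snd F (fst F M) (fst F N) (snd F M N f)"
      proof (rule inj[OF FM(1) m(2)])
        show "f * \<epsilon> M \<in> hom (fst F (fst F M)) N" by (rule hom_mult[OF FFM(1) m(1,2) \<epsilon>(1)[OF m(1)] m(3)])
        show "\<epsilon> N * snd F (fst F M) (fst F N) (snd F M N f) \<in> hom (fst F (fst F M)) N"
          by (rule hom_mult[OF FFM m(2) FFf \<epsilon>(1)[OF m(2)]])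
        show "\<phi> (fst F M) N (f * \<epsilon> M) = \<phi> (fst F M) N (\<epsilon> N * snd F (fst F M) (fst F N) (snd F M N f))"
          using n1[OF FM(1) m \<epsilon>(1)[OF m(1)]] n2[OF FM(2,1) m(2) Ff \<epsilon>(1)[OF m(2)]] \<epsilon>(2)[OF m(1)] \<epsilon>(2)[OF m(2)]
            Ff[THEN homD] by simp
      qed
      thus "snd fid M N f * \<epsilon> M = \<epsilon> N * snd (fcomp F F) M N f" by simp
    qed (use \<epsilon> in simp)
    fix M assume m: "md M"
    note FM = fn_md[OF F m] and FFM = fn_md[OF F fn_md[OF F m]]
    show "snd F (fst F (fst F M)) M (\<epsilon> M) * \<eta> (fst F M) = 1\<^sub>m (fst (fst F M))"
      using \<phi>e[OF FM m \<epsilon>(1)[OF m]] \<epsilon>(2)[OF m] by simp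
    show "\<epsilon> (fst F M) * snd F M (fst F (fst F M)) (\<eta> M) = 1\<^sub>m (fst (fst F M))"
    proof (rule inj[OF m FM])
      show "\<epsilon> (fst F M) * snd F M (fst F (fst F M)) (\<eta> M) \<in> hom (fst F M) (fst F M)"
        by (rule hom_mult[OF FM fn_md[OF F FFM] FM fn_hom[OF F m FFM \<eta>h[OF m]] \<epsilon>(1)[OF FM]])
      show "1\<^sub>m (fst (fst F M)) \<in> hom (fst F M) (fst F M)" by (rule hom_one[OF FM])
      show "\<phi> M (fst F M) (\<epsilon> (fst F M) * snd F M (fst F (fst F M)) (\<eta> M)) = \<phi> M (fst F M) (1\<^sub>m (fst (fst F M)))"
        using n2[OF FFM m FM \<eta>h[OF m] \<epsilon>(1)[OF FM]] \<epsilon>(2)[OF FM] \<eta>h[OF m, THEN homD]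
        by (simp add: \<eta>_def)
    qed
  qed
  thus thesis by (rule that)
qed

end

subsection \<open>Linear algebra over matrices\<close>

lemma mult_mat_unit_vec:
  "i < dim_col A \<Longrightarrow> A *\<^sub>v unit_vec (dim_col A) i = col A (i :: nat)" for A :: "'k::field mat"
  by (rule eq_vecI) auto

lemma mat_mult_zero_vec: "dim_col A = n \<Longrightarrow> A *\<^sub>v 0\<^sub>v n = (0\<^sub>v (dim_row A) :: 'k::field vec)"
  by (rule eq_vecI) auto

lemma mat_eq_of_vec:
  assumes "A \<in> carrier_mat r c" "B \<in> carrier_mat r c"
    "\<And>v. v \<in> carrier_vec c \<Longrightarrow> A *\<^sub>v v = B *\<^sub>v (v :: 'k::field vec)"
  shows "A = B"
proof (rule mat_col_eqI)
  fix i assume "i < dim_col B"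
  hence i: "i < c" using assms by simp
  show "col A i = col B i"
    using mult_mat_unit_vec[of i A] mult_mat_unit_vec[of i B] assms i by auto
qed (use assms in auto)

lemma mat_of_vec_fun:
  assumes "\<And>j. j < d \<Longrightarrow> \<exists>u\<in>carrier_vec c. A *\<^sub>v u = col X j"
    "A \<in> carrier_mat r c" "X \<in> carrier_mat r d"
  obtains V where "V \<in> carrier_mat c d" "A * V = (X :: 'k::field mat)"
proof -
  from assms(1) obtain u where u: "\<And>j. j < d \<Longrightarrow> u j \<in> carrier_vec c \<and> A *\<^sub>v u j = col X j"
    by metis
  define V where "V = mat c d (\<lambda>(i, j). u j $ i)"
  have colV: "col V j = u j" if "j < d" for j
    using that u[OF that] by (auto simp: V_def)
  have "A * V = X"
  proof (rule mat_col_eqI)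
    fix j assume "j < dim_col X"
    hence j: "j < d" using assms by simp
    have "col (A * V) j = A *\<^sub>v col V j"
      using j assms by (auto simp: V_def)
    thus "col (A * V) j = col X j" using colV[OF j] u[OF j] by simp
  qed (use assms in \<open>auto simp: V_def\<close>)
  thus thesis using that[of V] by (simp add: V_def)
qed

lemma factor_through_image:
  assumes "A \<in> carrier_mat r c" "X \<in> carrier_mat r d"
    "\<And>v. v \<in> carrier_vec d \<Longrightarrow> \<exists>u\<in>carrier_vec c. X *\<^sub>v v = A *\<^sub>v u"
  obtains V where "V \<in> carrier_mat c d" "A * V = (X :: 'k::field mat)"
proof (rule mat_of_vec_fun[OF _ assms(1,2)])
  fix j assume j: "j < d"
  obtain u where u: "u \<in> carrier_vec c" "X *\<^sub>v unit_vec d j = A *\<^sub>v u"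
    using assms(3)[of "unit_vec d j"] by auto
  thus "\<exists>u\<in>carrier_vec c. A *\<^sub>v u = col X j"
    using mult_mat_unit_vec[of j X] assms(2) j by auto
qed (use that in auto)

text \<open>The columns of \<open>X\<close> form a basis of \<open>W\<close>, and the left inverse
  \<open>R\<close> certifies their independence. Among the independent systems inside
  \<open>W\<close> take one of greatest size, which exists because
  \<open>right_inverse_dim_le\<close> bounds the size by \<open>n\<close>; a vector of
  \<open>W\<close> outside the span would enlarge it.\<close>

lemma subspace_basis:
  fixes W :: "'k::field vec set"
  assumes W: "W \<subseteq> carrier_vec n" "0\<^sub>v n \<in> W" "\<And>v w. v \<in> W \<Longrightarrow> w \<in> W \<Longrightarrow> v + w \<in> W"
    "\<And>c v. v \<in> W \<Longrightarrow> c \<cdot>\<^sub>v v \<in> W"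
  obtains d X R where "X \<in> carrier_mat n d" "R \<in> carrier_mat d n" "R * X = 1\<^sub>m d"
    "W = {X *\<^sub>v v | v. v \<in> carrier_vec d}"
proof -
  define P where "P d \<longleftrightarrow> (\<exists>X R. X \<in> carrier_mat n d \<and> R \<in> carrier_mat d n \<and> R * X = 1\<^sub>m d \<and>
     (\<forall>v\<in>carrier_vec d. X *\<^sub>v v \<in> W))" for d
  have "P 0"
    unfolding P_def
  proof (intro exI conjI ballI)
    show "0\<^sub>m n 0 \<in> carrier_mat n 0" "0\<^sub>m 0 n \<in> carrier_mat 0 n" by auto
    fix v :: "'k vec" assume "v \<in> carrier_vec 0"
    hence "0\<^sub>m n 0 *\<^sub>v v = 0\<^sub>v n" by (intro eq_vecI) (auto simp: scalar_prod_def)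
    thus "0\<^sub>m n 0 *\<^sub>v v \<in> W" using W(2) by simp
  qed auto
  have bound: "d \<le> n" if "P d" for d
    using that unfolding P_def using right_inverse_dim_le by blast
  have "P (Greatest P)" by (rule GreatestI_nat[of P, OF \<open>P 0\<close> bound])
  have max: "d \<le> Greatest P" if "P d" for d by (rule Greatest_le_nat[of P, OF that bound])
  define d where "d = Greatest P"
  have "P d" unfolding d_def by fact
  from this[unfolded P_def] obtain X R where
    X: "X \<in> carrier_mat n d" and R: "R \<in> carrier_mat d n" and RX: "R * X = 1\<^sub>m d"
    and XW0: "\<forall>v\<in>carrier_vec d. X *\<^sub>v v \<in> W"
    by (elim exE conjE) (rule that)
  note XW = XW0[rule_format]
  have "\<exists>v\<in>carrier_vec d. w = X *\<^sub>v v" if w: "w \<in> W" for w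
  proof (rule ccontr)
    assume neg: "\<not> (\<exists>v\<in>carrier_vec d. w = X *\<^sub>v v)"
    have wc: "w \<in> carrier_vec n" using w W(1) by auto
    \<comment> \<open>The residue of \<open>w\<close> modulo the columns of \<open>X\<close>: it
      lies in \<open>W\<close>, is killed by \<open>R\<close>, and is nonzero because
      \<open>w\<close> is not in the span.\<close>
    define u where "u = w + (- 1) \<cdot>\<^sub>v (X *\<^sub>v (R *\<^sub>v w))"
    have Rw: "R *\<^sub>v w \<in> carrier_vec d" using R wc by auto
    have uW: "u \<in> W" unfolding u_def by (intro W(3,4) w XW Rw)
    have uc: "u \<in> carrier_vec n" using uW W(1) by auto
    have "\<exists>i<n. u $ i \<noteq> 0"
    proof (rule ccontr)
      assume "\<not> (\<exists>i<n. u $ i \<noteq> 0)"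
      hence "w = X *\<^sub>v (R *\<^sub>v w)"
        using wc X Rw uc by (intro eq_vecI) (auto simp: u_def)
      thus False using neg Rw by blast
    qed
    then obtain i where i: "i < n" "u $ i \<noteq> 0" by blast
    define um where "um = mat n 1 (\<lambda>(r, _). u $ r)"
    define wm where "wm = mat n 1 (\<lambda>(r, _). w $ r)"
    define p where "p = mat 1 n (\<lambda>(_, j). if j = i then inverse (u $ i) else 0)"
    have c: "um \<in> carrier_mat n 1" "wm \<in> carrier_mat n 1" "p \<in> carrier_mat 1 n"
      by (auto simp: um_def wm_def p_def)
    have RwmE: "R *\<^sub>v w = col (R * wm) 0"
    proof -
      have "col wm 0 = w" using wc by (auto simp: wm_def)
      thus ?thesis using R c by simp
    qed
    have um: "um = wm - X * (R * wm)"
    proof (rule eq_matI)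
      fix a b assume "a < dim_row (wm - X * (R * wm))" "b < dim_col (wm - X * (R * wm))"
      hence a: "a < n" "b = 0" using X c by auto
      have "(X * (R * wm)) $$ (a, 0) = (X *\<^sub>v (R *\<^sub>v w)) $ a"
        using X R a c unfolding RwmE by simp
      thus "um $$ (a, b) = (wm - X * (R * wm)) $$ (a, b)"
        using a X wc by (simp add: um_def u_def wm_def)
    qed (use c X in auto)
    have "R * um = R * wm - (R * X) * (R * wm)"
      using c X R by (simp add: um mat_mult_minus mat_mult_assoc)
    hence Rum: "R * um = 0\<^sub>m d 1" using RX c R by (auto simp: minus_r_inv_mat[of _ d 1])
    have pum: "p * um = 1\<^sub>m 1"
    proof (rule eq_matI)
      fix a b assume "a < dim_row (1\<^sub>m 1)" "b < dim_col (1\<^sub>m 1)"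
      hence ab: "a = 0" "b = 0" by auto
      have "(p * um) $$ (0, 0) = (\<Sum>j\<in>{0..<n}. (if j = i then inverse (u $ i) else 0) * u $ j)"
        by (simp add: p_def um_def scalar_prod_def)
      also have "\<dots> = 1" using i by (simp add: if_distrib[of "\<lambda>x. x * _"] cong: if_cong)
      finally show "(p * um) $$ (a, b) = 1\<^sub>m 1 $$ (a, b)" using ab by simp
    qed (use c in auto)
    \<comment> \<open>\<open>p\<close> reads off a nonzero coordinate of \<open>um\<close>, scaled
      to 1. Subtracting \<open>p X R\<close> makes it vanish on \<open>X\<close> and keeps its value
      on \<open>um\<close>, since \<open>R um = 0\<close>; thus \<open>R\<close> and
      \<open>p'\<close> together form a left inverse of the enlarged system.\<close>
    define p' where "p' = p - (p * X) * R"
    have p'c: "p' \<in> carrier_mat 1 n" using c X R by (auto simp: p'_def)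
    have "p' * X = p * X - (p * X) * (R * X)"
      using c X R by (simp add: p'_def mat_minus_mult mat_mult_assoc)
    hence p'X: "p' * X = 0\<^sub>m 1 d" using RX X c by (auto simp: minus_r_inv_mat[of _ 1 d])
    have "p' * um = p * um - (p * X) * (R * um)"
      using c X R by (simp add: p'_def mat_minus_mult mat_mult_assoc)
    hence p'u: "p' * um = 1\<^sub>m 1" using Rum pum c X by (auto simp: right_mult_zero_mat)
    define X' where "X' = X * pr1 d 1 + um * pr2 d 1"
    define R' where "R' = in1 d 1 * R + in2 d 1 * p'"
    have c': "X' \<in> carrier_mat n (d + 1)" "R' \<in> carrier_mat (d + 1) n"
      using c X R p'c by (auto simp: X'_def R'_def intro!: carrier_matI)
    have RX1: "R' * X = in1 d 1"
      using RX p'X X R p'c by (simp add: R'_def mat_add_mult mat_mult_assoc mat_add_zero)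
    have Ru1: "R' * um = in2 d 1"
      using Rum p'u R p'c c by (simp add: R'_def mat_add_mult mat_mult_assoc mat_add_zero)
    have "R' * X' = (R' * X) * pr1 d 1 + (R' * um) * pr2 d 1"
      using c' X c by (simp add: X'_def mat_mult_add mat_mult_assoc)
    hence "R' * X' = 1\<^sub>m (d + 1)" by (simp add: RX1 Ru1 in_pr)
    moreover have "X' *\<^sub>v v \<in> W" if v: "v \<in> carrier_vec (d + 1)" for v
    proof -
      have "X' *\<^sub>v v = X *\<^sub>v (pr1 d 1 *\<^sub>v v) + um *\<^sub>v (pr2 d 1 *\<^sub>v v)"
        unfolding X'_def using X c v
        by (subst add_mult_distrib_mat_vec[of _ n "d + 1"])
          (auto simp: mat_vec_assoc intro!: carrier_matI)
      also have "um *\<^sub>v (pr2 d 1 *\<^sub>v v) = (pr2 d 1 *\<^sub>v v) $ 0 \<cdot>\<^sub>v u"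
      proof (rule eq_vecI)
        fix a assume "a < dim_vec ((pr2 d 1 *\<^sub>v v) $ 0 \<cdot>\<^sub>v u)"
        hence a: "a < n" using uc by simp
        have "(um *\<^sub>v (pr2 d 1 *\<^sub>v v)) $ a = um $$ (a, 0) * (pr2 d 1 *\<^sub>v v) $ 0"
          using a c by (simp add: scalar_prod_def)
        thus "(um *\<^sub>v (pr2 d 1 *\<^sub>v v)) $ a = ((pr2 d 1 *\<^sub>v v) $ 0 \<cdot>\<^sub>v u) $ a"
          using a uc by (simp add: um_def)
      qed (use c uc in auto)
      finally show ?thesis
        using XW[of "pr1 d 1 *\<^sub>v v"] v W(3,4) uW by (metis in_pr_carrier(3) mult_mat_vec_carrier)
    qed
    ultimately have "P (d + 1)" unfolding P_def using c' by blast
    thus False using max[of "d + 1"] by (simp add: d_def)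
  qed
  hence "W = {X *\<^sub>v v | v. v \<in> carrier_vec d}" using XW by blast
  thus thesis using that X R RX by blast
qed

text \<open>\<open>X\<close> is a basis of the column space of \<open>A\<close>: \<open>U\<close>
  expresses \<open>A\<close> through it, \<open>V\<close> records that its columns are values of
  \<open>A\<close>, and \<open>R\<close> that they are independent.\<close>

lemma rank_factorization:
  fixes A :: "'k::field mat"
  assumes A: "A \<in> carrier_mat r c"
  obtains d X R V U where "X \<in> carrier_mat r d" "R \<in> carrier_mat d r" "R * X = 1\<^sub>m d"
    "V \<in> carrier_mat c d" "A * V = X" "U \<in> carrier_mat d c" "X * U = A"
proof -
  define W where "W = {A *\<^sub>v v | v. v \<in> carrier_vec c}"
  obtain d X R where X: "X \<in> carrier_mat r d" and R: "R \<in> carrier_mat d r" and RX: "R * X = 1\<^sub>m d"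
    and W: "W = {X *\<^sub>v v | v. v \<in> carrier_vec d}"
  proof (rule subspace_basis[of W r])
    show "W \<subseteq> carrier_vec r" using A by (auto simp: W_def)
    have "A *\<^sub>v 0\<^sub>v c = 0\<^sub>v r" using A by (intro eq_vecI) auto
    thus "0\<^sub>v r \<in> W" unfolding W_def using zero_carrier_vec[of c] by (metis (mono_tags, lifting) mem_Collect_eq)
    show "v + w \<in> W" if "v \<in> W" "w \<in> W" for v w
    proof -
      obtain a b where "v = A *\<^sub>v a" "w = A *\<^sub>v b" "a \<in> carrier_vec c" "b \<in> carrier_vec c"
        using \<open>v \<in> W\<close> \<open>w \<in> W\<close> unfolding W_def by blast
      hence "v + w = A *\<^sub>v (a + b)" "a + b \<in> carrier_vec c"
        using A by (simp_all add: mult_add_distrib_mat_vec[of A r c])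
      thus ?thesis unfolding W_def by blast
    qed
    show "x \<cdot>\<^sub>v v \<in> W" if "v \<in> W" for x v
    proof -
      obtain a where "v = A *\<^sub>v a" "a \<in> carrier_vec c" using \<open>v \<in> W\<close> unfolding W_def by blast
      hence "x \<cdot>\<^sub>v v = A *\<^sub>v (x \<cdot>\<^sub>v a)" "x \<cdot>\<^sub>v a \<in> carrier_vec c"
        using A by (simp_all add: mult_mat_vec[of A r c])
      thus ?thesis unfolding W_def by blast
    qed
  qed blast
  obtain V where V: "V \<in> carrier_mat c d" "A * V = X"
    using factor_through_image[OF A X] W unfolding W_def by blast
  obtain U where U: "U \<in> carrier_mat d c" "X * U = A"
    using factor_through_image[OF X A] W unfolding W_def by blast
  show thesis by (rule that[OF X R RX V U])
qed

text \<open>The columns of \<open>X\<close> span the image of \<open>E\<close>, on which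
  \<open>E\<close> acts as the identity. Hence \<open>E X = X\<close>, and \<open>R E\<close> gives
  the coordinates of the projection onto that image.\<close>

lemma idempotent_split:
  fixes E :: "'k::field mat"
  assumes E: "E \<in> carrier_mat n n" "E * E = E"
  obtains d S T where "S \<in> carrier_mat n d" "T \<in> carrier_mat d n" "T * S = 1\<^sub>m d" "S * T = E"
proof -
  obtain d X R V U where X: "X \<in> carrier_mat n d" and R: "R \<in> carrier_mat d n" and RX: "R * X = 1\<^sub>m d"
    and V: "V \<in> carrier_mat n d" "E * V = X" and U: "U \<in> carrier_mat d n" "X * U = E"
    by (rule rank_factorization[OF E(1)])
  have EX: "E * X = X" using V(1) E by (simp add: V(2)[symmetric] mat_mult_assoc[symmetric])
  have "X * (R * E) = X * ((R * X) * U)" using U(1) X R by (simp add: U(2)[symmetric] mat_mult_assoc)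
  hence "X * (R * E) = E" using U RX X by simp
  moreover have "(R * E) * X = 1\<^sub>m d" using EX E R X RX by (simp add: mat_mult_assoc)
  ultimately show thesis using that[of X d "R * E"] X R E by auto
qed

text \<open>\<open>X R\<close> is idempotent, hence so is \<open>1 - X R\<close>; splitting the
  latter yields the complement.\<close>

lemma complement_split:
  fixes X :: "'k::field mat"
  assumes X: "X \<in> carrier_mat n d" and R: "R \<in> carrier_mat d n" and RX: "R * X = 1\<^sub>m d"
  obtains e S T where "S \<in> carrier_mat n e" "T \<in> carrier_mat e n" "T * S = 1\<^sub>m e" "X * R + S * T = 1\<^sub>m n"
    "T * X = 0\<^sub>m e d"
proof -
  define E where "E = 1\<^sub>m n - X * R"
  have Ec: "E \<in> carrier_mat n n" using X R by (auto simp: E_def)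
  have EX: "E * X = 0\<^sub>m n d" using X R RX by (simp add: E_def mat_minus_mult mat_mult_assoc)
  have "E * E = E - (E * X) * R" using X R Ec by (subst (2) E_def) (simp add: mat_mult_minus mat_mult_assoc)
  hence EE: "E * E = E" using EX R Ec by (auto intro!: eq_matI)
  obtain e S T where S: "S \<in> carrier_mat n e" "T \<in> carrier_mat e n" "T * S = 1\<^sub>m e" "S * T = E"
    by (rule idempotent_split[OF Ec EE])
  have "T * X = (T * S) * (T * X)" using S X by simp
  also have "\<dots> = T * (E * X)" using S(1,2) X by (simp add: S(4)[symmetric] mat_mult_assoc)
  finally have "T * X = 0\<^sub>m e d" using EX S by simp
  moreover have "X * R + S * T = 1\<^sub>m n" using X R by (auto simp: S(4) E_def intro!: eq_matI)
  ultimately show thesis using that S by blast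
qed

text \<open>The rank factorization gives \<open>A V U = A\<close>, and injectivity cancels
  \<open>A\<close> to \<open>V U = 1\<close>. Then \<open>V R\<close> is a left inverse, because
  \<open>V R A = V (R X) U = V U\<close>.\<close>

lemma injective_left_inverse:
  fixes A :: "'k::field mat"
  assumes A: "A \<in> carrier_mat r c" and inj: "\<And>v. v \<in> carrier_vec c \<Longrightarrow> A *\<^sub>v v = 0\<^sub>v r \<Longrightarrow> v = 0\<^sub>v c"
  obtains B where "B \<in> carrier_mat c r" "B * A = 1\<^sub>m c"
proof -
  obtain d X R V U where X: "X \<in> carrier_mat r d" and R: "R \<in> carrier_mat d r" and RX: "R * X = 1\<^sub>m d"
    and V: "V \<in> carrier_mat c d" "A * V = X" and U: "U \<in> carrier_mat d c" "X * U = A"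
    by (rule rank_factorization[OF A])
  have VU: "V * U = 1\<^sub>m c"
  proof (rule mat_eq_of_vec[of _ c c])
    fix v :: "'k vec" assume v: "v \<in> carrier_vec c"
    define w where "w = (V * U) *\<^sub>v v + (- 1) \<cdot>\<^sub>v v"
    have w: "w \<in> carrier_vec c" using V(1) U(1) v by (intro carrier_vecI) (simp add: w_def)
    have VUv: "(V * U) *\<^sub>v v \<in> carrier_vec c" using V(1) U(1) v by (intro carrier_vecI) simp
    have "A *\<^sub>v ((V * U) *\<^sub>v v) = A *\<^sub>v v"
    proof -
      have "A * (V * U) = (A * V) * U" by (rule mat_mult_assoc[symmetric]) (use A V(1) U(1) in auto)
      hence "A * (V * U) = A" by (simp add: V(2) U(2))
      moreover have "(A * (V * U)) *\<^sub>v v = A *\<^sub>v ((V * U) *\<^sub>v v)"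
        by (rule mat_vec_assoc) (use A V(1) U(1) v in auto)
      ultimately show ?thesis by simp
    qed
    moreover have "A *\<^sub>v w = A *\<^sub>v ((V * U) *\<^sub>v v) + (- 1) \<cdot>\<^sub>v (A *\<^sub>v v)"
      unfolding w_def using A VUv v by (simp add: mult_add_distrib_mat_vec[of A r c] mult_mat_vec[of A r c])
    ultimately have "A *\<^sub>v w = 0\<^sub>v r" using A v by (intro eq_vecI) auto
    hence w0: "w = 0\<^sub>v c" using inj w by blast
    show "(V * U) *\<^sub>v v = 1\<^sub>m c *\<^sub>v v"
    proof (rule eq_vecI)
      fix i assume "i < dim_vec (1\<^sub>m c *\<^sub>v v)"
      hence i: "i < c" using v by simp
      have "w $ i = 0" using w0 i by simp
      thus "((V * U) *\<^sub>v v) $ i = (1\<^sub>m c *\<^sub>v v) $ i" using i v VUv by (simp add: w_def del: index_mult_mat_vec)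
    qed (use V v in auto)
  qed (use V U in auto)
  have "(V * R) * A = V * ((R * X) * U)" using U(1) V X R by (simp add: U(2)[symmetric] mat_mult_assoc)
  hence "(V * R) * A = 1\<^sub>m c" using RX VU U by simp
  thus thesis using that[of "V * R"] V R by auto
qed


subsection \<open>Short exact sequences and exact functors\<close>

context kalg
begin

text \<open>The isotypic semisimple module on which \<open>a\<close> acts by the scalar
  \<open>\<chi> a\<close>. Scalar matrices are unaffected by a change of basis, so a module
  isomorphic to \<open>scal n \<chi>\<close> is equal to it. Values of functors on simple modules
  can therefore be given by equations.\<close>

definition scal :: "nat \<Rightarrow> ('a \<Rightarrow> 'k) \<Rightarrow> ('a, 'k) modl" where
  "scal n \<chi> = (n, \<lambda>a. \<chi> a \<cdot>\<^sub>m 1\<^sub>m n)"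

definition lin :: "('a \<Rightarrow> 'k) \<Rightarrow> ('a, 'k) modl" where
  "lin \<chi> = scal 1 \<chi>"

definition is_char :: "('a \<Rightarrow> 'k) \<Rightarrow> bool" where
  "is_char \<chi> \<longleftrightarrow> \<chi> 1 = 1 \<and> (\<forall>a b. \<chi> (a * b) = \<chi> a * \<chi> b) \<and> (\<forall>a b. \<chi> (a + b) = \<chi> a + \<chi> b) \<and>
     (\<forall>c a. \<chi> (sm c a) = c * \<chi> a)"

lemma fst_scal [simp]: "fst (scal n \<chi>) = n" by (simp add: scal_def)

lemma md_scal: "is_char \<chi> \<Longrightarrow> md (scal n \<chi>)"
  by (auto simp: is_module_def scal_def is_char_def mat_smult_mult mat_mult_smult intro!: eq_matI)

lemma fst_lin [simp]: "fst (lin \<chi>) = 1" by (simp add: lin_def)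

lemma md_lin: "is_char \<chi> \<Longrightarrow> md (lin \<chi>)" by (simp add: lin_def md_scal)

lemma hom_scal: "hom (scal n \<chi>) (scal m \<chi>) = carrier_mat m n"
  by (auto simp: hom_def scal_def mat_smult_mult mat_mult_smult)

text \<open>The splitting is only required to be linear.\<close>

definition ses where
  "ses L i M p Q \<longleftrightarrow> md L \<and> md M \<and> md Q \<and> i \<in> hom L M \<and> p \<in> hom M Q \<and> p * i = 0\<^sub>m (fst Q) (fst L) \<and>
     (\<exists>r s. r \<in> carrier_mat (fst L) (fst M) \<and> s \<in> carrier_mat (fst M) (fst Q) \<and>
        r * i = 1\<^sub>m (fst L) \<and> p * s = 1\<^sub>m (fst Q) \<and> i * r + s * p = 1\<^sub>m (fst M))"

lemma sesE:
  assumes "ses L i M p Q"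
  obtains r s where "md L" "md M" "md Q" "i \<in> hom L M" "p \<in> hom M Q" "p * i = 0\<^sub>m (fst Q) (fst L)"
    "r \<in> carrier_mat (fst L) (fst M)" "s \<in> carrier_mat (fst M) (fst Q)"
    "r * i = 1\<^sub>m (fst L)" "p * s = 1\<^sub>m (fst Q)" "i * r + s * p = 1\<^sub>m (fst M)"
  using assms unfolding ses_def by (elim conjE exE) (rule that)

lemma ses_intro:
  assumes "md L" "md M" "md Q" "i \<in> hom L M" "p \<in> hom M Q" "p * i = 0\<^sub>m (fst Q) (fst L)"
    "r \<in> carrier_mat (fst L) (fst M)" "s \<in> carrier_mat (fst M) (fst Q)"
    "r * i = 1\<^sub>m (fst L)" "p * s = 1\<^sub>m (fst Q)" "i * r + s * p = 1\<^sub>m (fst M)"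
  shows "ses L i M p Q"
  using assms unfolding ses_def by blast

text \<open>The block row with entries \<open>i\<close>, \<open>s\<close> and the block column with
  entries \<open>r\<close>, \<open>p\<close> are mutually inverse. The one relation that is not
  among the hypotheses, \<open>r s = 0\<close>, comes from \<open>s p = 1 - i r\<close> by
  multiplying with \<open>r\<close> on the left and with \<open>s\<close> on the right.\<close>

lemma ses_dim:
  assumes "ses L i M p Q" shows "fst M = fst L + fst Q"
proof -
  obtain r s where h: "i \<in> hom L M" "p \<in> hom M Q" and pi: "p * i = 0\<^sub>m (fst Q) (fst L)"
    and rs: "r \<in> carrier_mat (fst L) (fst M)" "s \<in> carrier_mat (fst M) (fst Q)"
    and ri: "r * i = 1\<^sub>m (fst L)" and ps: "p * s = 1\<^sub>m (fst Q)" and e: "i * r + s * p = 1\<^sub>m (fst M)"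
    by (rule sesE[OF assms])
  note c = h[THEN homD] rs
  define A where "A = i * pr1 (fst L) (fst Q) + s * pr2 (fst L) (fst Q)"
  define B where "B = in1 (fst L) (fst Q) * r + in2 (fst L) (fst Q) * p"
  have AB: "A \<in> carrier_mat (fst M) (fst L + fst Q)" "B \<in> carrier_mat (fst L + fst Q) (fst M)"
    using c by (auto simp: A_def B_def intro!: carrier_matI)
  have "A * in1 (fst L) (fst Q) = i" "A * in2 (fst L) (fst Q) = s"
    using c by (simp_all add: A_def mat_add_mult mat_mult_assoc pr_in mat_add_zero)
  hence "A * B = i * r + s * p"
    using AB c by (simp add: B_def mat_mult_add mat_mult_assoc[symmetric])
  hence 1: "A * B = 1\<^sub>m (fst M)" using e by simp
  have "(r * s) * p = r * (s * p)" using c by (simp add: mat_mult_assoc)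
  also have "s * p = 1\<^sub>m (fst M) - i * r" using c unfolding e[symmetric] by (intro eq_matI) auto
  also have "r * (1\<^sub>m (fst M) - i * r) = r - (r * i) * r" using c by (simp add: mat_mult_minus mat_mult_assoc)
  also have "\<dots> = 0\<^sub>m (fst L) (fst M)" using c by (simp add: ri minus_r_inv_mat[of _ "fst L" "fst M"])
  finally have "(r * s) * (p * s) = 0\<^sub>m (fst L) (fst M) * s" using c by (simp add: mat_mult_assoc[symmetric])
  hence rs0: "r * s = 0\<^sub>m (fst L) (fst Q)" using ps c by simp
  have "B * i = in1 (fst L) (fst Q)" "B * s = in2 (fst L) (fst Q)"
    using c by (simp_all add: B_def mat_add_mult mat_mult_assoc mat_add_zero ri ps pi rs0)
  hence "B * A = in1 (fst L) (fst Q) * pr1 (fst L) (fst Q) + in2 (fst L) (fst Q) * pr2 (fst L) (fst Q)"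
    using AB c by (simp add: A_def mat_mult_add mat_mult_assoc[symmetric])
  hence 2: "B * A = 1\<^sub>m (fst L + fst Q)" by (simp add: in_pr)
  show ?thesis using right_inverse_dim_le[OF AB 1] right_inverse_dim_le[OF AB(2,1) 2] by simp
qed

text \<open>An arbitrary retraction \<open>r\<close> and section \<open>s\<close> need not be
  complementary. The section is corrected to \<open>(1 - i r) s\<close>: the map
  \<open>1 - s p\<close> goes into the kernel of \<open>p\<close>, which is the image of
  \<open>i\<close>, and that image is annihilated by \<open>1 - i r\<close>.\<close>

lemma sesI:
  assumes m: "md L" "md M" "md Q" and h: "i \<in> hom L M" "p \<in> hom M Q" and pi: "p * i = 0\<^sub>m (fst Q) (fst L)"
    and r: "r \<in> carrier_mat (fst L) (fst M)" "r * i = 1\<^sub>m (fst L)"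
    and s: "s \<in> carrier_mat (fst M) (fst Q)" "p * s = 1\<^sub>m (fst Q)"
    and ker: "\<And>v. v \<in> carrier_vec (fst M) \<Longrightarrow> p *\<^sub>v v = 0\<^sub>v (fst Q) \<Longrightarrow> \<exists>u\<in>carrier_vec (fst L). v = i *\<^sub>v u"
  shows "ses L i M p Q"
proof -
  note c = h[THEN homD] r(1) s(1)
  define E where "E = 1\<^sub>m (fst M) - i * r"
  have Ec: "E \<in> carrier_mat (fst M) (fst M)" using c by (auto simp: E_def)
  have pE: "p * E = p"
    using c pi by (simp add: E_def mat_mult_minus mat_mult_assoc[symmetric]) (auto intro!: eq_matI)
  have Ei: "E * i = 0\<^sub>m (fst M) (fst L)"
    using c r(2) by (simp add: E_def mat_minus_mult mat_mult_assoc)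
  define D where "D = 1\<^sub>m (fst M) - s * p"
  have Dc: "D \<in> carrier_mat (fst M) (fst M)" using c by (auto simp: D_def)
  have "p * (s * p) = p" using c s(2) by (simp add: mat_mult_assoc[symmetric])
  hence pD: "p * D = 0\<^sub>m (fst Q) (fst M)"
    using c by (simp add: D_def mat_mult_minus)
  obtain t where t: "t \<in> carrier_mat (fst L) (fst M)" "i * t = D"
  proof (rule factor_through_image[OF c(1) Dc])
    fix v :: "'k vec" assume v: "v \<in> carrier_vec (fst M)"
    have "p *\<^sub>v (D *\<^sub>v v) = (p * D) *\<^sub>v v" using c Dc v by (simp add: mat_vec_assoc)
    hence "p *\<^sub>v (D *\<^sub>v v) = 0\<^sub>v (fst Q)" using pD v by (auto intro!: eq_vecI)
    thus "\<exists>u\<in>carrier_vec (fst L). D *\<^sub>v v = i *\<^sub>v u" using Dc v by (intro ker) auto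
  qed
  have "E * D = (E * i) * t" unfolding t(2)[symmetric] using t(1) c Ec by (simp add: mat_mult_assoc)
  hence "E * D = 0\<^sub>m (fst M) (fst M)" using Ei t by simp
  hence "E - E * (s * p) = 0\<^sub>m (fst M) (fst M)"
    using c Ec by (simp add: D_def mat_mult_minus)
  hence EE: "E $$ (a, b) = (E * (s * p)) $$ (a, b)" if "a < fst M" "b < fst M" for a b
    using that Ec c by (metis (no_types, lifting) carrier_matD eq_iff_diff_eq_0 index_minus_mat(1) index_mult_mat(2,3) index_zero_mat(1))
  have e: "i * r + (E * s) * p = 1\<^sub>m (fst M)"
  proof (rule eq_matI)
    fix a b assume "a < dim_row (1\<^sub>m (fst M))" "b < dim_col (1\<^sub>m (fst M))"
    hence ab: "a < fst M" "b < fst M" by auto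
    have "((E * s) * p) $$ (a, b) = E $$ (a, b)"
      using EE[OF ab] c Ec by (simp add: mat_mult_assoc)
    thus "(i * r + (E * s) * p) $$ (a, b) = 1\<^sub>m (fst M) $$ (a, b)"
      using ab c Ec by (simp add: E_def del: index_mult_mat(1))
  qed (use c Ec in auto)
  have ps: "p * (E * s) = 1\<^sub>m (fst Q)" using pE s(2) c Ec by (simp add: mat_mult_assoc[symmetric])
  show ?thesis
    by (rule ses_intro[OF m h pi r(1) _ r(2) ps e]) (use Ec s in auto)
qed

text \<open>\<open>i\<close> can be cancelled on the left, so each module axiom for
  \<open>\<rho>\<close> follows from the one for \<open>M\<close> after multiplication by
  \<open>i\<close>; \<open>md_quot\<close> is the dual statement.\<close>

lemma md_sub:
  assumes M: "md M" and i: "i \<in> carrier_mat (fst M) d" "r \<in> carrier_mat d (fst M)" "r * i = 1\<^sub>m d"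
    and \<rho>: "\<And>a. \<rho> a \<in> carrier_mat d d" "\<And>a. i * \<rho> a = snd M a * i"
  shows "md (d, \<rho>)"
proof -
  have cancel: "A = B" if "A \<in> carrier_mat d d" "B \<in> carrier_mat d d" "i * A = i * B" for A B
  proof -
    have "A = (r * i) * A" using that(1) by (simp add: i(3))
    also have "\<dots> = r * (i * B)" using that(1) i(1,2) by (simp add: mat_mult_assoc that(3))
    also have "\<dots> = (r * i) * B" using that(2) i(1,2) by (simp add: mat_mult_assoc)
    finally show ?thesis using that(2) by (simp add: i(3))
  qed
  have 1: "\<rho> 1 = 1\<^sub>m d" 
  proof (rule cancel)
    show "i * \<rho> 1 = i * 1\<^sub>m d" using i(1) by (simp add: \<rho>(2) md_one[OF M])
  qed (use \<rho>(1) in auto)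
  have 2: "\<rho> (a * b) = \<rho> a * \<rho> b" for a b
  proof (rule cancel)
    have "i * (\<rho> a * \<rho> b) = (i * \<rho> a) * \<rho> b" using i \<rho>(1)[of a] \<rho>(1)[of b] by (simp add: mat_mult_assoc)
    also have "\<dots> = snd M a * (i * \<rho> b)"
      using i \<rho>(1)[of b] md_dim[OF M] by (simp add: \<rho>(2) mat_mult_assoc)
    also have "\<dots> = i * \<rho> (a * b)"
      using i md_dim[OF M] by (simp add: \<rho>(2) mat_mult_assoc md_mult[OF M])
    finally show "i * \<rho> (a * b) = i * (\<rho> a * \<rho> b)" ..
  qed (rule \<rho>(1), rule mult_carrier_mat[OF \<rho>(1) \<rho>(1)])
  have 3: "\<rho> (a + b) = \<rho> a + \<rho> b" for a b
  proof (rule cancel)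
    have "i * (\<rho> a + \<rho> b) = i * \<rho> a + i * \<rho> b"
      using i \<rho>(1)[of a] \<rho>(1)[of b] by (simp add: mat_mult_add)
    thus "i * \<rho> (a + b) = i * (\<rho> a + \<rho> b)"
      using i md_dim[OF M] by (simp add: \<rho>(2) md_add[OF M] mat_add_mult)
  qed (use \<rho>(1) in auto)
  have 4: "\<rho> (sm x a) = x \<cdot>\<^sub>m \<rho> a" for x a
  proof (rule cancel)
    have "i * (x \<cdot>\<^sub>m \<rho> a) = x \<cdot>\<^sub>m (i * \<rho> a)"
      using i \<rho>(1)[of a] by (simp add: mat_mult_smult)
    thus "i * \<rho> (sm x a) = i * (x \<cdot>\<^sub>m \<rho> a)"
      using i md_dim[OF M] by (simp add: \<rho>(2) md_smult[OF M] mat_smult_mult)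
  qed (use \<rho>(1) in auto)
  show ?thesis unfolding is_module_def using \<rho>(1) 1 2 3 4 by simp
qed

lemma md_quot:
  assumes M: "md M" and p: "p \<in> carrier_mat d (fst M)" "s \<in> carrier_mat (fst M) d" "p * s = 1\<^sub>m d"
    and \<rho>: "\<And>a. \<rho> a \<in> carrier_mat d d" "\<And>a. \<rho> a * p = p * snd M a"
  shows "md (d, \<rho>)"
proof -
  have cancel: "A = B" if "A \<in> carrier_mat d d" "B \<in> carrier_mat d d" "A * p = B * p" for A B
  proof -
    have "A = A * (p * s)" using that(1) by (simp add: p(3))
    also have "\<dots> = (B * p) * s" using that(1) p(1,2) by (simp add: mat_mult_assoc[symmetric] that(3))
    also have "\<dots> = B * (p * s)" using that(2) p(1,2) by (simp add: mat_mult_assoc)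
    finally show ?thesis using that(2) by (simp add: p(3))
  qed
  have 1: "\<rho> 1 = 1\<^sub>m d" 
  proof (rule cancel)
    show "\<rho> 1 * p = 1\<^sub>m d * p" using p(1) by (simp add: \<rho>(2) md_one[OF M])
  qed (use \<rho>(1) in auto)
  have 2: "\<rho> (a * b) = \<rho> a * \<rho> b" for a b
  proof (rule cancel)
    have "(\<rho> a * \<rho> b) * p = \<rho> a * (\<rho> b * p)" using p \<rho>(1)[of a] \<rho>(1)[of b] by (simp add: mat_mult_assoc)
    also have "\<dots> = (\<rho> a * p) * snd M b"
      using p \<rho>(1)[of a] md_dim[OF M] unfolding \<rho>(2)[of b] by (simp add: mat_mult_assoc)
    also have "\<dots> = \<rho> (a * b) * p"
      using p md_dim[OF M] by (simp add: \<rho>(2) mat_mult_assoc md_mult[OF M])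
    finally show "\<rho> (a * b) * p = (\<rho> a * \<rho> b) * p" ..
  qed (rule \<rho>(1), rule mult_carrier_mat[OF \<rho>(1) \<rho>(1)])
  have 3: "\<rho> (a + b) = \<rho> a + \<rho> b" for a b
  proof (rule cancel)
    have "(\<rho> a + \<rho> b) * p = \<rho> a * p + \<rho> b * p"
      using p \<rho>(1)[of a] \<rho>(1)[of b] by (simp add: mat_add_mult)
    thus "\<rho> (a + b) * p = (\<rho> a + \<rho> b) * p"
      using p md_dim[OF M] by (simp add: \<rho>(2) md_add[OF M] mat_mult_add)
  qed (use \<rho>(1) in auto)
  have 4: "\<rho> (sm x a) = x \<cdot>\<^sub>m \<rho> a" for x a
  proof (rule cancel)
    have "(x \<cdot>\<^sub>m \<rho> a) * p = x \<cdot>\<^sub>m (\<rho> a * p)"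
      using p \<rho>(1)[of a] by (simp add: mat_smult_mult)
    thus "\<rho> (sm x a) * p = (x \<cdot>\<^sub>m \<rho> a) * p"
      using p md_dim[OF M] by (simp add: \<rho>(2) md_smult[OF M] mat_mult_smult)
  qed (use \<rho>(1) in auto)
  show ?thesis unfolding is_module_def using \<rho>(1) 1 2 3 4 by simp
qed

text \<open>The quotient is realised on a linear complement, where \<open>a\<close> acts by
  \<open>T a S\<close>. The projection \<open>T\<close> is equivariant because it kills the image of
  \<open>X\<close>, which is stable under the action.\<close>

lemma injective_ses:
  assumes L: "md L" and M: "md M" and X: "X \<in> hom L M" and R: "R \<in> carrier_mat (fst L) (fst M)"
    and RX: "R * X = 1\<^sub>m (fst L)"
  obtains Q p where "ses L X M p Q"
proof -
  note Xc = homD[OF X]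
  obtain e S T where S: "S \<in> carrier_mat (fst M) e" and T: "T \<in> carrier_mat e (fst M)" and TS: "T * S = 1\<^sub>m e"
    and one: "X * R + S * T = 1\<^sub>m (fst M)" and TX: "T * X = 0\<^sub>m e (fst L)"
    by (rule complement_split[OF Xc R RX])
  note md = md_dim[OF M] md_dim[OF L]
  define Q where "Q = (e, \<lambda>a. T * (snd M a * S))"
  have Tq: "T * (snd M a * S) * T = T * snd M a" for a
  proof -
    have "T * snd M a = T * (snd M a * (X * R + S * T))" using one md T by simp
    also have "\<dots> = T * (snd M a * X) * R + T * (snd M a * S) * T"
      using md T S Xc R by (simp add: mat_mult_add mat_mult_assoc)
    also have "T * (snd M a * X) = (T * X) * snd L a"
      using md T Xc by (simp add: hom_comm[OF X, symmetric] mat_mult_assoc)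
    also have "\<dots> = 0\<^sub>m e (fst L)" using TX md by simp
    also have "0\<^sub>m e (fst L) * R + T * (snd M a * S) * T = T * (snd M a * S) * T"
      using R T S by (simp add: mat_add_zero)
    finally show ?thesis ..
  qed
  have Q: "md Q" unfolding Q_def
    by (rule md_quot[OF M T S TS]) (use Tq S T md in \<open>auto intro!: carrier_matI\<close>)
  have "T \<in> hom M Q" using T Tq by (simp add: hom_def Q_def)
  hence "ses L X M T Q"
    by (intro ses_intro[OF L M Q X, of T R S]) (use R S T RX TS one TX in \<open>auto simp: Q_def\<close>)
  thus thesis by (rule that)
qed

lemma submodule_ses:
  assumes M: "md M" and W: "submodule M W"
  obtains L i Q p where "ses L i M p Q" "W = {i *\<^sub>v v | v. v \<in> carrier_vec (fst L)}"
proof -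
  obtain d X R where X: "X \<in> carrier_mat (fst M) d" and R: "R \<in> carrier_mat d (fst M)" and RX: "R * X = 1\<^sub>m d"
    and WX: "W = {X *\<^sub>v v | v. v \<in> carrier_vec d}"
    by (rule subspace_basis[of W "fst M"]) (use W in \<open>unfold submodule_def, blast+\<close>)
  note md = md_dim[OF M]
  have inv: "X * (R * (snd M a * X)) = snd M a * X" for a
  proof -
    obtain V where V: "V \<in> carrier_mat d d" "X * V = snd M a * X"
    proof (rule factor_through_image[OF X, of "snd M a * X" d])
      fix v :: "'k vec" assume v: "v \<in> carrier_vec d"
      hence "snd M a *\<^sub>v (X *\<^sub>v v) \<in> W"
        using W WX unfolding submodule_def by blast
      moreover have "(snd M a * X) *\<^sub>v v = snd M a *\<^sub>v (X *\<^sub>v v)"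
        using v X md by (simp add: mat_vec_assoc)
      ultimately show "\<exists>u\<in>carrier_vec d. (snd M a * X) *\<^sub>v v = X *\<^sub>v u"
        using WX by auto
    qed (use X md in \<open>auto intro!: carrier_matI\<close>)
    have "X * (R * (X * V)) = X * ((R * X) * V)" using X R V(1) by (simp add: mat_mult_assoc)
    thus ?thesis using RX V by simp
  qed
  define L where "L = (d, \<lambda>a. R * (snd M a * X))"
  have L: "md L" unfolding L_def
    by (rule md_sub[OF M X R RX]) (use inv R X md in \<open>auto intro!: carrier_matI\<close>)
  have Xh: "X \<in> hom L M" using X inv by (simp add: hom_def L_def)
  obtain Q p where "ses L X M p Q"
    by (rule injective_ses[OF L M Xh]) (use R RX in \<open>auto simp: L_def\<close>)
  thus thesis using that[of L X p Q] WX by (simp add: L_def)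
qed

lemma kernel_submodule:
  assumes m: "md M" "md N" and f: "f \<in> hom M N"
  shows "submodule M {v \<in> carrier_vec (fst M). f *\<^sub>v v = 0\<^sub>v (fst N)}"
proof -
  note c = homD[OF f]
  have "f *\<^sub>v (snd M a *\<^sub>v v) = 0\<^sub>v (fst N)" if v: "v \<in> carrier_vec (fst M)" "f *\<^sub>v v = 0\<^sub>v (fst N)" for a v
  proof -
    have "f *\<^sub>v (snd M a *\<^sub>v v) = (f * snd M a) *\<^sub>v v" using c v md_dim[OF m(1)] by (simp add: mat_vec_assoc)
    also have "\<dots> = snd N a *\<^sub>v (f *\<^sub>v v)"
      using c v md_dim[OF m(2)] by (simp add: hom_comm[OF f] mat_vec_assoc)
    also have "\<dots> = 0\<^sub>v (fst N)" using v md_dim[OF m(2)] by (simp add: mat_mult_zero_vec)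
    finally show ?thesis .
  qed
  thus ?thesis unfolding submodule_def
    using c md_dim[OF m(1)]
    by (auto intro!: carrier_vecI simp: mat_mult_zero_vec mult_add_distrib_mat_vec[of f "fst N" "fst M"] mult_mat_vec[of f "fst N" "fst M"])
qed

lemma image_submodule:
  assumes m: "md M" "md N" and f: "f \<in> hom M N"
  shows "submodule N {f *\<^sub>v v | v. v \<in> carrier_vec (fst M)}"
proof -
  note c = homD[OF f]
  let ?W = "{f *\<^sub>v v | v. v \<in> carrier_vec (fst M)}"
  have I: "f *\<^sub>v v \<in> ?W" if "v \<in> carrier_vec (fst M)" for v using that by blast
  show ?thesis unfolding submodule_def
  proof (intro conjI ballI allI)
    show "?W \<subseteq> carrier_vec (fst N)" using c by auto
    have "f *\<^sub>v 0\<^sub>v (fst M) = 0\<^sub>v (fst N)" using c by (auto intro!: eq_vecI)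
    thus "0\<^sub>v (fst N) \<in> ?W" using I[of "0\<^sub>v (fst M)"] by simp
    fix x assume "x \<in> ?W"
    then obtain v where v: "v \<in> carrier_vec (fst M)" "x = f *\<^sub>v v" by blast
    show "k \<cdot>\<^sub>v x \<in> ?W" for k
      using I[of "k \<cdot>\<^sub>v v"] v c by (simp add: mult_mat_vec[of f "fst N" "fst M"])
    have "snd N a *\<^sub>v x = f *\<^sub>v (snd M a *\<^sub>v v)" for a
      using v c md_dim[OF m(1)] md_dim[OF m(2)]
      by (simp add: mat_vec_assoc[symmetric] hom_comm[OF f])
    thus "snd N a *\<^sub>v x \<in> ?W" for a
      using I[of "snd M a *\<^sub>v v"] v md_carrier[OF m(1), of a] by simp
    fix y assume "y \<in> ?W"
    then obtain w where w: "w \<in> carrier_vec (fst M)" "y = f *\<^sub>v w" by blast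
    show "x + y \<in> ?W"
      using I[of "v + w"] v w c by (simp add: mult_add_distrib_mat_vec[of f "fst N" "fst M"])
  qed
qed

section \<open>Exact functors\<close>

definition exact where
  "exact F \<longleftrightarrow> (\<forall>L i M p Q. ses L i M p Q \<longrightarrow>
     ses (fst F L) (snd F L M i) (fst F M) (snd F M Q p) (fst F Q))"

lemma exactD: "exact F \<Longrightarrow> ses L i M p Q \<Longrightarrow>
     ses (fst F L) (snd F L M i) (fst F M) (snd F M Q p) (fst F Q)"
  unfolding exact_def by blast

lemma hom_kernel:
  assumes m: "md M" "md N" and f: "f \<in> hom M N"
  obtains K j where "md K" "j \<in> hom K M" "f * j = 0\<^sub>m (fst N) (fst K)"
    "\<And>v. v \<in> carrier_vec (fst M) \<Longrightarrow> f *\<^sub>v v = 0\<^sub>v (fst N) \<Longrightarrow> \<exists>u\<in>carrier_vec (fst K). v = j *\<^sub>v u"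
proof -
  obtain K j Q p where s: "ses K j M p Q"
    and W: "{v \<in> carrier_vec (fst M). f *\<^sub>v v = 0\<^sub>v (fst N)} = {j *\<^sub>v v | v. v \<in> carrier_vec (fst K)}"
    by (rule submodule_ses[OF m(1) kernel_submodule[OF m f]])
  have h: "md K" "j \<in> hom K M" using s by (auto simp: ses_def)
  have "f * j = 0\<^sub>m (fst N) (fst K)"
  proof (rule mat_eq_of_vec)
    fix u :: "'k vec" assume u: "u \<in> carrier_vec (fst K)"
    hence "j *\<^sub>v u \<in> {v \<in> carrier_vec (fst M). f *\<^sub>v v = 0\<^sub>v (fst N)}" unfolding W by blast
    thus "(f * j) *\<^sub>v u = 0\<^sub>m (fst N) (fst K) *\<^sub>v u"
      using u h(2)[THEN homD] f[THEN homD] by (auto simp: mat_vec_assoc intro!: eq_vecI)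
  qed (use h(2)[THEN homD] f[THEN homD] in auto)
  moreover have "\<exists>u\<in>carrier_vec (fst K). v = j *\<^sub>v u"
    if "v \<in> carrier_vec (fst M)" "f *\<^sub>v v = 0\<^sub>v (fst N)" for v
  proof -
    have "v \<in> {j *\<^sub>v v | v. v \<in> carrier_vec (fst K)}" using that unfolding W[symmetric] by blast
    thus ?thesis by blast
  qed
  ultimately show thesis using that h by blast
qed

lemma hom_cancel_left:
  assumes m: "md K" "md L" "md M" and i: "i \<in> hom L M" "r \<in> carrier_mat (fst L) (fst M)" "r * i = 1\<^sub>m (fst L)"
    and t: "t \<in> carrier_mat (fst L) (fst K)" "i * t \<in> hom K M"
  shows "t \<in> hom K L"
proof -
  note c = homD[OF i(1)] i(2) t(1) md_dim[OF m(1)] md_dim[OF m(2)] md_dim[OF m(3)]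
  have "t * snd K a = snd L a * t" for a
  proof -
    have "t * snd K a = (r * i) * (t * snd K a)" using c by (simp add: i(3))
    also have "\<dots> = r * ((i * t) * snd K a)" using c by (simp add: mat_mult_assoc)
    also have "\<dots> = r * ((snd M a * i) * t)" using c hom_comm[OF t(2)] by (simp add: mat_mult_assoc)
    also have "\<dots> = (r * i) * (snd L a * t)" using c by (simp add: hom_comm[OF i(1), symmetric] mat_mult_assoc)
    also have "\<dots> = snd L a * t" using c by (simp add: i(3))
    finally show ?thesis .
  qed
  thus ?thesis using t(1) by (simp add: hom_def)
qed

text \<open>A left adjoint preserves cokernels and a right adjoint preserves kernels; here
  \<open>F\<close> is both. Each half takes the kernel or cokernel of a map in the image sequence,
  transposes it, and uses exactness of the original sequence.\<close>

lemma adj_exact: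
  assumes F: "fn F" and a: "adj F F \<eta> \<epsilon>"
  shows "exact F"
  unfolding exact_def
proof (intro allI impI)
  fix L i M p Q assume ses: "ses L i M p Q"
  obtain r s where m: "md L" "md M" "md Q" and h: "i \<in> hom L M" "p \<in> hom M Q"
    and pi: "p * i = 0\<^sub>m (fst Q) (fst L)"
    and rs: "r \<in> carrier_mat (fst L) (fst M)" "s \<in> carrier_mat (fst M) (fst Q)"
    and ri: "r * i = 1\<^sub>m (fst L)" and ps: "p * s = 1\<^sub>m (fst Q)" and e: "i * r + s * p = 1\<^sub>m (fst M)"
    by (rule sesE[OF ses])
  note Fm = m[THEN fn_md[OF F]]
  note FFm = Fm[THEN fn_md[OF F]]
  let ?Fi = "snd F L M i" and ?Fp = "snd F M Q p"
  have Fi: "?Fi \<in> hom (fst F L) (fst F M)" and Fp: "?Fp \<in> hom (fst F M) (fst F Q)"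
    using fn_hom[OF F] m h by auto
  note c = h[THEN homD] rs homD[OF Fi] homD[OF Fp]
  \<comment> \<open>If \<open>F f\<close> kills \<open>j\<close>, then \<open>f\<close> kills the
    transpose of \<open>j\<close>, by naturality of the counit.\<close>
  have zero_transpose: "f * (\<epsilon> N * snd F K (fst F N) j) = 0\<^sub>m (fst P) (fst (fst F K))"
    if "md N" "md P" "f \<in> hom N P" "md K" "j \<in> hom K (fst F N)"
      and z: "snd F N P f * j = 0\<^sub>m (fst (fst F P)) (fst K)" for f N P K j
  proof -
    note FN = fn_md[OF F that(1)] fn_md[OF F that(2)] fn_md[OF F that(4)]
    note Fj = fn_hom[OF F that(4) FN(1) that(5)] and Ff = fn_hom[OF F that(1-3)]
    note d = that(3)[THEN homD] Fj[THEN homD] adj_counit[OF a that(1), THEN homD] adj_counit[OF a that(2), THEN homD]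
      fn_hom[OF F FN(1,2) Ff, THEN homD]
    have "f * (\<epsilon> N * snd F K (fst F N) j) = (f * \<epsilon> N) * snd F K (fst F N) j"
      using d by (simp add: mat_mult_assoc)
    also have "\<dots> = \<epsilon> P * (snd F (fst F N) (fst F P) (snd F N P f) * snd F K (fst F N) j)"
      unfolding adj_counit_nat[OF a that(1-3), symmetric] using d by (simp add: mat_mult_assoc)
    also have "\<dots> = \<epsilon> P * snd F K (fst F P) (0\<^sub>m (fst (fst F P)) (fst K))"
      using fn_mult[OF F that(4) FN(1,2) that(5) Ff] z by simp
    also have "\<dots> = 0\<^sub>m (fst P) (fst (fst F K))"
      using fn_zero[OF F that(4) FN(2)] d by simp
    finally show ?thesis .
  qed
  \<comment> \<open>Here \<open>j\<close> is the inclusion of the kernel of \<open>F i\<close>. Its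
    transpose is killed by the injective map \<open>i\<close>, so it is zero, and hence so is
    \<open>j\<close>.\<close>
  obtain r' where r': "r' \<in> carrier_mat (fst (fst F L)) (fst (fst F M))" "r' * ?Fi = 1\<^sub>m (fst (fst F L))"
  proof (rule injective_left_inverse[OF homD[OF Fi]])
    fix v :: "'k vec" assume v: "v \<in> carrier_vec (fst (fst F L))" "?Fi *\<^sub>v v = 0\<^sub>v (fst (fst F M))"
    obtain K j where K: "md K" "j \<in> hom K (fst F L)" "?Fi * j = 0\<^sub>m (fst (fst F M)) (fst K)"
      and ker: "\<And>v. v \<in> carrier_vec (fst (fst F L)) \<Longrightarrow> ?Fi *\<^sub>v v = 0\<^sub>v (fst (fst F M)) \<Longrightarrow>
        \<exists>u\<in>carrier_vec (fst K). v = j *\<^sub>v u"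
      using hom_kernel[OF Fm(1,2) Fi] by blast
    define t where "t = \<epsilon> L * snd F K (fst F L) j"
    note Fj = fn_hom[OF F K(1) Fm(1) K(2)]
    have t: "t \<in> carrier_mat (fst L) (fst (fst F K))"
      using homD[OF adj_counit[OF a m(1)]] homD[OF Fj] by (auto simp: t_def)
    have "i * t = 0\<^sub>m (fst M) (fst (fst F K))"
      unfolding t_def by (rule zero_transpose[OF m(1,2) h(1) K])
    hence "(r * i) * t = 0\<^sub>m (fst L) (fst (fst F K))" using c t by (simp add: mat_mult_assoc)
    hence t0: "t = 0\<^sub>m (fst L) (fst (fst F K))" using t by (simp add: ri)
    have "j = snd F (fst F K) L t * \<eta> K"
      unfolding t_def by (rule adj_transpose2[OF F F a K(1) m(1) K(2), symmetric])
    also have "\<dots> = 0\<^sub>m (fst (fst F L)) (fst K)"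
      using fn_zero[OF F fn_md[OF F K(1)] m(1)] homD[OF adj_unit[OF a K(1)]] by (simp add: t0)
    finally have j0: "j = 0\<^sub>m (fst (fst F L)) (fst K)" .
    obtain u where "u \<in> carrier_vec (fst K)" "v = j *\<^sub>v u" using ker[OF v] by blast
    thus "v = 0\<^sub>v (fst (fst F L))" using j0 by (auto intro!: eq_vecI)
  qed
  \<comment> \<open>Dually, the cokernel \<open>q\<close> of \<open>F p\<close> has a transpose
    \<open>g\<close> with \<open>g p = 0\<close>. Since \<open>p\<close> is onto,
    \<open>g = 0\<close> and then \<open>q = 0\<close>, so the image of \<open>F p\<close> is
    everything.\<close>
  obtain s' where s': "s' \<in> carrier_mat (fst (fst F M)) (fst (fst F Q))" "?Fp * s' = 1\<^sub>m (fst (fst F Q))"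
  proof (rule factor_through_image[OF homD[OF Fp], of "1\<^sub>m (fst (fst F Q))"])
    fix v :: "'k vec" assume v: "v \<in> carrier_vec (fst (fst F Q))"
    obtain I i' q C where s1: "ses I i' (fst F Q) q C"
      and W: "{?Fp *\<^sub>v v | v. v \<in> carrier_vec (fst (fst F M))} = {i' *\<^sub>v v | v. v \<in> carrier_vec (fst I)}"
      by (rule submodule_ses[OF Fm(3) image_submodule[OF Fm(2,3) Fp]])
    obtain r2 s2 where C: "md I" "md C" and h': "i' \<in> hom I (fst F Q)" "q \<in> hom (fst F Q) C"
       and qi: "q * i' = 0\<^sub>m (fst C) (fst I)"
       and r2: "r2 \<in> carrier_mat (fst I) (fst (fst F Q))" and s2: "s2 \<in> carrier_mat (fst (fst F Q)) (fst C)"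
       and e2: "i' * r2 + s2 * q = 1\<^sub>m (fst (fst F Q))"
      by (rule sesE[OF s1])
    note d = h'[THEN homD] r2 s2
    have qF: "q * ?Fp = 0\<^sub>m (fst C) (fst (fst F M))"
    proof (rule mat_eq_of_vec)
      fix u :: "'k vec" assume u: "u \<in> carrier_vec (fst (fst F M))"
      hence "?Fp *\<^sub>v u \<in> {i' *\<^sub>v v | v. v \<in> carrier_vec (fst I)}" unfolding W[symmetric] by blast
      then obtain w where w: "w \<in> carrier_vec (fst I)" "?Fp *\<^sub>v u = i' *\<^sub>v w" by blast
      have "(q * ?Fp) *\<^sub>v u = (q * i') *\<^sub>v w"
        using d c u w by (simp add: mat_vec_assoc)
      thus "(q * ?Fp) *\<^sub>v u = 0\<^sub>m (fst C) (fst (fst F M)) *\<^sub>v u"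
        using qi w u by (auto intro!: eq_vecI)
    qed (use c d in auto)
    define g where "g = snd F (fst F Q) C q * \<eta> Q"
    note FC = fn_md[OF F C(2)]
    note Fq = fn_hom[OF F Fm(3) C(2) h'(2)] and FFp = fn_hom[OF F Fm(2,3) Fp]
    note d' = Fq[THEN homD] FFp[THEN homD] adj_unit[OF a m(2), THEN homD] adj_unit[OF a m(3), THEN homD]
    have g: "g \<in> carrier_mat (fst (fst F C)) (fst Q)" using d' by (auto simp: g_def)
    have "g * p = snd F (fst F Q) C q * (snd F (fst F M) (fst F Q) ?Fp * \<eta> M)"
      unfolding adj_unit_nat[OF a m(2,3) h(2)] using d' c by (simp add: g_def mat_mult_assoc)
    also have "\<dots> = snd F (fst F M) C (q * ?Fp) * \<eta> M"
      using fn_mult[OF F Fm(2,3) C(2) Fp h'(2)] d' by (simp add: mat_mult_assoc)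
    also have "\<dots> = 0\<^sub>m (fst (fst F C)) (fst M)"
      using fn_zero[OF F Fm(2) C(2)] d' by (simp add: qF)
    finally have "g * (p * s) = 0\<^sub>m (fst (fst F C)) (fst M) * s"
      using g c by (simp add: mat_mult_assoc[symmetric])
    hence g0: "g = 0\<^sub>m (fst (fst F C)) (fst Q)" using g c by (simp add: ps)
    have "q = \<epsilon> C * snd F Q (fst F C) g"
      unfolding g_def by (rule adj_transpose1[OF F F a m(3) C(2) h'(2), symmetric])
    also have "\<dots> = 0\<^sub>m (fst C) (fst (fst F Q))"
      using fn_zero[OF F m(3) FC] homD[OF adj_counit[OF a C(2)]] by (simp add: g0)
    finally have "i' * r2 = 1\<^sub>m (fst (fst F Q))" using e2 d by (simp add: mat_add_zero)
    hence "1\<^sub>m (fst (fst F Q)) *\<^sub>v v = i' *\<^sub>v (r2 *\<^sub>v v)"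
      using d v by (metis carrier_matD carrier_vecD mat_vec_assoc)
    moreover have "r2 *\<^sub>v v \<in> carrier_vec (fst I)" using r2 v by auto
    ultimately have "1\<^sub>m (fst (fst F Q)) *\<^sub>v v \<in> {?Fp *\<^sub>v v | v. v \<in> carrier_vec (fst (fst F M))}"
      unfolding W by blast
    thus "\<exists>u\<in>carrier_vec (fst (fst F M)). 1\<^sub>m (fst (fst F Q)) *\<^sub>v v = ?Fp *\<^sub>v u" by blast
  qed auto
  show "ses (fst F L) ?Fi (fst F M) ?Fp (fst F Q)"
  proof (rule sesI[OF Fm Fi Fp _ r' s'])
    show "?Fp * ?Fi = 0\<^sub>m (fst (fst F Q)) (fst (fst F L))"
      using fn_mult[OF F m h] fn_zero[OF F m(1,3)] pi by simp
    fix v :: "'k vec" assume v: "v \<in> carrier_vec (fst (fst F M))" "?Fp *\<^sub>v v = 0\<^sub>v (fst (fst F Q))"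
    obtain K j where K: "md K" "j \<in> hom K (fst F M)" "?Fp * j = 0\<^sub>m (fst (fst F Q)) (fst K)"
      and ker: "\<And>v. v \<in> carrier_vec (fst (fst F M)) \<Longrightarrow> ?Fp *\<^sub>v v = 0\<^sub>v (fst (fst F Q)) \<Longrightarrow>
        \<exists>u\<in>carrier_vec (fst K). v = j *\<^sub>v u"
      using hom_kernel[OF Fm(2,3) Fp] by blast
    \<comment> \<open>The kernel inclusion \<open>j\<close> of \<open>F p\<close> transposes to a
      map into the kernel of \<open>p\<close>, which factors through \<open>i\<close> as
      \<open>i (r t)\<close>. Transposing back writes \<open>j\<close> as \<open>F i\<close>
      composed with another map.\<close>
    define t where "t = \<epsilon> M * snd F K (fst F M) j"
    note FK = fn_md[OF F K(1)]
    note Fj = fn_hom[OF F K(1) Fm(2) K(2)]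
    have th: "t \<in> hom (fst F K) M"
      unfolding t_def by (rule hom_mult[OF FK FFm(2) m(2) Fj adj_counit[OF a m(2)]])
    note t = homD[OF th]
    have pt: "p * t = 0\<^sub>m (fst Q) (fst (fst F K))"
      unfolding t_def by (rule zero_transpose[OF m(2,3) h(2) K])
    have "t = (i * r + s * p) * t" using t by (simp add: e)
    also have "\<dots> = i * (r * t)" using t c pt by (simp add: mat_add_mult mat_mult_assoc mat_add_zero)
    finally have irt: "i * (r * t) = t" ..
    have rt: "r * t \<in> hom (fst F K) L"
      by (rule hom_cancel_left[OF FK m(1,2) h(1) rs(1) ri]) (use c t irt th in auto)
    note d = homD[OF rt] homD[OF fn_hom[OF F FK m(1) rt]] homD[OF adj_unit[OF a K(1)]]
    have "j = snd F (fst F K) M (i * (r * t)) * \<eta> K"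
      unfolding irt unfolding t_def by (rule adj_transpose2[OF F F a K(1) m(2) K(2), symmetric])
    also have "\<dots> = ?Fi * (snd F (fst F K) L (r * t) * \<eta> K)"
      using fn_mult[OF F FK m(1,2) rt h(1)] c d by (simp add: mat_mult_assoc)
    finally have j: "j = ?Fi * (snd F (fst F K) L (r * t) * \<eta> K)" .
    obtain u where u: "u \<in> carrier_vec (fst K)" "v = j *\<^sub>v u" using ker[OF v] by blast
    have "v = ?Fi *\<^sub>v ((snd F (fst F K) L (r * t) * \<eta> K) *\<^sub>v u)"
      using u(1) c d unfolding u(2) by (subst j) (simp add: mat_vec_assoc)
    thus "\<exists>u\<in>carrier_vec (fst (fst F L)). v = ?Fi *\<^sub>v u"
      using u(1) d by (intro bexI[of _ "(snd F (fst F K) L (r * t) * \<eta> K) *\<^sub>v u"]) (auto intro!: carrier_vecI)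
  qed
qed

lemma exact_fcomp: "exact F \<Longrightarrow> exact G \<Longrightarrow> exact (fcomp G F)"
  unfolding exact_def fst_fcomp snd_fcomp by blast

lemma exact_fid: "exact fid"
  unfolding exact_def by simp

text \<open>The linear splitting of the sequence under \<open>F\<close>, conjugated by
  \<open>\<iota>\<close> and \<open>\<pi>\<close>, splits the sequence under \<open>G\<close>:
  naturality moves both past the maps of the sequence, and \<open>\<pi> \<iota> = 1\<close> removes
  them.\<close>

lemma exact_summand:
  assumes F: "fn F" "fn G" and ex: "exact F" and n: "nt G F \<iota>" "nt F G \<pi>"
    and one: "\<And>M. md M \<Longrightarrow> \<pi> M * \<iota> M = 1\<^sub>m (fst (fst G M))"
  shows "exact G"
  unfolding exact_def
proof (intro allI impI)
  fix L i M p Q assume ses: "ses L i M p Q"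
  have m: "md L" "md M" "md Q" and h: "i \<in> hom L M" "p \<in> hom M Q" and pi: "p * i = 0\<^sub>m (fst Q) (fst L)"
    using ses by (auto simp: ses_def)
  obtain r s where rs: "r \<in> carrier_mat (fst (fst F L)) (fst (fst F M))" "s \<in> carrier_mat (fst (fst F M)) (fst (fst F Q))"
    and ri: "r * snd F L M i = 1\<^sub>m (fst (fst F L))" and ps: "snd F M Q p * s = 1\<^sub>m (fst (fst F Q))"
    and e: "snd F L M i * r + s * snd F M Q p = 1\<^sub>m (fst (fst F M))"
    by (rule sesE[OF exactD[OF ex ses]])
  note G = m[THEN fn_md[OF F(2)]]
  note hG = fn_hom[OF F(2) m(1,2) h(1)] fn_hom[OF F(2) m(2,3) h(2)]
  note hF = fn_hom[OF F(1) m(1,2) h(1)] fn_hom[OF F(1) m(2,3) h(2)]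
  note c = rs hG[THEN homD] hF[THEN homD] m[THEN nt_hom[OF n(1)], THEN homD] m[THEN nt_hom[OF n(2)], THEN homD]
  note nat = nt_nat[OF n(1) m(1,2) h(1)] nt_nat[OF n(1) m(2,3) h(2)] nt_nat[OF n(2) m(1,2) h(1)] nt_nat[OF n(2) m(2,3) h(2)]
  show "ses (fst G L) (snd G L M i) (fst G M) (snd G M Q p) (fst G Q)"
  proof (rule ses_intro[OF G hG, of "\<pi> L * (r * \<iota> M)" "\<pi> M * (s * \<iota> Q)"])
    show "snd G M Q p * snd G L M i = 0\<^sub>m (fst (fst G Q)) (fst (fst G L))"
      using fn_mult[OF F(2) m h] fn_zero[OF F(2) m(1,3)] pi by simp
    have "\<pi> L * (r * \<iota> M) * snd G L M i = \<pi> L * (r * (\<iota> M * snd G L M i))"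
      using c by (simp add: mat_mult_assoc)
    also have "\<dots> = \<pi> L * ((r * snd F L M i) * \<iota> L)"
      unfolding nat(1)[symmetric] using c by (simp add: mat_mult_assoc)
    finally show "\<pi> L * (r * \<iota> M) * snd G L M i = 1\<^sub>m (fst (fst G L))"
      using c one[OF m(1)] by (simp add: ri)
    have "snd G M Q p * (\<pi> M * (s * \<iota> Q)) = (snd G M Q p * \<pi> M) * (s * \<iota> Q)"
      using c by (simp add: mat_mult_assoc)
    also have "\<dots> = \<pi> Q * ((snd F M Q p * s) * \<iota> Q)"
      unfolding nat(4) using c by (simp add: mat_mult_assoc)
    finally show "snd G M Q p * (\<pi> M * (s * \<iota> Q)) = 1\<^sub>m (fst (fst G Q))"
      using c one[OF m(3)] by (simp add: ps)
    have "snd G L M i * (\<pi> L * (r * \<iota> M)) + (\<pi> M * (s * \<iota> Q)) * snd G M Q p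
       = (snd G L M i * \<pi> L) * (r * \<iota> M) + \<pi> M * (s * (\<iota> Q * snd G M Q p))"
      using c by (simp add: mat_mult_assoc)
    also have "\<dots> = \<pi> M * ((snd F L M i * r + s * snd F M Q p) * \<iota> M)"
      unfolding nat(3) nat(2)[symmetric] using c by (simp add: mat_mult_assoc mat_mult_add mat_add_mult)
    finally show "snd G L M i * (\<pi> L * (r * \<iota> M)) + (\<pi> M * (s * \<iota> Q)) * snd G M Q p = 1\<^sub>m (fst (fst G M))"
      using c one[OF m(2)] by (simp add: e)
  qed (use c in auto)
qed

lemma fn_dim_zero:
  assumes F: "fn F" and m: "md M" "fst M = 0" shows "fst (fst F M) = 0"
proof (rule ccontr)
  assume n: "fst (fst F M) \<noteq> 0"
  have "1\<^sub>m (fst M) = (0\<^sub>m (fst M) (fst M) :: 'k mat)" using m by (auto intro!: eq_matI)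
  hence "(1\<^sub>m (fst (fst F M)) :: 'k mat) = 0\<^sub>m (fst (fst F M)) (fst (fst F M))"
    using fn_one[OF F m(1)] fn_zero[OF F m(1,1)] by simp
  hence "(1\<^sub>m (fst (fst F M)) :: 'k mat) $$ (0, 0) = 0\<^sub>m (fst (fst F M)) (fst (fst F M)) $$ (0, 0)" by simp
  thus False using n by simp
qed

lemma inverse_hom:
  assumes m: "md M" "md N" and f: "f \<in> hom M N" and g: "g \<in> carrier_mat (fst M) (fst N)"
    "g * f = 1\<^sub>m (fst M)" "f * g = 1\<^sub>m (fst N)"
  shows "g \<in> hom N M"
  by (rule hom_cancel_left[OF m(2,1,2) f g(1,2,1)]) (use g hom_one[OF m(2)] in auto)

end

section \<open>Modules over a basic algebra\<close>

locale basic_kalg = kalg sm for sm :: "'k::field \<Rightarrow> 'a::ring_1 \<Rightarrow> 'a" +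
  assumes basic: "basic_algebra sm"
begin

lemma one_dim_lin:
  assumes m: "md K" "fst K = 1"
  obtains \<chi> where "is_char \<chi>" "K = lin \<chi>"
proof
  define \<chi> where "\<chi> a = snd K a $$ (0, 0)" for a
  have c: "snd K a \<in> carrier_mat 1 1" for a using md_carrier[OF m(1)] m(2) by simp
  have e: "snd K a = \<chi> a \<cdot>\<^sub>m 1\<^sub>m 1" for a
    using c[of a] by (auto simp: \<chi>_def intro!: eq_matI)
  show "K = lin \<chi>" using m(2) e by (auto simp: lin_def scal_def intro!: prod_eqI ext)
  show "is_char \<chi>"
    unfolding is_char_def \<chi>_def
    using c[THEN carrier_matD(1)] c[THEN carrier_matD(2)] by (auto simp: md_one[OF m(1)] md_mult[OF m(1)] md_add[OF m(1)] md_smult[OF m(1)] m(2) scalar_prod_def)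
qed

text \<open>A nonzero submodule of least dimension is simple, since a proper nonzero submodule of it
  would again embed into \<open>M\<close>. Over a basic algebra it is one-dimensional, that is,
  given by a character.\<close>

lemma ex_ses_lin:
  assumes M: "md M" "fst M > 0"
  obtains \<chi> i p Q where "is_char \<chi>" "ses (lin \<chi>) i M p Q"
proof -
  define P where "P d \<longleftrightarrow> (\<exists>K i r. md K \<and> fst K = d \<and> d > 0 \<and> i \<in> hom K M \<and>
    r \<in> carrier_mat d (fst M) \<and> r * i = 1\<^sub>m d)" for d
  have "P (fst M)" unfolding P_def
    using M hom_one[OF M(1)] by (intro exI[of _ M] exI[of _ "1\<^sub>m (fst M)"]) auto
  hence PL: "P (LEAST d. P d)" by (rule LeastI)
  define d where "d = (LEAST d. P d)"
  have "P d" unfolding d_def by fact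
  have least: "d \<le> d'" if "P d'" for d' unfolding d_def by (rule Least_le[of P, OF that])
  from \<open>P d\<close>[unfolded P_def] obtain K i r where K: "md K" "fst K = d" "d > 0" "i \<in> hom K M"
    "r \<in> carrier_mat d (fst M)" "r * i = 1\<^sub>m d" by (elim exE conjE) (rule that)
  have "simple_module K"
    unfolding simple_module_def
  proof (intro conjI allI impI)
    show "fst K > 0" using K by simp
    fix W assume W: "submodule K W"
    obtain L j Q p where s: "ses L j K p Q" and WW: "W = {j *\<^sub>v v | v. v \<in> carrier_vec (fst L)}"
      by (rule submodule_ses[OF K(1) W])
    obtain r' s' where L: "md L" "md Q" "j \<in> hom L K" "p \<in> hom K Q" and r': "r' \<in> carrier_mat (fst L) (fst K)"
       "r' * j = 1\<^sub>m (fst L)" "s' \<in> carrier_mat (fst K) (fst Q)" "j * r' + s' * p = 1\<^sub>m (fst K)"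
      by (rule sesE[OF s])
    note c = L(3,4)[THEN homD] r'(1,3) homD[OF K(4)] K(5)
    have dim: "fst K = fst L + fst Q" by (rule ses_dim[OF s])
    consider "fst L = 0" | "fst Q = 0" | "fst L > 0" "fst L < d" using dim K(2) by linarith
    thus "W = {0\<^sub>v (fst K)} \<or> W = carrier_vec (fst K)"
    proof cases
      case 1
      have "j *\<^sub>v v = 0\<^sub>v (fst K)" if "v \<in> carrier_vec (fst L)" for v
        using that c 1 by (intro eq_vecI) (auto simp: scalar_prod_def)
      moreover have "0\<^sub>v (fst K) \<in> W" using W by (simp add: submodule_def)
      ultimately have "W = {0\<^sub>v (fst K)}" unfolding WW by auto
      thus ?thesis ..
    next
      case 2
      have "s' * p = 0\<^sub>m (fst K) (fst K)" using c 2 by (intro eq_matI) (auto simp: scalar_prod_def)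
      hence jr: "j * r' = 1\<^sub>m (fst K)" using r'(4) c by (simp add: mat_add_zero)
      have "v \<in> W" if v: "v \<in> carrier_vec (fst K)" for v
      proof -
        have "v = (j * r') *\<^sub>v v" using v by (simp add: jr)
        also have "\<dots> = j *\<^sub>v (r' *\<^sub>v v)" using c v by (simp add: mat_vec_assoc)
        finally show ?thesis unfolding WW using mult_mat_vec_carrier[OF r'(1) v] by blast
      qed
      moreover have "W \<subseteq> carrier_vec (fst K)" using W by (simp add: submodule_def)
      ultimately show ?thesis by blast
    next
      case 3
      have 1: "i * j \<in> hom L M" by (rule hom_mult[OF L(1) K(1) M(1) L(3) K(4)])
      have "(r' * r) * (i * j) = r' * ((r * i) * j)" using c K(2) by (simp add: mat_mult_assoc)
      hence 2: "(r' * r) * (i * j) = 1\<^sub>m (fst L)" using c K(2) by (simp add: K(6) r'(2))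
      have "r' * r \<in> carrier_mat (fst L) (fst M)" using c K(2) by auto
      hence "P (fst L)" unfolding P_def using L(1) 3(1) 1 2 by blast
      thus ?thesis using least 3(2) by fastforce
    qed
  qed
  hence K1: "fst K = 1" using basic K(1) unfolding basic_algebra_def by blast
  obtain \<chi> where \<chi>: "is_char \<chi>" "K = lin \<chi>" by (rule one_dim_lin[OF K(1) K1])
  obtain Q p where "ses K i M p Q"
    by (rule injective_ses[OF K(1) M(1) K(4)]) (use K in auto)
  thus thesis using that \<chi> by simp
qed

text \<open>Induction along a composition series from the bottom: \<open>Q\<close> is obtained by
  dividing out a one-dimensional submodule and has smaller dimension.\<close>

lemma md_induct [consumes 1, case_names zero step]:
  assumes "md M" and zero: "\<And>M. md M \<Longrightarrow> fst M = 0 \<Longrightarrow> P M"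
    and step: "\<And>\<chi> i M p Q. is_char \<chi> \<Longrightarrow> ses (lin \<chi>) i M p Q \<Longrightarrow> P Q \<Longrightarrow> P M"
  shows "P M"
  using assms(1)
proof (induction "fst M" arbitrary: M rule: less_induct)
  case less
  show ?case
  proof (cases "fst M = 0")
    case False
    obtain \<chi> i p Q where s: "is_char \<chi>" "ses (lin \<chi>) i M p Q"
      using ex_ses_lin[OF less.prems] False by blast
    have "fst Q < fst M" "md Q" using ses_dim[OF s(2)] s(2) by (auto simp: ses_def)
    thus ?thesis using step[OF s] less.hyps by blast
  qed (use zero less.prems in blast)
qed

text \<open>A simple quotient of \<open>Q\<close> is also one of \<open>M\<close>; if
  \<open>Q\<close> is zero, then \<open>M\<close> is isomorphic to the simple submodule
  itself.\<close>

lemma ex_quotient_lin: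
  assumes "md M" "fst M > 0"
  obtains \<chi> q s where "is_char \<chi>" "q \<in> hom M (lin \<chi>)" "s \<in> carrier_mat (fst M) 1" "q * s = 1\<^sub>m 1"
proof -
  have "fst M > 0 \<longrightarrow> (\<exists>\<chi> q s. is_char \<chi> \<and> q \<in> hom M (lin \<chi>) \<and> s \<in> carrier_mat (fst M) 1 \<and> q * s = 1\<^sub>m 1)"
    using assms(1)
  proof (induction rule: md_induct)
    case (step \<chi> i M p Q)
    obtain r s where m: "md M" "md Q" and h: "i \<in> hom (lin \<chi>) M" "p \<in> hom M Q"
      and rs: "r \<in> carrier_mat 1 (fst M)" "s \<in> carrier_mat (fst M) (fst Q)"
      and ri: "r * i = 1\<^sub>m 1" and ps: "p * s = 1\<^sub>m (fst Q)" and e: "i * r + s * p = 1\<^sub>m (fst M)"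
      by (rule sesE[OF step(2)]) auto
    note c = h[THEN homD] rs
    show ?case
    proof (cases "fst Q = 0")
      case True
      have "s * p = 0\<^sub>m (fst M) (fst M)" using c True by (intro eq_matI) (auto simp: scalar_prod_def)
      hence ir: "i * r = 1\<^sub>m (fst M)" using e c by (simp add: mat_add_zero)
      have "r \<in> hom M (lin \<chi>)"
        by (rule inverse_hom[OF md_lin[OF step(1)] m(1) h(1)]) (use rs ri ir in auto)
      thus ?thesis using step(1) ri c by auto
    next
      case False
      then obtain \<psi> q t where q: "is_char \<psi>" "q \<in> hom Q (lin \<psi>)" "t \<in> carrier_mat (fst Q) 1" "q * t = 1\<^sub>m 1"
        using step(3) by blast
      have "q * p \<in> hom M (lin \<psi>)" by (rule hom_mult[OF m md_lin[OF q(1)] h(2) q(2)])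
      moreover have "(q * p) * (s * t) = q * ((p * s) * t)" using c homD[OF q(2)] q(3) by (simp add: mat_mult_assoc)
      ultimately show ?thesis using q ps c by (intro impI exI[of _ \<psi>] exI[of _ "q * p"] exI[of _ "s * t"]) auto
    qed
  qed auto
  thus thesis using that assms(2) by blast
qed

text \<open>Devissage along composition series: both functors being exact, the five lemma applies.\<close>

lemma nat_iso_of_simple:
  assumes F: "fn F" "fn G" and ex: "exact F" "exact G" and n: "nt F G \<eta>"
    and simple: "\<And>\<chi>. is_char \<chi> \<Longrightarrow> \<exists>\<theta>. \<theta> \<in> carrier_mat (fst (fst F (lin \<chi>))) (fst (fst G (lin \<chi>))) \<and>
      \<theta> * \<eta> (lin \<chi>) = 1\<^sub>m (fst (fst F (lin \<chi>))) \<and> \<eta> (lin \<chi>) * \<theta> = 1\<^sub>m (fst (fst G (lin \<chi>)))"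
  shows "nat_iso sm F G"
proof -
  have inv: "\<exists>\<theta>. \<theta> \<in> carrier_mat (fst (fst F M)) (fst (fst G M)) \<and>
      \<theta> * \<eta> M = 1\<^sub>m (fst (fst F M)) \<and> \<eta> M * \<theta> = 1\<^sub>m (fst (fst G M))" if "md M" for M
    using that
  proof (induction rule: md_induct)
    case (zero M)
    have d: "fst (fst F M) = 0" "fst (fst G M) = 0" using fn_dim_zero F zero by auto
    have "\<eta> M \<in> carrier_mat 0 0" using homD[OF nt_hom[OF n zero(1)]] d by simp
    thus ?case unfolding d by (intro exI[of _ "0\<^sub>m 0 0"]) (auto intro!: eq_matI)
  next
    case (step \<chi> i M p Q)
    let ?L = "lin \<chi>"
    have m: "md ?L" "md M" "md Q" and h: "i \<in> hom ?L M" "p \<in> hom M Q"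
      using step(2) by (auto simp: ses_def)
    note sF = exactD[OF ex(1) step(2)] and sG = exactD[OF ex(2) step(2)]
    let ?Fi = "snd F ?L M i" and ?Fp = "snd F M Q p" and ?Gi = "snd G ?L M i" and ?Gp = "snd G M Q p"
    obtain s where rs: "s \<in> carrier_mat (fst (fst F M)) (fst (fst F Q))"
      and psF: "?Fp * s = 1\<^sub>m (fst (fst F Q))"
      by (rule sesE[OF sF]) (rule that; assumption)
    obtain r' s' where rs': "r' \<in> carrier_mat (fst (fst G ?L)) (fst (fst G M))" "s' \<in> carrier_mat (fst (fst G M)) (fst (fst G Q))"
      and e: "?Gi * r' + s' * ?Gp = 1\<^sub>m (fst (fst G M))"
      by (rule sesE[OF sG]) (rule that; assumption)
    obtain t where t: "t \<in> carrier_mat (fst (fst F ?L)) (fst (fst G ?L))"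
      "t * \<eta> ?L = 1\<^sub>m (fst (fst F ?L))" "\<eta> ?L * t = 1\<^sub>m (fst (fst G ?L))"
      using simple[OF step(1)] by blast
    obtain u where u: "u \<in> carrier_mat (fst (fst F Q)) (fst (fst G Q))"
      "u * \<eta> Q = 1\<^sub>m (fst (fst F Q))" "\<eta> Q * u = 1\<^sub>m (fst (fst G Q))"
      using step(3) by blast
    note hh = fn_hom[OF F(1) m(1,2) h(1)] fn_hom[OF F(1) m(2,3) h(2)]
      fn_hom[OF F(2) m(1,2) h(1)] fn_hom[OF F(2) m(2,3) h(2)] m[THEN nt_hom[OF n]]
    note c = hh[THEN homD] rs rs' t(1) u(1)
    note nat = nt_nat[OF n m(1,2) h(1)] nt_nat[OF n m(2,3) h(2)]
    \<comment> \<open>Lifting through \<open>F Q\<close> by \<open>s\<close> gives a candidate that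
      inverts \<open>\<eta> M\<close> up to an error \<open>Y\<close>. The error is killed by
      \<open>G p\<close>, hence lies in the image of \<open>G i\<close>, where the inverse
      \<open>t\<close> at the simple submodule corrects it.\<close>
    define X where "X = \<eta> M * (s * (u * ?Gp))"
    define Y where "Y = 1\<^sub>m (fst (fst G M)) - X"
    have Xc: "X \<in> carrier_mat (fst (fst G M)) (fst (fst G M))" and Yc: "Y \<in> carrier_mat (fst (fst G M)) (fst (fst G M))"
      using c by (auto simp: X_def Y_def)
    have "?Gp * X = (?Gp * \<eta> M) * (s * (u * ?Gp))" using c by (simp add: X_def mat_mult_assoc)
    also have "\<dots> = \<eta> Q * ((?Fp * s) * (u * ?Gp))" unfolding nat using c by (simp add: mat_mult_assoc)
    also have "\<dots> = (\<eta> Q * u) * ?Gp" using c by (simp add: psF mat_mult_assoc)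
    also have "\<dots> = ?Gp" using c by (simp add: u(3))
    finally have GY: "?Gp * Y = 0\<^sub>m (fst (fst G Q)) (fst (fst G M))"
      using c Xc by (simp add: Y_def mat_mult_minus minus_r_inv_mat[of _ "fst (fst G Q)" "fst (fst G M)"])
    have "Y = (?Gi * r' + s' * ?Gp) * Y" using Yc by (simp add: e)
    also have "\<dots> = ?Gi * (r' * Y)" using c Yc GY by (simp add: mat_add_mult mat_mult_assoc mat_add_zero)
    finally have GiY: "?Gi * (r' * Y) = Y" ..
    define \<theta> where "\<theta> = s * (u * ?Gp) + ?Fi * (t * (r' * Y))"
    have \<theta>c: "\<theta> \<in> carrier_mat (fst (fst F M)) (fst (fst G M))" using c Yc by (auto simp: \<theta>_def)
    have "\<eta> M * \<theta> = X + (\<eta> M * ?Fi) * (t * (r' * Y))"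
      using c Yc by (simp add: \<theta>_def X_def mat_mult_add mat_mult_assoc)
    also have "(\<eta> M * ?Fi) * (t * (r' * Y)) = ?Gi * ((\<eta> ?L * t) * (r' * Y))"
      unfolding nat(1)[symmetric] using c Yc by (simp add: mat_mult_assoc)
    also have "\<dots> = Y" using c Yc by (simp add: t(3) GiY)
    also have "X + Y = 1\<^sub>m (fst (fst G M))" using Xc by (auto simp: Y_def intro!: eq_matI)
    finally have 1: "\<eta> M * \<theta> = 1\<^sub>m (fst (fst G M))" .
    \<comment> \<open>Equal dimensions at both ends make \<open>\<eta> M\<close> square, so the
      right inverse just found is two-sided.\<close>
    have "fst (fst F ?L) = fst (fst G ?L)" "fst (fst F Q) = fst (fst G Q)"
      using right_inverse_dim_le[OF t(1) _ t(2)] right_inverse_dim_le[OF _ t(1) t(3)]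
        right_inverse_dim_le[OF u(1) _ u(2)] right_inverse_dim_le[OF _ u(1) u(3)] c by (auto intro: antisym)
    hence d: "fst (fst F M) = fst (fst G M)" using ses_dim[OF sF] ses_dim[OF sG] by simp
    have "\<theta> * \<eta> M = 1\<^sub>m (fst (fst F M))"
      using mat_mult_left_right_inverse[of "\<eta> M" "fst (fst G M)" \<theta>] 1 \<theta>c c d by simp
    thus ?case using 1 \<theta>c by blast
  qed
  then obtain \<theta> where \<theta>: "\<And>M. md M \<Longrightarrow> \<theta> M \<in> carrier_mat (fst (fst F M)) (fst (fst G M)) \<and>
      \<theta> M * \<eta> M = 1\<^sub>m (fst (fst F M)) \<and> \<eta> M * \<theta> M = 1\<^sub>m (fst (fst G M))" by metis
  have "\<theta> M \<in> hom (fst G M) (fst F M)" if "md M" for M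
    by (rule inverse_hom[OF _ _ nt_hom[OF n that]]) (use \<theta>[OF that] fn_md F that in auto)
  thus ?thesis using \<theta> by (intro nat_isoI[OF n]) blast+
qed

end

subsection \<open>Generic choices over an infinite field\<close>

text \<open>Over a finite field, 1 plus the product of all linear factors \<open>x - a\<close> takes
  the value 1 everywhere and has no root.\<close>

lemma alg_closed_infinite:
  assumes "alg_closed TYPE('k::field)"
  shows "infinite (UNIV :: 'k set)"
proof
  assume fin: "finite (UNIV :: 'k set)"
  define q where "q = (\<Prod>a\<in>(UNIV :: 'k set). [:- a, 1:])"
  have "degree q = (\<Sum>a\<in>(UNIV :: 'k set). degree [:- a, 1:])"
    unfolding q_def by (rule degree_prod_eq_sum_degree) auto
  also have "\<dots> = card (UNIV :: 'k set)" by simp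
  finally have "degree q > 0" using fin by (simp add: card_gt_0_iff)
  hence "degree (1 + q) > 0" by (subst degree_add_eq_right) auto
  then obtain x where "poly (1 + q) x = 0" using assms unfolding alg_closed_def by blast
  moreover have "poly q x = 0"
    unfolding q_def poly_prod using fin by (intro prod_zero) auto
  ultimately show False by simp
qed

text \<open>When the point \<open>x\<close> is added, \<open>f\<close> is replaced by
  \<open>f + c g\<close> with \<open>g x \<noteq> 0\<close>. A point where \<open>g\<close> vanishes
  excludes no \<open>c\<close>, any other point excludes exactly one, and an infinite field leaves a
  choice.\<close>

lemma generic_nonvanishing:
  fixes S :: "('i \<Rightarrow> 'k::field) set"
  assumes inf: "infinite (UNIV :: 'k set)" and ne: "S \<noteq> {}"
    and comb: "\<And>f g c. f \<in> S \<Longrightarrow> g \<in> S \<Longrightarrow> (\<lambda>i. f i + c * g i) \<in> S"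
    and "finite J" and "\<And>j. j \<in> J \<Longrightarrow> \<exists>f\<in>S. f j \<noteq> 0"
  shows "\<exists>f\<in>S. \<forall>j\<in>J. f j \<noteq> 0"
  using assms(4,5)
proof (induction J)
  case (insert x J)
  obtain f where f: "f \<in> S" "\<forall>j\<in>J. f j \<noteq> 0" using insert by blast
  obtain g where g: "g \<in> S" "g x \<noteq> 0" using insert.prems by blast
  have "finite ((\<lambda>j. - f j / g j) ` insert x J)" using insert by simp
  then obtain c where c: "c \<notin> (\<lambda>j. - f j / g j) ` insert x J"
    using inf by (metis ex_new_if_finite)
  have nz: "f j + c * g j \<noteq> 0" if j: "j \<in> insert x J" for j
  proof (cases "g j = 0")
    case True
    thus ?thesis using j f(2) g(2) by auto
  next
    case False
    have "c \<noteq> - f j / g j" using c j by blast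
    moreover have "c = - f j / g j" if "f j + c * g j = 0"
    proof -
      have "c = (c * g j) / g j" using False by simp
      also have "c * g j = - f j" using that by (simp add: eq_neg_iff_add_eq_0 add.commute)
      finally show ?thesis .
    qed
    ultimately show ?thesis by blast
  qed
  show ?case by (rule bexI[OF _ comb[OF f(1) g(1), of c]]) (rule ballI, rule nz)
qed (use ne in auto)

text \<open>Lagrange interpolation: a further point \<open>y\<close> is handled by multiplying with
  the affine function of \<open>g\<close> that is 1 at \<open>x\<close> and 0 at \<open>y\<close>.
  It serves twice, for algebra elements as functions of the character and for central elements as
  functions of the simple module.\<close>

lemma separate_points:
  fixes S :: "('i \<Rightarrow> 'k::field) set"
  assumes one: "(\<lambda>_. 1) \<in> S"
    and aff: "\<And>f a b. f \<in> S \<Longrightarrow> (\<lambda>i. a * f i + b) \<in> S"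
    and mult: "\<And>f g. f \<in> S \<Longrightarrow> g \<in> S \<Longrightarrow> (\<lambda>i. f i * g i) \<in> S"
    and "finite J" and "\<And>j. j \<in> J \<Longrightarrow> \<exists>f\<in>S. f x \<noteq> f j"
  shows "\<exists>f\<in>S. f x = 1 \<and> (\<forall>j\<in>J. f j = 0)"
  using assms(4,5)
proof (induction J)
  case (insert y J)
  obtain f where f: "f \<in> S" "f x = 1" "\<forall>j\<in>J. f j = 0" using insert by blast
  obtain g where g: "g \<in> S" "g x \<noteq> g y" using insert.prems by blast
  let ?h = "\<lambda>i. f i * (inverse (g x - g y) * g i + (- g y * inverse (g x - g y)))"
  have hS: "?h \<in> S" by (intro mult f aff g)
  have "inverse (g x - g y) * g x + (- g y * inverse (g x - g y)) = (g x - g y) * inverse (g x - g y)"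
    by (simp add: algebra_simps)
  hence hx: "?h x = 1" using f g by simp
  have "\<forall>j\<in>insert y J. ?h j = 0" using f(3) by (simp add: algebra_simps)
  with hx show ?case by (intro bexI[OF _ hS] conjI)
qed (use one in auto)

lemma linear_map_matrix:
  fixes f :: "'k::field vec \<Rightarrow> 'k vec"
  assumes c: "\<And>v. v \<in> carrier_vec n \<Longrightarrow> f v \<in> carrier_vec m"
    and add: "\<And>v w. v \<in> carrier_vec n \<Longrightarrow> w \<in> carrier_vec n \<Longrightarrow> f (v + w) = f v + f w"
    and smult: "\<And>a v. v \<in> carrier_vec n \<Longrightarrow> f (a \<cdot>\<^sub>v v) = a \<cdot>\<^sub>v f v"
  obtains A where "A \<in> carrier_mat m n" "\<And>v. v \<in> carrier_vec n \<Longrightarrow> A *\<^sub>v v = f v"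
proof
  define A where "A = mat m n (\<lambda>(i, j). f (unit_vec n j) $ i)"
  show "A \<in> carrier_mat m n" by (simp add: A_def)
  fix v :: "'k vec" assume v: "v \<in> carrier_vec n"
  \<comment> \<open>The truncation of \<open>v\<close> to its first \<open>k\<close> coordinates, so
    that linearity is applied one coordinate at a time.\<close>
  define t where "t k = vec n (\<lambda>j. if j < k then v $ j else 0)" for k
  have tc: "t k \<in> carrier_vec n" for k by (simp add: t_def)
  have main: "f (t k) $ i = (\<Sum>j<k. v $ j * f (unit_vec n j) $ i)" if "k \<le> n" "i < m" for k i
    using that(1)
  proof (induction k)
    case 0
    have "t 0 = 0 \<cdot>\<^sub>v t 0" by (auto simp: t_def)
    hence "f (t 0) = 0 \<cdot>\<^sub>v f (t 0)" using smult[OF tc[of 0], of 0] by simp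
    hence "f (t 0) $ i = (0 \<cdot>\<^sub>v f (t 0)) $ i" by simp
    also have "\<dots> = 0" using that(2) c[OF tc[of 0]] by simp
    finally show ?case by simp
  next
    case (Suc k)
    have "t (Suc k) = t k + v $ k \<cdot>\<^sub>v unit_vec n k"
      using Suc.prems by (intro eq_vecI) (auto simp: t_def less_Suc_eq)
    hence "f (t (Suc k)) = f (t k) + v $ k \<cdot>\<^sub>v f (unit_vec n k)"
      using tc by (simp add: add smult)
    thus ?case using Suc that(2) c[OF tc[of k]] c[of "unit_vec n k"] by simp
  qed
  have tn: "t n = v" using v by (auto simp: t_def)
  show "A *\<^sub>v v = f v"
  proof (rule eq_vecI)
    fix i assume "i < dim_vec (f v)"
    hence i: "i < m" using c[OF v] by simp
    have "(A *\<^sub>v v) $ i = (\<Sum>j<n. f (unit_vec n j) $ i * v $ j)"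
      using i v by (simp add: A_def scalar_prod_def lessThan_atLeast0)
    thus "(A *\<^sub>v v) $ i = f v $ i" using main[of n i] i tn by (simp add: mult.commute)
  qed (use c[OF v] in \<open>simp add: A_def\<close>)
qed

section \<open>Characters of the algebra, and transformations that are nonzero on simple
  modules\<close>

locale basic_closed_kalg = basic_kalg sm for sm :: "'k::field \<Rightarrow> 'a::ring_1 \<Rightarrow> 'a" +
  assumes closed: "alg_closed TYPE('k)" and kalg: "k_algebra sm" and findim: "fin_dim_algebra sm"
begin

lemma inf_field: "infinite (UNIV :: 'k set)"
  by (rule alg_closed_infinite[OF closed])

lemma sm_simps:
  "sm c (x + y) = sm c x + sm c y" "sm (c + d) x = sm c x + sm d x" "sm (c * d) x = sm c (sm d x)"
  "sm 1 x = x" "sm c (x * y) = sm c x * y" "sm c (x * y) = x * sm c y"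
  using kalg unfolding k_algebra_def by blast+

lemma sm_zero: "sm c 0 = 0" "sm 0 x = 0"
  using sm_simps(1)[of c 0 0] sm_simps(2)[of 0 0 x] by auto

lemma sm_sum: "sm c (\<Sum>i\<in>I. f i) = (\<Sum>i\<in>I. sm c (f i))"
  by (induction I rule: infinite_finite_induct) (auto simp: sm_zero sm_simps(1))

lemma spanning:
  obtains b :: "nat \<Rightarrow> 'a" and n :: nat where "\<forall>x. \<exists>c. x = (\<Sum>i<n. sm (c i) (b i))"
proof -
  obtain bs :: "'a list" where bs: "\<And>x. \<exists>cs :: 'k list. length cs = length bs \<and> x = sum_list (map2 sm cs bs)"
    using findim unfolding fin_dim_algebra_def by blast
  have "\<exists>c. x = (\<Sum>i<length bs. sm (c i) (bs ! i))" for x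
  proof -
    obtain cs where cs: "length cs = length bs" "x = sum_list (map2 sm cs bs)" using bs by blast
    have "x = (\<Sum>i<length bs. sm (cs ! i) (bs ! i))"
      unfolding cs(2) using cs(1) by (simp add: sum_list_sum_nth lessThan_atLeast0)
    thus ?thesis by blast
  qed
  thus thesis by (intro that allI)
qed

lemma char_sum:
  fixes n :: nat
  assumes "is_char \<chi>" shows "\<chi> (\<Sum>i<n. sm (c i) (b i)) = (\<Sum>i<n. c i * \<chi> (b i))"
proof (induction n)
  case 0
  have "\<chi> (0 + 0) = \<chi> 0 + \<chi> 0" using assms unfolding is_char_def by blast
  hence "\<chi> 0 + 0 = \<chi> 0 + \<chi> 0" by (simp only: add_0_right)
  hence "0 = \<chi> 0" by (simp only: add_left_cancel)
  thus ?case by simp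
next
  case (Suc n)
  thus ?case using assms by (simp add: is_char_def)
qed

text \<open>Distinct characters are linearly independent, so there are at most \<open>n\<close> of
  them if \<open>n\<close> elements span the algebra. Given \<open>n + 1\<close> characters,
  interpolation yields elements dual to them; expanding these in the spanning elements factors the
  identity matrix of size \<open>n + 1\<close> through an n-dimensional space.\<close>

lemma finite_chars: "finite {\<chi>. is_char \<chi>}"
proof (rule ccontr)
  assume inf: "infinite {\<chi>. is_char \<chi>}"
  obtain b :: "nat \<Rightarrow> 'a" and n where b: "\<forall>x. \<exists>c. x = (\<Sum>i<n. sm (c i) (b i))" by (rule spanning)
  obtain C where C: "C \<subseteq> {\<chi>. is_char \<chi>}" "finite C" "card C = Suc n"
    using infinite_arbitrarily_large[OF inf, of "Suc n"] by blast
  obtain e where e: "bij_betw e {..<Suc n} C"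
    using ex_bij_betw_nat_finite[OF C(2)] C(3) by (auto simp: lessThan_atLeast0)
  have echar: "is_char (e l)" if "l < Suc n" for l
    using e C(1) that by (auto simp: bij_betw_def)
  \<comment> \<open>Values are prescribed at characters only: the closure properties required for
    interpolation come from multiplicativity and linearity of the characters.\<close>
  define S where "S = {f. \<exists>a. \<forall>\<psi>. is_char \<psi> \<longrightarrow> f \<psi> = \<psi> a}"
  have sep: "\<exists>u. e i u = 1 \<and> (\<forall>l<Suc n. l \<noteq> i \<longrightarrow> e l u = 0)" if i: "i < Suc n" for i
  proof -
    have "\<exists>f\<in>S. f (e i) = 1 \<and> (\<forall>\<psi>\<in>C - {e i}. f \<psi> = 0)"
    proof (rule separate_points)
      show "(\<lambda>_. 1) \<in> S" unfolding S_def by (auto simp: is_char_def)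
      show "(\<lambda>i. a * f i + c) \<in> S" if f: "f \<in> S" for f a c
      proof -
        obtain x where x: "\<forall>\<psi>. is_char \<psi> \<longrightarrow> f \<psi> = \<psi> x" using f S_def by blast
        have "\<psi> (sm a x + sm c 1) = a * f \<psi> + c" if "is_char \<psi>" for \<psi>
          using that x by (simp add: is_char_def)
        thus ?thesis unfolding S_def by (auto intro!: exI[of _ "sm a x + sm c 1"])
      qed
      show "(\<lambda>i. f i * g i) \<in> S" if fg: "f \<in> S" "g \<in> S" for f g
      proof -
        obtain x where x: "\<forall>\<psi>. is_char \<psi> \<longrightarrow> f \<psi> = \<psi> x" using fg S_def by blast
        obtain y where y: "\<forall>\<psi>. is_char \<psi> \<longrightarrow> g \<psi> = \<psi> y" using fg S_def by blast
        have "\<psi> (x * y) = f \<psi> * g \<psi>" if "is_char \<psi>" for \<psi>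
          using that x y by (simp add: is_char_def)
        thus ?thesis unfolding S_def by (auto intro!: exI[of _ "x * y"])
      qed
      show "finite (C - {e i})" using C by simp
      show "\<exists>f\<in>S. f (e i) \<noteq> f \<psi>" if "\<psi> \<in> C - {e i}" for \<psi>
      proof -
        have "e i \<noteq> \<psi>" using that by blast
        then obtain a where "e i a \<noteq> \<psi> a" by blast
        thus ?thesis unfolding S_def by (intro bexI[of _ "\<lambda>\<psi>. \<psi> a"]) auto
      qed
    qed
    then obtain f where f: "f \<in> S" "f (e i) = 1" "\<forall>\<psi>\<in>C - {e i}. f \<psi> = 0" by blast
    then obtain a where a: "\<And>\<psi>. is_char \<psi> \<Longrightarrow> f \<psi> = \<psi> a" unfolding S_def by blast
    have "e l a = 0" if l: "l < Suc n" "l \<noteq> i" for l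
    proof -
      have "e l \<in> C - {e i}" using e l i by (auto simp: bij_betw_def inj_on_def)
      thus ?thesis using f(3) a[OF echar[OF l(1)]] by auto
    qed
    moreover have "e i a = 1" using f(2) a[OF echar[OF i]] by simp
    ultimately show ?thesis by blast
  qed
  then obtain u where u: "\<And>i. i < Suc n \<Longrightarrow> e i (u i) = 1" "\<And>i l. i < Suc n \<Longrightarrow> l < Suc n \<Longrightarrow> l \<noteq> i \<Longrightarrow> e l (u i) = 0"
    by metis
  from b obtain c where c: "\<And>x. x = (\<Sum>i<n. sm (c x i) (b i))" by metis
  define A where "A = mat (Suc n) n (\<lambda>(i, j). c (u i) j)"
  define B where "B = mat n (Suc n) (\<lambda>(j, l). e l (b j))"
  have "A * B = 1\<^sub>m (Suc n)"
  proof (rule eq_matI)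
    fix i l assume "i < dim_row (1\<^sub>m (Suc n) :: 'k mat)" "l < dim_col (1\<^sub>m (Suc n) :: 'k mat)"
    hence il: "i < Suc n" "l < Suc n" by auto
    have "(A * B) $$ (i, l) = (\<Sum>j<n. c (u i) j * e l (b j))"
      using il by (simp add: A_def B_def scalar_prod_def lessThan_atLeast0)
    also have "\<dots> = e l (u i)" using char_sum[OF echar[OF il(2)], of "c (u i)" b n] c[of "u i"] by simp
    finally show "(A * B) $$ (i, l) = 1\<^sub>m (Suc n) $$ (i, l)" using u il by auto
  qed (auto simp: A_def B_def)
  hence "Suc n \<le> n" by (intro right_inverse_dim_le[of A _ _ B]) (auto simp: A_def B_def)
  thus False by simp
qed

text \<open>The regular module, in coordinates with respect to a basis of the algebra.\<close>

lemma ex_nonzero_module: "\<exists>M. md M \<and> fst M > 0"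
proof -
  obtain b :: "nat \<Rightarrow> 'a" and n where b: "\<forall>x. \<exists>c. x = (\<Sum>i<n. sm (c i) (b i))" by (rule spanning)
  \<comment> \<open>The elements \<open>b i\<close> span the algebra but may satisfy relations.
    \<open>T\<close> turns coordinates into elements; its kernel \<open>W\<close> is split off, and
    the complement given by \<open>S\<close> and \<open>P\<close> provides coordinates
    \<open>c\<close> inverse to \<open>t\<close>.\<close>
  define T where "T v = (\<Sum>i<n. sm (v $ i) (b i))" for v :: "'k vec"
  have Tadd: "T (v + w) = T v + T w" if "v \<in> carrier_vec n" "w \<in> carrier_vec n" for v w
    unfolding T_def sum.distrib[symmetric] using that by (intro sum.cong) (auto simp: sm_simps(2))
  have Tsm: "T (c \<cdot>\<^sub>v v) = sm c (T v)" if "v \<in> carrier_vec n" for c v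
    unfolding T_def sm_sum using that by (intro sum.cong) (auto simp: sm_simps(3))
  have T0: "T (0\<^sub>v n) = 0" unfolding T_def by (simp add: sm_zero)
  have Tsurj: "\<exists>v\<in>carrier_vec n. T v = x" for x
  proof -
    obtain c where "x = (\<Sum>i<n. sm (c i) (b i))" using b by blast
    thus ?thesis by (intro bexI[of _ "vec n c"]) (auto simp: T_def)
  qed
  define W where "W = {v \<in> carrier_vec n. T v = 0}"
  obtain d X R where X: "X \<in> carrier_mat n d" and R: "R \<in> carrier_mat d n" and RX: "R * X = 1\<^sub>m d"
    and W: "W = {X *\<^sub>v v | v. v \<in> carrier_vec d}"
    by (rule subspace_basis[of W n]) (auto simp: W_def T0 Tadd Tsm sm_zero)
  obtain e S P where S: "S \<in> carrier_mat n e" and P: "P \<in> carrier_mat e n" and PS: "P * S = 1\<^sub>m e"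
    and one: "X * R + S * P = 1\<^sub>m n" and PX: "P * X = 0\<^sub>m e d"
    by (rule complement_split[OF X R RX])
  define t where "t w = T (S *\<^sub>v w)" for w
  have Sw: "S *\<^sub>v w \<in> carrier_vec n" if "w \<in> carrier_vec e" for w using S that by auto
  have Pv: "P *\<^sub>v v \<in> carrier_vec e" if "v \<in> carrier_vec n" for v using P that by auto
  have PW: "P *\<^sub>v v = 0\<^sub>v e" if vW: "v \<in> W" for v
  proof -
    obtain u where u: "u \<in> carrier_vec d" "v = X *\<^sub>v u" using vW W by blast
    hence "P *\<^sub>v v = (P * X) *\<^sub>v u" using P X by (simp add: mat_vec_assoc)
    thus ?thesis using PX u by (auto intro!: eq_vecI)
  qed
  have PT: "P *\<^sub>v v = P *\<^sub>v w" if vw: "v \<in> carrier_vec n" "w \<in> carrier_vec n" "T v = T w" for v w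
  proof -
    have "T (v + (- 1) \<cdot>\<^sub>v w) = T v + sm (- 1) (T w)" using vw by (simp add: Tadd Tsm)
    also have "\<dots> = sm (1 + (- 1)) (T w)" using vw(3) by (simp only: sm_simps(2,4))
    finally have "v + (- 1) \<cdot>\<^sub>v w \<in> W" using vw by (simp add: W_def sm_zero)
    hence "P *\<^sub>v (v + (- 1) \<cdot>\<^sub>v w) = 0\<^sub>v e" by (rule PW)
    hence 0: "P *\<^sub>v v + (- 1) \<cdot>\<^sub>v (P *\<^sub>v w) = 0\<^sub>v e"
      using P vw by (simp add: mult_add_distrib_mat_vec[of P e n] mult_mat_vec[of P e n])
    show ?thesis
    proof (rule eq_vecI)
      fix i assume "i < dim_vec (P *\<^sub>v w)"
      hence i: "i < e" using P by simp
      have "(P *\<^sub>v v + (- 1) \<cdot>\<^sub>v (P *\<^sub>v w)) $ i = 0" unfolding 0 using i by simp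
      thus "(P *\<^sub>v v) $ i = (P *\<^sub>v w) $ i" using i P by simp
    qed (use P in auto)
  qed
  from Tsurj obtain l where l: "\<And>x. l x \<in> carrier_vec n" "\<And>x. T (l x) = x" by metis
  define c where "c x = P *\<^sub>v l x" for x
  have cc: "c x \<in> carrier_vec e" for x unfolding c_def by (rule Pv[OF l(1)])
  have cT: "c (T v) = P *\<^sub>v v" if "v \<in> carrier_vec n" for v
    unfolding c_def by (rule PT[OF l(1) that l(2)])
  have ct: "c (t w) = w" if w: "w \<in> carrier_vec e" for w
  proof -
    have "c (t w) = (P * S) *\<^sub>v w" unfolding t_def cT[OF Sw[OF w]] using P S w by (simp add: mat_vec_assoc)
    thus ?thesis using w by (simp add: PS)
  qed
  have cadd: "c (x + y) = c x + c y" for x y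
  proof -
    have "c (T (l x + l y)) = P *\<^sub>v (l x + l y)" by (rule cT) (use l in auto)
    also have "\<dots> = c x + c y"
      unfolding c_def by (rule mult_add_distrib_mat_vec[OF P l(1) l(1)])
    finally have "c (T (l x + l y)) = c x + c y" .
    thus ?thesis using l by (simp add: Tadd)
  qed
  have csm: "c (sm a x) = a \<cdot>\<^sub>v c x" for a x
  proof -
    have "c (T (a \<cdot>\<^sub>v l x)) = P *\<^sub>v (a \<cdot>\<^sub>v l x)" by (rule cT) (use l in auto)
    also have "\<dots> = a \<cdot>\<^sub>v c x"
      unfolding c_def by (rule mult_mat_vec[OF P l(1)])
    finally have "c (T (a \<cdot>\<^sub>v l x)) = a \<cdot>\<^sub>v c x" .
    thus ?thesis using l by (simp add: Tsm)
  qed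
  have tadd: "t (v + w) = t v + t w" if "v \<in> carrier_vec e" "w \<in> carrier_vec e" for v w
    using that S Sw by (simp add: t_def mult_add_distrib_mat_vec[of S n e] Tadd)
  have tsm: "t (a \<cdot>\<^sub>v v) = sm a (t v)" if "v \<in> carrier_vec e" for a v
    using that S Sw by (simp add: t_def mult_mat_vec[of S n e] Tsm)
  have tc: "t (c x) = x" for x
  proof -
    have "l x = (X * R + S * P) *\<^sub>v l x" unfolding one using l(1)[of x] by simp
    also have "\<dots> = X *\<^sub>v (R *\<^sub>v l x) + S *\<^sub>v c x"
      using X R S P l(1)[of x] by (subst add_mult_distrib_mat_vec[of _ n n]) (auto simp: mat_vec_assoc c_def)
    finally have "x = T (X *\<^sub>v (R *\<^sub>v l x) + S *\<^sub>v c x)" using l(2)[of x] by simp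
    also have "\<dots> = T (X *\<^sub>v (R *\<^sub>v l x)) + t (c x)"
      unfolding t_def using X R l(1)[of x] Sw[OF cc] by (intro Tadd) auto
    also have "X *\<^sub>v (R *\<^sub>v l x) \<in> W" unfolding W using mult_mat_vec_carrier[OF R l(1)] by blast
    hence "T (X *\<^sub>v (R *\<^sub>v l x)) = 0" by (simp add: W_def)
    finally show ?thesis by simp
  qed
  have "\<exists>A. A \<in> carrier_mat e e \<and> (\<forall>w\<in>carrier_vec e. A *\<^sub>v w = c (a * t w))" for a
  proof -
    obtain A where A: "A \<in> carrier_mat e e" "\<And>v. v \<in> carrier_vec e \<Longrightarrow> A *\<^sub>v v = c (a * t v)"
    proof (rule linear_map_matrix[of e "\<lambda>w. c (a * t w)" e])
      fix v w :: "'k vec" assume "v \<in> carrier_vec e" "w \<in> carrier_vec e"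
      thus "c (a * t (v + w)) = c (a * t v) + c (a * t w)" by (simp add: tadd cadd distrib_left)
    next
      fix x :: 'k and v :: "'k vec" assume "v \<in> carrier_vec e"
      thus "c (a * t (x \<cdot>\<^sub>v v)) = x \<cdot>\<^sub>v c (a * t v)" by (simp add: tsm csm sm_simps(6)[symmetric])
    qed (use cc in auto)
    thus ?thesis by blast
  qed
  then obtain \<rho> where \<rho>c: "\<And>a. \<rho> a \<in> carrier_mat e e"
    and \<rho>: "\<And>a w. w \<in> carrier_vec e \<Longrightarrow> \<rho> a *\<^sub>v w = c (a * t w)" by metis
  have "md (e, \<rho>)"
    unfolding is_module_def fst_conv snd_conv
  proof (intro conjI allI \<rho>c)
    show "\<rho> 1 = 1\<^sub>m e"
      by (rule mat_eq_of_vec[OF \<rho>c one_carrier_mat]) (simp add: \<rho> ct)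
    fix a a'
    show "\<rho> (a * a') = \<rho> a * \<rho> a'"
    proof (rule mat_eq_of_vec[OF \<rho>c mult_carrier_mat[OF \<rho>c \<rho>c]])
      fix v :: "'k vec" assume v: "v \<in> carrier_vec e"
      have "(\<rho> a * \<rho> a') *\<^sub>v v = \<rho> a *\<^sub>v (\<rho> a' *\<^sub>v v)"
        using \<rho>c[of a] \<rho>c[of a'] v by (simp add: mat_vec_assoc)
      thus "\<rho> (a * a') *\<^sub>v v = (\<rho> a * \<rho> a') *\<^sub>v v" using v by (simp add: \<rho> cc tc mult.assoc)
    qed
    show "\<rho> (a + a') = \<rho> a + \<rho> a'"
    proof (rule mat_eq_of_vec[OF \<rho>c add_carrier_mat[OF \<rho>c]])
      fix v :: "'k vec" assume v: "v \<in> carrier_vec e"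
      show "\<rho> (a + a') *\<^sub>v v = (\<rho> a + \<rho> a') *\<^sub>v v"
        using v add_mult_distrib_mat_vec[OF \<rho>c \<rho>c v] by (simp add: \<rho> distrib_right cadd)
    qed
    fix x
    show "\<rho> (sm x a) = x \<cdot>\<^sub>m \<rho> a"
    proof (rule mat_eq_of_vec[OF \<rho>c])
      fix v :: "'k vec" assume v: "v \<in> carrier_vec e"
      have "(x \<cdot>\<^sub>m \<rho> a) *\<^sub>v v = x \<cdot>\<^sub>v (\<rho> a *\<^sub>v v)" using \<rho>c[of a] v by (auto intro!: eq_vecI)
      thus "\<rho> (sm x a) *\<^sub>v v = (x \<cdot>\<^sub>m \<rho> a) *\<^sub>v v" using v by (simp add: \<rho> csm sm_simps(5)[symmetric])
    qed (use \<rho>c in simp)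
  qed
  \<comment> \<open>The module is nonzero because \<open>1 \<noteq> 0\<close> in the algebra: with
    no coordinates, \<open>c\<close> could not distinguish the two.\<close>
  moreover have "e > 0"
  proof (rule ccontr)
    assume "\<not> e > 0"
    hence "c 1 = c 0" using cc[of 1] cc[of 0] by (intro eq_vecI) auto
    hence "t (c 1) = t (c 0)" by simp
    thus False unfolding tc by simp
  qed
  ultimately show ?thesis by (intro exI[of _ "(e, \<rho>)"]) auto
qed

lemma ex_char: "\<exists>\<chi>. is_char \<chi>"
  using ex_nonzero_module ex_ses_lin by blast

lemma nat_iso_of_nonzero:
  assumes F: "fn F" "fn G" and ex: "exact F" "exact G"
    and dim: "\<And>\<chi>. is_char \<chi> \<Longrightarrow> fst (fst F (lin \<chi>)) = 1 \<and> fst (fst G (lin \<chi>)) = 1"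
    and nz: "\<And>\<chi>. is_char \<chi> \<Longrightarrow> \<exists>\<eta>. nt F G \<eta> \<and> \<eta> (lin \<chi>) $$ (0, 0) \<noteq> 0"
  shows "nat_iso sm F G"
proof -
  \<comment> \<open>The value at a one-dimensional module is a scalar, so each transformation
    becomes a function of the character. The default 0 off the characters keeps this form under
    linear combinations.\<close>
  define S where "S = {\<lambda>\<chi>. if is_char \<chi> then \<eta> (lin \<chi>) $$ (0, 0) else 0 | \<eta>. nt F G \<eta>}"
  have "\<exists>f\<in>S. \<forall>\<chi>\<in>{\<chi>. is_char \<chi>}. f \<chi> \<noteq> 0"
  proof (rule generic_nonvanishing[OF inf_field _ _ finite_chars])
    show "S \<noteq> {}" unfolding S_def using nt_zero[OF F] by blast
    show "(\<lambda>\<chi>. f \<chi> + c * g \<chi>) \<in> S" if fg: "f \<in> S" "g \<in> S" for f g c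
    proof -
      obtain \<eta> \<theta> where e: "f = (\<lambda>\<chi>. if is_char \<chi> then \<eta> (lin \<chi>) $$ (0, 0) else 0)" "nt F G \<eta>"
        "g = (\<lambda>\<chi>. if is_char \<chi> then \<theta> (lin \<chi>) $$ (0, 0) else 0)" "nt F G \<theta>"
        using fg unfolding S_def by blast
      have n: "nt F G (\<lambda>M. \<eta> M + c \<cdot>\<^sub>m \<theta> M)" by (intro nt_add nt_smult F e)
      have "(\<lambda>\<chi>. f \<chi> + c * g \<chi>) = (\<lambda>\<chi>. if is_char \<chi> then (\<eta> (lin \<chi>) + c \<cdot>\<^sub>m \<theta> (lin \<chi>)) $$ (0, 0) else 0)"
      proof
        fix \<chi>
        show "f \<chi> + c * g \<chi> = (if is_char \<chi> then (\<eta> (lin \<chi>) + c \<cdot>\<^sub>m \<theta> (lin \<chi>)) $$ (0, 0) else 0)"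
        proof (cases "is_char \<chi>")
          case True
          have "\<theta> (lin \<chi>) \<in> carrier_mat 1 1"
            using homD[OF nt_hom[OF e(4) md_lin[OF True]]] dim[OF True] by simp
          thus ?thesis using True by (simp add: e)
        qed (simp add: e)
      qed
      thus ?thesis unfolding S_def using n
        by (intro CollectI exI[of _ "\<lambda>M. \<eta> M + c \<cdot>\<^sub>m \<theta> M"]) (rule conjI)
    qed
    show "\<exists>f\<in>S. f \<chi> \<noteq> 0" if "\<chi> \<in> {\<chi>. is_char \<chi>}" for \<chi>
    proof -
      have \<chi>: "is_char \<chi>" using that by simp
      obtain \<eta> where \<eta>: "nt F G \<eta>" "\<eta> (lin \<chi>) $$ (0, 0) \<noteq> 0" using nz[OF \<chi>] by blast
      have "(\<lambda>\<chi>. if is_char \<chi> then \<eta> (lin \<chi>) $$ (0, 0) else 0) \<in> S" unfolding S_def using \<eta>(1) by blast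
      thus ?thesis using \<eta>(2) \<chi> by (intro bexI) auto
    qed
  qed
  then obtain f where f: "f \<in> S" "\<And>\<chi>. is_char \<chi> \<Longrightarrow> f \<chi> \<noteq> 0" by auto
  then obtain \<eta> where \<eta>0: "nt F G \<eta>" "f = (\<lambda>\<chi>. if is_char \<chi> then \<eta> (lin \<chi>) $$ (0, 0) else 0)"
    unfolding S_def by blast
  have \<eta>: "nt F G \<eta>" "\<And>\<chi>. is_char \<chi> \<Longrightarrow> \<eta> (lin \<chi>) $$ (0, 0) \<noteq> 0"
    using \<eta>0 f(2) by auto
  show ?thesis
  proof (rule nat_iso_of_simple[OF F ex \<eta>(1)])
    fix \<chi> assume \<chi>: "is_char \<chi>"
    let ?e = "\<eta> (lin \<chi>)"
    have c: "?e \<in> carrier_mat 1 1" using homD[OF nt_hom[OF \<eta>(1) md_lin[OF \<chi>]]] dim[OF \<chi>] by simp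
    let ?t = "mat 1 1 (\<lambda>_. inverse (?e $$ (0, 0)))"
    have "?t * ?e = 1\<^sub>m 1" "?e * ?t = 1\<^sub>m 1"
      using c \<eta>(2)[OF \<chi>] by (auto intro!: eq_matI simp: scalar_prod_def)
    thus "\<exists>\<theta>. \<theta> \<in> carrier_mat (fst (fst F (lin \<chi>))) (fst (fst G (lin \<chi>))) \<and>
      \<theta> * ?e = 1\<^sub>m (fst (fst F (lin \<chi>))) \<and> ?e * \<theta> = 1\<^sub>m (fst (fst G (lin \<chi>)))"
      using dim[OF \<chi>] by (intro exI[of _ ?t]) auto
  qed
qed

end

subsection \<open>Direct sums, summands and adjoints\<close>

context kalg
begin

lemma bip_joint_mono:
  assumes b: "bip m X Y \<iota> \<pi>" and g: "g \<in> carrier_mat (fst Y) c"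
    and z: "\<And>i. i < m \<Longrightarrow> \<pi> i * g = 0\<^sub>m (fst X) c"
  shows "g = 0\<^sub>m (fst Y) c"
proof -
  have "g = msum (fst Y) (fst Y) (\<lambda>i. \<iota> i * \<pi> i) m * g" using g by (simp add: bip_sum[OF b])
  also have "\<dots> = msum (fst Y) c (\<lambda>i. (\<iota> i * \<pi> i) * g) m"
    using g bip_carrier[OF b] by (intro msum_mult) (auto intro!: mult_carrier_mat)
  also have "\<dots> = msum (fst Y) c (\<lambda>i. 0\<^sub>m (fst Y) c) m"
    using g by (intro msum_cong) (simp add: mat_mult_assoc bip_dims[OF b] z)
  finally show ?thesis by (simp add: msum_zero)
qed

lemma bip_joint_epi:
  assumes b: "bip m X Y \<iota> \<pi>" and g: "g \<in> carrier_mat r (fst Y)"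
    and z: "\<And>i. i < m \<Longrightarrow> g * \<iota> i = 0\<^sub>m r (fst X)"
  shows "g = 0\<^sub>m r (fst Y)"
proof -
  have "g = g * msum (fst Y) (fst Y) (\<lambda>i. \<iota> i * \<pi> i) m" using g by (simp add: bip_sum[OF b])
  also have "\<dots> = msum r (fst Y) (\<lambda>i. g * (\<iota> i * \<pi> i)) m"
    using g bip_carrier[OF b] by (intro mult_msum) (auto intro!: mult_carrier_mat)
  also have "\<dots> = msum r (fst Y) (\<lambda>i. 0\<^sub>m r (fst Y)) m"
    using g by (intro msum_cong) (simp add: mat_mult_assoc[symmetric] bip_dims[OF b] z)
  finally show ?thesis by (simp add: msum_zero)
qed

text \<open>Unit and counit are assembled diagonally: the summand of \<open>\<eta>'\<close> with
  index \<open>i\<close> is \<open>\<eta>\<close> followed by \<open>\<iota> i\<close> in both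
  factors, that of \<open>\<epsilon>'\<close> is \<open>\<epsilon>\<close> preceded by
  \<open>\<pi> i\<close> in both factors. Mixed terms vanish by orthogonality, and both triangles
  reduce to the sum of all \<open>\<iota> i * \<pi> i\<close> being 1.\<close>

lemma adj_copies:
  assumes F: "fn F" and G: "fn G" and a: "adj F F \<eta> \<epsilon>" and c: "copies m F G"
  shows "\<exists>\<eta> \<epsilon>. adj G G \<eta> \<epsilon>"
proof -
  obtain \<iota> \<pi> where \<iota>: "\<And>i. i < m \<Longrightarrow> nt F G (\<iota> i)" and \<pi>: "\<And>i. i < m \<Longrightarrow> nt G F (\<pi> i)"
    and b: "\<And>M. md M \<Longrightarrow> bip m (fst F M) (fst G M) (\<lambda>i. \<iota> i M) (\<lambda>i. \<pi> i M)"
    using copiesE[OF c] by blast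
  note FF = fn_fcomp[OF F F] and FG = fn_fcomp[OF G F] and GG = fn_fcomp[OF G G]
  have a\<eta>: "nt fid (fcomp F F) \<eta>" and a\<epsilon>: "nt (fcomp F F) fid \<epsilon>" using a by (auto simp: adj_def)
  define \<alpha> where "\<alpha> i M = snd F (fst F M) (fst G M) (\<iota> i M) * \<eta> M" for i M
  define \<beta> where "\<beta> i M = \<epsilon> M * snd F (fst G M) (fst F M) (\<pi> i M)" for i M
  have \<alpha>: "nt fid (fcomp F G) (\<alpha> i)" if "i < m" for i
    unfolding \<alpha>_def by (rule nt_comp[OF fn_fid FF FG a\<eta> nt_whisker_left[OF F F G \<iota>[OF that]], simplified]) 
  have \<beta>: "nt (fcomp F G) fid (\<beta> i)" if "i < m" for i
    unfolding \<beta>_def by (rule nt_comp[OF FG FF fn_fid nt_whisker_left[OF F G F \<pi>[OF that]] a\<epsilon>, simplified])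
  define \<eta>' where "\<eta>' M = msum (fst (fst G (fst G M))) (fst M) (\<lambda>i. \<iota> i (fst G M) * \<alpha> i M) m" for M
  define \<epsilon>' where "\<epsilon>' N = msum (fst N) (fst (fst G (fst G N))) (\<lambda>i. \<beta> i N * \<pi> i (fst G N)) m" for N
  have n\<eta>: "nt fid (fcomp G G) \<eta>'"
    unfolding \<eta>'_def
    using nt_msum[OF fn_fid GG nt_comp[OF fn_fid FG GG \<alpha> nt_whisker_right[OF G \<iota>]]] by simp
  have n\<epsilon>: "nt (fcomp G G) fid \<epsilon>'"
    unfolding \<epsilon>'_def
    using nt_msum[OF GG fn_fid nt_comp[OF GG FG fn_fid nt_whisker_right[OF G \<pi>] \<beta>]] by simp
  have "adj G G \<eta>' \<epsilon>'"
    unfolding adj_def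
  proof (intro conjI allI impI n\<eta> n\<epsilon>)
    fix M assume M: "md M"
    note FM = fn_md[OF F M] and GM = fn_md[OF G M]
    note FGM = fn_md[OF F GM] and GGM = fn_md[OF G GM]
    have \<eta>'h: "\<eta>' M \<in> hom M (fst G (fst G M))" using nt_hom[OF n\<eta> M] by simp
    have \<epsilon>'h: "\<epsilon>' M \<in> hom (fst G (fst G M)) M" using nt_hom[OF n\<epsilon> M] by simp
    note \<alpha>h = nt_hom[OF \<alpha> M, unfolded fst_fcomp fst_fid] and \<beta>h = nt_hom[OF \<beta> M, unfolded fst_fcomp fst_fid]
    note bM = b[OF M] and bGM = b[OF GM]
    have c\<beta>: "\<beta> i (fst G M) \<in> hom (fst F (fst G (fst G M))) (fst G M)" if "i < m" for i
      using nt_hom[OF \<beta>[OF that] GM] by simp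
    have G\<eta>: "snd G M (fst G (fst G M)) (\<eta>' M) \<in> hom (fst G M) (fst G (fst G (fst G M)))"
      by (rule fn_hom[OF G M GGM \<eta>'h])
    have t1: "(\<beta> i (fst G M) * \<pi> i (fst G (fst G M))) * snd G M (fst G (fst G M)) (\<eta>' M) = \<iota> i M * \<pi> i M"
      if i: "i < m" for i
    proof -
      have F\<eta>: "snd F M (fst G (fst G M)) (\<eta>' M) \<in> hom (fst F M) (fst F (fst G (fst G M)))"
        by (rule fn_hom[OF F M GGM \<eta>'h])
      have F\<pi>: "snd F (fst G (fst G M)) (fst F (fst G M)) (\<pi> i (fst G M)) \<in> hom (fst F (fst G (fst G M))) (fst F (fst F (fst G M)))"
        by (rule fn_hom[OF F GGM FGM nt_hom[OF \<pi>[OF i] GM]])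
      note d = c\<beta>[OF i, THEN homD] nt_hom[OF \<pi>[OF i] GGM, THEN homD] homD[OF G\<eta>] homD[OF F\<eta>] homD[OF F\<pi>]
        nt_hom[OF \<pi>[OF i] M, THEN homD] adj_counit[OF a GM, THEN homD]
      have \<pi>\<eta>: "\<pi> i (fst G M) * \<eta>' M = \<alpha> i M"
        unfolding \<eta>'_def using bip_pr_sum[OF bGM i, of "\<lambda>i. \<alpha> i M" "fst M"] \<alpha>h homD by blast
      have "(\<beta> i (fst G M) * \<pi> i (fst G (fst G M))) * snd G M (fst G (fst G M)) (\<eta>' M)
         = \<beta> i (fst G M) * (\<pi> i (fst G (fst G M)) * snd G M (fst G (fst G M)) (\<eta>' M))"
        using d by (simp add: mat_mult_assoc)
      also have "\<dots> = \<beta> i (fst G M) * snd F M (fst G (fst G M)) (\<eta>' M) * \<pi> i M"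
        unfolding nt_nat[OF \<pi>[OF i] M GGM \<eta>'h, symmetric] using d by (simp add: mat_mult_assoc)
      also have "\<beta> i (fst G M) * snd F M (fst G (fst G M)) (\<eta>' M)
         = \<epsilon> (fst G M) * snd F M (fst F (fst G M)) (\<pi> i (fst G M) * \<eta>' M)"
        unfolding \<beta>_def fn_mult[OF F M GGM FGM \<eta>'h nt_hom[OF \<pi>[OF i] GM]] using d by (simp add: mat_mult_assoc)
      also have "\<dots> = \<iota> i M"
        unfolding \<pi>\<eta> \<alpha>_def by (rule adj_transpose1[OF F F a M GM nt_hom[OF \<iota>[OF i] M]])
      finally show ?thesis .
    qed
    have "\<epsilon>' (fst G M) * snd G M (fst G (fst G M)) (\<eta>' M)
       = msum (fst (fst G M)) (fst (fst G M)) (\<lambda>i. (\<beta> i (fst G M) * \<pi> i (fst G (fst G M))) * snd G M (fst G (fst G M)) (\<eta>' M)) m"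
      unfolding \<epsilon>'_def
      by (rule msum_mult[OF homD[OF G\<eta>]])
        (rule mult_carrier_mat[OF homD[OF c\<beta>] homD[OF nt_hom[OF \<pi> GGM]]])
    also have "\<dots> = msum (fst (fst G M)) (fst (fst G M)) (\<lambda>i. \<iota> i M * \<pi> i M) m"
      by (rule msum_cong[OF t1])
    finally show "\<epsilon>' (fst G M) * snd G M (fst G (fst G M)) (\<eta>' M) = 1\<^sub>m (fst (fst G M))"
      using bip_sum[OF bM] by simp
    have G\<epsilon>: "snd G (fst G (fst G M)) M (\<epsilon>' M) \<in> hom (fst G (fst G (fst G M))) (fst G M)"
      by (rule fn_hom[OF G GGM M \<epsilon>'h])
    have c\<alpha>: "\<alpha> i (fst G M) \<in> hom (fst G M) (fst F (fst G (fst G M)))" if "i < m" for i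
      using nt_hom[OF \<alpha>[OF that] GM] by simp
    have t2: "snd G (fst G (fst G M)) M (\<epsilon>' M) * (\<iota> i (fst G (fst G M)) * \<alpha> i (fst G M)) = \<iota> i M * \<pi> i M"
      if i: "i < m" for i
    proof -
      have F\<epsilon>: "snd F (fst G (fst G M)) M (\<epsilon>' M) \<in> hom (fst F (fst G (fst G M))) (fst F M)"
        by (rule fn_hom[OF F GGM M \<epsilon>'h])
      have F\<iota>: "snd F (fst F (fst G M)) (fst G (fst G M)) (\<iota> i (fst G M)) \<in> hom (fst F (fst F (fst G M))) (fst F (fst G (fst G M)))"
        by (rule fn_hom[OF F FGM GGM nt_hom[OF \<iota>[OF i] GM]])
      note d = c\<alpha>[OF i, THEN homD] nt_hom[OF \<iota>[OF i] GGM, THEN homD] homD[OF G\<epsilon>] homD[OF F\<epsilon>] homD[OF F\<iota>]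
        nt_hom[OF \<iota>[OF i] M, THEN homD] adj_unit[OF a GM, THEN homD]
      have \<epsilon>\<iota>: "\<epsilon>' M * \<iota> i (fst G M) = \<beta> i M"
        unfolding \<epsilon>'_def using bip_sum_in[OF bGM i, of "\<lambda>i. \<beta> i M" "fst M"] \<beta>h homD by blast
      have "snd G (fst G (fst G M)) M (\<epsilon>' M) * (\<iota> i (fst G (fst G M)) * \<alpha> i (fst G M))
         = (snd G (fst G (fst G M)) M (\<epsilon>' M) * \<iota> i (fst G (fst G M))) * \<alpha> i (fst G M)"
        using d by (simp add: mat_mult_assoc)
      also have "\<dots> = \<iota> i M * (snd F (fst G (fst G M)) M (\<epsilon>' M) * \<alpha> i (fst G M))"
        unfolding nt_nat[OF \<iota>[OF i] GGM M \<epsilon>'h] using d by (simp add: mat_mult_assoc)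
      also have "snd F (fst G (fst G M)) M (\<epsilon>' M) * \<alpha> i (fst G M)
         = snd F (fst F (fst G M)) M (\<epsilon>' M * \<iota> i (fst G M)) * \<eta> (fst G M)"
        unfolding \<alpha>_def fn_mult[OF F FGM GGM M nt_hom[OF \<iota>[OF i] GM] \<epsilon>'h] using d by (simp add: mat_mult_assoc)
      also have "\<dots> = \<pi> i M"
        unfolding \<epsilon>\<iota> \<beta>_def by (rule adj_transpose2[OF F F a GM M nt_hom[OF \<pi>[OF i] M]])
      finally show ?thesis .
    qed
    have "snd G (fst G (fst G M)) M (\<epsilon>' M) * \<eta>' (fst G M)
       = msum (fst (fst G M)) (fst (fst G M)) (\<lambda>i. snd G (fst G (fst G M)) M (\<epsilon>' M) * (\<iota> i (fst G (fst G M)) * \<alpha> i (fst G M))) m"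
      unfolding \<eta>'_def
      by (rule mult_msum[OF homD[OF G\<epsilon>]])
        (rule mult_carrier_mat[OF homD[OF nt_hom[OF \<iota> GGM]] homD[OF c\<alpha>]])
    also have "\<dots> = msum (fst (fst G M)) (fst (fst G M)) (\<lambda>i. \<iota> i M * \<pi> i M) m"
      by (rule msum_cong[OF t2])
    finally show "snd G (fst G (fst G M)) M (\<epsilon>' M) * \<eta>' (fst G M) = 1\<^sub>m (fst (fst G M))"
      using bip_sum[OF bM] by simp
  qed
  thus ?thesis by blast
qed

text \<open>The linear splittings under \<open>F\<close> are placed on the diagonal. That
  \<open>r'\<close> and \<open>s'\<close> are complementary is checked after composition with each
  \<open>\<iota> j\<close>, since these jointly cover \<open>G M\<close>.\<close>

lemma exact_copies:
  assumes F: "fn F" and G: "fn G" and ex: "exact F" and c: "copies m F G"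
  shows "exact G"
  unfolding exact_def
proof (intro allI impI)
  obtain \<iota> \<pi> where \<iota>: "\<And>i. i < m \<Longrightarrow> nt F G (\<iota> i)" and \<pi>: "\<And>i. i < m \<Longrightarrow> nt G F (\<pi> i)"
    and b: "\<And>M. md M \<Longrightarrow> bip m (fst F M) (fst G M) (\<lambda>i. \<iota> i M) (\<lambda>i. \<pi> i M)"
    using copiesE[OF c] by blast
  fix L i M p Q assume ses: "ses L i M p Q"
  have m: "md L" "md M" "md Q" and h: "i \<in> hom L M" "p \<in> hom M Q" and pi: "p * i = 0\<^sub>m (fst Q) (fst L)"
    using ses by (auto simp: ses_def)
  obtain r s where rs: "r \<in> carrier_mat (fst (fst F L)) (fst (fst F M))" "s \<in> carrier_mat (fst (fst F M)) (fst (fst F Q))"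
    and ri: "r * snd F L M i = 1\<^sub>m (fst (fst F L))" and ps: "snd F M Q p * s = 1\<^sub>m (fst (fst F Q))"
    and e: "snd F L M i * r + s * snd F M Q p = 1\<^sub>m (fst (fst F M))"
    by (rule sesE[OF exactD[OF ex ses]])
  note Gm = m[THEN fn_md[OF G]]
  note hG = fn_hom[OF G m(1,2) h(1)] fn_hom[OF G m(2,3) h(2)]
  note hF = fn_hom[OF F m(1,2) h(1)] fn_hom[OF F m(2,3) h(2)]
  note cc = rs hG[THEN homD] hF[THEN homD]
  note ct = b[OF m(1), THEN bip_carrier(1)] b[OF m(1), THEN bip_carrier(2)] b[OF m(2), THEN bip_carrier(1)]
    b[OF m(2), THEN bip_carrier(2)] b[OF m(3), THEN bip_carrier(1)] b[OF m(3), THEN bip_carrier(2)]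
  note dt = bip_dims[OF b[OF m(1)]] bip_dims[OF b[OF m(2)]] bip_dims[OF b[OF m(3)]]
  define r' where "r' = msum (fst (fst G L)) (fst (fst G M)) (\<lambda>j. \<iota> j L * (r * \<pi> j M)) m"
  define s' where "s' = msum (fst (fst G M)) (fst (fst G Q)) (\<lambda>j. \<iota> j M * (s * \<pi> j Q)) m"
  have rs': "r' \<in> carrier_mat (fst (fst G L)) (fst (fst G M))" "s' \<in> carrier_mat (fst (fst G M)) (fst (fst G Q))"
    by (auto simp: r'_def s'_def intro!: carrier_matI)
  have "r' * snd G L M i = msum (fst (fst G L)) (fst (fst G L)) (\<lambda>j. (\<iota> j L * (r * \<pi> j M)) * snd G L M i) m"
    unfolding r'_def by (rule msum_mult[OF cc(3)]) (rule mult_carrier_mat[OF ct(1) mult_carrier_mat[OF rs(1) ct(4)]])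
  also have "\<dots> = msum (fst (fst G L)) (fst (fst G L)) (\<lambda>j. \<iota> j L * \<pi> j L) m"
  proof (rule msum_cong)
    fix j assume j: "j < m"
    have "(\<iota> j L * (r * \<pi> j M)) * snd G L M i = \<iota> j L * (r * (\<pi> j M * snd G L M i))"
      using cc j by (simp add: mat_mult_assoc dt)
    also have "\<dots> = \<iota> j L * ((r * snd F L M i) * \<pi> j L)"
      unfolding nt_nat[OF \<pi>[OF j] m(1,2) h(1), symmetric] using cc j by (simp add: mat_mult_assoc dt)
    finally show "(\<iota> j L * (r * \<pi> j M)) * snd G L M i = \<iota> j L * \<pi> j L" using j by (simp add: ri dt)
  qed
  finally have 1: "r' * snd G L M i = 1\<^sub>m (fst (fst G L))" using bip_sum[OF b[OF m(1)]] by simp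
  have "snd G M Q p * s' = msum (fst (fst G Q)) (fst (fst G Q)) (\<lambda>j. snd G M Q p * (\<iota> j M * (s * \<pi> j Q))) m"
    unfolding s'_def by (rule mult_msum[OF cc(4)]) (rule mult_carrier_mat[OF ct(3) mult_carrier_mat[OF rs(2) ct(6)]])
  also have "\<dots> = msum (fst (fst G Q)) (fst (fst G Q)) (\<lambda>j. \<iota> j Q * \<pi> j Q) m"
  proof (rule msum_cong)
    fix j assume j: "j < m"
    have "snd G M Q p * (\<iota> j M * (s * \<pi> j Q)) = (snd G M Q p * \<iota> j M) * (s * \<pi> j Q)"
      using cc j by (simp add: mat_mult_assoc dt)
    also have "\<dots> = \<iota> j Q * ((snd F M Q p * s) * \<pi> j Q)"
      unfolding nt_nat[OF \<iota>[OF j] m(2,3) h(2)] using cc j by (simp add: mat_mult_assoc dt)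
    finally show "snd G M Q p * (\<iota> j M * (s * \<pi> j Q)) = \<iota> j Q * \<pi> j Q" using j by (simp add: ps dt)
  qed
  finally have 2: "snd G M Q p * s' = 1\<^sub>m (fst (fst G Q))" using bip_sum[OF b[OF m(3)]] by simp
  let ?E = "snd G L M i * r' + s' * snd G M Q p"
  have Ec: "?E \<in> carrier_mat (fst (fst G M)) (fst (fst G M))" using cc rs' by auto
  have 3: "?E = 1\<^sub>m (fst (fst G M))"
  proof -
    have E\<iota>: "?E * \<iota> j M = \<iota> j M" if j: "j < m" for j
    proof -
      have r\<iota>: "r' * \<iota> j M = \<iota> j L * r"
      proof -
        have "r' = msum (fst (fst G L)) (fst (fst G M)) (\<lambda>j. (\<iota> j L * r) * \<pi> j M) m"
          unfolding r'_def using rs by (intro msum_cong) (simp add: mat_mult_assoc dt)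
        thus ?thesis using bip_sum_in[OF b[OF m(2)] j, of "\<lambda>j. \<iota> j L * r" "fst (fst G L)"]
          by (simp add: mult_carrier_mat[OF ct(1) rs(1)])
      qed
      have s\<iota>: "s' * \<iota> j Q = \<iota> j M * s"
      proof -
        have "s' = msum (fst (fst G M)) (fst (fst G Q)) (\<lambda>j. (\<iota> j M * s) * \<pi> j Q) m"
          unfolding s'_def using rs by (intro msum_cong) (simp add: mat_mult_assoc dt)
        thus ?thesis using bip_sum_in[OF b[OF m(3)] j, of "\<lambda>j. \<iota> j M * s" "fst (fst G M)"]
          by (simp add: mult_carrier_mat[OF ct(3) rs(2)])
      qed
      have "?E * \<iota> j M = snd G L M i * (r' * \<iota> j M) + s' * (snd G M Q p * \<iota> j M)"
        using cc rs' j by (simp add: mat_add_mult mat_mult_assoc dt)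
      also have "\<dots> = (snd G L M i * \<iota> j L) * r + (s' * \<iota> j Q) * snd F M Q p"
        unfolding r\<iota> nt_nat[OF \<iota>[OF j] m(2,3) h(2)] using cc rs' j by (simp add: mat_mult_assoc dt)
      also have "\<dots> = \<iota> j M * (snd F L M i * r + s * snd F M Q p)"
        unfolding s\<iota> nt_nat[OF \<iota>[OF j] m(1,2) h(1)] using cc rs' j by (simp add: mat_mult_assoc mat_mult_add dt)
      finally show ?thesis using j by (simp add: e dt)
    qed
    have "?E = ?E * msum (fst (fst G M)) (fst (fst G M)) (\<lambda>j. \<iota> j M * \<pi> j M) m"
      unfolding bip_sum[OF b[OF m(2)]] by (rule right_mult_one_mat[OF Ec, symmetric])
    also have "\<dots> = msum (fst (fst G M)) (fst (fst G M)) (\<lambda>j. ?E * (\<iota> j M * \<pi> j M)) m"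
      by (rule mult_msum[OF Ec]) (rule mult_carrier_mat[OF ct(3) ct(4)])
    also have "\<dots> = msum (fst (fst G M)) (fst (fst G M)) (\<lambda>j. \<iota> j M * \<pi> j M) m"
    proof (rule msum_cong)
      fix j assume j: "j < m"
      have "?E * (\<iota> j M * \<pi> j M) = (?E * \<iota> j M) * \<pi> j M"
        by (rule assoc_mult_mat[symmetric, OF Ec ct(3)[OF j] ct(4)[OF j]])
      thus "?E * (\<iota> j M * \<pi> j M) = \<iota> j M * \<pi> j M" unfolding E\<iota>[OF j] .
    qed
    finally show ?thesis using bip_sum[OF b[OF m(2)]] by simp
  qed
  have 0: "snd G M Q p * snd G L M i = 0\<^sub>m (fst (fst G Q)) (fst (fst G L))"
    using fn_mult[OF G m h] fn_zero[OF G m(1,3)] pi by simp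
  show "ses (fst G L) (snd G L M i) (fst G M) (snd G M Q p) (fst G Q)"
    by (rule ses_intro[OF Gm hG 0 rs' 1 2 3])
qed

text \<open>Unit and counit are transported along the isomorphism; in this way a functor isomorphic
  to its right adjoint becomes selfadjoint.\<close>

lemma adj_iso:
  assumes F: "fn F" and G: "fn G" and a: "adj F G \<eta> \<epsilon>" and i: "nat_iso sm G F"
  shows "\<exists>\<eta> \<epsilon>. adj F F \<eta> \<epsilon>"
proof -
  obtain \<alpha> \<beta> where \<alpha>: "nt G F \<alpha>" and \<beta>: "nt F G \<beta>"
    and \<beta>\<alpha>: "\<And>M. md M \<Longrightarrow> \<beta> M * \<alpha> M = 1\<^sub>m (fst (fst G M))" and \<alpha>\<beta>: "\<And>M. md M \<Longrightarrow> \<alpha> M * \<beta> M = 1\<^sub>m (fst (fst F M))"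
    using nat_isoE[OF G F i] by blast
  have a\<eta>: "nt fid (fcomp G F) \<eta>" and a\<epsilon>: "nt (fcomp F G) fid \<epsilon>" using a by (auto simp: adj_def)
  have n\<eta>: "nt fid (fcomp F F) (\<lambda>M. \<alpha> (fst F M) * \<eta> M)"
    by (rule nt_comp[OF fn_fid fn_fcomp[OF F G] fn_fcomp[OF F F] a\<eta> nt_whisker_right[OF F \<alpha>]])
  have n\<epsilon>: "nt (fcomp F F) fid (\<lambda>M. \<epsilon> M * snd F (fst F M) (fst G M) (\<beta> M))"
    by (rule nt_comp[OF fn_fcomp[OF F F] fn_fcomp[OF G F] fn_fid nt_whisker_left[OF F F G \<beta>] a\<epsilon>])
  have "adj F F (\<lambda>M. \<alpha> (fst F M) * \<eta> M) (\<lambda>M. \<epsilon> M * snd F (fst F M) (fst G M) (\<beta> M))"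
    unfolding adj_def
  proof (intro conjI allI impI n\<eta> n\<epsilon>)
    fix M assume M: "md M"
    note FM = fn_md[OF F M] and GM = fn_md[OF G M]
    note FFM = fn_md[OF F FM] and GFM = fn_md[OF G FM] and FGM = fn_md[OF F GM]
    have h\<eta>: "\<alpha> (fst F M) * \<eta> M \<in> hom M (fst F (fst F M))" using nt_hom[OF n\<eta> M] by simp
    have h\<epsilon>: "\<epsilon> M * snd F (fst F M) (fst G M) (\<beta> M) \<in> hom (fst F (fst F M)) M" using nt_hom[OF n\<epsilon> M] by simp
    note F\<eta> = fn_hom[OF F M FFM h\<eta>] and F\<beta> = fn_hom[OF F FFM GFM nt_hom[OF \<beta> FM]]
    have "\<epsilon> (fst F M) * snd F (fst F (fst F M)) (fst G (fst F M)) (\<beta> (fst F M)) * snd F M (fst F (fst F M)) (\<alpha> (fst F M) * \<eta> M)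
       = \<epsilon> (fst F M) * snd F M (fst G (fst F M)) (\<beta> (fst F M) * (\<alpha> (fst F M) * \<eta> M))"
      unfolding fn_mult[OF F M FFM GFM h\<eta> nt_hom[OF \<beta> FM]]
      using homD[OF F\<eta>] homD[OF F\<beta>] homD[OF adj_counit[OF a FM]] by (simp add: mat_mult_assoc)
    also have "\<beta> (fst F M) * (\<alpha> (fst F M) * \<eta> M) = (\<beta> (fst F M) * \<alpha> (fst F M)) * \<eta> M"
      by (rule hom_assoc[symmetric, OF adj_unit[OF a M] nt_hom[OF \<alpha> FM] nt_hom[OF \<beta> FM]])
    also have "\<dots> = \<eta> M" unfolding \<beta>\<alpha>[OF FM] using homD[OF adj_unit[OF a M]] by simp
    finally show "\<epsilon> (fst F M) * snd F (fst F (fst F M)) (fst G (fst F M)) (\<beta> (fst F M)) * snd F M (fst F (fst F M)) (\<alpha> (fst F M) * \<eta> M)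
      = 1\<^sub>m (fst (fst F M))" by (simp add: adj_triangle1[OF a M])
    have "snd F (fst F (fst F M)) M (\<epsilon> M * snd F (fst F M) (fst G M) (\<beta> M)) * (\<alpha> (fst F (fst F M)) * \<eta> (fst F M))
      = (snd F (fst F (fst F M)) M (\<epsilon> M * snd F (fst F M) (fst G M) (\<beta> M)) * \<alpha> (fst F (fst F M))) * \<eta> (fst F M)"
      by (rule hom_assoc[symmetric, OF adj_unit[OF a FM] nt_hom[OF \<alpha> FFM] fn_hom[OF F FFM M h\<epsilon>]])
    also have "\<dots> = (\<alpha> M * snd G (fst F (fst F M)) M (\<epsilon> M * snd F (fst F M) (fst G M) (\<beta> M))) * \<eta> (fst F M)"
      unfolding nt_nat[OF \<alpha> FFM M h\<epsilon>] ..
    also have "\<dots> = \<alpha> M * (snd G (fst F (fst F M)) M (\<epsilon> M * snd F (fst F M) (fst G M) (\<beta> M)) * \<eta> (fst F M))"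
      by (rule hom_assoc[OF adj_unit[OF a FM] fn_hom[OF G FFM M h\<epsilon>] nt_hom[OF \<alpha> M]])
    also have "\<dots> = \<alpha> M * \<beta> M"
      unfolding adj_transpose2[OF F G a FM M nt_hom[OF \<beta> M]] ..
    finally show "snd F (fst F (fst F M)) M (\<epsilon> M * snd F (fst F M) (fst G M) (\<beta> M)) * (\<alpha> (fst F (fst F M)) * \<eta> (fst F M))
      = 1\<^sub>m (fst (fst F M))" using \<alpha>\<beta>[OF M] by simp
  qed
  thus ?thesis by blast
qed

text \<open>The image of \<open>e M\<close> receives a basis by an independent choice at every
  module, and \<open>G\<close> is \<open>F\<close> conjugated by these choices. Functoriality does
  not require them to be coherent, because \<open>e\<close> is natural.\<close>

lemma functor_split:
  assumes F: "fn F" and e: "nt F F e" and idem: "\<And>M. md M \<Longrightarrow> e M * e M = e M"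
  obtains G \<iota> \<pi> where "fn G" "nt G F \<iota>" "nt F G \<pi>" "\<And>M. md M \<Longrightarrow> \<pi> M * \<iota> M = 1\<^sub>m (fst (fst G M))"
    "\<And>M. md M \<Longrightarrow> \<iota> M * \<pi> M = e M"
proof -
  have "\<exists>d S T. md M \<longrightarrow> S \<in> carrier_mat (fst (fst F M)) d \<and> T \<in> carrier_mat d (fst (fst F M)) \<and>
     T * S = 1\<^sub>m d \<and> S * T = e M" for M
  proof (cases "md M")
    case True
    obtain d S T where "S \<in> carrier_mat (fst (fst F M)) d" "T \<in> carrier_mat d (fst (fst F M))" "T * S = 1\<^sub>m d" "S * T = e M"
      by (rule idempotent_split[OF homD[OF nt_hom[OF e True]] idem[OF True]])
    thus ?thesis by metis
  qed simp
  then obtain d \<iota> \<pi> where split: "\<And>M. md M \<Longrightarrow> \<iota> M \<in> carrier_mat (fst (fst F M)) (d M) \<and> \<pi> M \<in> carrier_mat (d M) (fst (fst F M)) \<and>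
     \<pi> M * \<iota> M = 1\<^sub>m (d M) \<and> \<iota> M * \<pi> M = e M" by metis
  hence \<iota>c: "\<And>M. md M \<Longrightarrow> \<iota> M \<in> carrier_mat (fst (fst F M)) (d M)"
    and \<pi>c: "\<And>M. md M \<Longrightarrow> \<pi> M \<in> carrier_mat (d M) (fst (fst F M))"
    and \<pi>\<iota>: "\<And>M. md M \<Longrightarrow> \<pi> M * \<iota> M = 1\<^sub>m (d M)" and \<iota>\<pi>: "\<And>M. md M \<Longrightarrow> \<iota> M * \<pi> M = e M" by blast+
  \<comment> \<open>Any \<open>x\<close> commuting with \<open>e\<close> restricts to the images.
    This is applied to the action of algebra elements, which makes \<open>\<iota>\<close> and
    \<open>\<pi>\<close> module homomorphisms, and to the matrices \<open>F f\<close>, which makes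
    them natural.\<close>
  have slide: "\<iota> N * (\<pi> N * (x * \<iota> M)) = x * \<iota> M" "(\<pi> N * (x * \<iota> M)) * \<pi> M = \<pi> N * x"
    if M: "md M" "md N" and x: "x \<in> carrier_mat (fst (fst F N)) (fst (fst F M))" "x * e M = e N * x" for M N x
  proof -
    note c = \<iota>c[OF M(1)] \<iota>c[OF M(2)] \<pi>c[OF M(1)] \<pi>c[OF M(2)] x(1) homD[OF nt_hom[OF e M(1)]] homD[OF nt_hom[OF e M(2)]]
    have "\<iota> N * (\<pi> N * (x * \<iota> M)) = (\<iota> N * \<pi> N) * x * \<iota> M" using c by (simp add: mat_mult_assoc)
    also have "\<dots> = x * ((\<iota> M * \<pi> M) * \<iota> M)" unfolding \<iota>\<pi>[OF M(2)] x(2)[symmetric] \<iota>\<pi>[OF M(1)] using c by (simp add: mat_mult_assoc)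
    also have "\<dots> = x * (\<iota> M * (\<pi> M * \<iota> M))" using c by (simp add: mat_mult_assoc)
    finally show "\<iota> N * (\<pi> N * (x * \<iota> M)) = x * \<iota> M" unfolding \<pi>\<iota>[OF M(1)] using c by simp
    have "(\<pi> N * (x * \<iota> M)) * \<pi> M = \<pi> N * (x * (\<iota> M * \<pi> M))" using c by (simp add: mat_mult_assoc)
    also have "\<dots> = \<pi> N * ((\<iota> N * \<pi> N) * x)" unfolding \<iota>\<pi>[OF M(1)] x(2) \<iota>\<pi>[OF M(2)] ..
    also have "\<dots> = (\<pi> N * \<iota> N) * (\<pi> N * x)" using c by (simp add: mat_mult_assoc)
    finally show "(\<pi> N * (x * \<iota> M)) * \<pi> M = \<pi> N * x" unfolding \<pi>\<iota>[OF M(2)] using c by simp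
  qed
  define G :: "('a, 'k) endofun" where
    "G = (\<lambda>M. (d M, \<lambda>a. \<pi> M * (snd (fst F M) a * \<iota> M)), \<lambda>M N f. \<pi> N * (snd F M N f * \<iota> M))"
  have fG: "fst (fst G M) = d M" "snd (fst G M) a = \<pi> M * (snd (fst F M) a * \<iota> M)"
    "snd G M N f = \<pi> N * (snd F M N f * \<iota> M)" for M N f a by (simp_all add: G_def)
  have obj: "snd (fst F M) a \<in> carrier_mat (fst (fst F M)) (fst (fst F M))"
     "snd (fst F M) a * e M = e M * snd (fst F M) a" if "md M" for M a
    using md_carrier[OF fn_md[OF F that]] hom_comm[OF nt_hom[OF e that]] by auto
  have mor: "snd F M N f \<in> carrier_mat (fst (fst F N)) (fst (fst F M))" "snd F M N f * e M = e N * snd F M N f"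
    if "md M" "md N" "f \<in> hom M N" for M N f
    using homD[OF fn_hom[OF F that]] nt_nat[OF e that] by auto
  have \<iota>h: "\<iota> M \<in> hom (fst G M) (fst F M)" if M: "md M" for M
    using \<iota>c[OF M] slide(1)[OF M M obj[OF M]] by (simp add: hom_def fG)
  have \<pi>h: "\<pi> M \<in> hom (fst F M) (fst G M)" if M: "md M" for M
    using \<pi>c[OF M] slide(2)[OF M M obj[OF M]] by (simp add: hom_def fG)
  have n\<iota>0: "snd F M N f * \<iota> M = \<iota> N * snd G M N f" if "md M" "md N" "f \<in> hom M N" for M N f
    using slide(1)[OF that(1,2) mor[OF that]] by (simp add: fG)
  have n\<pi>0: "snd G M N f * \<pi> M = \<pi> N * snd F M N f" if "md M" "md N" "f \<in> hom M N" for M N f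
    using slide(2)[OF that(1,2) mor[OF that]] by (simp add: fG)
  have Gmd: "md (fst G M)" if M: "md M" for M
  proof -
    have "md (d M, snd (fst G M))"
    proof (rule md_sub[OF fn_md[OF F M] \<iota>c[OF M] \<pi>c[OF M] \<pi>\<iota>[OF M]])
      show "snd (fst G M) a \<in> carrier_mat (d M) (d M)" for a
        using \<iota>c[OF M] \<pi>c[OF M] by (auto simp: fG intro!: carrier_matI)
      show "\<iota> M * snd (fst G M) a = snd (fst F M) a * \<iota> M" for a
        using hom_comm[OF \<iota>h[OF M]] .
    qed
    moreover have "(d M, snd (fst G M)) = fst G M" by (rule prod_eqI) (simp_all add: fG)
    ultimately show ?thesis by simp
  qed
  have Gfn: "fn G"
  proof (rule fnI)
    show "md (fst G M)" if "md M" for M by (rule Gmd[OF that])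
    show "snd G M N f \<in> hom (fst G M) (fst G N)" if m: "md M" "md N" "f \<in> hom M N" for M N f
      unfolding fG
      by (intro hom_mult[OF Gmd[OF m(1)] fn_md[OF F m(2)] Gmd[OF m(2)]] \<pi>h m
        hom_mult[OF Gmd[OF m(1)] fn_md[OF F m(1)] fn_md[OF F m(2)]] \<iota>h fn_hom[OF F])
    show "snd G M M (1\<^sub>m (fst M)) = 1\<^sub>m (fst (fst G M))" if M: "md M" for M
      using \<iota>c[OF M] by (simp add: fG fn_one[OF F M] \<pi>\<iota>[OF M])
    show "snd G L N (g * f) = snd G M N g * snd G L M f"
      if m: "md L" "md M" "md N" "f \<in> hom L M" "g \<in> hom M N" for L M N f g
    proof -
      note c = homD[OF fn_hom[OF F m(1,2,4)]] homD[OF fn_hom[OF F m(2,3,5)]] \<iota>c[OF m(1)] \<iota>c[OF m(2)] \<pi>c[OF m(3)] \<pi>c[OF m(2)]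
      have "snd G M N g * snd G L M f = \<pi> N * (snd F M N g * (\<iota> M * snd G L M f))"
        using c by (simp add: fG mat_mult_assoc)
      also have "\<dots> = snd G L N (g * f)"
        unfolding n\<iota>0[OF m(1,2,4), symmetric] using c by (simp add: fG fn_mult[OF F m] mat_mult_assoc)
      finally show ?thesis ..
    qed
    show "snd G M N (f + g) = snd G M N f + snd G M N g"
      if m: "md M" "md N" "f \<in> hom M N" "g \<in> hom M N" for M N f g
      using homD[OF fn_hom[OF F m(1,2,3)]] homD[OF fn_hom[OF F m(1,2,4)]] \<iota>c[OF m(1)] \<pi>c[OF m(2)]
      by (simp add: fG fn_add[OF F m] mat_add_mult mat_mult_add)
    show "snd G M N (c \<cdot>\<^sub>m f) = c \<cdot>\<^sub>m snd G M N f"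
      if m: "md M" "md N" "f \<in> hom M N" for M N f c
      using homD[OF fn_hom[OF F m(1,2,3)]] \<iota>c[OF m(1)] \<pi>c[OF m(2)]
      by (simp add: fG fn_smult[OF F m] mat_mult_smult mat_smult_mult)
  qed
  show thesis
  proof (rule that[OF Gfn])
    show "nt G F \<iota>" by (rule ntI) (use \<iota>h n\<iota>0 in auto)
    show "nt F G \<pi>" by (rule ntI) (use \<pi>h n\<pi>0 in auto)
  qed (use \<pi>\<iota> \<iota>\<pi> in \<open>auto simp: fG\<close>)
qed

text \<open>The mate of an endomorphism \<open>e\<close> of \<open>F\<close>: precomposition with \<open>e\<close> on \<open>Hom(F M, N)\<close> becomes
  postcomposition with \<open>mate e\<close> on \<open>Hom(M, F N)\<close>.\<close>

definition mate where
  "mate F \<eta> \<epsilon> e N = snd F (fst F (fst F N)) N (\<epsilon> N * e (fst F N)) * \<eta> (fst F N)"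

lemma mate_hom:
  assumes F: "fn F" and a: "adj F F \<eta> \<epsilon>" and e: "nt F F e" and N: "md N"
  shows "mate F \<eta> \<epsilon> e N \<in> hom (fst F N) (fst F N)" "\<epsilon> N * e (fst F N) \<in> hom (fst F (fst F N)) N"
proof -
  note FN = fn_md[OF F N]
  note FFN = fn_md[OF F FN]
  show *: "\<epsilon> N * e (fst F N) \<in> hom (fst F (fst F N)) N"
    by (rule hom_mult[OF FFN FFN N nt_hom[OF e FN] adj_counit[OF a N]])
  show "mate F \<eta> \<epsilon> e N \<in> hom (fst F N) (fst F N)"
    unfolding mate_def
    by (rule hom_mult[OF FN fn_md[OF F FFN] FN adj_unit[OF a FN] fn_hom[OF F FFN N *]])
qed

text \<open>The defining property of the mate, read through the transposition
  \<open>g \<mapsto> \<epsilon> * F g\<close>; \<open>mate_comp\<close> is the same identity read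
  through the opposite transposition.\<close>

lemma mate_transpose:
  assumes F: "fn F" and a: "adj F F \<eta> \<epsilon>" and e: "nt F F e" and m: "md M" "md N" and g: "g \<in> hom M (fst F N)"
  shows "\<epsilon> N * snd F M (fst F N) (mate F \<eta> \<epsilon> e N * g) = \<epsilon> N * snd F M (fst F N) g * e M"
proof -
  note FM = fn_md[OF F m(1)] and FN = fn_md[OF F m(2)]
  note FFN = fn_md[OF F FN]
  note h = mate_hom[OF F a e m(2)]
  note Fg = fn_hom[OF F m(1) FN g]
  note d = homD[OF Fg] homD[OF fn_hom[OF F FN FN h(1)]] homD[OF adj_counit[OF a m(2)]]
    homD[OF nt_hom[OF e m(1)]] homD[OF nt_hom[OF e FN]]
  have "\<epsilon> N * snd F M (fst F N) (mate F \<eta> \<epsilon> e N * g)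
      = (\<epsilon> N * snd F (fst F N) (fst F N) (mate F \<eta> \<epsilon> e N)) * snd F M (fst F N) g"
    unfolding fn_mult[OF F m(1) FN FN g h(1)] using d by (simp add: mat_mult_assoc)
  also have "\<epsilon> N * snd F (fst F N) (fst F N) (mate F \<eta> \<epsilon> e N) = \<epsilon> N * e (fst F N)"
    unfolding mate_def by (rule adj_transpose1[OF F F a FN m(2) h(2)])
  also have "\<epsilon> N * e (fst F N) * snd F M (fst F N) g = \<epsilon> N * (snd F M (fst F N) g * e M)"
    unfolding nt_nat[OF e m(1) FN g] using d by (simp add: mat_mult_assoc)
  finally show ?thesis using d by (simp add: mat_mult_assoc)
qed

lemma mate_comp:
  assumes F: "fn F" and a: "adj F F \<eta> \<epsilon>" and e: "nt F F e" and m: "md M" "md N" and f: "f \<in> hom (fst F M) N"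
  shows "mate F \<eta> \<epsilon> e N * (snd F (fst F M) N f * \<eta> M) = snd F (fst F M) N (f * e M) * \<eta> M"
proof -
  note FM = fn_md[OF F m(1)] and FN = fn_md[OF F m(2)]
  note FFM = fn_md[OF F FM]
  let ?g = "snd F (fst F M) N f * \<eta> M"
  have g: "?g \<in> hom M (fst F N)" by (rule hom_mult[OF m(1) FFM FN adj_unit[OF a m(1)] fn_hom[OF F FM m(2) f]])
  have mg: "mate F \<eta> \<epsilon> e N * ?g \<in> hom M (fst F N)"
    by (rule hom_mult[OF m(1) FN FN g mate_hom(1)[OF F a e m(2)]])
  have "mate F \<eta> \<epsilon> e N * ?g = snd F (fst F M) N (\<epsilon> N * snd F M (fst F N) (mate F \<eta> \<epsilon> e N * ?g)) * \<eta> M"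
    by (rule adj_transpose2[OF F F a m mg, symmetric])
  also have "\<dots> = snd F (fst F M) N (f * e M) * \<eta> M"
    unfolding mate_transpose[OF F a e m g] adj_transpose1[OF F F a m f] ..
  finally show ?thesis .
qed

lemma nt_mate:
  assumes F: "fn F" and a: "adj F F \<eta> \<epsilon>" and e: "nt F F e"
  shows "nt F F (mate F \<eta> \<epsilon> e)"
proof -
  note FF = fn_fcomp[OF F F]
  note FFF = fn_fcomp[OF F FF] fn_fcomp[OF FF F]
  have a\<eta>: "nt fid (fcomp F F) \<eta>" and a\<epsilon>: "nt (fcomp F F) fid \<epsilon>" using a by (auto simp: adj_def)
  have "nt (fcomp F F) fid (\<lambda>N. \<epsilon> N * e (fst F N))"
    by (rule nt_comp[OF FF FF fn_fid nt_whisker_right[OF F e] a\<epsilon>])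
  from nt_whisker_left[OF F FF fn_fid this]
  have n2: "nt (fcomp F (fcomp F F)) F (\<lambda>N. snd F (fst F (fst F N)) N (\<epsilon> N * e (fst F N)))"
    unfolding nt_def by simp
  from nt_whisker_right[OF F a\<eta>]
  have n1: "nt F (fcomp F (fcomp F F)) (\<lambda>N. \<eta> (fst F N))"
    unfolding nt_def by simp
  show ?thesis
    using nt_comp[OF F FFF(2) F n1 n2] unfolding mate_def[abs_def] .
qed

text \<open>The mate is itself the transpose of \<open>\<epsilon> e\<close>, so by
  \<open>mate_comp\<close> its square is the transpose of \<open>\<epsilon> e e\<close>.\<close>

lemma mate_idem:
  assumes F: "fn F" and a: "adj F F \<eta> \<epsilon>" and e: "nt F F e" and N: "md N" and idem: "e (fst F N) * e (fst F N) = e (fst F N)"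
  shows "mate F \<eta> \<epsilon> e N * mate F \<eta> \<epsilon> e N = mate F \<eta> \<epsilon> e N"
proof -
  note FN = fn_md[OF F N]
  define m where "m = mate F \<eta> \<epsilon> e N"
  have m: "snd F (fst F (fst F N)) N (\<epsilon> N * e (fst F N)) * \<eta> (fst F N) = m"
    by (simp only: m_def mate_def)
  have "m * (snd F (fst F (fst F N)) N (\<epsilon> N * e (fst F N)) * \<eta> (fst F N))
     = snd F (fst F (fst F N)) N (\<epsilon> N * e (fst F N) * e (fst F N)) * \<eta> (fst F N)"
    unfolding m_def by (rule mate_comp[OF F a e FN N mate_hom(2)[OF F a e N]])
  also have "\<epsilon> N * e (fst F N) * e (fst F N) = \<epsilon> N * (e (fst F N) * e (fst F N))"
    by (rule hom_assoc[OF nt_hom[OF e FN] nt_hom[OF e FN] adj_counit[OF a N]])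
  finally show ?thesis unfolding idem m m_def .
qed

text \<open>If \<open>G\<close> is the image of \<open>e\<close> and \<open>H\<close> the image of
  its mate, then \<open>Hom(G M, N)\<close> is the set of \<open>f\<close> in
  \<open>Hom(F M, N)\<close> with \<open>f e = f\<close>. Transposition turns these into the
  \<open>g\<close> in \<open>Hom(M, F N)\<close> fixed by the mate, which form
  \<open>Hom(M, H N)\<close>.\<close>

lemma adj_summand:
  assumes F: "fn F" and a: "adj F F \<eta> \<epsilon>" and G: "fn G" and H: "fn H"
    and n: "nt G F \<iota>" "nt F G \<pi>" and one: "\<And>M. md M \<Longrightarrow> \<pi> M * \<iota> M = 1\<^sub>m (fst (fst G M))"
    and n': "nt H F \<iota>'" "nt F H \<pi>'" and one': "\<And>M. md M \<Longrightarrow> \<pi>' M * \<iota>' M = 1\<^sub>m (fst (fst H M))"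
    and mate: "\<And>M. md M \<Longrightarrow> \<iota>' M * \<pi>' M = mate F \<eta> \<epsilon> (\<lambda>M. \<iota> M * \<pi> M) M"
  shows "\<exists>\<eta> \<epsilon>. adj G H \<eta> \<epsilon>"
proof -
  let ?e = "\<lambda>M. \<iota> M * \<pi> M"
  have e: "nt F F ?e" by (rule nt_comp[OF F G F n(2,1)])
  have a\<eta>: "nt fid (fcomp F F) \<eta>" and a\<epsilon>: "nt (fcomp F F) fid \<epsilon>" using a by (auto simp: adj_def)
  note FF = fn_fcomp[OF F F] and FG = fn_fcomp[OF G F] and HG = fn_fcomp[OF G H] and GH = fn_fcomp[OF H G] and FH = fn_fcomp[OF H F]
  define \<eta>' where "\<eta>' M = \<pi>' (fst G M) * (snd F (fst F M) (fst G M) (\<pi> M) * \<eta> M)" for M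
  define \<epsilon>' where "\<epsilon>' N = (\<epsilon> N * snd F (fst H N) (fst F N) (\<iota>' N)) * \<iota> (fst H N)" for N
  have n\<eta>: "nt fid (fcomp H G) \<eta>'"
    unfolding \<eta>'_def
    by (rule nt_comp[OF fn_fid FG HG nt_comp[OF fn_fid FF FG a\<eta> nt_whisker_left[OF F F G n(2)]] nt_whisker_right[OF G n'(2)]])
  have n\<epsilon>: "nt (fcomp G H) fid \<epsilon>'"
    unfolding \<epsilon>'_def
    by (rule nt_comp[OF GH FH fn_fid nt_whisker_right[OF H n(1)] nt_comp[OF FH FF fn_fid nt_whisker_left[OF F H F n'(1)] a\<epsilon>]])
  have "adj G H \<eta>' \<epsilon>'"
    unfolding adj_def
  proof (intro conjI allI impI n\<eta> n\<epsilon>)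
    fix M assume M: "md M"
    note FM = fn_md[OF F M] and GM = fn_md[OF G M] and HM = fn_md[OF H M]
    note FFM = fn_md[OF F FM] and FGM = fn_md[OF F GM] and HGM = fn_md[OF H GM] and FHM = fn_md[OF F HM] and GHM = fn_md[OF G HM]
    have \<eta>'h: "\<eta>' M \<in> hom M (fst H (fst G M))" using nt_hom[OF n\<eta> M] by simp
    have \<epsilon>'h: "\<epsilon>' M \<in> hom (fst G (fst H M)) M" using nt_hom[OF n\<epsilon> M] by simp
    let ?g = "snd F (fst F M) (fst G M) (\<pi> M) * \<eta> M"
    have g: "?g \<in> hom M (fst F (fst G M))"
      by (rule hom_mult[OF M FFM FGM adj_unit[OF a M] fn_hom[OF F FM GM nt_hom[OF n(2) M]]])
    note h = nt_hom[OF n(1) M] nt_hom[OF n(2) M] nt_hom[OF n'(1) GM] nt_hom[OF n'(2) GM] nt_hom[OF n(1) HGM]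
       nt_hom[OF n'(1) M] nt_hom[OF n'(2) M]
    note F\<iota>' = fn_hom[OF F HGM FGM h(3)] and G\<eta> = fn_hom[OF G M HGM \<eta>'h] and F\<eta> = fn_hom[OF F M HGM \<eta>'h]
    note d = h[THEN homD] homD[OF F\<iota>'] homD[OF G\<eta>] homD[OF F\<eta>] homD[OF adj_counit[OF a GM]]
    have "\<epsilon>' (fst G M) * snd G M (fst H (fst G M)) (\<eta>' M)
       = (\<epsilon> (fst G M) * snd F (fst H (fst G M)) (fst F (fst G M)) (\<iota>' (fst G M))) * (\<iota> (fst H (fst G M)) * snd G M (fst H (fst G M)) (\<eta>' M))"
      unfolding \<epsilon>'_def using d by (simp add: mat_mult_assoc)
    also have "\<dots> = \<epsilon> (fst G M) * (snd F (fst H (fst G M)) (fst F (fst G M)) (\<iota>' (fst G M)) * snd F M (fst H (fst G M)) (\<eta>' M)) * \<iota> M"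
      unfolding nt_nat[OF n(1) M HGM \<eta>'h, symmetric] using d by (simp add: mat_mult_assoc)
    also have "snd F (fst H (fst G M)) (fst F (fst G M)) (\<iota>' (fst G M)) * snd F M (fst H (fst G M)) (\<eta>' M)
       = snd F M (fst F (fst G M)) (\<iota>' (fst G M) * \<eta>' M)"
      by (rule fn_mult[OF F M HGM FGM \<eta>'h h(3), symmetric])
    also have "\<iota>' (fst G M) * \<eta>' M = (\<iota>' (fst G M) * \<pi>' (fst G M)) * ?g"
      unfolding \<eta>'_def by (rule hom_assoc[symmetric, OF g h(4,3)])
    also have "\<iota>' (fst G M) * \<pi>' (fst G M) = mate F \<eta> \<epsilon> ?e (fst G M)" by (rule mate[OF GM])
    also have "\<epsilon> (fst G M) * snd F M (fst F (fst G M)) (mate F \<eta> \<epsilon> ?e (fst G M) * ?g) = \<epsilon> (fst G M) * snd F M (fst F (fst G M)) ?g * ?e M"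
      by (rule mate_transpose[OF F a e M GM g])
    also have "\<epsilon> (fst G M) * snd F M (fst F (fst G M)) ?g = \<pi> M"
      by (rule adj_transpose1[OF F F a M GM h(2)])
    also have "\<pi> M * ?e M * \<iota> M = (\<pi> M * \<iota> M) * (\<pi> M * \<iota> M)" using d by (simp add: mat_mult_assoc)
    finally show "\<epsilon>' (fst G M) * snd G M (fst H (fst G M)) (\<eta>' M) = 1\<^sub>m (fst (fst G M))"
      unfolding one[OF M] by simp
    note h2 = nt_hom[OF n(1) HM] nt_hom[OF n(2) HM] nt_hom[OF n'(2) GHM]
    let ?f = "\<epsilon> M * snd F (fst H M) (fst F M) (\<iota>' M)"
    note F\<iota>'M = fn_hom[OF F HM FM h(6)]
    have f: "?f \<in> hom (fst F (fst H M)) M" by (rule hom_mult[OF FHM FFM M F\<iota>'M adj_counit[OF a M]])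
    note H\<epsilon> = fn_hom[OF H GHM M \<epsilon>'h] and F\<epsilon> = fn_hom[OF F GHM M \<epsilon>'h] and F\<pi> = fn_hom[OF F FHM GHM h2(2)]
    note d2 = h2[THEN homD] h[THEN homD] homD[OF H\<epsilon>] homD[OF F\<epsilon>] homD[OF F\<pi>] homD[OF f] homD[OF adj_unit[OF a HM]]
    have "snd H (fst G (fst H M)) M (\<epsilon>' M) * \<eta>' (fst H M)
       = (snd H (fst G (fst H M)) M (\<epsilon>' M) * \<pi>' (fst G (fst H M))) * (snd F (fst F (fst H M)) (fst G (fst H M)) (\<pi> (fst H M)) * \<eta> (fst H M))"
      unfolding \<eta>'_def using d2 by (simp add: mat_mult_assoc)
    also have "\<dots> = \<pi>' M * ((snd F (fst G (fst H M)) M (\<epsilon>' M) * snd F (fst F (fst H M)) (fst G (fst H M)) (\<pi> (fst H M))) * \<eta> (fst H M))"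
      unfolding nt_nat[OF n'(2) GHM M \<epsilon>'h] using d2 by (simp add: mat_mult_assoc)
    also have "snd F (fst G (fst H M)) M (\<epsilon>' M) * snd F (fst F (fst H M)) (fst G (fst H M)) (\<pi> (fst H M))
       = snd F (fst F (fst H M)) M (\<epsilon>' M * \<pi> (fst H M))"
      by (rule fn_mult[OF F FHM GHM M h2(2) \<epsilon>'h, symmetric])
    also have "\<epsilon>' M * \<pi> (fst H M) = ?f * ?e (fst H M)"
      unfolding \<epsilon>'_def by (rule hom_assoc[OF h2(2,1) f])
    also have "snd F (fst F (fst H M)) M (?f * ?e (fst H M)) * \<eta> (fst H M) = mate F \<eta> \<epsilon> ?e M * (snd F (fst F (fst H M)) M ?f * \<eta> (fst H M))"
      by (rule mate_comp[OF F a e HM M f, symmetric])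
    also have "snd F (fst F (fst H M)) M ?f * \<eta> (fst H M) = \<iota>' M"
      by (rule adj_transpose2[OF F F a HM M h(6)])
    also have "\<pi>' M * (mate F \<eta> \<epsilon> ?e M * \<iota>' M) = (\<pi>' M * \<iota>' M) * (\<pi>' M * \<iota>' M)"
      unfolding mate[OF M, symmetric] using d by (simp add: mat_mult_assoc)
    finally show "snd H (fst G (fst H M)) M (\<epsilon>' M) * \<eta>' (fst H M) = 1\<^sub>m (fst (fst H M))"
      unfolding one'[OF M] by simp
  qed
  thus ?thesis by blast
qed

end

subsection \<open>Values on simple modules\<close>

context kalg
begin

lemma scal_eqI: "fst N = n \<Longrightarrow> (\<And>a. snd N a = \<chi> a \<cdot>\<^sub>m 1\<^sub>m n) \<Longrightarrow> N = scal n \<chi>"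
  by (rule prod_eqI) (auto simp: scal_def)

lemma snd_scal: "snd (scal n \<chi>) a = \<chi> a \<cdot>\<^sub>m 1\<^sub>m n" by (simp add: scal_def)

lemma scal_quotient:
  assumes m: "md N" and q: "q \<in> hom (scal n \<chi>) N" and s: "s \<in> carrier_mat n (fst N)" "q * s = 1\<^sub>m (fst N)"
  shows "N = scal (fst N) \<chi>"
proof (rule scal_eqI[OF refl])
  fix a
  note c = homD[OF q] s(1) md_dim[OF m]
  have "snd N a = snd N a * (q * s)" using c by (simp add: s(2))
  also have "\<dots> = (q * snd (scal n \<chi>) a) * s" unfolding hom_comm[OF q] using c by (simp add: mat_mult_assoc)
  also have "\<dots> = \<chi> a \<cdot>\<^sub>m (q * s)" using c by (simp add: snd_scal mat_mult_smult mat_smult_mult)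
  finally show "snd N a = \<chi> a \<cdot>\<^sub>m 1\<^sub>m (fst N)" by (simp add: s(2))
qed

lemma scal_sub:
  assumes m: "md N" and i: "i \<in> hom N (scal n \<chi>)" and r: "r \<in> carrier_mat (fst N) n" "r * i = 1\<^sub>m (fst N)"
  shows "N = scal (fst N) \<chi>"
proof (rule scal_eqI[OF refl])
  fix a
  note c = homD[OF i] r(1) md_dim[OF m]
  have "snd N a = (r * i) * snd N a" using c by (simp add: r(2))
  also have "\<dots> = r * (snd (scal n \<chi>) a * i)" unfolding hom_comm[OF i, symmetric] using c by (simp add: mat_mult_assoc)
  also have "\<dots> = \<chi> a \<cdot>\<^sub>m (r * i)" using c by (simp add: snd_scal mat_mult_smult mat_smult_mult)
  finally show "snd N a = \<chi> a \<cdot>\<^sub>m 1\<^sub>m (fst N)" by (simp add: r(2))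
qed

lemma bip_lin:
  assumes \<chi>: "is_char \<chi>" and Y: "md Y" and b: "bip n (lin \<chi>) Y \<iota> \<pi>"
  shows "Y = scal n \<chi>"
proof (rule scal_eqI)
  show n: "fst Y = n" using bip_dim[OF md_lin[OF \<chi>] b] by simp
  fix a
  have "snd Y a = snd Y a * msum (fst Y) (fst Y) (\<lambda>i. \<iota> i * \<pi> i) n"
    unfolding bip_sum[OF b] using md_dim[OF Y] by simp
  also have "\<dots> = msum (fst Y) (fst Y) (\<lambda>i. snd Y a * (\<iota> i * \<pi> i)) n"
    by (rule mult_msum[OF md_carrier[OF Y]]) (rule mult_carrier_mat[OF bip_carrier[OF b]])
  also have "\<dots> = msum (fst Y) (fst Y) (\<lambda>i. (\<chi> a \<cdot>\<^sub>m 1\<^sub>m (fst Y)) * (\<iota> i * \<pi> i)) n"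
  proof (rule msum_cong)
    fix i assume i: "i < n"
    have "snd Y a * (\<iota> i * \<pi> i) = (\<iota> i * snd (lin \<chi>) a) * \<pi> i"
      unfolding hom_comm[OF bip_hom(1)[OF b i]] using md_dim[OF Y] i by (simp add: mat_mult_assoc bip_dims[OF b])
    also have "\<dots> = (\<chi> a \<cdot>\<^sub>m 1\<^sub>m (fst Y)) * (\<iota> i * \<pi> i)"
      using i bip_dims[OF b i] by (simp add: lin_def snd_scal mat_mult_smult mat_smult_mult)
    finally show "snd Y a * (\<iota> i * \<pi> i) = (\<chi> a \<cdot>\<^sub>m 1\<^sub>m (fst Y)) * (\<iota> i * \<pi> i)" .
  qed
  also have "\<dots> = (\<chi> a \<cdot>\<^sub>m 1\<^sub>m (fst Y)) * msum (fst Y) (fst Y) (\<lambda>i. \<iota> i * \<pi> i) n"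
    by (rule mult_msum[symmetric, of _ "fst Y"]) (simp, rule mult_carrier_mat[OF bip_carrier[OF b]])
  finally have "snd Y a = \<chi> a \<cdot>\<^sub>m 1\<^sub>m (fst Y) * 1\<^sub>m (fst Y)" unfolding bip_sum[OF b] .
  thus "snd Y a = \<chi> a \<cdot>\<^sub>m 1\<^sub>m n" by (simp add: n)
qed

lemma surjective_ses:
  assumes m: "md M" "md N" and q: "q \<in> hom M N" and s: "s \<in> carrier_mat (fst M) (fst N)" "q * s = 1\<^sub>m (fst N)"
  obtains K i where "ses K i M q N"
proof -
  obtain K i Q p where ses: "ses K i M p Q"
    and W: "{v \<in> carrier_vec (fst M). q *\<^sub>v v = 0\<^sub>v (fst N)} = {i *\<^sub>v v | v. v \<in> carrier_vec (fst K)}"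
    by (rule submodule_ses[OF m(1) kernel_submodule[OF m q]])
  obtain r where K: "md K" "i \<in> hom K M" and r: "r \<in> carrier_mat (fst K) (fst M)" "r * i = 1\<^sub>m (fst K)"
    by (rule sesE[OF ses]) (rule that; assumption)
  have "q * i = 0\<^sub>m (fst N) (fst K)"
  proof (rule mat_eq_of_vec)
    fix u :: "'k vec" assume u: "u \<in> carrier_vec (fst K)"
    hence "i *\<^sub>v u \<in> {v \<in> carrier_vec (fst M). q *\<^sub>v v = 0\<^sub>v (fst N)}" unfolding W by blast
    thus "(q * i) *\<^sub>v u = 0\<^sub>m (fst N) (fst K) *\<^sub>v u"
      using u K(2)[THEN homD] q[THEN homD] by (auto simp: mat_vec_assoc intro!: eq_vecI)
  qed (use K(2)[THEN homD] q[THEN homD] in auto)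
  hence "ses K i M q N"
  proof (rule sesI[OF K(1) m K(2) q _ r s])
    fix v assume "v \<in> carrier_vec (fst M)" "q *\<^sub>v v = 0\<^sub>v (fst N)"
    hence "v \<in> {i *\<^sub>v v | v. v \<in> carrier_vec (fst K)}" unfolding W[symmetric] by blast
    thus "\<exists>u\<in>carrier_vec (fst K). v = i *\<^sub>v u" by blast
  qed
  thus thesis by (rule that)
qed

text \<open>\<open>n\<close> is the dimension of \<open>Hom(scal n \<psi>, lin \<psi>)\<close>,
  which by adjunction is \<open>Hom(lin \<chi>, F (lin \<psi>))\<close> and so embeds into the space
  \<open>F (lin \<psi>)\<close>. The homomorphisms are the row vectors \<open>rv v\<close>, their
  transposes the columns \<open>G v\<close>, and \<open>A\<close> is the matrix of
  \<open>v \<mapsto> G v\<close>.\<close>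

lemma adj_dim_le:
  assumes F: "fn F" and a: "adj F F \<eta> \<epsilon>" and \<chi>: "is_char \<chi>" and \<psi>: "is_char \<psi>"
    and im: "fst F (lin \<chi>) = scal n \<psi>"
  shows "n \<le> fst (fst F (lin \<psi>))"
proof -
  let ?b = "fst (fst F (lin \<psi>))"
  define rv where "rv v = mat 1 n (\<lambda>(_, j). v $ j)" for v :: "'k vec"
  note S = md_scal[OF \<psi>, of n] and L = md_lin[OF \<chi>] and L' = md_lin[OF \<psi>]
  have rv: "rv v \<in> hom (scal n \<psi>) (lin \<psi>)" for v
    unfolding lin_def hom_scal by (simp add: rv_def)
  have \<eta>: "\<eta> (lin \<chi>) \<in> carrier_mat (fst (fst F (scal n \<psi>))) 1"
    using homD[OF adj_unit[OF a L]] by (simp add: im)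
  define G where "G v = snd F (scal n \<psi>) (lin \<psi>) (rv v) * \<eta> (lin \<chi>)" for v
  note Fc = homD[OF fn_hom[OF F S L' rv]]
  have G: "G v \<in> carrier_mat ?b 1" for v unfolding G_def using Fc[of v] \<eta> by auto
  have untranspose: "\<epsilon> (lin \<psi>) * snd F (lin \<chi>) (fst F (lin \<psi>)) (G v) = rv v" for v
    unfolding G_def using adj_transpose1[OF F F a L L', of "rv v"] rv[of v] by (simp add: im)
  have Gadd: "G (v + w) = G v + G w" if "v \<in> carrier_vec n" "w \<in> carrier_vec n" for v w
  proof -
    have "rv (v + w) = rv v + rv w" using that by (auto simp: rv_def intro!: eq_matI)
    thus ?thesis unfolding G_def using fn_add[OF F S L' rv[of v] rv[of w]] Fc[of v] Fc[of w] \<eta> by (simp add: mat_add_mult)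
  qed
  have Gsm: "G (x \<cdot>\<^sub>v v) = x \<cdot>\<^sub>m G v" if "v \<in> carrier_vec n" for x v
  proof -
    have "rv (x \<cdot>\<^sub>v v) = x \<cdot>\<^sub>m rv v" using that by (auto simp: rv_def intro!: eq_matI)
    thus ?thesis unfolding G_def using fn_smult[OF F S L' rv[of v]] Fc[of v] \<eta> by (simp add: mat_smult_mult)
  qed
  obtain A where A: "A \<in> carrier_mat ?b n" "\<And>v. v \<in> carrier_vec n \<Longrightarrow> A *\<^sub>v v = col (G v) 0"
  proof (rule linear_map_matrix[of n "\<lambda>v. col (G v) 0" ?b])
    show "col (G v) 0 \<in> carrier_vec ?b" for v using G[of v] by (auto intro!: carrier_vecI)
    show "col (G (v + w)) 0 = col (G v) 0 + col (G w) 0" if "v \<in> carrier_vec n" "w \<in> carrier_vec n" for v w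
      using G[of v] G[of w] by (simp add: Gadd[OF that])
    show "col (G (x \<cdot>\<^sub>v v)) 0 = x \<cdot>\<^sub>v col (G v) 0" if "v \<in> carrier_vec n" for x v
      using G[of v] by (simp add: Gsm[OF that])
  qed blast
  obtain B where B: "B \<in> carrier_mat n ?b" "B * A = 1\<^sub>m n"
  proof (rule injective_left_inverse[OF A(1)])
    fix v :: "'k vec" assume v: "v \<in> carrier_vec n" "A *\<^sub>v v = 0\<^sub>v ?b"
    have "G v = 0\<^sub>m ?b 1"
    proof (rule eq_matI)
      fix i j assume "i < dim_row (0\<^sub>m ?b 1)" "j < dim_col (0\<^sub>m ?b 1)"
      hence ij: "i < ?b" "j = 0" by auto
      have "col (G v) 0 $ i = 0" unfolding A(2)[OF v(1), symmetric] v(2) using ij by simp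
      thus "G v $$ (i, j) = 0\<^sub>m ?b 1 $$ (i, j)" using ij G[of v] by simp
    qed (use G[of v] in auto)
    hence "rv v = 0\<^sub>m 1 n"
      using untranspose[of v] fn_zero[OF F L fn_md[OF F L']] homD[OF adj_counit[OF a L']] by (simp add: im)
    hence "rv v $$ (0, j) = 0" if "j < n" for j using that by simp
    thus "v = 0\<^sub>v n" using v(1) by (intro eq_vecI) (auto simp: rv_def)
  qed blast
  show ?thesis by (rule right_inverse_dim_le[OF B(1) A(1) B(2)])
qed

end

context basic_kalg
begin

text \<open>A simple quotient \<open>lin \<psi>\<close> of \<open>F (lin \<chi>)\<close> has \<open>F (lin \<psi>)\<close> as a quotient of the semisimple isotypic
  module \<open>F (F (lin \<chi>))\<close>; this pins down both values.\<close>

lemma functor_on_simple: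
  assumes F: "fn F" and a: "adj F F \<eta> \<epsilon>" and c: "copies k fid (fcomp F F)" and k: "k > 0" and \<chi>: "is_char \<chi>"
  obtains \<psi> m where "is_char \<psi>" "fst F (lin \<chi>) = scal m \<psi>" "fst F (lin \<psi>) = scal m \<chi>" "m * m = k"
proof -
  obtain \<iota> \<pi> where b: "\<And>M. md M \<Longrightarrow> bip k M (fst F (fst F M)) (\<lambda>i. \<iota> i M) (\<lambda>i. \<pi> i M)"
    by (rule copiesE[OF c]) auto
  have FF: "fst F (fst F (lin \<chi>)) = scal k \<chi>" if "is_char \<chi>" for \<chi>
    by (rule bip_lin[OF that fn_md[OF F fn_md[OF F md_lin[OF that]]] b[OF md_lin[OF that]]])
  have nz: "fst (fst F (lin \<chi>)) > 0" if "is_char \<chi>" for \<chi>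
    using fn_dim_zero[OF F fn_md[OF F md_lin[OF that]]] FF[OF that] k by (auto intro: ccontr)
  have ex: "exact F" by (rule adj_exact[OF F a])
  let ?X = "fst F (lin \<chi>)"
  note L = md_lin[OF \<chi>]
  note X = fn_md[OF F L]
  obtain \<psi> q s where \<psi>: "is_char \<psi>" and q: "q \<in> hom ?X (lin \<psi>)" "s \<in> carrier_mat (fst ?X) 1" "q * s = 1\<^sub>m 1"
    by (rule ex_quotient_lin[OF X nz[OF \<chi>]])
  note L' = md_lin[OF \<psi>]
  obtain K i where ses: "ses K i ?X q (lin \<psi>)"
    by (rule surjective_ses[OF X L' q(1)]) (use q in auto)
  obtain s' where s': "s' \<in> carrier_mat (fst (fst F ?X)) (fst (fst F (lin \<psi>)))"
    "snd F ?X (lin \<psi>) q * s' = 1\<^sub>m (fst (fst F (lin \<psi>)))"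
    by (rule sesE[OF exactD[OF ex ses]]) (rule that; assumption)
  define n where "n = fst (fst F (lin \<psi>))"
  have F\<psi>: "fst F (lin \<psi>) = scal n \<chi>"
    unfolding n_def
    by (rule scal_quotient[OF fn_md[OF F L'], of "snd F ?X (lin \<psi>) q" k])
      (use fn_hom[OF F X L' q(1)] s' FF[OF \<chi>] in auto)
  have n0: "n > 0" unfolding n_def by (rule nz[OF \<psi>])
  \<comment> \<open>\<open>F (lin \<psi>)\<close> is n copies of \<open>lin \<chi>\<close>. Applying
    \<open>F\<close> once more, n copies of \<open>F (lin \<chi>)\<close> make up
    \<open>F (F (lin \<psi>)) = scal k \<psi>\<close>, and the first copy embeds
    \<open>F (lin \<chi>)\<close> into this isotypic module.\<close>
  let ?R = "rep_obj n (lin \<chi>)"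
  note R = md_rep_obj[OF L, of n]
  have Rs: "?R = scal n \<chi>" by (rule bip_lin[OF \<chi> R bip_rep[OF L]])
  have FR: "fst F ?R = scal k \<psi>" unfolding Rs F\<psi>[symmetric] by (rule FF[OF \<psi>])
  note bF = bip_fn[OF F L R bip_rep[OF L, of n]]
  define m where "m = fst ?X"
  have F\<chi>: "?X = scal m \<psi>"
    unfolding m_def
  proof (rule scal_sub[OF X])
    show "snd F (lin \<chi>) ?R (inc 1 n 0) \<in> hom ?X (scal k \<psi>)"
      using bip_hom(1)[OF bF n0] FR by simp
    show "snd F ?R (lin \<chi>) (prj 1 n 0) \<in> carrier_mat (fst ?X) k"
      using bip_carrier(2)[OF bF n0] FR by simp
    show "snd F ?R (lin \<chi>) (prj 1 n 0) * snd F (lin \<chi>) ?R (inc 1 n 0) = 1\<^sub>m (fst ?X)"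
      using bip_delta[OF bF n0 n0] by simp
  qed
  \<comment> \<open>The dimension of \<open>F ?R\<close> counted in two ways. Adjunction, used in
    both directions between \<open>\<chi>\<close> and \<open>\<psi>\<close>, then forces
    \<open>n = m\<close>.\<close>
  have "k = n * m" using bip_dim[OF X bF] FR by (simp add: m_def)
  moreover have "m \<le> n" using adj_dim_le[OF F a \<chi> \<psi> F\<chi>] by (simp add: n_def)
  moreover have "n \<le> m" using adj_dim_le[OF F a \<psi> \<chi> F\<psi>] by (simp add: m_def)
  ultimately have "n = m" "m * m = k" by auto
  thus thesis using that[OF \<psi> F\<chi>] F\<psi> by simp
qed

end

subsection \<open>Lifting idempotents\<close>

text \<open>A Newton step for \<open>x\<^sup>2 = x\<close>: \<open>S\<close> is \<open>3 A\<^sup>2 - 2 A\<^sup>3\<close>, written in terms of the defect \<open>D\<close>.\<close>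

lemma idempotent_newton_step:
  fixes A :: "'k::field mat"
  assumes A: "A \<in> carrier_mat n n" and D: "D = A * A + (- 1) \<cdot>\<^sub>m A" and DD: "D * D = 0\<^sub>m n n"
    and S: "S = A * A + (- 2) \<cdot>\<^sub>m (A * D)"
  shows "S * S = S"
proof -
  have Dc: "D \<in> carrier_mat n n" using A by (auto simp: D)
  define B where "B = A * D"
  have Bc: "B \<in> carrier_mat n n" using A Dc by (auto simp: B_def)
  note c = A Dc Bc
  \<comment> \<open>With \<open>D D = 0\<close> the products close up: \<open>A A = A + D\<close>,
    every product of \<open>A\<close> with \<open>D\<close> or \<open>B\<close> is \<open>B\<close>,
    and the products among \<open>D\<close> and \<open>B\<close> vanish. In these terms
    \<open>S = A + D - 2 B\<close>.\<close>
  have AA: "A * A = A + D" using A by (auto simp: D intro!: eq_matI)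
  have AD: "A * D = B" by (simp add: B_def)
  have DA: "D * A = B" using A by (simp add: B_def D mat_simps)
  have AB: "A * B = B"
  proof -
    have "A * B = (A * A) * D" using A Dc by (simp add: B_def mat_mult_assoc)
    thus ?thesis unfolding AA using A Dc by (simp add: mat_add_mult DD AD mat_add_zero carrier_matD[OF Bc])
  qed
  have BD: "B * D = 0\<^sub>m n n" using A Dc by (simp add: B_def mat_mult_assoc DD)
  have DB: "D * B = 0\<^sub>m n n"
  proof -
    have "D * B = (D * A) * D" using A Dc by (simp add: B_def mat_mult_assoc)
    thus ?thesis by (simp add: DA BD)
  qed
  have BA: "B * A = B"
  proof -
    have "B * A = A * (D * A)" using A Dc by (simp add: B_def mat_mult_assoc)
    thus ?thesis by (simp add: DA AB)
  qed
  have BB: "B * B = 0\<^sub>m n n"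
  proof -
    have "B * B = A * (D * B)" using A Dc Bc by (subst (1) B_def) (simp add: mat_mult_assoc)
    thus ?thesis using A by (simp add: DB)
  qed
  have S: "S = A + D + (- 2) \<cdot>\<^sub>m B" by (simp add: S AA AD)
  have 1: "A * S = (A + D) + B + (- 2) \<cdot>\<^sub>m B" and 2: "D * S = B + 0\<^sub>m n n + (- 2) \<cdot>\<^sub>m 0\<^sub>m n n"
    and 3: "B * S = B + 0\<^sub>m n n + (- 2) \<cdot>\<^sub>m 0\<^sub>m n n"
    unfolding S using c by (simp_all add: mat_mult_add mat_mult_smult AA AD AB DA DD DB BA BD BB)
  have Sc: "S \<in> carrier_mat n n" using c by (simp add: S)
  have "S * S = (A + D + (- 2) \<cdot>\<^sub>m B) * S" by (subst (1) S) (rule refl)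
  also have "\<dots> = (A + D) * S + ((- 2) \<cdot>\<^sub>m B) * S" by (rule mat_add_mult) (use c Sc in auto)
  also have "(A + D) * S = A * S + D * S" by (rule mat_add_mult) (use c Sc in auto)
  also have "((- 2) \<cdot>\<^sub>m B) * S = (- 2) \<cdot>\<^sub>m (B * S)" by (rule mat_smult_mult) (use c Sc in auto)
  finally have "S * S = A * S + D * S + (- 2) \<cdot>\<^sub>m (B * S)" .
  also have "\<dots> = S" unfolding 1 2 3 unfolding S
    using c by (intro eq_matI) (auto simp: algebra_simps)
  finally show ?thesis .
qed

lemma idempotent_newton_fixed:
  fixes A :: "'k::field mat"
  assumes A: "A \<in> carrier_mat n n" and idem: "A * A = A"
  shows "A * A + (- 2) \<cdot>\<^sub>m (A * (A * A + (- 1) \<cdot>\<^sub>m A)) = A"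
proof -
  have "A * A + (- 1) \<cdot>\<^sub>m A = 0\<^sub>m n n" unfolding idem using A by (auto intro!: eq_matI)
  moreover have "A * 0\<^sub>m n n = 0\<^sub>m n n" using A by simp
  ultimately show ?thesis using A by (auto simp: idem intro!: eq_matI)
qed

context basic_kalg
begin

text \<open>The defect \<open>y y - y\<close> of a natural endomorphism is again natural. If it
  vanishes on a simple submodule \<open>L\<close> and on the quotient \<open>Q\<close> of
  \<open>M\<close>, then at \<open>M\<close> it kills the image of \<open>F L\<close> and lands in
  the kernel of the map to \<open>F Q\<close>. So its square is zero, and one Newton step makes
  \<open>y M\<close> idempotent.\<close>

lemma lift_idempotent:
  assumes F: "fn F" and ex: "exact F" and x: "nt F F x"
    and idem: "\<And>\<chi>. is_char \<chi> \<Longrightarrow> x (lin \<chi>) * x (lin \<chi>) = x (lin \<chi>)"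
  obtains e where "nt F F e" "\<And>M. md M \<Longrightarrow> e M * e M = e M" "\<And>\<chi>. is_char \<chi> \<Longrightarrow> e (lin \<chi>) = x (lin \<chi>)"
proof -
  define s where "s y = (\<lambda>M. y M * y M + (- 2) \<cdot>\<^sub>m (y M * (y M * y M + (- 1) \<cdot>\<^sub>m y M)))"
    for y :: "('a, 'k) modl \<Rightarrow> 'k mat"
  define X where "X n = (s ^^ n) x" for n
  have snt: "nt F F (s y)" if "nt F F y" for y
    unfolding s_def by (intro nt_add nt_smult nt_comp[OF F F F] F that)
  have Xnt: "nt F F (X n)" for n unfolding X_def using x by (induction n) (auto intro: snt)
  have XS: "X (Suc n) = s (X n)" for n by (simp add: X_def)
  have c: "X n M \<in> carrier_mat (fst (fst F M)) (fst (fst F M))" if "md M" for n M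
    by (rule homD[OF nt_hom[OF Xnt that]])
  have fixed: "X (Suc n) M = X n M" if "md M" "X n M * X n M = X n M" for n M
    unfolding XS s_def by (rule idempotent_newton_fixed[OF c[OF that(1)] that(2)])
  have stable: "X (n + j) M = X n M" if "md M" "X n M * X n M = X n M" for n j M
  proof (induction j)
    case (Suc j)
    show ?case using fixed[OF that(1), of "n + j"] Suc that(2) by simp
  qed simp
  \<comment> \<open>The bound is \<open>n + 1\<close> because \<open>X 0 = x\<close> is, by
    hypothesis, already idempotent in dimension 1.\<close>
  have main: "X n M * X n M = X n M" if "md M" "fst M \<le> n + 1" for n M
    using that
  proof (induction n arbitrary: M)
    case 0
    consider "fst M = 0" | "fst M = 1" using 0(2) by linarith
    thus ?case
    proof cases
      case 1
      thus ?thesis using fn_dim_zero[OF F 0(1)] c[OF 0(1), of 0] by (intro eq_matI) auto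
    next
      case 2
      obtain \<chi> where "is_char \<chi>" "M = lin \<chi>" by (rule one_dim_lin[OF 0(1) 2])
      thus ?thesis using idem by (simp add: X_def)
    qed
  next
    case (Suc n)
    note M = Suc.prems(1)
    show ?case
    proof (cases "fst M = 0")
      case True
      thus ?thesis using fn_dim_zero[OF F M] c[OF M, of "Suc n"] by (intro eq_matI) auto
    next
      case False
      hence M0: "fst M > 0" by simp
      obtain \<chi> i p Q where \<chi>: "is_char \<chi>" and ses: "ses (lin \<chi>) i M p Q"
        by (rule ex_ses_lin[OF M M0])
      let ?L = "lin \<chi>"
      have m: "md ?L" "md M" "md Q" and h: "i \<in> hom ?L M" "p \<in> hom M Q"
        using ses by (auto simp: ses_def)
      have Q: "fst Q \<le> n + 1" using ses_dim[OF ses] Suc.prems(2) by simp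
      obtain r t where rs: "r \<in> carrier_mat (fst (fst F ?L)) (fst (fst F M))" "t \<in> carrier_mat (fst (fst F M)) (fst (fst F Q))"
        and e: "snd F ?L M i * r + t * snd F M Q p = 1\<^sub>m (fst (fst F M))"
        by (rule sesE[OF exactD[OF ex ses]]) (rule that; assumption)
      define d where "d = (\<lambda>M. X n M * X n M + (- 1) \<cdot>\<^sub>m X n M)"
      have dnt: "nt F F d" unfolding d_def by (intro nt_add nt_smult nt_comp[OF F F F] F Xnt)
      have d0: "d N = 0\<^sub>m (fst (fst F N)) (fst (fst F N))" if "md N" "fst N \<le> n + 1" for N
        unfolding d_def Suc.IH[OF that] using c[OF that(1), of n] by (intro eq_matI) auto
      note hF = fn_hom[OF F m(1,2) h(1)] fn_hom[OF F m(2,3) h(2)]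
      note cc = rs hF[THEN homD] homD[OF nt_hom[OF dnt M]]
      have di: "d M * snd F ?L M i = 0\<^sub>m (fst (fst F M)) (fst (fst F ?L))"
        unfolding nt_nat[OF dnt m(1,2) h(1), symmetric] d0[OF m(1), simplified] using cc by simp
      have pd: "snd F M Q p * d M = 0\<^sub>m (fst (fst F Q)) (fst (fst F M))"
        unfolding nt_nat[OF dnt m(2,3) h(2)] d0[OF m(3) Q] using cc by simp
      have "d M = d M * (snd F ?L M i * r + t * snd F M Q p)" unfolding e using cc by simp
      also have "\<dots> = (d M * snd F ?L M i) * r + d M * (t * snd F M Q p)"
        using cc by (simp add: mat_mult_add mat_mult_assoc)
      also have "\<dots> = d M * (t * snd F M Q p)" unfolding di using cc by (simp add: mat_add_zero)
      finally have dM: "d M = d M * (t * snd F M Q p)" .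
      have "d M * d M = (d M * (t * snd F M Q p)) * d M" using dM by (rule arg_cong)
      also have "\<dots> = d M * (t * (snd F M Q p * d M))" using cc by (simp add: mat_mult_assoc)
      finally have dd: "d M * d M = 0\<^sub>m (fst (fst F M)) (fst (fst F M))" unfolding pd using cc by simp
      show ?thesis
        unfolding XS s_def
        by (rule idempotent_newton_step[OF c[OF M, of n], of "d M"]) (use dd in \<open>auto simp: d_def\<close>)
    qed
  qed
  \<comment> \<open>Once idempotent, the iteration is stationary. For a map between two modules both
    values can therefore be read off at the larger number of steps, where naturality is
    known.\<close>
  define e where "e M = X (fst M) M" for M
  have eX: "X n M = e M" if "md M" "fst M \<le> n" for n M
  proof -
    have "X (fst M + (n - fst M)) M = X (fst M) M"
      by (rule stable[OF that(1) main[OF that(1)]]) simp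
    thus ?thesis using that(2) by (simp add: e_def)
  qed
  show thesis
  proof (rule that)
    show "nt F F e"
    proof (rule ntI)
      show "e M \<in> hom (fst F M) (fst F M)" if "md M" for M
        unfolding e_def by (rule nt_hom[OF Xnt that])
      show "snd F M N f * e M = e N * snd F M N f" if m: "md M" "md N" "f \<in> hom M N" for M N f
        using nt_nat[OF Xnt[of "max (fst M) (fst N)"] m] eX[OF m(1), of "max (fst M) (fst N)"]
          eX[OF m(2), of "max (fst M) (fst N)"] by simp
    qed
    show "e M * e M = e M" if "md M" for M unfolding e_def by (rule main[OF that]) simp
    show "e (lin \<chi>) = x (lin \<chi>)" if "is_char \<chi>" for \<chi>
      using stable[OF md_lin[OF that], of 0 1] idem[OF that] by (simp add: e_def X_def)
  qed
qed

end

subsection \<open>Square roots of multiples of the identity functor\<close>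

definition unit_mat :: "nat \<Rightarrow> nat \<Rightarrow> nat \<Rightarrow> 'k::field mat" where
  "unit_mat n i j = mat n n (\<lambda>(r, c). if r = i \<and> c = j then 1 else 0)"

lemma unit_mat_carrier [simp]: "unit_mat n i j \<in> carrier_mat n n"
  and unit_mat_dim [simp]: "dim_row (unit_mat n i j) = n" "dim_col (unit_mat n i j) = n"
  by (auto simp: unit_mat_def)

lemma unit_mat_mult:
  assumes "j < n" "k < n"
  shows "unit_mat n i j * unit_mat n k l = (if j = k then unit_mat n i l else (0\<^sub>m n n :: 'k::field mat))"
proof (rule eq_matI)
  fix r c assume "r < dim_row (if j = k then unit_mat n i l else (0\<^sub>m n n :: 'k mat))"
    "c < dim_col (if j = k then unit_mat n i l else (0\<^sub>m n n :: 'k mat))"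
  hence rc: "r < n" "c < n" by (auto split: if_splits)
  have "(unit_mat n i j * unit_mat n k l :: 'k mat) $$ (r, c)
     = (\<Sum>x\<in>{0..<n}. (if r = i \<and> x = j then 1 else 0) * (if x = k \<and> c = l then 1 else 0))"
    using rc by (simp add: unit_mat_def scalar_prod_def)
  also have "\<dots> = (\<Sum>x\<in>{0..<n}. if x = j then (if r = i \<and> j = k \<and> c = l then 1 else 0) else 0)"
    by (intro sum.cong) auto
  also have "\<dots> = (if r = i \<and> j = k \<and> c = l then 1 else 0)" using assms by simp
  finally show "(unit_mat n i j * unit_mat n k l) $$ (r, c) = (if j = k then unit_mat n i l else (0\<^sub>m n n :: 'k mat)) $$ (r, c)"
    using rc by (simp add: unit_mat_def)
qed auto

lemma sum_unit_mat: "msum n n (\<lambda>j. unit_mat n j j) n = 1\<^sub>m n"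
proof (rule eq_matI)
  fix r c assume "r < dim_row (1\<^sub>m n :: 'a mat)" "c < dim_col (1\<^sub>m n :: 'a mat)"
  hence rc: "r < n" "c < n" by auto
  have "msum n n (\<lambda>j. unit_mat n j j) n $$ (r, c) = (\<Sum>j<n. (unit_mat n j j :: 'a mat) $$ (r, c))"
    by (rule msum_index) (use rc in auto)
  also have "\<dots> = (\<Sum>j<n. if j = r then (if r = c then 1 else 0) else 0)"
    using rc by (intro sum.cong) (auto simp: unit_mat_def)
  finally show "msum n n (\<lambda>j. unit_mat n j j) n $$ (r, c) = (1\<^sub>m n :: 'a mat) $$ (r, c)" using rc by simp
qed auto

section \<open>Natural endomorphisms of a square root of \<open>m\<^sup>2 ID\<close>\<close>

locale square_root = basic_closed_kalg sm for sm :: "'k::field \<Rightarrow> 'a::ring_1 \<Rightarrow> 'a" +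
  fixes F :: "('a, 'k) endofun" and \<eta> \<epsilon> :: "('a, 'k) modl \<Rightarrow> 'k mat" and m :: nat
    and \<iota> \<pi> :: "nat \<Rightarrow> ('a, 'k) modl \<Rightarrow> 'k mat"
  assumes F: "is_functor sm F" and adjoint: "kalg.adj sm F F \<eta> \<epsilon>" and m_pos: "m > 0"
    and \<iota>: "\<And>i. i < m * m \<Longrightarrow> kalg.nt sm fid (fcomp F F) (\<iota> i)"
    and \<pi>: "\<And>i. i < m * m \<Longrightarrow> kalg.nt sm (fcomp F F) fid (\<pi> i)"
    and b: "\<And>M. is_module sm M \<Longrightarrow> kalg.bip (m * m) M (fst F (fst F M)) (\<lambda>i. \<iota> i M) (\<lambda>i. \<pi> i M)"
begin

lemmas FF = fn_fcomp[OF F F]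

lemma unit_nt: "nt fid (fcomp F F) \<eta>" and counit_nt: "nt (fcomp F F) fid \<epsilon>"
  using adjoint by (auto simp: adj_def)

lemma F_exact: "exact F" by (rule adj_exact[OF F adjoint])

lemma FF_copies: "copies (m * m) fid (fcomp F F)"
  by (rule copiesI[of _ _ _ \<iota> \<pi>]) (use \<iota> \<pi> b in auto)

lemma simple_image:
  assumes "is_char \<chi>"
  obtains \<psi> where "is_char \<psi>" "fst F (lin \<chi>) = scal m \<psi>" "fst F (lin \<psi>) = scal m \<chi>"
proof -
  obtain \<psi> n where *: "is_char \<psi>" "fst F (lin \<chi>) = scal n \<psi>" "fst F (lin \<psi>) = scal n \<chi>" "n * n = m * m"
    by (rule functor_on_simple[OF F adjoint FF_copies _ assms]) (use m_pos in auto)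
  have "n = m" using *(4) by (metis power2_eq_iff_nonneg power2_eq_square zero_le)
  thus thesis using that * by simp
qed

lemma dim_image [simp]: "is_char \<chi> \<Longrightarrow> fst (fst F (lin \<chi>)) = m"
  by (rule simple_image) auto

lemma end_carrier: "nt F F y \<Longrightarrow> is_char \<chi> \<Longrightarrow> y (lin \<chi>) \<in> carrier_mat m m"
  using homD[OF nt_hom[OF _ md_lin]] dim_image by metis

text \<open>Natural endomorphisms of the identity functor are the central elements of the algebra;
  two simple modules lie in one block when all of these act on them by the same scalar.\<close>

definition same_block where
  "same_block \<chi> \<psi> \<longleftrightarrow> (\<forall>z. nt fid fid z \<longrightarrow> z (lin \<chi>) = z (lin \<psi>))"

text \<open>\<open>End F = Hom(ID, F \<circ> F)\<close> is free of rank \<open>m * m\<close> over the center, so evaluation at a simple module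
  depends only on the block.\<close>

lemma block_kernel:
  assumes y: "nt F F y" and \<chi>: "is_char \<chi>" and \<psi>: "is_char \<psi>" and s: "same_block \<chi> \<psi>"
    and z: "y (lin \<chi>) = 0\<^sub>m m m"
  shows "y (lin \<psi>) = 0\<^sub>m m m"
proof -
  \<comment> \<open>The transpose of \<open>y\<close>. Its coordinates \<open>\<pi> i * g\<close>
    are natural endomorphisms of the identity, so their values at the two simple modules
    agree.\<close>
  define g where "g M = snd F (fst F M) (fst F M) (y M) * \<eta> M" for M
  have g: "nt fid (fcomp F F) g"
    unfolding g_def by (rule nt_comp[OF fn_fid FF FF unit_nt nt_whisker_left[OF F F F y]])
  have zn: "nt fid fid (\<lambda>M. \<pi> i M * g M)" if "i < m * m" for i
    by (rule nt_comp[OF fn_fid FF fn_fid g \<pi>[OF that]])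
  note L = md_lin[OF \<chi>] and L' = md_lin[OF \<psi>]
  note FL = fn_md[OF F L] and FL' = fn_md[OF F L']
  have g0: "g (lin \<chi>) = 0\<^sub>m (fst (fst F (fst F (lin \<chi>)))) 1"
    unfolding g_def z using fn_zero[OF F FL FL] homD[OF adj_unit[OF adjoint L]] \<chi> by simp
  have gc: "g (lin \<psi>) \<in> carrier_mat (fst (fst F (fst F (lin \<psi>)))) 1"
    using homD[OF nt_hom[OF g L']] by simp
  have "g (lin \<psi>) = 0\<^sub>m (fst (fst F (fst F (lin \<psi>)))) 1"
  proof (rule bip_joint_mono[OF b[OF L'] gc])
    fix i assume i: "i < m * m"
    have "\<pi> i (lin \<psi>) * g (lin \<psi>) = \<pi> i (lin \<chi>) * g (lin \<chi>)"
      using s zn[OF i] unfolding same_block_def by metis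
    also have "\<dots> = 0\<^sub>m 1 1" unfolding g0 using bip_carrier(2)[OF b[OF L] i] by simp
    finally show "\<pi> i (lin \<psi>) * g (lin \<psi>) = 0\<^sub>m (fst (lin \<psi>)) 1" by simp
  qed
  moreover have "y (lin \<psi>) = \<epsilon> (fst F (lin \<psi>)) * snd F (lin \<psi>) (fst F (fst F (lin \<psi>))) (g (lin \<psi>))"
    unfolding g_def by (rule adj_transpose1[OF F F adjoint L' FL' nt_hom[OF y L'], symmetric])
  ultimately show ?thesis
    using fn_zero[OF F L' fn_md[OF F FL']] homD[OF adj_counit[OF adjoint FL']] \<psi> by simp
qed

lemma block_eq:
  assumes y: "nt F F y" "nt F F y'" and \<chi>: "is_char \<chi>" and \<psi>: "is_char \<psi>" and s: "same_block \<chi> \<psi>"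
    and e: "y (lin \<chi>) = y' (lin \<chi>)"
  shows "y (lin \<psi>) = y' (lin \<psi>)"
proof -
  note c = end_carrier[OF y(1) \<chi>] end_carrier[OF y(2) \<chi>] end_carrier[OF y(1) \<psi>] end_carrier[OF y(2) \<psi>]
  let ?d = "\<lambda>M. y M + (- 1) \<cdot>\<^sub>m y' M"
  have d: "nt F F ?d" by (intro nt_add nt_smult F y)
  have "?d (lin \<chi>) = 0\<^sub>m m m" unfolding e using c by (intro eq_matI) auto
  hence z: "?d (lin \<psi>) = 0\<^sub>m m m" by (rule block_kernel[OF d \<chi> \<psi> s])
  show ?thesis
  proof (rule eq_matI)
    fix i j assume ij: "i < dim_row (y' (lin \<psi>))" "j < dim_col (y' (lin \<psi>))"
    have "?d (lin \<psi>) $$ (i, j) = 0" unfolding z using ij c by simp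
    thus "y (lin \<psi>) $$ (i, j) = y' (lin \<psi>) $$ (i, j)" using ij c by simp
  qed (use c in auto)
qed

text \<open>The transpose \<open>g\<close> of \<open>f\<close> lives at the single module
  \<open>lin \<chi>\<close>, where its coordinates are scalars \<open>c i\<close>. The combination
  of the natural maps \<open>\<iota> i\<close> with these constants extends \<open>g\<close> to all
  modules, and transposing back gives \<open>x\<close>.\<close>

lemma evaluation_surj:
  assumes \<chi>: "is_char \<chi>" and f: "f \<in> carrier_mat m m"
  obtains x where "nt F F x" "x (lin \<chi>) = f"
proof -
  obtain \<psi> where \<psi>: "is_char \<psi>" "fst F (lin \<chi>) = scal m \<psi>" by (rule simple_image[OF \<chi>])
  let ?L = "lin \<chi>"
  note L = md_lin[OF \<chi>]
  note FL = fn_md[OF F L] and bL = b[OF L]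
  note FFL = fn_md[OF F FL]
  have fh: "f \<in> hom (fst F ?L) (fst F ?L)" unfolding \<psi>(2) hom_scal by (rule f)
  define g where "g = snd F (fst F ?L) (fst F ?L) f * \<eta> ?L"
  have g: "g \<in> hom ?L (fst F (fst F ?L))"
    unfolding g_def by (rule hom_mult[OF L FFL FFL adj_unit[OF adjoint L] fn_hom[OF F FL FL fh]])
  define c where "c i = (\<pi> i ?L * g) $$ (0, 0)" for i
  define w where "w M = msum (fst (fst F (fst F M))) (fst M) (\<lambda>i. c i \<cdot>\<^sub>m \<iota> i M) (m * m)" for M
  have w: "nt fid (fcomp F F) w"
    using nt_msum[OF fn_fid FF nt_smult[OF fn_fid FF \<iota>]] unfolding w_def by simp
  have "w ?L = msum (fst (fst F (fst F ?L))) (fst ?L) (\<lambda>i. (\<iota> i ?L * \<pi> i ?L) * g) (m * m)"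
    unfolding w_def
  proof (rule msum_cong)
    fix i assume i: "i < m * m"
    note d = bip_carrier[OF bL i] homD[OF g]
    have "\<pi> i ?L * g = c i \<cdot>\<^sub>m 1\<^sub>m 1" using d by (auto simp: c_def intro!: eq_matI)
    hence "(\<iota> i ?L * \<pi> i ?L) * g = \<iota> i ?L * (c i \<cdot>\<^sub>m 1\<^sub>m 1)" using d by (simp add: mat_mult_assoc)
    thus "c i \<cdot>\<^sub>m \<iota> i ?L = (\<iota> i ?L * \<pi> i ?L) * g" using d by (simp add: mat_mult_smult)
  qed
  also have "\<dots> = msum (fst (fst F (fst F ?L))) (fst (fst F (fst F ?L))) (\<lambda>i. \<iota> i ?L * \<pi> i ?L) (m * m) * g"
    by (rule msum_mult[symmetric, OF homD[OF g]]) (rule mult_carrier_mat[OF bip_carrier[OF bL]])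
  also have "\<dots> = g" unfolding bip_sum[OF bL] using homD[OF g] by simp
  finally have wL: "w ?L = g" .
  define x where "x M = \<epsilon> (fst F M) * snd F M (fst F (fst F M)) (w M)" for M
  have "nt (fcomp F fid) (fcomp F (fcomp F F)) (\<lambda>M. snd F M (fst F (fst F M)) (w M))"
    using nt_whisker_left[OF F fn_fid FF w] by simp
  hence 1: "nt F (fcomp F (fcomp F F)) (\<lambda>M. snd F M (fst F (fst F M)) (w M))"
    unfolding nt_def by simp
  from nt_whisker_right[OF F counit_nt]
  have 2: "nt (fcomp F (fcomp F F)) F (\<lambda>M. \<epsilon> (fst F M))"
    unfolding nt_def by simp
  have "nt F F x" unfolding x_def by (rule nt_comp[OF F fn_fcomp[OF FF F] F 1 2])
  moreover have "x ?L = f"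
    unfolding x_def wL g_def by (rule adj_transpose1[OF F F adjoint L FL fh])
  ultimately show thesis by (rule that)
qed

text \<open>On \<open>F (lin \<chi>)\<close>, the endomorphisms \<open>a j\<close>, \<open>b' j\<close> and \<open>x\<close> act like the matrix units with indices
  \<open>(j, 0)\<close>, \<open>(0, j)\<close> and \<open>(0, 0)\<close>.\<close>

definition unit_system where
  "unit_system a b' x \<chi> \<longleftrightarrow> x (lin \<chi>) * x (lin \<chi>) = x (lin \<chi>) \<and>
     (\<forall>i<m. \<forall>j<m. b' i (lin \<chi>) * a j (lin \<chi>) = (if i = j then x (lin \<chi>) else 0\<^sub>m m m)) \<and>
     msum m m (\<lambda>j. a j (lin \<chi>) * (x (lin \<chi>) * b' j (lin \<chi>))) m = 1\<^sub>m m"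

text \<open>Each condition is an equation between evaluations of natural endomorphisms of
  \<open>F\<close>, and such equations propagate through a block.\<close>

lemma unit_system_block:
  assumes n: "\<And>j. nt F F (a j)" "\<And>j. nt F F (b' j)" "nt F F x" and \<chi>: "is_char \<chi>" and \<psi>: "is_char \<psi>"
    and s: "same_block \<chi> \<psi>" and u: "unit_system a b' x \<chi>"
  shows "unit_system a b' x \<psi>"
  unfolding unit_system_def
proof (intro conjI allI impI)
  show "x (lin \<psi>) * x (lin \<psi>) = x (lin \<psi>)"
    by (rule block_eq[OF nt_comp[OF F F F n(3,3)] n(3) \<chi> \<psi> s]) (use u in \<open>simp add: unit_system_def\<close>)
  fix i j assume ij: "i < m" "j < m"
  show "b' i (lin \<psi>) * a j (lin \<psi>) = (if i = j then x (lin \<psi>) else 0\<^sub>m m m)"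
  proof (cases "i = j")
    case True
    have "b' i (lin \<psi>) * a j (lin \<psi>) = x (lin \<psi>)"
      by (rule block_eq[OF nt_comp[OF F F F n(1,2)] n(3) \<chi> \<psi> s]) (use u ij True in \<open>simp add: unit_system_def\<close>)
    thus ?thesis using True by simp
  next
    case False
    have "b' i (lin \<psi>) * a j (lin \<psi>) = 0\<^sub>m m m"
      by (rule block_kernel[OF nt_comp[OF F F F n(1,2)] \<chi> \<psi> s]) (use u ij False in \<open>simp add: unit_system_def\<close>)
    thus ?thesis using False by simp
  qed
next
  let ?S = "\<lambda>M. msum (fst (fst F M)) (fst (fst F M)) (\<lambda>j. a j M * (x M * b' j M)) m"
  have S: "nt F F ?S" by (intro nt_msum F nt_comp[OF F F F] n)
  have "?S (lin \<psi>) = 1\<^sub>m (fst (fst F (lin \<psi>)))"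
    by (rule block_eq[OF S nt_id[OF F] \<chi> \<psi> s]) (use u \<chi> in \<open>simp add: unit_system_def\<close>)
  thus "msum m m (\<lambda>j. a j (lin \<psi>) * (x (lin \<psi>) * b' j (lin \<psi>))) m = 1\<^sub>m m" using \<psi> by simp
qed

lemma lin_end_carrier: "nt fid fid z \<Longrightarrow> is_char \<chi> \<Longrightarrow> z (lin \<chi>) \<in> carrier_mat 1 1"
  using homD[OF nt_hom[OF _ md_lin]] fst_fid fst_lin by metis

text \<open>The scalars by which central elements act form an algebra of functions on the
  characters. Different blocks are separated by definition, so interpolation applies.\<close>

lemma separate_blocks:
  assumes fin: "finite J" "J \<subseteq> {\<chi>. is_char \<chi>}" and \<psi>: "is_char \<psi>" and nb: "\<And>\<chi>. \<chi> \<in> J \<Longrightarrow> \<not> same_block \<chi> \<psi>"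
  obtains u where "nt fid fid u" "u (lin \<psi>) = 1\<^sub>m 1" "\<And>\<chi>. \<chi> \<in> J \<Longrightarrow> u (lin \<chi>) = 0\<^sub>m 1 1"
proof -
  define S where "S = {f. \<exists>z. nt fid fid z \<and> (\<forall>\<chi>. is_char \<chi> \<longrightarrow> f \<chi> = z (lin \<chi>) $$ (0, 0))}"
  have SI: "f \<in> S" if "nt fid fid z" "\<And>\<chi>. is_char \<chi> \<Longrightarrow> f \<chi> = z (lin \<chi>) $$ (0, 0)" for f z
    using that unfolding S_def by blast
  have id: "nt fid fid (\<lambda>M. 1\<^sub>m (fst M))" using nt_id[OF fn_fid] by simp
  have "\<exists>f\<in>S. f \<psi> = 1 \<and> (\<forall>\<chi>\<in>J. f \<chi> = 0)"
  proof (rule separate_points[OF _ _ _ fin(1)])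
    show "(\<lambda>_. 1) \<in> S" by (rule SI[OF id]) simp
    show "(\<lambda>i. x * f i + y) \<in> S" if f: "f \<in> S" for f x y
    proof -
      obtain z where z: "nt fid fid z" "\<And>\<chi>. is_char \<chi> \<Longrightarrow> f \<chi> = z (lin \<chi>) $$ (0, 0)"
        using f unfolding S_def by blast
      show ?thesis
      proof (rule SI)
        show "nt fid fid (\<lambda>M. x \<cdot>\<^sub>m z M + y \<cdot>\<^sub>m 1\<^sub>m (fst M))"
          by (intro nt_add nt_smult fn_fid z(1) id)
        show "x * f \<chi> + y = (x \<cdot>\<^sub>m z (lin \<chi>) + y \<cdot>\<^sub>m 1\<^sub>m (fst (lin \<chi>))) $$ (0, 0)" if "is_char \<chi>" for \<chi>
          using lin_end_carrier[OF z(1) that] z(2)[OF that] by simp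
      qed
    qed
    show "(\<lambda>i. f i * g i) \<in> S" if fg: "f \<in> S" "g \<in> S" for f g
    proof -
      obtain z where z: "nt fid fid z" "\<And>\<chi>. is_char \<chi> \<Longrightarrow> f \<chi> = z (lin \<chi>) $$ (0, 0)"
        using fg unfolding S_def by blast
      obtain w where w: "nt fid fid w" "\<And>\<chi>. is_char \<chi> \<Longrightarrow> g \<chi> = w (lin \<chi>) $$ (0, 0)"
        using fg unfolding S_def by blast
      show ?thesis
      proof (rule SI)
        show "nt fid fid (\<lambda>M. z M * w M)" by (rule nt_comp[OF fn_fid fn_fid fn_fid w(1) z(1)])
        show "f \<chi> * g \<chi> = (z (lin \<chi>) * w (lin \<chi>)) $$ (0, 0)" if "is_char \<chi>" for \<chi>
          using lin_end_carrier[OF z(1) that] z(2)[OF that] lin_end_carrier[OF w(1) that] w(2)[OF that]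
          by (simp add: scalar_prod_def)
      qed
    qed
    show "\<exists>f\<in>S. f \<psi> \<noteq> f \<chi>" if \<chi>J: "\<chi> \<in> J" for \<chi>
    proof -
      have \<chi>: "is_char \<chi>" using \<chi>J fin by blast
      obtain z where z: "nt fid fid z" "z (lin \<chi>) \<noteq> z (lin \<psi>)"
        using nb[OF \<chi>J] unfolding same_block_def by blast
      have "(\<lambda>\<chi>. z (lin \<chi>) $$ (0, 0)) \<in> S" by (rule SI[OF z(1)]) simp
      moreover have "z (lin \<psi>) $$ (0, 0) \<noteq> z (lin \<chi>) $$ (0, 0)"
      proof
        assume "z (lin \<psi>) $$ (0, 0) = z (lin \<chi>) $$ (0, 0)"
        hence "z (lin \<chi>) = z (lin \<psi>)"
          using lin_end_carrier[OF z(1) \<chi>] lin_end_carrier[OF z(1) \<psi>] by (intro eq_matI) auto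
        thus False using z(2) by simp
      qed
      ultimately show ?thesis by (intro bexI[of _ "\<lambda>\<chi>. z (lin \<chi>) $$ (0, 0)"])
    qed
  qed
  then obtain f where f: "f \<in> S" "f \<psi> = 1" "\<forall>\<chi>\<in>J. f \<chi> = 0" by blast
  then obtain z where z: "nt fid fid z" "\<And>\<chi>. is_char \<chi> \<Longrightarrow> f \<chi> = z (lin \<chi>) $$ (0, 0)" unfolding S_def by blast
  show thesis
  proof (rule that[OF z(1)])
    show "z (lin \<psi>) = 1\<^sub>m 1" using lin_end_carrier[OF z(1) \<psi>] z(2)[OF \<psi>] f(2) by (intro eq_matI) auto
    show "z (lin \<chi>) = 0\<^sub>m 1 1" if "\<chi> \<in> J" for \<chi>
    proof -
      have \<chi>: "is_char \<chi>" using that fin by blast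
      show ?thesis using lin_end_carrier[OF z(1) \<chi>] z(2)[OF \<chi>] f(3) that by (intro eq_matI) auto
    qed
  qed
qed

text \<open>Simple modules are added one at a time. One from a block already met inherits the
  system. For a new block the matrix units at \<open>\<psi>\<close> are lifted by
  \<open>evaluation_surj\<close>, with no control over their other values, and a central element
  glues them to the old system.\<close>

lemma ex_unit_system:
  assumes "finite J" "J \<subseteq> {\<chi>. is_char \<chi>}"
  shows "\<exists>a b' x. (\<forall>j. nt F F (a j)) \<and> (\<forall>j. nt F F (b' j)) \<and> nt F F x \<and> (\<forall>\<chi>\<in>J. unit_system a b' x \<chi>)"
  using assms
proof (induction J)
  case empty
  show ?case using nt_id[OF F] by (intro exI[of _ "\<lambda>_ M. 1\<^sub>m (fst (fst F M))"] exI[of _ "\<lambda>M. 1\<^sub>m (fst (fst F M))"]) auto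
next
  case (insert \<psi> J)
  have \<psi>: "is_char \<psi>" and J: "J \<subseteq> {\<chi>. is_char \<chi>}" using insert.prems by auto
  obtain a b' x where n: "\<And>j. nt F F (a j)" "\<And>j. nt F F (b' j)" "nt F F x"
    and u: "\<And>\<chi>. \<chi> \<in> J \<Longrightarrow> unit_system a b' x \<chi>"
    using insert.IH[OF J] by blast
  show ?case
  proof (cases "\<exists>\<chi>\<in>J. same_block \<chi> \<psi>")
    case True
    then obtain \<chi> where \<chi>: "\<chi> \<in> J" "same_block \<chi> \<psi>" by blast
    have "unit_system a b' x \<psi>"
      by (rule unit_system_block[OF n _ \<psi> \<chi>(2) u[OF \<chi>(1)]]) (use \<chi>(1) J in blast)
    hence "\<forall>\<chi>\<in>insert \<psi> J. unit_system a b' x \<chi>" using u by blast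
    thus ?thesis using n by blast
  next
    case False
    obtain z where z: "nt fid fid z" "z (lin \<psi>) = 1\<^sub>m 1" "\<And>\<chi>. \<chi> \<in> J \<Longrightarrow> z (lin \<chi>) = 0\<^sub>m 1 1"
      by (rule separate_blocks[OF insert.hyps(1) J \<psi>]) (use False in auto)
    \<comment> \<open>\<open>z\<close> is 1 at \<open>\<psi>\<close> and 0 on \<open>J\<close>, so
      the mixture agrees with \<open>y\<close> on \<open>J\<close> and with \<open>y'\<close> at
      \<open>\<psi>\<close>. On other modules \<open>z\<close> may fail to be idempotent, which is
      harmless because unit systems concern values on simple modules.\<close>
    define mix where "mix y y' M = y M * snd F M M (1\<^sub>m (fst M) + (- 1) \<cdot>\<^sub>m z M) + y' M * snd F M M (z M)" for y y' M
    have id: "nt fid fid (\<lambda>M. 1\<^sub>m (fst M))" using nt_id[OF fn_fid] by simp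
    have zc: "nt fid fid (\<lambda>M. 1\<^sub>m (fst M) + (- 1) \<cdot>\<^sub>m z M)" by (intro nt_add nt_smult fn_fid id z(1))
    have "nt (fcomp F fid) (fcomp F fid) (\<lambda>M. snd F M M (z M))" using nt_whisker_left[OF F fn_fid fn_fid z(1)] by simp
    hence n1: "nt F F (\<lambda>M. snd F M M (z M))" unfolding nt_def by simp
    have "nt (fcomp F fid) (fcomp F fid) (\<lambda>M. snd F M M (1\<^sub>m (fst M) + (- 1) \<cdot>\<^sub>m z M))"
      using nt_whisker_left[OF F fn_fid fn_fid zc] by simp
    hence n2: "nt F F (\<lambda>M. snd F M M (1\<^sub>m (fst M) + (- 1) \<cdot>\<^sub>m z M))" unfolding nt_def by simp
    have mix: "nt F F (mix y y')" if "nt F F y" "nt F F y'" for y y'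
      unfolding mix_def by (intro nt_add F nt_comp[OF F F F] that n1 n2)
    have mixJ: "mix y y' (lin \<chi>) = y (lin \<chi>)" if y: "nt F F y" "nt F F y'" and \<chi>J: "\<chi> \<in> J" for y y' \<chi>
    proof -
      have \<chi>: "is_char \<chi>" using \<chi>J J by blast
      note L = md_lin[OF \<chi>]
      have "1\<^sub>m 1 + (- 1) \<cdot>\<^sub>m 0\<^sub>m 1 1 = (1\<^sub>m 1 :: 'k mat)" by (intro eq_matI) auto
      thus ?thesis unfolding mix_def z(3)[OF \<chi>J]
        using fn_one[OF F L] fn_zero[OF F L L] end_carrier[OF y(1) \<chi>] end_carrier[OF y(2) \<chi>] \<chi> by simp
    qed
    have mix\<psi>: "mix y y' (lin \<psi>) = y' (lin \<psi>)" if y: "nt F F y" "nt F F y'" for y y'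
    proof -
      note L = md_lin[OF \<psi>]
      have "1\<^sub>m 1 + (- 1) \<cdot>\<^sub>m 1\<^sub>m 1 = (0\<^sub>m 1 1 :: 'k mat)" by (intro eq_matI) auto
      thus ?thesis unfolding mix_def z(2)
        using fn_one[OF F L] fn_zero[OF F L L] end_carrier[OF y(1) \<psi>] end_carrier[OF y(2) \<psi>] \<psi> by simp
    qed
    have "\<exists>y. nt F F y \<and> y (lin \<psi>) = unit_mat m i j" for i j
      using evaluation_surj[OF \<psi> unit_mat_carrier] by metis
    then obtain e where e: "\<And>i j. nt F F (e i j)" "\<And>i j. e i j (lin \<psi>) = unit_mat m i j" by metis
    define a1 where "a1 j = mix (a j) (e j 0)" for j
    define b1 where "b1 j = mix (b' j) (e 0 j)" for j
    define x1 where "x1 = mix x (e 0 0)"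
    have n1: "\<And>j. nt F F (a1 j)" "\<And>j. nt F F (b1 j)" "nt F F x1"
      unfolding a1_def b1_def x1_def by (intro mix n e)+
    have "unit_system a1 b1 x1 \<chi>" if "\<chi> \<in> J" for \<chi>
      using u[OF that] unfolding unit_system_def a1_def b1_def x1_def
      by (simp add: mixJ[OF n(1) e(1) that] mixJ[OF n(2) e(1) that] mixJ[OF n(3) e(1) that])
    moreover have "unit_system a1 b1 x1 \<psi>"
      unfolding unit_system_def a1_def b1_def x1_def
        mix\<psi>[OF n(1) e(1)] mix\<psi>[OF n(2) e(1)] mix\<psi>[OF n(3) e(1)] e(2)
    proof (intro conjI allI impI)
      show "unit_mat m 0 0 * unit_mat m 0 0 = (unit_mat m 0 0 :: 'k mat)" using m_pos by (simp add: unit_mat_mult)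
      show "unit_mat m 0 i * unit_mat m j 0 = (if i = j then unit_mat m 0 0 else 0\<^sub>m m m :: 'k mat)" if "i < m" "j < m" for i j
        using that by (simp add: unit_mat_mult)
      have "msum m m (\<lambda>j. unit_mat m j 0 * (unit_mat m 0 0 * unit_mat m 0 j)) m = msum m m (\<lambda>j. unit_mat m j j :: 'k mat) m"
        by (rule msum_cong) (use m_pos in \<open>simp add: unit_mat_mult\<close>)
      thus "msum m m (\<lambda>j. unit_mat m j 0 * (unit_mat m 0 0 * unit_mat m 0 j)) m = (1\<^sub>m m :: 'k mat)"
        by (simp add: sum_unit_mat)
    qed
    ultimately have "\<forall>\<chi>\<in>insert \<psi> J. unit_system a1 b1 x1 \<chi>" by blast
    thus ?thesis using n1 by blast
  qed
qed

lemma ex_root: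
  obtains G \<kappa> \<rho> where "fn G" "nt G F \<kappa>" "nt F G \<rho>" "\<And>M. md M \<Longrightarrow> \<rho> M * \<kappa> M = 1\<^sub>m (fst (fst G M))"
    "copies m G F" "\<And>\<chi>. is_char \<chi> \<Longrightarrow> fst (fst G (lin \<chi>)) = 1"
proof -
  obtain a b' x where n: "\<And>j. nt F F (a j)" "\<And>j. nt F F (b' j)" "nt F F x"
    and u: "\<And>\<chi>. is_char \<chi> \<Longrightarrow> unit_system a b' x \<chi>"
    using ex_unit_system[OF finite_chars] by blast
  obtain e where e: "nt F F e" "\<And>M. md M \<Longrightarrow> e M * e M = e M" "\<And>\<chi>. is_char \<chi> \<Longrightarrow> e (lin \<chi>) = x (lin \<chi>)"
    by (rule lift_idempotent[OF F F_exact n(3)]) (use u in \<open>auto simp: unit_system_def\<close>)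
  obtain G \<kappa> \<rho> where G: "fn G" and \<kappa>: "nt G F \<kappa>" and \<rho>: "nt F G \<rho>"
    and \<rho>\<kappa>: "\<And>M. md M \<Longrightarrow> \<rho> M * \<kappa> M = 1\<^sub>m (fst (fst G M))" and \<kappa>\<rho>: "\<And>M. md M \<Longrightarrow> \<kappa> M * \<rho> M = e M"
    using functor_split[OF F e(1,2)] by blast
  have exG: "exact G" by (rule exact_summand[OF F G F_exact \<kappa> \<rho> \<rho>\<kappa>])
  let ?H = "fmult m G"
  have H: "fn ?H" by (rule fn_fmult[OF G])
  have exH: "exact ?H" by (rule exact_copies[OF G H exG copies_fmult[OF G]])
  obtain i p where i: "\<And>j. j < m \<Longrightarrow> nt G ?H (i j)" and p: "\<And>j. j < m \<Longrightarrow> nt ?H G (p j)"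
    and bH: "\<And>M. md M \<Longrightarrow> bip m (fst G M) (fst ?H M) (\<lambda>j. i j M) (\<lambda>j. p j M)"
    using copiesE[OF copies_fmult[OF G]] by blast
  \<comment> \<open>\<open>e\<close> is known to agree with \<open>x\<close> on simple modules, and
    there the matrix unit relations make \<open>\<alpha>\<close> and \<open>\<beta>\<close> mutually
    inverse. Elsewhere \<open>\<beta>\<close> need not invert \<open>\<alpha>\<close>; invertibility
    of \<open>\<alpha>\<close> comes from \<open>nat_iso_of_simple\<close>.\<close>
  define \<alpha> where "\<alpha> M = msum (fst (fst F M)) (fst (fst ?H M)) (\<lambda>j. (a j M * \<kappa> M) * p j M) m" for M
  define \<beta> where "\<beta> M = msum (fst (fst ?H M)) (fst (fst F M)) (\<lambda>j. i j M * (\<rho> M * b' j M)) m" for M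
  have \<alpha>: "nt ?H F \<alpha>"
    unfolding \<alpha>_def by (intro nt_msum H F nt_comp[OF H G F] nt_comp[OF G F F] \<kappa> n p)
  have \<beta>: "nt F ?H \<beta>"
    unfolding \<beta>_def by (intro nt_msum H F nt_comp[OF F G H] nt_comp[OF F F G] \<rho> n i)
  have inv: "\<beta> (lin \<chi>) * \<alpha> (lin \<chi>) = 1\<^sub>m (fst (fst ?H (lin \<chi>)))" "\<alpha> (lin \<chi>) * \<beta> (lin \<chi>) = 1\<^sub>m m"
    if \<chi>: "is_char \<chi>" for \<chi>
  proof -
    let ?L = "lin \<chi>"
    note L = md_lin[OF \<chi>]
    note bL = bH[OF L]
    define g where "g = fst (fst G ?L)"
    define h where "h = fst (fst ?H ?L)"
    have ac: "a j ?L \<in> carrier_mat m m" "b' j ?L \<in> carrier_mat m m" "x ?L \<in> carrier_mat m m" for j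
      by (intro end_carrier n \<chi>)+
    have kc: "\<kappa> ?L \<in> carrier_mat m g" "\<rho> ?L \<in> carrier_mat g m"
      using homD[OF nt_hom[OF \<kappa> L]] homD[OF nt_hom[OF \<rho> L]] \<chi> by (auto simp: g_def)
    have pc: "i j ?L \<in> carrier_mat h g" "p j ?L \<in> carrier_mat g h" if "j < m" for j
      using bip_carrier[OF bL that] by (auto simp: g_def h_def)
    have \<alpha>E: "\<alpha> ?L = msum m h (\<lambda>j. (a j ?L * \<kappa> ?L) * p j ?L) m"
      and \<beta>E: "\<beta> ?L = msum h m (\<lambda>j. i j ?L * (\<rho> ?L * b' j ?L)) m"
      by (simp_all only: \<alpha>_def \<beta>_def h_def dim_image[OF \<chi>])
    have \<alpha>c: "\<alpha> ?L \<in> carrier_mat m h" and \<beta>c: "\<beta> ?L \<in> carrier_mat h m"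
      using \<chi> by (auto simp: \<alpha>_def \<beta>_def h_def intro!: carrier_matI)
    have us: "b' j ?L * a l ?L = (if j = l then x ?L else 0\<^sub>m m m)" if "j < m" "l < m" for j l
      using u[OF \<chi>] that by (simp add: unit_system_def)
    have \<kappa>\<rho>L: "\<kappa> ?L * \<rho> ?L = x ?L" using \<kappa>\<rho>[OF L] e(3)[OF \<chi>] by simp
    have \<rho>\<kappa>L: "\<rho> ?L * \<kappa> ?L = 1\<^sub>m g" using \<rho>\<kappa>[OF L] by (simp add: g_def)
    have \<rho>x\<kappa>: "\<rho> ?L * (x ?L * \<kappa> ?L) = 1\<^sub>m g"
    proof -
      have "\<rho> ?L * (x ?L * \<kappa> ?L) = (\<rho> ?L * \<kappa> ?L) * (\<rho> ?L * \<kappa> ?L)"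
        unfolding \<kappa>\<rho>L[symmetric] using kc by (simp add: mat_mult_assoc)
      thus ?thesis unfolding \<rho>\<kappa>L by simp
    qed
    have p\<beta>: "p j ?L * \<beta> ?L = \<rho> ?L * b' j ?L" if "j < m" for j
      using bip_pr_sum[OF bL that, of "\<lambda>j. \<rho> ?L * b' j ?L" m] mult_carrier_mat[OF kc(2) ac(2)] \<chi>
      by (simp add: \<beta>_def g_def)
    have \<alpha>i: "\<alpha> ?L * i j ?L = a j ?L * \<kappa> ?L" if "j < m" for j
      using bip_sum_in[OF bL that, of "\<lambda>j. a j ?L * \<kappa> ?L" m] mult_carrier_mat[OF ac(1) kc(1)] \<chi>
      by (simp add: \<alpha>_def g_def)
    have "\<alpha> ?L * \<beta> ?L = msum m m (\<lambda>j. ((a j ?L * \<kappa> ?L) * p j ?L) * \<beta> ?L) m"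
      by (subst \<alpha>E, rule msum_mult[OF \<beta>c]) (rule mult_carrier_mat[OF mult_carrier_mat[OF ac(1) kc(1)] pc(2)])
    also have "\<dots> = msum m m (\<lambda>j. a j ?L * (x ?L * b' j ?L)) m"
    proof (rule msum_cong)
      fix j assume j: "j < m"
      note c = ac(1)[of j] ac(2)[of j] kc pc[OF j] \<beta>c
      have "((a j ?L * \<kappa> ?L) * p j ?L) * \<beta> ?L = a j ?L * (\<kappa> ?L * (p j ?L * \<beta> ?L))"
        using c by (simp add: mat_mult_assoc)
      also have "\<dots> = a j ?L * ((\<kappa> ?L * \<rho> ?L) * b' j ?L)"
        unfolding p\<beta>[OF j] using c by (simp add: mat_mult_assoc)
      finally show "((a j ?L * \<kappa> ?L) * p j ?L) * \<beta> ?L = a j ?L * (x ?L * b' j ?L)" unfolding \<kappa>\<rho>L .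
    qed
    also have "\<dots> = 1\<^sub>m m" using u[OF \<chi>] by (simp add: unit_system_def)
    finally show "\<alpha> ?L * \<beta> ?L = 1\<^sub>m m" .
    have \<beta>\<alpha>i: "(\<beta> ?L * \<alpha> ?L) * i j ?L = i j ?L" if j: "j < m" for j
    proof -
      have "(\<beta> ?L * \<alpha> ?L) * i j ?L = \<beta> ?L * (a j ?L * \<kappa> ?L)"
        unfolding \<alpha>i[OF j, symmetric] using \<beta>c \<alpha>c pc[OF j] by (simp add: mat_mult_assoc)
      also have "\<dots> = msum h g (\<lambda>l. (i l ?L * (\<rho> ?L * b' l ?L)) * (a j ?L * \<kappa> ?L)) m"
        by (subst \<beta>E, rule msum_mult[OF mult_carrier_mat[OF ac(1) kc(1)]])
          (rule mult_carrier_mat[OF pc(1) mult_carrier_mat[OF kc(2) ac(2)]])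
      also have "\<dots> = msum h g (\<lambda>l. if l = j then i l ?L else 0\<^sub>m h g) m"
      proof (rule msum_cong)
        fix l assume l: "l < m"
        note c = ac(1)[of j] ac(2)[of l] ac(3) kc pc[OF l]
        have "(i l ?L * (\<rho> ?L * b' l ?L)) * (a j ?L * \<kappa> ?L) = i l ?L * (\<rho> ?L * ((b' l ?L * a j ?L) * \<kappa> ?L))"
          using c by (simp add: mat_mult_assoc)
        also have "\<dots> = (if l = j then i l ?L * (\<rho> ?L * (x ?L * \<kappa> ?L)) else 0\<^sub>m h g)"
          unfolding us[OF l j] using c by auto
        finally show "(i l ?L * (\<rho> ?L * b' l ?L)) * (a j ?L * \<kappa> ?L) = (if l = j then i l ?L else 0\<^sub>m h g)"
          unfolding \<rho>x\<kappa> right_mult_one_mat[OF pc(1)[OF l]] .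
      qed
      also have "\<dots> = i j ?L" by (rule msum_delta[where f="\<lambda>l. i l ?L", OF j pc(1)[OF j]])
      finally show ?thesis .
    qed
    have \<beta>\<alpha>c: "\<beta> ?L * \<alpha> ?L \<in> carrier_mat h h" using \<alpha>c \<beta>c by auto
    have "\<beta> ?L * \<alpha> ?L = (\<beta> ?L * \<alpha> ?L) * msum h h (\<lambda>j. i j ?L * p j ?L) m"
      using bip_sum[OF bL] right_mult_one_mat[OF \<beta>\<alpha>c] unfolding h_def by simp
    also have "\<dots> = msum h h (\<lambda>j. (\<beta> ?L * \<alpha> ?L) * (i j ?L * p j ?L)) m"
      by (rule mult_msum[OF \<beta>\<alpha>c]) (rule mult_carrier_mat[OF pc])
    also have "\<dots> = msum h h (\<lambda>j. i j ?L * p j ?L) m"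
    proof (rule msum_cong)
      fix j assume j: "j < m"
      show "(\<beta> ?L * \<alpha> ?L) * (i j ?L * p j ?L) = i j ?L * p j ?L"
        using assoc_mult_mat[OF \<beta>\<alpha>c pc(1)[OF j] pc(2)[OF j]] unfolding \<beta>\<alpha>i[OF j] by simp
    qed
    also have "\<dots> = 1\<^sub>m h" using bip_sum[OF bL] unfolding h_def by simp
    finally show "\<beta> ?L * \<alpha> ?L = 1\<^sub>m (fst (fst ?H ?L))" unfolding h_def .
  qed
  have iso: "nat_iso sm ?H F"
  proof (rule nat_iso_of_simple[OF H F exH F_exact \<alpha>])
    fix \<chi> assume \<chi>: "is_char \<chi>"
    show "\<exists>\<theta>. \<theta> \<in> carrier_mat (fst (fst ?H (lin \<chi>))) (fst (fst F (lin \<chi>))) \<and>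
      \<theta> * \<alpha> (lin \<chi>) = 1\<^sub>m (fst (fst ?H (lin \<chi>))) \<and> \<alpha> (lin \<chi>) * \<theta> = 1\<^sub>m (fst (fst F (lin \<chi>)))"
      using inv[OF \<chi>] homD[OF nt_hom[OF \<beta> md_lin[OF \<chi>]]] \<chi> by (intro exI[of _ "\<beta> (lin \<chi>)"]) simp
  qed
  have c: "copies m G F" by (rule copies_iso_target[OF G H F copies_fmult[OF G] iso])
  have "fst (fst G (lin \<chi>)) = 1" if \<chi>: "is_char \<chi>" for \<chi>
  proof -
    obtain i' p' where "bip m (fst G (lin \<chi>)) (fst F (lin \<chi>)) i' p'"
      using c md_lin[OF \<chi>] unfolding copies_def by blast
    from bip_dim[OF fn_md[OF G md_lin[OF \<chi>]] this] show ?thesis using \<chi> m_pos by simp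
  qed
  thus thesis using that[OF G \<kappa> \<rho> \<rho>\<kappa> c] by blast
qed


lemma ex_selfadjoint_root:
  "\<exists>G. fn G \<and> selfadjoint sm G \<and> nat_iso sm (fcomp G G) fid \<and> nat_iso sm F (fmult m G)"
proof -
  obtain G \<kappa> \<rho> where G: "fn G" and \<kappa>: "nt G F \<kappa>" and \<rho>: "nt F G \<rho>"
    and \<rho>\<kappa>: "\<And>M. md M \<Longrightarrow> \<rho> M * \<kappa> M = 1\<^sub>m (fst (fst G M))" and c: "copies m G F"
    and dimG: "\<And>\<chi>. is_char \<chi> \<Longrightarrow> fst (fst G (lin \<chi>)) = 1"
    by (rule ex_root) blast
  have exG: "exact G" by (rule exact_summand[OF F G F_exact \<kappa> \<rho> \<rho>\<kappa>])
  define e where "e M = \<kappa> M * \<rho> M" for M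
  have e: "nt F F e" unfolding e_def by (rule nt_comp[OF F G F \<rho> \<kappa>])
  have ee: "e M * e M = e M" if M: "md M" for M
  proof -
    note d = homD[OF nt_hom[OF \<kappa> M]] homD[OF nt_hom[OF \<rho> M]]
    have "e M * e M = \<kappa> M * ((\<rho> M * \<kappa> M) * \<rho> M)" using d by (simp add: e_def mat_mult_assoc)
    thus ?thesis unfolding \<rho>\<kappa>[OF M] using d by (simp add: e_def)
  qed
  obtain H \<kappa>' \<rho>' where H: "fn H" and \<kappa>': "nt H F \<kappa>'" and \<rho>': "nt F H \<rho>'"
    and \<rho>\<kappa>': "\<And>M. md M \<Longrightarrow> \<rho>' M * \<kappa>' M = 1\<^sub>m (fst (fst H M))"
    and \<kappa>\<rho>': "\<And>M. md M \<Longrightarrow> \<kappa>' M * \<rho>' M = mate F \<eta> \<epsilon> e M"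
    using functor_split[OF F nt_mate[OF F adjoint e] mate_idem[OF F adjoint e _ ee[OF fn_md[OF F]]]] by blast
  have exH: "exact H" by (rule exact_summand[OF F H F_exact \<kappa>' \<rho>' \<rho>\<kappa>'])
  obtain \<eta>' \<epsilon>' where GH: "adj G H \<eta>' \<epsilon>'"
    using adj_summand[OF F adjoint G H \<kappa> \<rho> \<rho>\<kappa> \<kappa>' \<rho>' \<rho>\<kappa>'] \<kappa>\<rho>' unfolding e_def[abs_def] by blast
  have valG: "fst G (lin \<chi>) = lin \<psi>" if \<chi>: "is_char \<chi>" and im: "fst F (lin \<chi>) = scal m \<psi>" for \<chi> \<psi>
  proof -
    note L = md_lin[OF \<chi>]
    have "fst G (lin \<chi>) = scal (fst (fst G (lin \<chi>))) \<psi>"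
      by (rule scal_sub[OF fn_md[OF G L], of "\<kappa> (lin \<chi>)" m _ "\<rho> (lin \<chi>)"])
        (use nt_hom[OF \<kappa> L] homD[OF nt_hom[OF \<rho> L]] \<rho>\<kappa>[OF L] im in auto)
    thus ?thesis using dimG[OF \<chi>] by (simp add: lin_def)
  qed
  \<comment> \<open>As a submodule of \<open>F (lin \<chi>)\<close> the value is
    \<open>scal d \<psi>\<close>, so \<open>d\<close> is the dimension of \<open>Hom(lin \<psi>, H
    (lin \<chi>)) = Hom(G (lin \<psi>), lin \<chi>) = Hom(lin \<chi>, lin \<chi>)\<close>, which is
    1.\<close>
  have dimH: "fst (fst H (lin \<chi>)) = 1" if \<chi>: "is_char \<chi>" for \<chi>
  proof -
    obtain \<psi> where \<psi>: "is_char \<psi>" "fst F (lin \<chi>) = scal m \<psi>" "fst F (lin \<psi>) = scal m \<chi>" by (rule simple_image[OF \<chi>])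
    note L = md_lin[OF \<chi>] and L' = md_lin[OF \<psi>(1)]
    note HL = fn_md[OF H L]
    define d where "d = fst (fst H (lin \<chi>))"
    have Hd: "fst H (lin \<chi>) = scal d \<psi>" unfolding d_def
      by (rule scal_sub[OF HL, of "\<kappa>' (lin \<chi>)" m _ "\<rho>' (lin \<chi>)"])
        (use nt_hom[OF \<kappa>' L] homD[OF nt_hom[OF \<rho>' L]] \<rho>\<kappa>'[OF L] \<psi>(2) in auto)
    have G\<psi>: "fst G (lin \<psi>) = lin \<chi>" by (rule valG[OF \<psi>(1,3)])
    let ?u = "\<eta>' (lin \<psi>)"
    have u: "?u \<in> carrier_mat d 1" using homD[OF adj_unit[OF GH L']] by (simp add: G\<psi> d_def)
    \<comment> \<open>Transposition makes every vector of \<open>H (lin \<chi>)\<close> a multiple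
      of the unit \<open>?u\<close>, which excludes \<open>d \<ge> 2\<close>. If \<open>d\<close>
      were 0, the identity of \<open>lin \<chi>\<close> would be the transpose of a zero
      map.\<close>
    have scalar: "\<exists>x. g = x \<cdot>\<^sub>m ?u" if g: "g \<in> carrier_mat d 1" for g
    proof -
      have gh: "g \<in> hom (lin \<psi>) (fst H (lin \<chi>))" unfolding Hd unfolding lin_def hom_scal by (rule g)
      define f where "f = \<epsilon>' (lin \<chi>) * snd G (lin \<psi>) (fst H (lin \<chi>)) g"
      have f: "f \<in> carrier_mat 1 1"
        using homD[OF adj_counit[OF GH L]] homD[OF fn_hom[OF G L' HL gh]] by (simp add: f_def G\<psi>)
      have fx: "f = f $$ (0, 0) \<cdot>\<^sub>m 1\<^sub>m (fst (lin \<chi>))" using f by (auto intro!: eq_matI)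
      have "g = snd H (lin \<chi>) (lin \<chi>) f * ?u"
        using adj_transpose2[OF G H GH L' L gh] unfolding f_def G\<psi> by simp
      also have "snd H (lin \<chi>) (lin \<chi>) f = f $$ (0, 0) \<cdot>\<^sub>m 1\<^sub>m d"
        by (subst fx) (simp add: fn_smult[OF H L L hom_one[OF L], simplified] fn_one[OF H L, simplified] d_def)
      finally have "g = f $$ (0, 0) \<cdot>\<^sub>m ?u" using u by (simp add: mat_smult_mult)
      thus ?thesis by blast
    qed
    have "d \<noteq> 0"
    proof
      assume d0: "d = 0"
      have 1: "1\<^sub>m 1 \<in> hom (fst G (lin \<psi>)) (lin \<chi>)" unfolding G\<psi> using hom_one[OF L] by simp
      have z: "snd H (lin \<chi>) (lin \<chi>) (1\<^sub>m 1) * ?u = 0\<^sub>m (fst (fst H (lin \<chi>))) (fst (lin \<psi>))"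
        using u d0 homD[OF fn_hom[OF H L L hom_one[OF L]]] by (intro eq_matI) (auto simp: d_def)
      have "1\<^sub>m 1 = \<epsilon>' (lin \<chi>) * snd G (lin \<psi>) (fst H (lin \<chi>)) (snd H (lin \<chi>) (lin \<chi>) (1\<^sub>m 1) * ?u)"
        using adj_transpose1[OF G H GH L' L 1] unfolding G\<psi> by simp
      also have "\<dots> = 0\<^sub>m 1 1"
        unfolding z fn_zero[OF G L' HL] G\<psi> using homD[OF adj_counit[OF GH L]] by simp
      finally have "(1\<^sub>m 1 :: 'k mat) $$ (0, 0) = 0\<^sub>m 1 1 $$ (0, 0)" by simp
      thus False by simp
    qed
    moreover have "\<not> d \<ge> 2"
    proof
      assume d2: "d \<ge> 2"
      let ?g = "\<lambda>i :: nat. mat d 1 (\<lambda>(r, _). if r = i then 1 else 0) :: 'k mat"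
      obtain x where x: "?g 0 = x \<cdot>\<^sub>m ?u" using scalar[of "?g 0"] by auto
      obtain y where y: "?g 1 = y \<cdot>\<^sub>m ?u" using scalar[of "?g 1"] by auto
      have "?g 0 $$ (0, 0) = x * ?u $$ (0, 0)" "?g 0 $$ (1, 0) = x * ?u $$ (1, 0)"
        unfolding x using u d2 by simp_all
      hence "1 = x * ?u $$ (0, 0)" "0 = x * ?u $$ (1, 0)" using d2 by auto
      moreover have "?g 1 $$ (1, 0) = y * ?u $$ (1, 0)" unfolding y using u d2 by simp
      hence "1 = y * ?u $$ (1, 0)" using d2 by simp
      ultimately show False by auto
    qed
    ultimately show ?thesis unfolding d_def by linarith
  qed
  have "nat_iso sm H G"
  proof (rule nat_iso_of_nonzero[OF H G exH exG])
    fix \<chi> assume \<chi>: "is_char \<chi>"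
    show "fst (fst H (lin \<chi>)) = 1 \<and> fst (fst G (lin \<chi>)) = 1" using dimH dimG \<chi> by simp
    let ?L = "lin \<chi>"
    note L = md_lin[OF \<chi>]
    have d: "\<kappa> ?L \<in> carrier_mat m 1" "\<rho> ?L \<in> carrier_mat 1 m" "\<kappa>' ?L \<in> carrier_mat m 1" "\<rho>' ?L \<in> carrier_mat 1 m"
      using homD[OF nt_hom[OF \<kappa> L]] homD[OF nt_hom[OF \<rho> L]] homD[OF nt_hom[OF \<kappa>' L]] homD[OF nt_hom[OF \<rho>' L]]
        \<chi> dimG[OF \<chi>] dimH[OF \<chi>] by auto
    \<comment> \<open>A natural endomorphism of \<open>F\<close> prescribed at \<open>?L\<close> as
      the rank one matrix \<open>\<kappa> \<rho>'\<close>. Compressed between \<open>\<rho>\<close>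
      and \<open>\<kappa>'\<close>, it takes the value
      \<open>(\<rho> \<kappa>) (\<rho>' \<kappa>') = 1\<close> there.\<close>
    obtain x where x: "nt F F x" "x ?L = \<kappa> ?L * \<rho>' ?L"
      by (rule evaluation_surj[OF \<chi> mult_carrier_mat[OF d(1) d(4)]])
    have "nt H G (\<lambda>M. \<rho> M * (x M * \<kappa>' M))"
      by (rule nt_comp[OF H F G nt_comp[OF H F F \<kappa>' x(1)] \<rho>])
    moreover have "\<rho> ?L * (x ?L * \<kappa>' ?L) = (\<rho> ?L * \<kappa> ?L) * (\<rho>' ?L * \<kappa>' ?L)"
      unfolding x(2) using d by (simp add: mat_mult_assoc)
    hence "\<rho> ?L * (x ?L * \<kappa>' ?L) = 1\<^sub>m 1"
      unfolding \<rho>\<kappa>[OF L] \<rho>\<kappa>'[OF L] dimG[OF \<chi>] dimH[OF \<chi>] by simp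
    ultimately show "\<exists>\<eta>. nt H G \<eta> \<and> \<eta> ?L $$ (0, 0) \<noteq> 0"
      by (intro exI[of _ "\<lambda>M. \<rho> M * (x M * \<kappa>' M)"]) simp
  qed
  then obtain \<eta>1 \<epsilon>1 where "adj G G \<eta>1 \<epsilon>1" using adj_iso[OF G H GH] by blast
  hence sa: "selfadjoint sm G" by (rule adj_selfadjoint[OF G])
  note GG = fn_fcomp[OF G G]
  have "nat_iso sm fid (fcomp G G)"
  proof (rule nat_iso_of_nonzero[OF fn_fid GG exact_fid exact_fcomp[OF exG exG]])
    fix \<chi> assume \<chi>: "is_char \<chi>"
    obtain \<psi> where \<psi>: "is_char \<psi>" "fst F (lin \<chi>) = scal m \<psi>" "fst F (lin \<psi>) = scal m \<chi>" by (rule simple_image[OF \<chi>])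
    have G\<chi>: "fst G (lin \<chi>) = lin \<psi>" and G\<psi>: "fst G (lin \<psi>) = lin \<chi>"
      using valG[OF \<chi> \<psi>(2)] valG[OF \<psi>(1,3)] by auto
    show "fst (fst fid (lin \<chi>)) = 1 \<and> fst (fst (fcomp G G) (lin \<chi>)) = 1" by (simp add: G\<chi> G\<psi>)
    let ?L = "lin \<chi>"
    note L = md_lin[OF \<chi>]
    note FL = fn_md[OF F L] and GL = fn_md[OF G L]
    \<comment> \<open>The inclusion \<open>\<iota> i\<close> of the identity into
      \<open>F F\<close>, followed by the projection onto the summand \<open>G G\<close>. If all of
      these vanished at \<open>?L\<close>, so would the projection, because the
      \<open>\<iota> i\<close> jointly cover \<open>F F\<close>; but it has the section
      \<open>?s\<close>.\<close>
    define \<beta> where "\<beta> i M = (\<rho> (fst G M) * snd F (fst F M) (fst G M) (\<rho> M)) * \<iota> i M" for i M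
    have \<beta>: "nt fid (fcomp G G) (\<beta> i)" if "i < m * m" for i
      unfolding \<beta>_def
      by (rule nt_comp[OF fn_fid FF GG \<iota>[OF that]
            nt_comp[OF FF fn_fcomp[OF G F] GG nt_whisker_left[OF F F G \<rho>] nt_whisker_right[OF G \<rho>]]])
    have "\<exists>i<m * m. \<beta> i ?L $$ (0, 0) \<noteq> 0"
    proof (rule ccontr)
      assume neg: "\<not> (\<exists>i<m * m. \<beta> i ?L $$ (0, 0) \<noteq> 0)"
      let ?p = "\<rho> (fst G ?L) * snd F (fst F ?L) (fst G ?L) (\<rho> ?L)"
      let ?s = "snd F (fst G ?L) (fst F ?L) (\<kappa> ?L) * \<kappa> (fst G ?L)"
      note d = homD[OF nt_hom[OF \<rho> GL]] homD[OF nt_hom[OF \<kappa> GL]]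
        homD[OF fn_hom[OF F FL GL nt_hom[OF \<rho> L]]] homD[OF fn_hom[OF F GL FL nt_hom[OF \<kappa> L]]]
      have pc: "?p \<in> carrier_mat 1 (fst (fst F (fst F ?L)))" using d by (simp add: G\<chi> G\<psi>)
      have "?p = 0\<^sub>m 1 (fst (fst F (fst F ?L)))"
      proof (rule bip_joint_epi[OF b[OF L] pc])
        fix i assume i: "i < m * m"
        have "?p * \<iota> i ?L \<in> carrier_mat 1 1" using pc bip_carrier(1)[OF b[OF L] i] by auto
        thus "?p * \<iota> i ?L = 0\<^sub>m 1 (fst ?L)" using neg i by (intro eq_matI) (auto simp: \<beta>_def)
      qed
      hence "?p * ?s = 0\<^sub>m 1 1" using d by (simp add: G\<chi> G\<psi>)
      moreover have "?p * ?s = \<rho> (fst G ?L) * ((snd F (fst F ?L) (fst G ?L) (\<rho> ?L) * snd F (fst G ?L) (fst F ?L) (\<kappa> ?L)) * \<kappa> (fst G ?L))"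
        using d by (simp add: mat_mult_assoc)
      moreover have "snd F (fst F ?L) (fst G ?L) (\<rho> ?L) * snd F (fst G ?L) (fst F ?L) (\<kappa> ?L) = 1\<^sub>m (fst (fst F (fst G ?L)))"
        using fn_mult[OF F GL FL GL nt_hom[OF \<kappa> L] nt_hom[OF \<rho> L]] \<rho>\<kappa>[OF L] fn_one[OF F GL] by simp
      ultimately have "(1\<^sub>m 1 :: 'k mat) = 0\<^sub>m 1 1" using d \<rho>\<kappa>[OF GL] by (simp add: G\<chi> G\<psi>)
      hence "(1\<^sub>m 1 :: 'k mat) $$ (0, 0) = 0\<^sub>m 1 1 $$ (0, 0)" by simp
      thus False by simp
    qed
    thus "\<exists>\<eta>. nt fid (fcomp G G) \<eta> \<and> \<eta> ?L $$ (0, 0) \<noteq> 0" using \<beta> by blast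
  qed
  hence sq: "nat_iso sm (fcomp G G) fid" by (rule nat_iso_sym[OF fn_fid GG])
  have "nat_iso sm F (fmult m G)" using c copies_iff_nat_iso[OF G F] by blast
  thus ?thesis using G sa sq by blast
qed

end

section \<open>The correspondence between involutions and square roots\<close>

context basic_closed_kalg
begin

text \<open>Passing through \<open>G\<close> composed after \<open>m G\<close>, the composite of
  \<open>m G\<close> with itself is seen to be \<open>m * m\<close> copies of \<open>G G\<close>,
  and hence of the identity.\<close>

lemma fmult_square:
  assumes G: "fn G" and s: "selfadjoint sm G" and sq: "nat_iso sm (fcomp G G) fid"
  shows "fn (fmult m G)" "selfadjoint sm (fmult m G)"
    "nat_iso sm (fcomp (fmult m G) (fmult m G)) (fmult (m\<^sup>2) fid)"
proof -
  let ?H = "fmult m G"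
  show H: "fn ?H" by (rule fn_fmult[OF G])
  note c = copies_fmult[OF G, of m]
  obtain \<eta> \<epsilon> where "adj G G \<eta> \<epsilon>" by (rule selfadjoint_adj[OF G s])
  then obtain \<eta>' \<epsilon>' where "adj ?H ?H \<eta>' \<epsilon>'" using adj_copies[OF G H _ c] by blast
  thus "selfadjoint sm ?H" by (rule adj_selfadjoint[OF H])
  note GG = fn_fcomp[OF G G] and HH = fn_fcomp[OF H H] and GH = fn_fcomp[OF H G]
  have "copies (m * m) (fcomp G G) (fcomp ?H ?H)"
    by (rule copies_trans[OF GG GH HH copies_fcomp_left[OF G H G c] copies_fcomp_right[OF G H H c]])
  hence "copies (m * m) fid (fcomp ?H ?H)" by (rule copies_iso_source[OF GG HH fn_fid _ sq])
  thus "nat_iso sm (fcomp ?H ?H) (fmult (m\<^sup>2) fid)"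
    using copies_iff_nat_iso[OF fn_fid HH] by (simp add: power2_eq_square)
qed

lemma fid_selfadjoint: "selfadjoint sm fid"
proof (rule adj_selfadjoint[OF fn_fid])
  have id: "nt fid fid (\<lambda>M. 1\<^sub>m (fst M))" using nt_id[OF fn_fid] by simp
  show "adj fid fid (\<lambda>M. 1\<^sub>m (fst M)) (\<lambda>M. 1\<^sub>m (fst M))"
    unfolding adj_def using id by (simp add: nt_def)
qed

lemma nat_iso_fid_fid: "nat_iso sm (fcomp fid fid) fid"
proof (rule nat_isoI[of _ _ "\<lambda>M. 1\<^sub>m (fst M)" "\<lambda>M. 1\<^sub>m (fst M)"])
  show "nt (fcomp fid fid) fid (\<lambda>M. 1\<^sub>m (fst M))" using nt_id[OF fn_fid] by (simp add: nt_def)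
qed (auto intro: hom_one)

text \<open>The case \<open>k = 1\<close> of \<open>functor_on_simple\<close>: an isomorphism is a
  direct sum of one copy, and \<open>m * m = 1\<close>.\<close>

lemma involution_dim:
  assumes G: "fn G" and s: "selfadjoint sm G" and sq: "nat_iso sm (fcomp G G) fid" and \<chi>: "is_char \<chi>"
  shows "fst (fst G (lin \<chi>)) = 1"
proof -
  obtain \<eta> \<epsilon> where a: "adj G G \<eta> \<epsilon>" by (rule selfadjoint_adj[OF G s])
  note GG = fn_fcomp[OF G G]
  obtain \<alpha> \<beta> where n: "nt (fcomp G G) fid \<alpha>" "nt fid (fcomp G G) \<beta>"
    and i: "\<And>M. md M \<Longrightarrow> \<beta> M * \<alpha> M = 1\<^sub>m (fst (fst (fcomp G G) M))"
      "\<And>M. md M \<Longrightarrow> \<alpha> M * \<beta> M = 1\<^sub>m (fst (fst fid M))"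
    using nat_isoE[OF GG fn_fid sq] by blast
  have c: "copies 1 fid (fcomp G G)"
  proof (rule copiesI[of 1 _ _ "\<lambda>_. \<beta>" "\<lambda>_. \<alpha>"])
    fix M assume M: "md M"
    show "bip 1 (fst fid M) (fst (fcomp G G) M) (\<lambda>i. \<beta> M) (\<lambda>i. \<alpha> M)"
      unfolding bip_def using nt_hom[OF n(1) M] nt_hom[OF n(2) M] i[OF M] by (simp add: mat_add_zero)
  qed (use n in auto)
  obtain \<psi> m where "is_char \<psi>" "fst G (lin \<chi>) = scal m \<psi>" "fst G (lin \<psi>) = scal m \<chi>" "m * m = 1"
    by (rule functor_on_simple[OF G a c _ \<chi>]) auto
  thus ?thesis by simp
qed

text \<open>An isomorphism from \<open>m G\<close> to \<open>m H\<close> is a matrix of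
  transformations \<open>c j l\<close> from \<open>G\<close> to \<open>H\<close>. At each simple
  module some entry is nonzero, since an isomorphism of nonzero spaces does not vanish; which entry
  it is may depend on the simple module.\<close>

lemma fmult_cancel:
  assumes G: "fn G" "selfadjoint sm G" "nat_iso sm (fcomp G G) fid"
    and H: "fn H" "selfadjoint sm H" "nat_iso sm (fcomp H H) fid" and m: "m > 0"
    and iso: "nat_iso sm (fmult m G) (fmult m H)"
  shows "nat_iso sm G H"
proof (rule nat_iso_of_nonzero[OF G(1) H(1)])
  obtain \<eta> \<epsilon> where "adj G G \<eta> \<epsilon>" by (rule selfadjoint_adj[OF G(1,2)])
  thus "exact G" by (rule adj_exact[OF G(1)])
  obtain \<eta> \<epsilon> where "adj H H \<eta> \<epsilon>" by (rule selfadjoint_adj[OF H(1,2)])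
  thus "exact H" by (rule adj_exact[OF H(1)])
  fix \<chi> assume \<chi>: "is_char \<chi>"
  show dim: "fst (fst G (lin \<chi>)) = 1 \<and> fst (fst H (lin \<chi>)) = 1"
    using involution_dim[OF G \<chi>] involution_dim[OF H \<chi>] by simp
  let ?L = "lin \<chi>"
  note L = md_lin[OF \<chi>]
  note mG = fn_fmult[OF G(1), of m] and mH = fn_fmult[OF H(1), of m]
  obtain i p where ip: "\<And>j. j < m \<Longrightarrow> nt G (fmult m G) (i j)" "\<And>j. j < m \<Longrightarrow> nt (fmult m G) G (p j)"
    and b: "\<And>M. md M \<Longrightarrow> bip m (fst G M) (fst (fmult m G) M) (\<lambda>j. i j M) (\<lambda>j. p j M)"
    using copiesE[OF copies_fmult[OF G(1)]] by blast
  obtain i' p' where ip': "\<And>j. j < m \<Longrightarrow> nt H (fmult m H) (i' j)" "\<And>j. j < m \<Longrightarrow> nt (fmult m H) H (p' j)"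
    and b': "\<And>M. md M \<Longrightarrow> bip m (fst H M) (fst (fmult m H) M) (\<lambda>j. i' j M) (\<lambda>j. p' j M)"
    using copiesE[OF copies_fmult[OF H(1)]] by blast
  obtain \<theta> \<theta>' where t: "nt (fmult m G) (fmult m H) \<theta>" "nt (fmult m H) (fmult m G) \<theta>'"
    "\<And>M. md M \<Longrightarrow> \<theta>' M * \<theta> M = 1\<^sub>m (fst (fst (fmult m G) M))"
    "\<And>M. md M \<Longrightarrow> \<theta> M * \<theta>' M = 1\<^sub>m (fst (fst (fmult m H) M))"
    using nat_isoE[OF mG mH iso] by blast
  define c where "c j l M = p' j M * (\<theta> M * i l M)" for j l M
  have c: "nt G H (c j l)" if "j < m" "l < m" for j l
    unfolding c_def
    by (rule nt_comp[OF G(1) mH H(1) nt_comp[OF G(1) mG mH ip(1)[OF that(2)] t(1)] ip'(2)[OF that(1)]])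
  have "\<exists>j<m. \<exists>l<m. c j l ?L $$ (0, 0) \<noteq> 0"
  proof (rule ccontr)
    assume neg: "\<not> (\<exists>j<m. \<exists>l<m. c j l ?L $$ (0, 0) \<noteq> 0)"
    have tc: "\<theta> ?L \<in> carrier_mat m m" using homD[OF nt_hom[OF t(1) L]] dim by simp
    have tc': "\<theta>' ?L \<in> carrier_mat m m" using homD[OF nt_hom[OF t(2) L]] dim by simp
    have ic: "i l ?L \<in> carrier_mat m 1" if "l < m" for l
      using bip_carrier(1)[OF b[OF L] that] dim by simp
    have "\<theta> ?L = 0\<^sub>m m (fst (fst (fmult m G) ?L))"
    proof (rule bip_joint_epi[OF b[OF L]])
      show "\<theta> ?L \<in> carrier_mat m (fst (fst (fmult m G) ?L))" using tc dim by simp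
      fix l assume l: "l < m"
      have "\<theta> ?L * i l ?L = 0\<^sub>m (fst (fst (fmult m H) ?L)) 1"
      proof (rule bip_joint_mono[OF b'[OF L]])
        show "\<theta> ?L * i l ?L \<in> carrier_mat (fst (fst (fmult m H) ?L)) 1"
          using tc ic[OF l] dim by auto
        fix j assume j: "j < m"
        have "c j l ?L \<in> carrier_mat 1 1" using homD[OF nt_hom[OF c[OF j l] L]] dim by simp
        thus "p' j ?L * (\<theta> ?L * i l ?L) = 0\<^sub>m (fst (fst H ?L)) 1"
          using neg j l dim by (intro eq_matI) (auto simp: c_def)
      qed
      thus "\<theta> ?L * i l ?L = 0\<^sub>m m (fst (fst G ?L))" using dim by simp
    qed
    hence "1\<^sub>m m = (0\<^sub>m m m :: 'k mat)" using t(3)[OF L] tc' dim by simp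
    hence "(1\<^sub>m m :: 'k mat) $$ (0, 0) = 0\<^sub>m m m $$ (0, 0)" by simp
    thus False using m by simp
  qed
  thus "\<exists>\<eta>. nt G H \<eta> \<and> \<eta> ?L $$ (0, 0) \<noteq> 0" using c by blast
qed

lemma fmult_cong:
  assumes "fn G" "fn H" "nat_iso sm G H" shows "nat_iso sm (fmult m G) (fmult m H)"
  using copies_iff_nat_iso[OF assms(2) fn_fmult[OF assms(1)]]
    copies_iso_source[OF assms(1) fn_fmult[OF assms(1)] assms(2) copies_fmult[OF assms(1)] assms(3)] by blast

text \<open>Evaluation at a single simple module determines the root; \<open>ex_char\<close>
  guarantees that there is one.\<close>

lemma square_root_value:
  assumes F: "fn F" "selfadjoint sm F" "nat_iso sm (fcomp F F) (fmult k fid)" and k: "k > 0"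
  shows "\<exists>m. m * m = k"
proof -
  obtain \<eta> \<epsilon> where a: "adj F F \<eta> \<epsilon>" by (rule selfadjoint_adj[OF F(1,2)])
  have c: "copies k fid (fcomp F F)" using copies_iff_nat_iso[OF fn_fid fn_fcomp[OF F(1,1)]] F(3) by blast
  obtain \<chi> where "is_char \<chi>" using ex_char by blast
  from functor_on_simple[OF F(1) a c k this] show ?thesis by metis
qed

lemma square_root_split:
  assumes F: "fn F" "selfadjoint sm F" "nat_iso sm (fcomp F F) (fmult (m\<^sup>2) fid)" and m: "m > 0"
  shows "\<exists>G. fn G \<and> selfadjoint sm G \<and> nat_iso sm (fcomp G G) fid \<and> nat_iso sm F (fmult m G)"
proof -
  obtain \<eta> \<epsilon> where a: "adj F F \<eta> \<epsilon>" by (rule selfadjoint_adj[OF F(1,2)])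
  have c: "copies (m * m) fid (fcomp F F)"
    using copies_iff_nat_iso[OF fn_fid fn_fcomp[OF F(1,1)]] F(3) by (simp add: power2_eq_square)
  obtain \<iota> \<pi> where "\<And>i. i < m * m \<Longrightarrow> nt fid (fcomp F F) (\<iota> i)" "\<And>i. i < m * m \<Longrightarrow> nt (fcomp F F) fid (\<pi> i)"
    "\<And>M. md M \<Longrightarrow> bip (m * m) (fst fid M) (fst (fcomp F F) M) (\<lambda>i. \<iota> i M) (\<lambda>i. \<pi> i M)"
    using copiesE[OF c] by blast
  then interpret square_root sm F \<eta> \<epsilon> m \<iota> \<pi>
    using F a m by unfold_locales auto
  show ?thesis by (rule ex_selfadjoint_root)
qed

end

theorem theorem7:
  fixes sm :: "'k::field \<Rightarrow> 'a::ring_1 \<Rightarrow> 'a" and k :: nat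
  assumes "alg_closed TYPE('k)"
    and "k_algebra sm" and "fin_dim_algebra sm" and "basic_algebra sm"
    and "k \<ge> 2"
  shows "((\<exists>F. is_functor sm F \<and> selfadjoint sm F \<and> nat_iso sm (fcomp F F) (fmult k fid))
            \<longleftrightarrow> (\<exists>m\<ge>2. k = m\<^sup>2)) \<and>
         (\<forall>m. m \<ge> 2 \<and> k = m\<^sup>2 \<longrightarrow>
           (\<forall>F'. is_functor sm F' \<and> selfadjoint sm F' \<and> nat_iso sm (fcomp F' F') fid \<longrightarrow>
               is_functor sm (fmult m F') \<and> selfadjoint sm (fmult m F') \<and>
               nat_iso sm (fcomp (fmult m F') (fmult m F')) (fmult k fid)) \<and>
           (\<forall>F' G'. is_functor sm F' \<and> selfadjoint sm F' \<and> nat_iso sm (fcomp F' F') fid \<and>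
               is_functor sm G' \<and> selfadjoint sm G' \<and> nat_iso sm (fcomp G' G') fid \<longrightarrow>
               (nat_iso sm (fmult m F') (fmult m G') \<longleftrightarrow> nat_iso sm F' G')) \<and>
           (\<forall>F. is_functor sm F \<and> selfadjoint sm F \<and> nat_iso sm (fcomp F F) (fmult k fid) \<longrightarrow>
               (\<exists>F'. is_functor sm F' \<and> selfadjoint sm F' \<and> nat_iso sm (fcomp F' F') fid \<and>
                     nat_iso sm F (fmult m F'))))"
proof -
  interpret basic_closed_kalg sm using assms(1-4) by unfold_locales
  show ?thesis
  proof (intro conjI iffI allI impI; (elim exE conjE)?)
    fix F assume F: "fn F" "selfadjoint sm F" "nat_iso sm (fcomp F F) (fmult k fid)"
    obtain m where m: "m * m = k" using square_root_value[OF F] assms(5) by auto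
    have "m \<noteq> 0" using m assms(5) by (cases m) auto
    moreover have "m \<noteq> 1" using m assms(5) by auto
    ultimately have "m \<ge> 2" by linarith
    thus "\<exists>m\<ge>2. k = m\<^sup>2" using m by (auto simp: power2_eq_square)
  next
    \<comment> \<open>The identity is a selfadjoint involution, so \<open>m ID\<close> is a
      root.\<close>
    fix m assume "k = m\<^sup>2"
    thus "\<exists>F. fn F \<and> selfadjoint sm F \<and> nat_iso sm (fcomp F F) (fmult k fid)"
      using fmult_square[OF fn_fid fid_selfadjoint nat_iso_fid_fid, of m] by blast
  next
    fix m F' assume "k = m\<^sup>2" "fn F'" "selfadjoint sm F'" "nat_iso sm (fcomp F' F') fid"
    thus "fn (fmult m F')" "selfadjoint sm (fmult m F')" "nat_iso sm (fcomp (fmult m F') (fmult m F')) (fmult k fid)"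
      using fmult_square[of F' m] by simp_all
  next
    fix m :: nat and F' G' assume m: "m \<ge> 2" and F': "fn F'" "selfadjoint sm F'" "nat_iso sm (fcomp F' F') fid"
      and G': "fn G'" "selfadjoint sm G'" "nat_iso sm (fcomp G' G') fid"
    have "m > 0" using m by simp
    show "nat_iso sm F' G'" if "nat_iso sm (fmult m F') (fmult m G')"
      by (rule fmult_cancel[OF F' G' \<open>m > 0\<close> that])
    show "nat_iso sm (fmult m F') (fmult m G')" if "nat_iso sm F' G'"
      by (rule fmult_cong[OF F'(1) G'(1) that])
  next
    fix m F assume m: "m \<ge> 2" "k = m\<^sup>2" and F: "fn F" "selfadjoint sm F" "nat_iso sm (fcomp F F) (fmult k fid)"
    have "m > 0" using m by simp
    thus "\<exists>F'. fn F' \<and> selfadjoint sm F' \<and> nat_iso sm (fcomp F' F') fid \<and> nat_iso sm F (fmult m F')"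
      using square_root_split[OF F(1,2), of m] F(3) m(2) by simp
  qed
qed

end
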